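(* Let $f:\Sigma\to\mathbb{R}^3$ be a smooth immersion and let $f(\cdot,t):\Sigma\to\mathbb{R}^3$, $t\in(-\delta,\delta)$, be a smooth variation of $f=f(\cdot,0)$ with velocity field $\partial_t f(\cdot,t)|_{t=0}=\phi=\varphi\nu+Df\cdot\xi$, where $\varphi$ is a smooth function and $\xi$ a smooth tangential vector field on $\Sigma$. Then $$\frac{d}{dt}\mathcal{T}(f(\cdot,t))\Big|_{t=0}=\frac12\int_\Sigma W(f)\,\varphi\,d\mu_g+\int_{\partial\Sigma}\alpha(\eta)\,ds_g,$$ where $W(f)=\Delta_gH+|h^\circ|^2H$ and $$\alpha(\eta)=\frac12\,\varphi\,\frac{\partial H}{\partial\eta}-h^\circ(\operatorname{grad}_g\varphi,\eta)-\frac12|h^\circ|^2\,g(\xi,\eta).$$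
   Context: $\Sigma$ is a compact oriented two-dimensional smooth manifold with boundary $\partial\Sigma$. For a smooth immersion $f:\Sigma\to\mathbb{R}^3$: $g$ is the induced metric, $\mu_g$ its measure, $ds_g$ the induced length measure on $\partial\Sigma$, $\nu:\Sigma\to\mathbb{S}^2$ the unit normal, $h$ the second fundamental form with respect to $\nu$, with sign convention $h_{\alpha\beta}=\langle\partial^2_{\alpha\beta}f,\nu\rangle$, $H=g^{\alpha\beta}h_{\alpha\beta}$ the mean curvature, $h^\circ=h-\frac12Hg$, and $\eta$ the interior unit normal along $\partial\Sigma$ with respect to $g$. All geometric quantities in the formula are those of $f$ at $t=0$. The Thomsen functional is $\mathcal{T}(f)=\frac12\int_\Sigma|h^\circ|^2\,d\mu_g$. *)

theory Defs
  imports "HOL-Analysis.Analysis"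
begin

subsection \<open>Smooth maps\<close>

primrec times_differentiable_on ::
  "nat \<Rightarrow> 'a::euclidean_space set \<Rightarrow> ('a \<Rightarrow> 'b::real_normed_vector) \<Rightarrow> bool" where
  "times_differentiable_on 0 W F \<longleftrightarrow> continuous_on W F"
| "times_differentiable_on (Suc k) W F \<longleftrightarrow>
     (\<forall>x\<in>W. F differentiable (at x)) \<and>
     (\<forall>v. times_differentiable_on k W (\<lambda>x. frechet_derivative F (at x) v))"

text \<open>On a set that need not be open, such as a relatively open subset of a half-plane,
  smoothness means local extendability to smooth maps on open sets.\<close>

definition smooth_on ::
  "'a::euclidean_space set \<Rightarrow> ('a \<Rightarrow> 'b::real_normed_vector) \<Rightarrow> bool" where
  "smooth_on D F \<longleftrightarrow>
     (\<forall>x\<in>D. \<exists>W G. open W \<and> x \<in> W \<and> (\<forall>k. times_differentiable_on k W G) \<and>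
        (\<forall>y\<in>W \<inter> D. G y = F y))"

subsection \<open>Oriented surfaces with boundary\<close>

definition half_plane :: "(real^2) set" where
  "half_plane = {u. 0 \<le> u $ 2}"

text \<open>A chart is a pair of its domain and its coordinate map; the values of the
  coordinate map outside the domain are irrelevant.\<close>

type_synonym 'a chart = "'a set \<times> ('a \<Rightarrow> real^2)"

abbreviation chart_dom :: "'a chart \<Rightarrow> 'a set" where
  "chart_dom c \<equiv> fst c"

abbreviation chart_map :: "'a chart \<Rightarrow> 'a \<Rightarrow> real^2" where
  "chart_map c \<equiv> snd c"

definition chart_range :: "'a chart \<Rightarrow> (real^2) set" where
  "chart_range c = chart_map c ` chart_dom c"

definition chart_inv :: "'a chart \<Rightarrow> real^2 \<Rightarrow> 'a" where
  "chart_inv c = inv_into (chart_dom c) (chart_map c)"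

text \<open>The differential at \<open>p\<close> of a map on the surface, expressed in the chart \<open>c\<close>.  The
  derivative is taken within the chart range, hence it is one-sided at boundary points.\<close>

definition differential ::
  "'a chart \<Rightarrow> ('a \<Rightarrow> 'b::real_normed_vector) \<Rightarrow> 'a \<Rightarrow> real^2 \<Rightarrow> 'b" where
  "differential c F p =
     frechet_derivative (F \<circ> chart_inv c) (at (chart_map c p) within chart_range c)"

definition coord_deriv ::
  "'a chart \<Rightarrow> 2 \<Rightarrow> ('a \<Rightarrow> 'b::real_normed_vector) \<Rightarrow> 'a \<Rightarrow> 'b" where
  "coord_deriv c i F p = differential c F p (axis i 1)"

text \<open>\<open>A\<close> need not be maximal: it is any atlas of the given oriented smooth structure.\<close>

definition compact_oriented_surface :: "'a::t2_space set \<Rightarrow> 'a chart set \<Rightarrow> bool" where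
  "compact_oriented_surface S A \<longleftrightarrow>
     compact S \<and>
     (\<Union>c\<in>A. chart_dom c) = S \<and>
     (\<forall>c\<in>A. openin (top_of_set S) (chart_dom c) \<and>
            openin (top_of_set half_plane) (chart_range c) \<and>
            homeomorphism (chart_dom c) (chart_range c) (chart_map c) (chart_inv c)) \<and>
     (\<forall>c\<in>A. \<forall>c'\<in>A.
        smooth_on (chart_map c ` (chart_dom c \<inter> chart_dom c')) (chart_map c' \<circ> chart_inv c) \<and>
        (\<forall>p\<in>chart_dom c \<inter> chart_dom c'. 0 < det (matrix (differential c (chart_map c') p))))"

definition surface_boundary :: "'a chart set \<Rightarrow> 'a set" where
  "surface_boundary A = {p. \<exists>c\<in>A. p \<in> chart_dom c \<and> chart_map c p $ 2 = 0}"

text \<open>A chart around \<open>p\<close>, used to evaluate expressions which do not depend on the choice of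
  an oriented chart.\<close>

definition chart_at :: "'a chart set \<Rightarrow> 'a \<Rightarrow> 'a chart" where
  "chart_at A p = (SOME c. c \<in> A \<and> p \<in> chart_dom c)"

definition smooth_map :: "'a chart set \<Rightarrow> ('a \<Rightarrow> 'b::real_normed_vector) \<Rightarrow> bool" where
  "smooth_map A F \<longleftrightarrow> (\<forall>c\<in>A. smooth_on (chart_range c) (F \<circ> chart_inv c))"

definition smooth_immersion :: "'a chart set \<Rightarrow> ('a \<Rightarrow> real^3) \<Rightarrow> bool" where
  "smooth_immersion A f \<longleftrightarrow>
     smooth_map A f \<and> (\<forall>c\<in>A. \<forall>p\<in>chart_dom c. inj (differential c f p))"

text \<open>Smoothness of a one-parameter family jointly in the point and the parameter.\<close>

definition smooth_family ::
  "'a chart set \<Rightarrow> real \<Rightarrow> (real \<Rightarrow> 'a \<Rightarrow> real^3) \<Rightarrow> bool" where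
  "smooth_family A \<delta> F \<longleftrightarrow>
     (\<forall>c\<in>A. smooth_on (chart_range c \<times> {-\<delta><..<\<delta>}) (\<lambda>(u, t). F t (chart_inv c u)))"

text \<open>A tangential vector field is given by its components in each chart, subject to the
  transformation law of tangent vectors.\<close>

definition smooth_vector_field :: "'a chart set \<Rightarrow> ('a chart \<Rightarrow> 'a \<Rightarrow> real^2) \<Rightarrow> bool" where
  "smooth_vector_field A \<xi> \<longleftrightarrow>
     (\<forall>c\<in>A. smooth_on (chart_range c) (\<xi> c \<circ> chart_inv c)) \<and>
     (\<forall>c\<in>A. \<forall>c'\<in>A. \<forall>p\<in>chart_dom c \<inter> chart_dom c'.
        \<xi> c' p = differential c (chart_map c') p (\<xi> c p))"

subsection \<open>Geometry of an immersion in a chart\<close>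

definition metric :: "'a chart \<Rightarrow> ('a \<Rightarrow> real^3) \<Rightarrow> 'a \<Rightarrow> real^2^2" where
  "metric c f p = (\<chi> i j. coord_deriv c i f p \<bullet> coord_deriv c j f p)"

definition metric_inv :: "'a chart \<Rightarrow> ('a \<Rightarrow> real^3) \<Rightarrow> 'a \<Rightarrow> real^2^2" where
  "metric_inv c f p = matrix_inv (metric c f p)"

text \<open>The unit normal which is positively oriented with respect to the oriented chart \<open>c\<close>.\<close>

definition unit_normal :: "'a chart \<Rightarrow> ('a \<Rightarrow> real^3) \<Rightarrow> 'a \<Rightarrow> real^3" where
  "unit_normal c f p = sgn (cross3 (coord_deriv c 1 f p) (coord_deriv c 2 f p))"

definition second_form :: "'a chart \<Rightarrow> ('a \<Rightarrow> real^3) \<Rightarrow> 'a \<Rightarrow> real^2^2" where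
  "second_form c f p =
     (\<chi> i j. coord_deriv c i (coord_deriv c j f) p \<bullet> unit_normal c f p)"

definition mean_curvature_in :: "'a chart \<Rightarrow> ('a \<Rightarrow> real^3) \<Rightarrow> 'a \<Rightarrow> real" where
  "mean_curvature_in c f p =
     (\<Sum>i\<in>UNIV. \<Sum>j\<in>UNIV. metric_inv c f p $ i $ j * second_form c f p $ i $ j)"

definition tracefree_form :: "'a chart \<Rightarrow> ('a \<Rightarrow> real^3) \<Rightarrow> 'a \<Rightarrow> real^2^2" where
  "tracefree_form c f p = second_form c f p - (mean_curvature_in c f p / 2) *\<^sub>R metric c f p"

text \<open>The value of a covariant 2-tensor on two tangent vectors.\<close>

definition bilin :: "real^2^2 \<Rightarrow> real^2 \<Rightarrow> real^2 \<Rightarrow> real" where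
  "bilin B v w = (\<Sum>i\<in>UNIV. \<Sum>j\<in>UNIV. B $ i $ j * v $ i * w $ j)"

definition tracefree_norm_sq_in :: "'a chart \<Rightarrow> ('a \<Rightarrow> real^3) \<Rightarrow> 'a \<Rightarrow> real" where
  "tracefree_norm_sq_in c f p =
     (\<Sum>i\<in>UNIV. \<Sum>j\<in>UNIV. \<Sum>k\<in>UNIV. \<Sum>l\<in>UNIV.
        metric_inv c f p $ i $ k * metric_inv c f p $ j $ l *
        tracefree_form c f p $ i $ j * tracefree_form c f p $ k $ l)"

definition gradient :: "'a chart \<Rightarrow> ('a \<Rightarrow> real^3) \<Rightarrow> ('a \<Rightarrow> real) \<Rightarrow> 'a \<Rightarrow> real^2" where
  "gradient c f u p = metric_inv c f p *v (\<chi> j. coord_deriv c j u p)"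

definition divergence :: "'a chart \<Rightarrow> ('a \<Rightarrow> real^3) \<Rightarrow> ('a \<Rightarrow> real^2) \<Rightarrow> 'a \<Rightarrow> real" where
  "divergence c f X p =
     (\<Sum>i\<in>UNIV. coord_deriv c i (\<lambda>q. sqrt (det (metric c f q)) * X q $ i) p) /
     sqrt (det (metric c f p))"

definition laplacian_in :: "'a chart \<Rightarrow> ('a \<Rightarrow> real^3) \<Rightarrow> ('a \<Rightarrow> real) \<Rightarrow> 'a \<Rightarrow> real" where
  "laplacian_in c f u p = divergence c f (gradient c f u) p"

text \<open>The interior unit normal at a boundary point: the boundary is the line where the
  second coordinate vanishes, so \<open>axis 1 1\<close> is tangent to it and the vectors with positive
  second component point into the surface.\<close>

definition interior_normal :: "'a chart \<Rightarrow> ('a \<Rightarrow> real^3) \<Rightarrow> 'a \<Rightarrow> real^2" where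
  "interior_normal c f p =
     (THE n. bilin (metric c f p) n n = 1 \<and> bilin (metric c f p) n (axis 1 1) = 0 \<and> 0 < n $ 2)"

subsection \<open>Global quantities\<close>

definition mean_curvature :: "'a chart set \<Rightarrow> ('a \<Rightarrow> real^3) \<Rightarrow> 'a \<Rightarrow> real" where
  "mean_curvature A f p = mean_curvature_in (chart_at A p) f p"

definition tracefree_norm_sq :: "'a chart set \<Rightarrow> ('a \<Rightarrow> real^3) \<Rightarrow> 'a \<Rightarrow> real" where
  "tracefree_norm_sq A f p = tracefree_norm_sq_in (chart_at A p) f p"

definition laplacian :: "'a chart set \<Rightarrow> ('a \<Rightarrow> real^3) \<Rightarrow> ('a \<Rightarrow> real) \<Rightarrow> 'a \<Rightarrow> real" where
  "laplacian A f u p = laplacian_in (chart_at A p) f u p"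

definition area_measure ::
  "'a::t2_space set \<Rightarrow> 'a chart set \<Rightarrow> ('a \<Rightarrow> real^3) \<Rightarrow> 'a measure" where
  "area_measure S A f = (THE M.
     sets M = sets (restrict_space borel S) \<and>
     (\<forall>c\<in>A. \<forall>B\<in>sets M. B \<subseteq> chart_dom c \<longrightarrow>
        emeasure M B = (\<integral>\<^sup>+ u \<in> chart_map c ` B.
          ennreal (sqrt (det (metric c f (chart_inv c u)))) \<partial>lborel)))"

definition length_measure ::
  "'a::t2_space chart set \<Rightarrow> ('a \<Rightarrow> real^3) \<Rightarrow> 'a measure" where
  "length_measure A f = (THE M.
     sets M = sets (restrict_space borel (surface_boundary A)) \<and>
     (\<forall>c\<in>A. \<forall>B\<in>sets M. B \<subseteq> chart_dom c \<longrightarrow>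
        emeasure M B = (\<integral>\<^sup>+ s \<in> {s. vector [s, 0] \<in> chart_map c ` B}.
          ennreal (sqrt (metric c f (chart_inv c (vector [s, 0])) $ 1 $ 1)) \<partial>lborel)))"

definition thomsen :: "'a::t2_space set \<Rightarrow> 'a chart set \<Rightarrow> ('a \<Rightarrow> real^3) \<Rightarrow> real" where
  "thomsen S A f = 1/2 * (LINT p|area_measure S A f. tracefree_norm_sq A f p)"

definition thomsen_gradient :: "'a chart set \<Rightarrow> ('a \<Rightarrow> real^3) \<Rightarrow> 'a \<Rightarrow> real" where
  "thomsen_gradient A f p =
     laplacian A f (mean_curvature A f) p + tracefree_norm_sq A f p * mean_curvature A f p"

definition boundary_term ::
  "'a chart set \<Rightarrow> ('a \<Rightarrow> real^3) \<Rightarrow> ('a \<Rightarrow> real) \<Rightarrow> ('a chart \<Rightarrow> 'a \<Rightarrow> real^2) \<Rightarrow> 'a \<Rightarrow> real" where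
  "boundary_term A f \<phi> \<xi> p =
     (let c = chart_at A p; \<eta> = interior_normal c f p in
        1/2 * \<phi> p * differential c (mean_curvature A f) p \<eta>
        - bilin (tracefree_form c f p) (gradient c f \<phi> p) \<eta>
        - 1/2 * tracefree_norm_sq A f p * bilin (metric c f p) (\<xi> c p) \<eta>)"

end

theory Submission
  imports Defs
begin

text \<open>In dimension two \<open>|h\<^sup>\<circ>|\<^sup>2 / 2 = H\<^sup>2 / 4 - K\<close>, so in a chart the density of the functional is an
explicit function of the two fundamental forms. The Gauss formula gives their \<open>t\<close>-derivatives, and the
Codazzi equations (\<open>div h\<^sup>\<circ> = dH / 2\<close>) turn the derivative of the density into
\<open>1/2 W \<phi> \<surd>det g\<close> plus the divergence of \<open>\<surd>det g (h\<^sup>\<circ>(grad \<phi>, \<cdot>)\<^sup>\<sharp> - 1/2 \<phi> grad H + 1/2 |h\<^sup>\<circ>|\<^sup>2 \<xi>)\<close>.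
A partition of unity with supports in coordinate rectangles, whose only side off the zero set of the
cut-off lies on the boundary, reduces the theorem to differentiation under the integral and to the
divergence theorem on a rectangle; the terms with derivatives of the cut-offs add up to the
derivative of the constant 1 and vanish.\<close>

section \<open>The divergence of the trace-free second fundamental form\<close>

text \<open>The vector field arises from two integrations by parts of the pairing of the trace-free
  form with the Hessian of \<phi>: the first leaves minus half the pairing of dH with d\<phi>, the
  second turns this into half \<phi> times the Laplacian of H. The tangential part \<xi> acts on a
  density by the Lie derivative, which is already a divergence. Behind the Codazzi step is the
  adjugate: adj(h) / det g is divergence free, so grad H / 2 comes only from the product rule
  applied to the part H g / 2. Two obstacles shape the rest. At boundary points derivatives are
  one-sided, so all rules of calculus, including the symmetry of second derivatives, must hold
  within relatively open subsets of a half-plane. And global quantities are evaluated in an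
  arbitrarily chosen chart, while both measures are definite descriptions: fluxes must be shown to
  transform as vector densities, and the measures to exist uniquely, before an integral can be
  computed. The cut-offs are differentiated only once, so piecewise polynomial bumps of class C1
  suffice.\<close>

text \<open>The Codazzi equations enter as the symmetry of the numbers \<open>k111\<close>, \dots, the normal components
  of the third derivatives; \<open>a, A, b, B, e, C\<close> are the Christoffel symbols.\<close>

lemma codazzi_divergence:
  fixes E F G L M N s H :: real
  assumes s: "s > 0" "s * s = E * G - F * F"
    and g: "E1 = 2 * (a * E + A * F)" "E2 = 2 * (b * E + B * F)"
    "F1 = a * F + A * G + (b * E + B * F)" "F2 = b * F + B * G + (e * E + C * F)"
    "G1 = 2 * (b * F + B * G)" "G2 = 2 * (e * F + C * G)"
    and h: "L1 = k111 - (a * L + A * M)" "L2 = k112 - (a * M + A * N)"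
    "M1 = k112 - (b * L + B * M)" "M2 = k122 - (b * M + B * N)"
    "N1 = k122 - (e * L + C * M)" "N2 = k222 - (e * M + C * N)"
    and s1: "s1 = (E1 * G + E * G1 - 2 * F * F1) / (2 * s)"
    and s2: "s2 = (E2 * G + E * G2 - 2 * F * F2) / (2 * s)"
  shows "(- (N1 - (H1 * G + H * G1) / 2) * s + (N - H * G / 2) * s1) / (s * s)
       + ((M2 - (H2 * F + H * F2) / 2) * s - (M - H * F / 2) * s2) / (s * s)
     = (G * H1 - F * H2) / s / 2 - (- (N - H * G / 2) * a + 2 * (M - H * F / 2) * b - (L - H * E / 2) * e) / s"
    and "((M1 - (H1 * F + H * F1) / 2) * s - (M - H * F / 2) * s1) / (s * s)
       + (- (L2 - (H2 * E + H * E2) / 2) * s + (L - H * E / 2) * s2) / (s * s)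
     = (E * H2 - F * H1) / s / 2 - (- (N - H * G / 2) * A + 2 * (M - H * F / 2) * B - (L - H * E / 2) * C) / s"
proof -
  \<comment> \<open>The logarithmic derivative of sqrt(det g) is the trace of the Christoffel
    symbols: \<open>a + B\<close> in direction 1 and \<open>b + C\<close> in direction 2. With this
    each quotient loses one factor \<open>s\<close>.\<close>
  have "E1 * G + E * G1 - 2 * F * F1 = 2 * (s * s) * (a + B)" unfolding g s(2) by (simp add: algebra_simps)
  then have s1': "s1 = s * (a + B)" using s(1) by (simp add: s1)
  have "E2 * G + E * G2 - 2 * F * F2 = 2 * (s * s) * (b + C)" unfolding g s(2) by (simp add: algebra_simps)
  then have s2': "s2 = s * (b + C)" using s(1) by (simp add: s2)
  have *: "(x * s + y * (s * z)) / (s * s) = (x + y * z) / s" "(x * s - y * (s * z)) / (s * s) = (x - y * z) / s" for x y z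
    using s(1) by (simp_all add: field_simps)
  have **: "x / s + y / s = u / s / 2 - v / s" if "2 * (x + y) = u - 2 * v" for x y u v
  proof -
    have "x + y = u / 2 - v" using that by simp
    then show ?thesis unfolding add_divide_distrib[symmetric] by (simp add: diff_divide_distrib)
  qed
  show "(- (N1 - (H1 * G + H * G1) / 2) * s + (N - H * G / 2) * s1) / (s * s)
       + ((M2 - (H2 * F + H * F2) / 2) * s - (M - H * F / 2) * s2) / (s * s)
     = (G * H1 - F * H2) / s / 2 - (- (N - H * G / 2) * a + 2 * (M - H * F / 2) * b - (L - H * E / 2) * e) / s"
    unfolding s1' s2' * by (rule **) (simp add: g h field_simps)
  show "((M1 - (H1 * F + H * F1) / 2) * s - (M - H * F / 2) * s1) / (s * s)
       + (- (L2 - (H2 * E + H * E2) / 2) * s + (L - H * E / 2) * s2) / (s * s)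
     = (E * H2 - F * H1) / s / 2 - (- (N - H * G / 2) * A + 2 * (M - H * F / 2) * B - (L - H * E / 2) * C) / s"
    unfolding s1' s2' * by (rule **) (simp add: g h field_simps)
qed

section \<open>Smooth maps\<close>

lemma frechet_derivative_cong_open:
  assumes "open W" "x \<in> W" "\<And>y. y \<in> W \<Longrightarrow> F y = G y"
  shows "frechet_derivative F (at x) = frechet_derivative G (at x)"
proof -
  have "(F has_derivative L) (at x) \<longleftrightarrow> (G has_derivative L) (at x)" for L
    using assms by (metis has_derivative_transform_within_open)
  then show ?thesis unfolding frechet_derivative_def by simp
qed

lemma times_differentiable_on_cong:
  assumes "open W" "\<And>x. x \<in> W \<Longrightarrow> F x = G x"
  shows "times_differentiable_on k W F \<longleftrightarrow> times_differentiable_on k W G"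
  using assms(2)
proof (induction k arbitrary: F G)
  case 0
  then show ?case by (simp cong: continuous_on_cong)
next
  case (Suc k)
  have d: "F differentiable (at x) \<longleftrightarrow> G differentiable (at x)" if "x \<in> W" for x
    unfolding differentiable_def using has_derivative_transform_within_open[OF _ assms(1) that] Suc.prems
    by metis
  have e: "times_differentiable_on k W (\<lambda>x. frechet_derivative F (at x) v)
         = times_differentiable_on k W (\<lambda>x. frechet_derivative G (at x) v)" for v
    by (rule Suc.IH) (use frechet_derivative_cong_open[OF assms(1) _ Suc.prems] in auto)
  show ?case using d e by simp
qed

lemma times_differentiable_on_subset:
  "times_differentiable_on k W F \<Longrightarrow> V \<subseteq> W \<Longrightarrow> times_differentiable_on k V F"
  by (induction k arbitrary: F) (auto intro: continuous_on_subset)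

text \<open>The recursive clause speaks only of the derivatives, so the lower order follows by
  induction; at the bottom, continuity comes from differentiability.\<close>

lemma times_differentiable_on_SucD:
  "times_differentiable_on (Suc k) W F \<Longrightarrow> times_differentiable_on k W F"
proof (induction k arbitrary: F)
  case 0
  then have "F differentiable_on W"
    by (intro differentiable_at_imp_differentiable_on) simp
  then show ?case
    by (simp add: differentiable_imp_continuous_on)
next
  case (Suc k)
  then show ?case by (metis times_differentiable_on.simps(2))
qed

lemma times_differentiable_on_const: "times_differentiable_on k W (\<lambda>x. c)"
  by (induction k arbitrary: c) auto

lemma times_differentiable_on_add:
  assumes "open W"
  shows "times_differentiable_on k W F \<Longrightarrow> times_differentiable_on k W G \<Longrightarrow>
    times_differentiable_on k W (\<lambda>x. F x + G x)"
proof (induction k arbitrary: F G)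
  case 0
  then show ?case by (auto intro: continuous_intros)
next
  case (Suc k)
  have "frechet_derivative (\<lambda>x. F x + G x) (at x) v
      = frechet_derivative F (at x) v + frechet_derivative G (at x) v" if "x \<in> W" for x v
  proof -
    have "((\<lambda>x. F x + G x) has_derivative
      (\<lambda>v. frechet_derivative F (at x) v + frechet_derivative G (at x) v)) (at x)"
      using Suc.prems that by (intro has_derivative_add) (auto simp flip: frechet_derivative_works)
    from frechet_derivative_at[OF this] show ?thesis by metis
  qed
  then have "times_differentiable_on k W (\<lambda>x. frechet_derivative (\<lambda>x. F x + G x) (at x) v)" for v
    using Suc times_differentiable_on_cong[OF assms, of "(\<lambda>x. frechet_derivative (\<lambda>x. F x + G x) (at x) v)"]
    by simp
  then show ?case using Suc.prems by auto
qed

lemma times_differentiable_on_linear: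
  assumes "open W" "bounded_linear L"
  shows "times_differentiable_on k W F \<Longrightarrow> times_differentiable_on k W (\<lambda>x. L (F x))"
proof (induction k arbitrary: F)
  case 0
  then show ?case
    using assms(2) by (simp add: bounded_linear.continuous_on)
next
  case (Suc k)
  have D: "((\<lambda>x. L (F x)) has_derivative (\<lambda>v. L (frechet_derivative F (at x) v))) (at x)"
    if "x \<in> W" for x
    using Suc.prems that
    by (intro bounded_linear.has_derivative[OF assms(2)]) (auto simp flip: frechet_derivative_works)
  have "frechet_derivative (\<lambda>x. L (F x)) (at x) v = L (frechet_derivative F (at x) v)" if "x \<in> W" for x v
    using frechet_derivative_at[OF D[OF that]] by metis
  then have "times_differentiable_on k W (\<lambda>x. frechet_derivative (\<lambda>x. L (F x)) (at x) v)" for v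
    using Suc times_differentiable_on_cong[OF assms(1), of "(\<lambda>x. frechet_derivative (\<lambda>x. L (F x)) (at x) v)"]
    by simp
  then show ?case using D by (auto simp: differentiable_def)
qed

text \<open>The product rule gives terms that pair one map with a derivative of the other, so the
  induction needs both maps again at the lower order. Real products, scalar multiples, inner
  products and cross products are all instances.\<close>

lemma times_differentiable_on_bilinear:
  assumes "open W" "bounded_bilinear h"
  shows "times_differentiable_on k W F \<Longrightarrow> times_differentiable_on k W G \<Longrightarrow>
    times_differentiable_on k W (\<lambda>x. h (F x) (G x))"
proof (induction k arbitrary: F G)
  case 0
  then show ?case
    using assms(2) by (simp add: bounded_bilinear.continuous_on)
next
  case (Suc k)
  have D: "((\<lambda>x. h (F x) (G x)) has_derivative (\<lambda>v. h (F x) (frechet_derivative G (at x) v)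
      + h (frechet_derivative F (at x) v) (G x))) (at x)" if "x \<in> W" for x
    using Suc.prems that
    by (intro bounded_bilinear.FDERIV[OF assms(2)]) (auto simp flip: frechet_derivative_works)
  have E: "frechet_derivative (\<lambda>x. h (F x) (G x)) (at x) v
     = h (F x) (frechet_derivative G (at x) v) + h (frechet_derivative F (at x) v) (G x)" if "x \<in> W" for x v
    using fun_cong[OF frechet_derivative_at[OF D[OF that]], of v] by simp
  have "times_differentiable_on k W
    (\<lambda>x. h (F x) (frechet_derivative G (at x) v) + h (frechet_derivative F (at x) v) (G x))" for v
    using Suc.prems times_differentiable_on_SucD[OF Suc.prems(1)] times_differentiable_on_SucD[OF Suc.prems(2)]
    by (intro times_differentiable_on_add assms Suc.IH) auto
  then have "times_differentiable_on k W (\<lambda>x. frechet_derivative (\<lambda>x. h (F x) (G x)) (at x) v)" for v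
    using times_differentiable_on_cong[OF assms(1), of "\<lambda>x. frechet_derivative (\<lambda>x. h (F x) (G x)) (at x) v"] E
    by simp
  then show ?case using D by (auto simp: differentiable_def)
qed

lemmas times_differentiable_on_mult = times_differentiable_on_bilinear[OF _ bounded_bilinear_mult]

lemma times_differentiable_on_inverse:
  fixes F :: "'a::euclidean_space \<Rightarrow> real"
  assumes "open W" "\<And>x. x \<in> W \<Longrightarrow> F x \<noteq> 0" "times_differentiable_on k W F"
  shows "times_differentiable_on k W (\<lambda>x. inverse (F x))"
  using assms(3)
proof (induction k)
  case 0
  then show ?case using assms(2) by (auto intro: continuous_intros)
next
  case (Suc k)
  have D: "((\<lambda>x. inverse (F x)) has_derivative
     (\<lambda>v. - (inverse (F x) * frechet_derivative F (at x) v * inverse (F x)))) (at x)" if "x \<in> W" for x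
    using Suc.prems that assms(2)
    by (intro Deriv.has_derivative_inverse) (auto simp flip: frechet_derivative_works)
  have E: "frechet_derivative (\<lambda>x. inverse (F x)) (at x) v
     = (-1) * (inverse (F x) * frechet_derivative F (at x) v * inverse (F x))" if "x \<in> W" for x v
    using frechet_derivative_at[OF D[OF that]] by (metis mult_minus1)
  have IH: "times_differentiable_on k W (\<lambda>x. inverse (F x))"
    using Suc times_differentiable_on_SucD by blast
  have "times_differentiable_on k W
    (\<lambda>x. (-1) * (inverse (F x) * frechet_derivative F (at x) v * inverse (F x)))" for v
    using Suc.prems by (intro times_differentiable_on_mult IH times_differentiable_on_const assms) auto
  then have "times_differentiable_on k W (\<lambda>x. frechet_derivative (\<lambda>x. inverse (F x)) (at x) v)" for v
    using times_differentiable_on_cong[OF assms(1), of "\<lambda>x. frechet_derivative (\<lambda>x. inverse (F x)) (at x) v"] E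
    by simp
  then show ?case using D by (auto simp: differentiable_def)
qed

lemma times_differentiable_on_sqrt:
  fixes F :: "'a::euclidean_space \<Rightarrow> real"
  assumes "open W" "\<And>x. x \<in> W \<Longrightarrow> 0 < F x" "times_differentiable_on k W F"
  shows "times_differentiable_on k W (\<lambda>x. sqrt (F x))"
  using assms(3)
proof (induction k)
  case 0
  then show ?case using assms(2) by (auto intro: continuous_intros)
next
  case (Suc k)
  have D: "((\<lambda>x. sqrt (F x)) has_derivative
     (\<lambda>v. frechet_derivative F (at x) v * (inverse (sqrt (F x)) / 2))) (at x)" if "x \<in> W" for x
    using Suc.prems that assms(2)
    by (intro has_derivative_real_sqrt) (auto simp flip: frechet_derivative_works)
  have E: "frechet_derivative (\<lambda>x. sqrt (F x)) (at x) v
     = frechet_derivative F (at x) v * (inverse (sqrt (F x)) * (1/2))" if "x \<in> W" for x v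
    using fun_cong[OF frechet_derivative_at[OF D[OF that]], of v] by simp
  have IH: "times_differentiable_on k W (\<lambda>x. sqrt (F x))"
    using Suc times_differentiable_on_SucD by blast
  have "times_differentiable_on k W
    (\<lambda>x. frechet_derivative F (at x) v * (inverse (sqrt (F x)) * (1/2)))" for v
    using Suc.prems assms(2)
    by (intro times_differentiable_on_mult times_differentiable_on_inverse IH times_differentiable_on_const assms)
      (auto dest!: assms(2))
  moreover have "times_differentiable_on k W (\<lambda>x. frechet_derivative (\<lambda>x. sqrt (F x)) (at x) v)
     \<longleftrightarrow> times_differentiable_on k W (\<lambda>x. frechet_derivative F (at x) v * (inverse (sqrt (F x)) * (1/2)))" for v
    by (rule times_differentiable_on_cong[OF assms(1)]) (rule E)
  ultimately have "times_differentiable_on k W (\<lambda>x. frechet_derivative (\<lambda>x. sqrt (F x)) (at x) v)" for v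
    by blast
  then show ?case using D by (auto simp: differentiable_def)
qed

section \<open>Smooth maps on sets that need not be open\<close>

lemma smooth_onE:
  assumes "smooth_on D F" "x \<in> D"
  obtains W G where "open W" "x \<in> W" "\<And>k. times_differentiable_on k W G"
    "\<And>y. y \<in> W \<Longrightarrow> y \<in> D \<Longrightarrow> G y = F y"
  using assms unfolding smooth_on_def by fastforce

lemma smooth_onI:
  assumes "\<And>x. x \<in> D \<Longrightarrow> \<exists>W G. open W \<and> x \<in> W \<and> (\<forall>k. times_differentiable_on k W G) \<and>
        (\<forall>y\<in>W \<inter> D. G y = F y)"
  shows "smooth_on D F"
  using assms unfolding smooth_on_def by blast

lemma smooth_on_cong:
  assumes "\<And>x. x \<in> D \<Longrightarrow> F x = G x"
  shows "smooth_on D F \<longleftrightarrow> smooth_on D G"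
  unfolding smooth_on_def using assms by (metis (no_types, lifting) IntD2)

lemma smooth_on_subset: "smooth_on D F \<Longrightarrow> E \<subseteq> D \<Longrightarrow> smooth_on E F"
proof (rule smooth_onI)
  fix x assume "smooth_on D F" "E \<subseteq> D" "x \<in> E"
  then show "\<exists>W G. open W \<and> x \<in> W \<and> (\<forall>k. times_differentiable_on k W G) \<and> (\<forall>y\<in>W \<inter> E. G y = F y)"
    by (elim smooth_onE[of D F x]) (blast+)
qed

lemma smooth_on_const: "smooth_on D (\<lambda>x. c)"
  by (rule smooth_onI, rule exI[of _ UNIV], rule exI[of _ "\<lambda>x. c"])
    (auto intro: times_differentiable_on_const)

lemma smooth_on_linear:
  assumes "bounded_linear L" "smooth_on D F"
  shows "smooth_on D (\<lambda>x. L (F x))"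
proof (rule smooth_onI)
  fix x assume "x \<in> D"
  with assms(2) obtain W G where W: "open W" "x \<in> W" "\<And>k. times_differentiable_on k W G"
    "\<And>y. y \<in> W \<Longrightarrow> y \<in> D \<Longrightarrow> G y = F y" by (rule smooth_onE) blast
  then show "\<exists>W G. open W \<and> x \<in> W \<and> (\<forall>k. times_differentiable_on k W G) \<and> (\<forall>y\<in>W \<inter> D. G y = L (F y))"
    using assms(1) by (intro exI[of _ W] exI[of _ "\<lambda>x. L (G x)"]) (auto intro: times_differentiable_on_linear)
qed

lemma smooth_on_bilinear:
  assumes "bounded_bilinear h" "smooth_on D F" "smooth_on D G"
  shows "smooth_on D (\<lambda>x. h (F x) (G x))"
proof (rule smooth_onI)
  fix x assume x: "x \<in> D"
  from assms(2) x obtain W F' where W: "open W" "x \<in> W" "\<And>k. times_differentiable_on k W F'"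
    "\<And>y. y \<in> W \<Longrightarrow> y \<in> D \<Longrightarrow> F' y = F y" by (rule smooth_onE) blast
  from assms(3) x obtain V G' where V: "open V" "x \<in> V" "\<And>k. times_differentiable_on k V G'"
    "\<And>y. y \<in> V \<Longrightarrow> y \<in> D \<Longrightarrow> G' y = G y" by (rule smooth_onE) blast
  have "times_differentiable_on k (W \<inter> V) (\<lambda>x. h (F' x) (G' x))" for k
    by (rule times_differentiable_on_bilinear[OF open_Int[OF W(1) V(1)] assms(1)
          times_differentiable_on_subset[OF W(3)] times_differentiable_on_subset[OF V(3)]]) auto
  then show "\<exists>W H. open W \<and> x \<in> W \<and> (\<forall>k. times_differentiable_on k W H) \<and> (\<forall>y\<in>W \<inter> D. H y = h (F y) (G y))"
    using W V by (intro exI[of _ "W \<inter> V"] exI[of _ "\<lambda>x. h (F' x) (G' x)"]) auto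
qed

lemma smooth_on_add:
  assumes "smooth_on D F" "smooth_on D G"
  shows "smooth_on D (\<lambda>x. F x + G x)"
proof (rule smooth_onI)
  fix x assume x: "x \<in> D"
  from assms(1) x obtain W F' where W: "open W" "x \<in> W" "\<And>k. times_differentiable_on k W F'"
    "\<And>y. y \<in> W \<Longrightarrow> y \<in> D \<Longrightarrow> F' y = F y" by (rule smooth_onE) blast
  from assms(2) x obtain V G' where V: "open V" "x \<in> V" "\<And>k. times_differentiable_on k V G'"
    "\<And>y. y \<in> V \<Longrightarrow> y \<in> D \<Longrightarrow> G' y = G y" by (rule smooth_onE) blast
  have "times_differentiable_on k (W \<inter> V) (\<lambda>x. F' x + G' x)" for k
    by (rule times_differentiable_on_add[OF open_Int[OF W(1) V(1)]
          times_differentiable_on_subset[OF W(3)] times_differentiable_on_subset[OF V(3)]]) auto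
  then show "\<exists>W H. open W \<and> x \<in> W \<and> (\<forall>k. times_differentiable_on k W H) \<and> (\<forall>y\<in>W \<inter> D. H y = F y + G y)"
    using W V by (intro exI[of _ "W \<inter> V"] exI[of _ "\<lambda>x. F' x + G' x"]) auto
qed

lemma smooth_on_inverse:
  fixes F :: "'a::euclidean_space \<Rightarrow> real"
  assumes "smooth_on D F" "\<And>x. x \<in> D \<Longrightarrow> F x \<noteq> 0"
  shows "smooth_on D (\<lambda>x. inverse (F x))"
proof (rule smooth_onI)
  fix x assume x: "x \<in> D"
  from assms(1) x obtain W G where W: "open W" "x \<in> W" "\<And>k. times_differentiable_on k W G"
    "\<And>y. y \<in> W \<Longrightarrow> y \<in> D \<Longrightarrow> G y = F y" by (rule smooth_onE) blast
  have c: "continuous_on W G" using W(3)[of 0] by simp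
  \<comment> \<open>The local extension may vanish off \<open>D\<close> although \<open>F\<close>
    does not vanish on \<open>D\<close>; continuity allows shrinking the neighbourhood until it has
    no zeros.\<close>
  define V where "V = W \<inter> G -` (- {0})"
  have V: "open V" unfolding V_def using c W(1) by (intro continuous_open_preimage) auto
  have xV: "x \<in> V" using W x assms(2) by (auto simp: V_def)
  have "times_differentiable_on k V (\<lambda>x. inverse (G x))" for k
    by (rule times_differentiable_on_inverse[OF V _ times_differentiable_on_subset[OF W(3)]])
      (auto simp: V_def)
  then show "\<exists>W H. open W \<and> x \<in> W \<and> (\<forall>k. times_differentiable_on k W H) \<and> (\<forall>y\<in>W \<inter> D. H y = inverse (F y))"
    using V xV W by (intro exI[of _ V] exI[of _ "\<lambda>x. inverse (G x)"]) (auto simp: V_def)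
qed

lemma smooth_on_sqrt:
  fixes F :: "'a::euclidean_space \<Rightarrow> real"
  assumes "smooth_on D F" "\<And>x. x \<in> D \<Longrightarrow> 0 < F x"
  shows "smooth_on D (\<lambda>x. sqrt (F x))"
proof (rule smooth_onI)
  fix x assume x: "x \<in> D"
  from assms(1) x obtain W G where W: "open W" "x \<in> W" "\<And>k. times_differentiable_on k W G"
    "\<And>y. y \<in> W \<Longrightarrow> y \<in> D \<Longrightarrow> G y = F y" by (rule smooth_onE) blast
  have c: "continuous_on W G" using W(3)[of 0] by simp
  define V where "V = W \<inter> G -` {0<..}"
  have V: "open V" unfolding V_def using c W(1) by (intro continuous_open_preimage) auto
  have xV: "x \<in> V" using W x assms(2) by (auto simp: V_def)
  have "times_differentiable_on k V (\<lambda>x. sqrt (G x))" for k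
    by (rule times_differentiable_on_sqrt[OF V _ times_differentiable_on_subset[OF W(3)]])
      (auto simp: V_def)
  then show "\<exists>W H. open W \<and> x \<in> W \<and> (\<forall>k. times_differentiable_on k W H) \<and> (\<forall>y\<in>W \<inter> D. H y = sqrt (F y))"
    using V xV W by (intro exI[of _ V] exI[of _ "\<lambda>x. sqrt (G x)"]) (auto simp: V_def)
qed

lemmas smooth_on_mult = smooth_on_bilinear[OF bounded_bilinear_mult]
lemmas smooth_on_inner = smooth_on_bilinear[OF bounded_bilinear_inner]
lemmas smooth_on_scaleR = smooth_on_bilinear[OF bounded_bilinear_scaleR]

lemma smooth_on_minus: "smooth_on D F \<Longrightarrow> smooth_on D (\<lambda>x. - F x)"
  by (rule smooth_on_linear[OF bounded_linear_minus[OF bounded_linear_ident]])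

lemma smooth_on_diff: "smooth_on D F \<Longrightarrow> smooth_on D G \<Longrightarrow> smooth_on D (\<lambda>x. F x - G x)"
  using smooth_on_add[of D F "\<lambda>x. - G x"] smooth_on_minus[of D G] by simp

lemma smooth_on_divide:
  fixes F G :: "'a::euclidean_space \<Rightarrow> real"
  assumes "smooth_on D F" "smooth_on D G" "\<And>x. x \<in> D \<Longrightarrow> G x \<noteq> 0"
  shows "smooth_on D (\<lambda>x. F x / G x)"
  using smooth_on_mult[OF assms(1) smooth_on_inverse[OF assms(2,3)]] by (simp add: divide_inverse)

lemma smooth_on_power:
  fixes F :: "'a::euclidean_space \<Rightarrow> real"
  shows "smooth_on D F \<Longrightarrow> smooth_on D (\<lambda>x. F x ^ n)"
  by (induction n) (auto intro: smooth_on_const smooth_on_mult)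

lemma smooth_on_vec_nth: "smooth_on D F \<Longrightarrow> smooth_on D (\<lambda>x. F x $ i)"
  by (rule smooth_on_linear[OF bounded_linear_vec_nth])

lemma bounded_bilinear_cross3: "bounded_bilinear cross3"
  by (intro bilinear_conv_bounded_bilinear[THEN iffD1]) (auto simp: bilinear_def linear_iff cross3_simps)

lemmas smooth_on_cross3 = smooth_on_bilinear[OF bounded_bilinear_cross3]

lemmas smooth_on_intros = smooth_on_const smooth_on_add smooth_on_diff smooth_on_minus smooth_on_mult
  smooth_on_inner smooth_on_scaleR smooth_on_cross3 smooth_on_divide smooth_on_power smooth_on_vec_nth
  smooth_on_sqrt

lemma smooth_on_continuous_on: "smooth_on D F \<Longrightarrow> continuous_on D F"
proof (unfold continuous_on_eq_continuous_within, rule ballI)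
  fix x assume F: "smooth_on D F" and x: "x \<in> D"
  from F x obtain W G where W: "open W" "x \<in> W" "\<And>k. times_differentiable_on k W G"
    "\<And>y. y \<in> W \<Longrightarrow> y \<in> D \<Longrightarrow> G y = F y" by (rule smooth_onE) blast
  have "continuous (at x) G"
    using W(3)[of 0] W(1,2) by (simp add: continuous_on_eq_continuous_at)
  then have "continuous (at x within D) G" by (rule continuous_at_imp_continuous_at_within)
  then show "continuous (at x within D) F"
    unfolding continuous_within using W x
    by (subst tendsto_cong[of _ G]) (auto simp: eventually_at_topological intro!: exI[of _ W])
qed

subsection \<open>Derivatives within a set with unique derivatives\<close>

text \<open>Each point of the set has, in every coordinate direction, other points of the set
  arbitrarily close to it. This makes a derivative within the set unique. The condition passes to
  products and relatively open subsets and covers half-planes, boxes and open sets, hence all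
  domains used below.\<close>

definition wide :: "'a::euclidean_space set \<Rightarrow> bool" where
  "wide D \<longleftrightarrow> (\<forall>x\<in>D. \<forall>i\<in>Basis. \<forall>e>0. \<exists>d. 0 < \<bar>d\<bar> \<and> \<bar>d\<bar> < e \<and> x + d *\<^sub>R i \<in> D)"

lemma wide_unique:
  assumes "wide D" "x \<in> D" "(F has_derivative L) (at x within D)"
  shows "frechet_derivative F (at x within D) = L"
proof -
  have "(F has_derivative frechet_derivative F (at x within D)) (at x within D)"
    using assms(3) by (auto simp: differentiable_def simp flip: frechet_derivative_works)
  then show ?thesis
    using assms by (intro frechet_derivative_unique_within[OF _ assms(3)]) (auto simp: wide_def)
qed

lemma wide_Times:
  assumes "wide D" "wide E"
  shows "wide (D \<times> E)"
  unfolding wide_def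
proof (safe)
  fix a :: 'a and b :: 'b and i :: 'a and j :: 'b and e :: real
  assume *: "a \<in> D" "b \<in> E" "(i, j) \<in> Basis" "0 < e"
  then consider "i \<in> Basis" "j = 0" | "i = 0" "j \<in> Basis" by (auto simp: Basis_prod_def)
  then show "\<exists>d. 0 < \<bar>d\<bar> \<and> \<bar>d\<bar> < e \<and> (a, b) + d *\<^sub>R (i, j) \<in> D \<times> E"
  proof cases
    case 1
    then show ?thesis using * assms(1) unfolding wide_def by force
  next
    case 2
    then show ?thesis using * assms(2) unfolding wide_def by force
  qed
qed

lemma wide_openin:
  assumes "wide E" "openin (top_of_set E) D"
  shows "wide D"
  unfolding wide_def
proof (intro ballI allI impI)
  fix x i :: 'a and e :: real assume *: "x \<in> D" "i \<in> Basis" "0 < e"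
  obtain T where T: "open T" "D = E \<inter> T" using assms(2) by (auto simp: openin_open)
  obtain r where r: "r > 0" "ball x r \<subseteq> T" using T * by (metis IntD2 open_contains_ball)
  obtain d where d: "0 < \<bar>d\<bar>" "\<bar>d\<bar> < min e r" "x + d *\<^sub>R i \<in> E"
    using assms(1) * T r unfolding wide_def by (metis IntD1 min_less_iff_conj)
  moreover have "x + d *\<^sub>R i \<in> ball x r" using d *(2) by (simp add: dist_norm)
  ultimately show "\<exists>d. 0 < \<bar>d\<bar> \<and> \<bar>d\<bar> < e \<and> x + d *\<^sub>R i \<in> D" using r T by auto
qed

lemma wide_open: "open D \<Longrightarrow> wide D"
proof (rule wide_openin[of UNIV])
  show "wide (UNIV :: 'a set)" unfolding wide_def
  proof (intro ballI allI impI)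
    fix e :: real and x i :: 'a assume "e > 0"
    then show "\<exists>d. 0 < \<bar>d\<bar> \<and> \<bar>d\<bar> < e \<and> x + d *\<^sub>R i \<in> UNIV"
      by (intro exI[of _ "e/2"]) auto
  qed
qed simp

lemma wide_half_plane: "wide half_plane"
  unfolding wide_def half_plane_def
proof (intro ballI allI impI)
  fix x i :: "real^2" and e :: real assume *: "x \<in> {u. 0 \<le> u $ 2}" "i \<in> Basis" "0 < e"
  then show "\<exists>d. 0 < \<bar>d\<bar> \<and> \<bar>d\<bar> < e \<and> x + d *\<^sub>R i \<in> {u. 0 \<le> u $ 2}"
    by (intro exI[of _ "e/2"]) (auto simp: Basis_vec_def axis_def)
qed

lemma wide_cbox:
  fixes a b :: "'a::euclidean_space"
  assumes "\<And>i. i \<in> Basis \<Longrightarrow> a \<bullet> i < b \<bullet> i"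
  shows "wide (cbox a b)"
  unfolding wide_def
proof (intro ballI allI impI)
  fix x i :: 'a and e :: real assume *: "x \<in> cbox a b" "i \<in> Basis" "0 < e"
  define d where "d = (if x \<bullet> i = a \<bullet> i then min (e/2) (b \<bullet> i - a \<bullet> i) else - min (e/2) (x \<bullet> i - a \<bullet> i))"
  have "a \<bullet> i \<le> x \<bullet> i" "x \<bullet> i \<le> b \<bullet> i" using * by (auto simp: mem_box)
  then have d: "0 < \<bar>d\<bar>" "\<bar>d\<bar> < e" "a \<bullet> i \<le> x \<bullet> i + d" "x \<bullet> i + d \<le> b \<bullet> i"
    using *(2,3) assms[of i] unfolding d_def min_def by (simp_all split: if_splits)
  have "x + d *\<^sub>R i \<in> cbox a b"
    unfolding mem_box
  proof
    fix j :: 'a assume j: "j \<in> Basis"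
    show "a \<bullet> j \<le> (x + d *\<^sub>R i) \<bullet> j \<and> (x + d *\<^sub>R i) \<bullet> j \<le> b \<bullet> j"
      using d *(1) *(2) j by (cases "i = j") (auto simp: inner_add_left inner_Basis mem_box)
  qed
  with d show "\<exists>d. 0 < \<bar>d\<bar> \<and> \<bar>d\<bar> < e \<and> x + d *\<^sub>R i \<in> cbox a b" by blast
qed

lemma has_derivative_transform_openin:
  assumes "(F has_derivative L) (at x within D)" "openin (top_of_set D) E" "x \<in> E"
    and "\<And>y. y \<in> E \<Longrightarrow> F y = G y"
  shows "(G has_derivative L) (at x within D)"
proof -
  obtain r where r: "r > 0" "\<And>y. y \<in> D \<Longrightarrow> dist y x < r \<Longrightarrow> y \<in> E"
    using assms(2,3) by (metis openin_euclidean_subtopology_iff)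
  have "x \<in> D" using assms(2,3) openin_imp_subset by blast
  then show ?thesis
    using r assms(4) by (intro has_derivative_transform_within[OF assms(1) r(1)]) auto
qed

text \<open>An extension restricts to a derivative within \<open>D\<close>, and \<open>wide\<close>
  makes that derivative unique. So near \<open>x\<close> the one-sided derivative of
  \<open>F\<close> is the ordinary derivative of \<open>G\<close>, and results on open sets carry
  over to boundary points.\<close>

lemma smooth_on_extension:
  assumes "wide D" "smooth_on D F" "x \<in> D"
  obtains W G where "open W" "x \<in> W" "\<And>k. times_differentiable_on k W G"
    "\<And>y. y \<in> W \<Longrightarrow> y \<in> D \<Longrightarrow> G y = F y"
    "\<And>y. y \<in> W \<Longrightarrow> y \<in> D \<Longrightarrow> (F has_derivative frechet_derivative G (at y)) (at y within D)"
    "\<And>y. y \<in> W \<Longrightarrow> y \<in> D \<Longrightarrow> frechet_derivative F (at y within D) = frechet_derivative G (at y)"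
proof -
  from assms(2,3) obtain W G where W: "open W" "x \<in> W" "\<And>k. times_differentiable_on k W G"
    "\<And>y. y \<in> W \<Longrightarrow> y \<in> D \<Longrightarrow> G y = F y" by (rule smooth_onE) blast
  have "(F has_derivative frechet_derivative G (at y)) (at y within D)" if y: "y \<in> W" "y \<in> D" for y
  proof -
    have "G differentiable (at y)" using W(3)[of "Suc 0"] y by simp
    then have "(G has_derivative frechet_derivative G (at y)) (at y within D)"
      by (rule has_derivative_at_withinI[OF frechet_derivative_works[THEN iffD1]])
    moreover have "openin (top_of_set D) (D \<inter> W)" using W(1) by auto
    ultimately show ?thesis
      by (rule has_derivative_transform_openin) (use y W(4) in auto)
  qed
  then show ?thesis
    using that[OF W] wide_unique[OF assms(1)] by blast
qed

lemma smooth_on_has_derivative: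
  assumes "wide D" "smooth_on D F" "x \<in> D"
  shows "(F has_derivative frechet_derivative F (at x within D)) (at x within D)"
  using smooth_on_extension[OF assms] assms(3) by metis

lemma smooth_on_frechet_derivative:
  assumes "wide D" "smooth_on D F"
  shows "smooth_on D (\<lambda>x. frechet_derivative F (at x within D) v)"
proof (rule smooth_onI)
  fix x assume x: "x \<in> D"
  from smooth_on_extension[OF assms x] obtain W G where W: "open W" "x \<in> W" "\<And>k. times_differentiable_on k W G"
    "\<And>y. y \<in> W \<Longrightarrow> y \<in> D \<Longrightarrow> frechet_derivative F (at y within D) = frechet_derivative G (at y)"
    by metis
  have "times_differentiable_on k W (\<lambda>x. frechet_derivative G (at x) v)" for k
    using W(3)[of "Suc k"] by simp
  then show "\<exists>W G. open W \<and> x \<in> W \<and> (\<forall>k. times_differentiable_on k W G) \<and>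
      (\<forall>y\<in>W \<inter> D. G y = frechet_derivative F (at y within D) v)"
    using W by (intro exI[of _ W] exI[of _ "\<lambda>x. frechet_derivative G (at x) v"]) auto
qed

subsection \<open>Symmetry of second derivatives\<close>

text \<open>Two applications of the mean value theorem: first along \<open>v\<close> to the
  difference of \<open>G\<close> between the two sides parallel to \<open>v\<close>, then along
  \<open>w\<close> to the derivative of \<open>G\<close> in direction \<open>v\<close>. The bound on
  \<open>h\<close> keeps the whole parallelogram in the ball.\<close>

lemma mixed_difference_mvt:
  fixes G :: "'a::euclidean_space \<Rightarrow> real"
  assumes d: "\<And>x. x \<in> ball x0 r \<Longrightarrow> (G has_derivative G' x) (at x)"
    and d2: "\<And>x. x \<in> ball x0 r \<Longrightarrow> ((\<lambda>x. G' x v) has_derivative G'' x) (at x)"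
    and h: "0 < h" "h * (norm v + norm w) < r"
  shows "\<exists>y. dist x0 y \<le> h * (norm v + norm w) \<and>
    G (x0 + h *\<^sub>R v + h *\<^sub>R w) - G (x0 + h *\<^sub>R v) - G (x0 + h *\<^sub>R w) + G x0 = h * h * G'' y w"
proof -
  have mem: "dist x0 (x0 + s *\<^sub>R v + t *\<^sub>R w) \<le> h * (norm v + norm w)" if "0 \<le> s" "s \<le> h" "0 \<le> t" "t \<le> h" for s t
  proof -
    have "dist x0 (x0 + s *\<^sub>R v + t *\<^sub>R w) = norm (s *\<^sub>R v + t *\<^sub>R w)" by (subst dist_commute) (simp add: dist_norm add.assoc)
    also have "\<dots> \<le> s * norm v + t * norm w" using norm_triangle_ineq[of "s *\<^sub>R v" "t *\<^sub>R w"] that by simp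
    also have "\<dots> \<le> h * norm v + h * norm w" using that by (intro add_mono mult_right_mono) auto
    finally show ?thesis by (simp add: algebra_simps)
  qed
  define P where "P s = G (x0 + s *\<^sub>R v + h *\<^sub>R w) - G (x0 + s *\<^sub>R v)" for s
  have dP: "(P has_real_derivative G' (x0 + s *\<^sub>R v + h *\<^sub>R w) v - G' (x0 + s *\<^sub>R v) v) (at s)"
    if s: "0 \<le> s" "s \<le> h" for s
  proof -
    have in1: "x0 + s *\<^sub>R v + h *\<^sub>R w \<in> ball x0 r" "x0 + s *\<^sub>R v \<in> ball x0 r"
      using mem[of s h] mem[of s 0] s h by auto
    have l: "linear (G' (x0 + s *\<^sub>R v + h *\<^sub>R w))" "linear (G' (x0 + s *\<^sub>R v))"
      using d[OF in1(1)] d[OF in1(2)] by (auto intro: has_derivative_linear)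
    have "((\<lambda>s. G (x0 + s *\<^sub>R v + h *\<^sub>R w)) has_derivative (\<lambda>t. G' (x0 + s *\<^sub>R v + h *\<^sub>R w) (t *\<^sub>R v))) (at s)"
      by (rule has_derivative_compose[of "\<lambda>s. x0 + s *\<^sub>R v + h *\<^sub>R w", OF _ d[OF in1(1)]])
        (auto intro!: derivative_eq_intros)
    moreover have "((\<lambda>s. G (x0 + s *\<^sub>R v)) has_derivative (\<lambda>t. G' (x0 + s *\<^sub>R v) (t *\<^sub>R v))) (at s)"
      by (rule has_derivative_compose[of "\<lambda>s. x0 + s *\<^sub>R v", OF _ d[OF in1(2)]])
        (auto intro!: derivative_eq_intros)
    ultimately have "(P has_derivative (\<lambda>t. G' (x0 + s *\<^sub>R v + h *\<^sub>R w) (t *\<^sub>R v) - G' (x0 + s *\<^sub>R v) (t *\<^sub>R v))) (at s)"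
      unfolding P_def by (rule has_derivative_diff)
    then show ?thesis
      unfolding has_field_derivative_def
      by (rule has_derivative_eq_rhs)
        (simp add: fun_eq_iff linear_scale[OF l(1)] linear_scale[OF l(2)] right_diff_distrib mult.commute)
  qed
  obtain s where s: "0 < s" "s < h" "P h - P 0 = (h - 0) * (G' (x0 + s *\<^sub>R v + h *\<^sub>R w) v - G' (x0 + s *\<^sub>R v) v)"
    using MVT2[of 0 h P, OF h(1) dP] by blast
  define Q where "Q t = G' (x0 + s *\<^sub>R v + t *\<^sub>R w) v" for t
  have dQ: "(Q has_real_derivative G'' (x0 + s *\<^sub>R v + t *\<^sub>R w) w) (at t)" if t: "0 \<le> t" "t \<le> h" for t
  proof -
    have in1: "x0 + s *\<^sub>R v + t *\<^sub>R w \<in> ball x0 r" using mem[of s t] s t h by auto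
    have l: "linear (G'' (x0 + s *\<^sub>R v + t *\<^sub>R w))"
      using d2[OF in1] by (auto intro: has_derivative_linear)
    have "((\<lambda>t. G' (x0 + s *\<^sub>R v + t *\<^sub>R w) v) has_derivative (\<lambda>u. G'' (x0 + s *\<^sub>R v + t *\<^sub>R w) (u *\<^sub>R w))) (at t)"
      by (rule has_derivative_compose[of "\<lambda>t. x0 + s *\<^sub>R v + t *\<^sub>R w", OF _ d2[OF in1]])
        (auto intro!: derivative_eq_intros)
    then show ?thesis unfolding Q_def has_field_derivative_def
      by (rule has_derivative_eq_rhs) (simp add: fun_eq_iff linear_scale[OF l] mult.commute)
  qed
  obtain t where t: "0 < t" "t < h" "Q h - Q 0 = (h - 0) * G'' (x0 + s *\<^sub>R v + t *\<^sub>R w) w"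
    using MVT2[of 0 h Q, OF h(1) dQ] by blast
  show ?thesis
    using mem[of s t] s t by (intro exI[of _ "x0 + s *\<^sub>R v + t *\<^sub>R w"]) (auto simp: P_def Q_def)
qed

text \<open>The second difference over a parallelogram is symmetric in its two sides, so each mixed
  derivative takes the same value at some point near \<open>x\<close>. If the values at
  \<open>x\<close> differed, continuity would separate them on a small ball. The argument runs in
  one component at a time.\<close>

lemma times_differentiable_on_symmetric:
  fixes G :: "'a::euclidean_space \<Rightarrow> 'b::euclidean_space"
  assumes W: "open W" "x \<in> W" and G: "times_differentiable_on 2 W G"
  shows "frechet_derivative (\<lambda>y. frechet_derivative G (at y) v) (at x) w
       = frechet_derivative (\<lambda>y. frechet_derivative G (at y) w) (at x) v"
proof (rule euclidean_eqI)
  fix b :: 'b assume b: "b \<in> Basis"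
  define g where "g = (\<lambda>y. G y \<bullet> b)"
  have G1: "times_differentiable_on 1 W (\<lambda>y. frechet_derivative G (at y) v)" for v
    using G by (simp add: numeral_2_eq_2)
  have d1: "(g has_derivative (\<lambda>v. frechet_derivative G (at y) v \<bullet> b)) (at y)" if "y \<in> W" for y
    using G that unfolding g_def
    by (intro has_derivative_inner_left) (simp add: numeral_2_eq_2 frechet_derivative_works[symmetric])
  have d2: "((\<lambda>y. frechet_derivative G (at y) v \<bullet> b) has_derivative
      (\<lambda>w. frechet_derivative (\<lambda>y. frechet_derivative G (at y) v) (at y) w \<bullet> b)) (at y)" if "y \<in> W" for y v
    using G1[of v] that
    by (intro has_derivative_inner_left) (auto simp flip: frechet_derivative_works)
  define H where "H v w y = frechet_derivative (\<lambda>y. frechet_derivative G (at y) v) (at y) w \<bullet> b" for v w y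
  have cont: "isCont (H v w) x" for v w
  proof -
    have "continuous_on W (\<lambda>y. frechet_derivative (\<lambda>y. frechet_derivative G (at y) v) (at y) w)"
      using G1[of v] by simp
    then have "continuous_on W (H v w)" unfolding H_def by (intro continuous_intros)
    then show ?thesis using W by (simp add: continuous_on_eq_continuous_at)
  qed
  have "H v w x = H w v x"
  proof (rule ccontr)
    assume ne: "H v w x \<noteq> H w v x"
    define e where "e = \<bar>H v w x - H w v x\<bar> / 2"
    have e: "e > 0" using ne by (simp add: e_def)
    obtain r0 where r0: "r0 > 0" "ball x r0 \<subseteq> W" using W by (meson open_contains_ball)
    obtain r1 where r1: "r1 > 0" "\<And>y. dist y x < r1 \<Longrightarrow> dist (H v w y) (H v w x) < e"
      using cont[of v w] e by (auto simp: continuous_at_eps_delta)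
    obtain r2 where r2: "r2 > 0" "\<And>y. dist y x < r2 \<Longrightarrow> dist (H w v y) (H w v x) < e"
      using cont[of w v] e by (auto simp: continuous_at_eps_delta)
    define r where "r = min r0 (min r1 r2)"
    have r: "r > 0" using r0 r1 r2 by (simp add: r_def)
    \<comment> \<open>The summand 1 keeps the denominator positive even if both vectors vanish; the
      parallelogram stays within distance \<open>r / 2\<close> of \<open>x\<close>.\<close>
    define h where "h = r / (2 * (norm v + norm w + 1))"
    have pos: "norm v + norm w + 1 > 0" by (simp add: add_nonneg_pos)
    have halve: "r / (2 * n) * n = r / 2" if "n > 0" for n :: real using that by simp
    have h: "h > 0" "h * (norm v + norm w) < r"
    proof -
      show "h > 0" using r pos by (simp add: h_def)
      have "h * (norm v + norm w) \<le> h * (norm v + norm w + 1)" using \<open>h > 0\<close> by (intro mult_left_mono) auto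
      also have "\<dots> = r / 2"
        using halve[OF pos] unfolding h_def .
      finally show "h * (norm v + norm w) < r" using r by simp
    qed
    have sub: "y \<in> W" if "y \<in> ball x r" for y using that r0 by (auto simp: r_def)
    obtain y where y: "dist x y < r" "g (x + h *\<^sub>R v + h *\<^sub>R w) - g (x + h *\<^sub>R v) - g (x + h *\<^sub>R w) + g x = h * h * H v w y"
      using mixed_difference_mvt[of x r g _ v _ h w, OF d1[OF sub] d2[OF sub] h] h(2)
      unfolding H_def by (auto dest: le_less_trans)
    have h': "h * (norm w + norm v) < r" using h(2) by (simp add: add.commute)
    obtain z where z: "dist x z < r" "g (x + h *\<^sub>R w + h *\<^sub>R v) - g (x + h *\<^sub>R w) - g (x + h *\<^sub>R v) + g x = h * h * H w v z"
      using mixed_difference_mvt[of x r g _ w _ h v, OF d1[OF sub] d2[OF sub] h(1) h'] h'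
      unfolding H_def by (auto dest: le_less_trans)
    have "h * h * H v w y = h * h * H w v z"
      using y(2) z(2) by (simp add: algebra_simps)
    then have "H v w y = H w v z" using h by simp
    moreover have "dist (H v w y) (H v w x) < e" using y(1) r1(2)[of y] by (simp add: r_def dist_commute[of x y])
    moreover have "dist (H w v z) (H w v x) < e" using z(1) r2(2)[of z] by (simp add: r_def dist_commute[of x z])
    ultimately show False unfolding e_def dist_real_def by argo
  qed
  then show "frechet_derivative (\<lambda>y. frechet_derivative G (at y) v) (at x) w \<bullet> b
       = frechet_derivative (\<lambda>y. frechet_derivative G (at y) w) (at x) v \<bullet> b"
    by (simp add: H_def)
qed

text \<open>Both iterated one-sided derivatives agree with those of a local extension, where the
  order of differentiation is immaterial.\<close>

lemma smooth_on_symmetric: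
  fixes F :: "'a::euclidean_space \<Rightarrow> 'b::euclidean_space"
  assumes "wide D" "smooth_on D F" "x \<in> D"
  shows "frechet_derivative (\<lambda>y. frechet_derivative F (at y within D) v) (at x within D) w
       = frechet_derivative (\<lambda>y. frechet_derivative F (at y within D) w) (at x within D) v"
proof -
  from smooth_on_extension[OF assms] obtain W G where W: "open W" "x \<in> W" "\<And>k. times_differentiable_on k W G"
    "\<And>y. y \<in> W \<Longrightarrow> y \<in> D \<Longrightarrow> frechet_derivative F (at y within D) = frechet_derivative G (at y)"
    by metis
  have eq: "frechet_derivative (\<lambda>y. frechet_derivative F (at y within D) v) (at x within D)
     = frechet_derivative (\<lambda>y. frechet_derivative G (at y) v) (at x)" for v
  proof (rule wide_unique[OF assms(1,3)])
    have "(\<lambda>y. frechet_derivative G (at y) v) differentiable (at x)"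
      using W(3)[of 2] W(2) by (simp add: numeral_2_eq_2)
    then have "((\<lambda>y. frechet_derivative G (at y) v) has_derivative
       frechet_derivative (\<lambda>y. frechet_derivative G (at y) v) (at x)) (at x within D)"
      by (rule has_derivative_at_withinI[OF frechet_derivative_works[THEN iffD1]])
    moreover have "openin (top_of_set D) (D \<inter> W)" using W(1) by auto
    ultimately show "((\<lambda>y. frechet_derivative F (at y within D) v) has_derivative
       frechet_derivative (\<lambda>y. frechet_derivative G (at y) v) (at x)) (at x within D)"
      by (rule has_derivative_transform_openin) (use W assms(3) in auto)
  qed
  show ?thesis unfolding eq by (rule times_differentiable_on_symmetric[OF W(1,2) W(3)])
qed

subsection \<open>Slices of a product\<close>

lemma times_differentiable_on_slice:
  fixes G :: "'a::euclidean_space \<times> 'b::euclidean_space \<Rightarrow> 'c::real_normed_vector"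
  assumes "open W"
  shows "times_differentiable_on k W G \<Longrightarrow> times_differentiable_on k {u. (u, t) \<in> W} (\<lambda>u. G (u, t))"
proof (induction k arbitrary: G)
  case 0
  then have "continuous_on ((\<lambda>u. (u, t)) -` W) (G \<circ> (\<lambda>u. (u, t)))"
    by (intro continuous_on_compose) (auto intro!: continuous_intros intro: continuous_on_subset)
  then show ?case by (simp add: vimage_def o_def)
next
  case (Suc k)
  have op: "open {u. (u, t) \<in> W}"
    using continuous_open_vimage[OF assms, of "\<lambda>u. (u, t)"] by (simp add: vimage_def continuous_intros)
  have D: "((\<lambda>u. G (u, t)) has_derivative (\<lambda>v. frechet_derivative G (at (u, t)) (v, 0))) (at u)"
    if "(u, t) \<in> W" for u
    using Suc.prems that
    by (intro has_derivative_compose[of "\<lambda>u. (u, t)", where g=G])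
       (auto intro!: derivative_eq_intros simp flip: frechet_derivative_works)
  have "frechet_derivative (\<lambda>u. G (u, t)) (at u) v = frechet_derivative G (at (u, t)) (v, 0)"
    if "(u, t) \<in> W" for u v
    using frechet_derivative_at[OF D[OF that]] by metis
  moreover have "times_differentiable_on k {u. (u, t) \<in> W} (\<lambda>u. frechet_derivative G (at (u, t)) (v, 0))" for v
    using Suc.IH[of "\<lambda>x. frechet_derivative G (at x) (v, 0)"] Suc.prems by simp
  ultimately have "times_differentiable_on k {u. (u, t) \<in> W} (\<lambda>u. frechet_derivative (\<lambda>u. G (u, t)) (at u) v)" for v
    using times_differentiable_on_cong[OF op, of "\<lambda>u. frechet_derivative (\<lambda>u. G (u, t)) (at u) v"] by simp
  then show ?case using D by (auto simp: differentiable_def)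
qed

lemma smooth_on_slice:
  fixes R :: "'a::euclidean_space \<times> 'b::euclidean_space \<Rightarrow> 'c::real_normed_vector"
  assumes "smooth_on (D \<times> I) R" "t \<in> I"
  shows "smooth_on D (\<lambda>u. R (u, t))"
proof (rule smooth_onI)
  fix u assume "u \<in> D"
  then have "(u, t) \<in> D \<times> I" using assms(2) by simp
  with assms(1) obtain W G where W: "open W" "(u, t) \<in> W" "\<And>k. times_differentiable_on k W G"
    "\<And>y. y \<in> W \<Longrightarrow> y \<in> D \<times> I \<Longrightarrow> G y = R y" by (rule smooth_onE) blast
  have op: "open {u. (u, t) \<in> W}"
    using continuous_open_vimage[OF W(1), of "\<lambda>u. (u, t)"] by (simp add: vimage_def continuous_intros)
  show "\<exists>W G. open W \<and> u \<in> W \<and> (\<forall>k. times_differentiable_on k W G) \<and> (\<forall>y\<in>W \<inter> D. G y = R (y, t))"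
    using op W assms(2) times_differentiable_on_slice[OF W(1) W(3)]
    by (intro exI[of _ "{u. (u, t) \<in> W}"] exI[of _ "\<lambda>u. G (u, t)"]) auto
qed

lemma has_derivative_slice_left:
  assumes "(R has_derivative L) (at (u, t) within D \<times> I)" "t \<in> I"
  shows "((\<lambda>u. R (u, t)) has_derivative (\<lambda>v. L (v, 0))) (at u within D)"
proof (rule has_derivative_in_compose[of "\<lambda>u. (u, t)", where g=R])
  show "(R has_derivative L) (at (u, t) within (\<lambda>u. (u, t)) ` D)"
    using assms by (auto intro: has_derivative_subset)
qed (auto intro!: derivative_eq_intros)

lemma has_derivative_slice_right:
  assumes "(R has_derivative L) (at (u, t) within D \<times> I)" "u \<in> D"
  shows "((\<lambda>t. R (u, t)) has_derivative (\<lambda>v. L (0, v))) (at t within I)"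
proof (rule has_derivative_in_compose[of "\<lambda>t. (u, t)", where g=R])
  show "(R has_derivative L) (at (u, t) within (\<lambda>t. (u, t)) ` I)"
    using assms by (auto intro: has_derivative_subset)
qed (auto intro!: derivative_eq_intros)

section \<open>Calculus in charts\<close>

text \<open>Derivatives within an overlap of charts are thereby derivatives within the full chart
  range, so formulas found on an overlap need no change of filter.\<close>

lemma at_within_openin:
  assumes "openin (top_of_set D) E" "x \<in> E"
  shows "at x within E = at x within D"
proof -
  obtain T where "open T" "E = D \<inter> T" using assms(1) by (auto simp: openin_open)
  then show ?thesis using assms(2) by (intro at_within_nhd[of x T]) auto
qed

lemma real2_decomp: "(v::real^2) = (v $ 1) *\<^sub>R axis 1 1 + (v $ 2) *\<^sub>R axis 2 1"
  by (simp add: vec_eq_iff forall_2 axis_def)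

lemma axis2_simps [simp]:
  "(axis 1 1 :: real^2) $ 1 = 1" "(axis 1 1 :: real^2) $ 2 = 0"
  "(axis 2 1 :: real^2) $ 1 = 0" "(axis 2 1 :: real^2) $ 2 = 1"
  by (simp_all add: axis_def)

locale surface =
  fixes S :: "'a::t2_space set" and A :: "'a chart set"
  assumes surface: "compact_oriented_surface S A"
begin

lemma compact_S: "compact S" using surface by (simp add: compact_oriented_surface_def)

lemma dom_cover: "(\<Union>c\<in>A. chart_dom c) = S"
  using surface by (simp add: compact_oriented_surface_def)

lemma dom_subset: "c \<in> A \<Longrightarrow> chart_dom c \<subseteq> S" using dom_cover by blast

lemma dom_openin: "c \<in> A \<Longrightarrow> openin (top_of_set S) (chart_dom c)"
  using surface by (simp add: compact_oriented_surface_def)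

lemma range_openin: "c \<in> A \<Longrightarrow> openin (top_of_set half_plane) (chart_range c)"
  using surface by (simp add: compact_oriented_surface_def)

lemma chart_homeo: "c \<in> A \<Longrightarrow> homeomorphism (chart_dom c) (chart_range c) (chart_map c) (chart_inv c)"
  using surface by (simp add: compact_oriented_surface_def)

lemma range_half_plane: "c \<in> A \<Longrightarrow> u \<in> chart_range c \<Longrightarrow> 0 \<le> u $ 2"
  using range_openin openin_imp_subset unfolding half_plane_def by blast

lemma wide_range: "c \<in> A \<Longrightarrow> wide (chart_range c)"
  using wide_openin[OF wide_half_plane range_openin] .

lemma map_inv: "c \<in> A \<Longrightarrow> u \<in> chart_range c \<Longrightarrow> chart_map c (chart_inv c u) = u"
  using chart_homeo by (simp add: homeomorphism_def)

lemma inv_map: "c \<in> A \<Longrightarrow> p \<in> chart_dom c \<Longrightarrow> chart_inv c (chart_map c p) = p"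
  using chart_homeo by (simp add: homeomorphism_def)

lemma map_in: "p \<in> chart_dom c \<Longrightarrow> chart_map c p \<in> chart_range c"
  by (simp add: chart_range_def)

lemma inv_in: "c \<in> A \<Longrightarrow> u \<in> chart_range c \<Longrightarrow> chart_inv c u \<in> chart_dom c"
  using chart_homeo[of c] unfolding homeomorphism_def by blast

lemma chart_map_image: "c \<in> A \<Longrightarrow> U \<subseteq> chart_dom c \<Longrightarrow> u \<in> chart_map c ` U \<longleftrightarrow> u \<in> chart_range c \<and> chart_inv c u \<in> U"
proof
  assume c: "c \<in> A" "U \<subseteq> chart_dom c" and "u \<in> chart_map c ` U"
  then obtain q where "q \<in> U" "u = chart_map c q" by blast
  then show "u \<in> chart_range c \<and> chart_inv c u \<in> U" using c inv_map[of c q] map_in[of q c] by auto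
next
  assume "c \<in> A" "u \<in> chart_range c \<and> chart_inv c u \<in> U"
  then show "u \<in> chart_map c ` U" using map_inv[of c u] by (metis imageI)
qed

text \<open>Identities between expressions in two charts hold only on the overlap of their domains.
  Patches are the sets on which such identities can be differentiated in the coordinates of
  \<open>c\<close>.\<close>

definition patch :: "'a chart \<Rightarrow> 'a set \<Rightarrow> bool" where
  "patch c U \<longleftrightarrow> c \<in> A \<and> openin (top_of_set (chart_dom c)) U"

lemma patch_dom: "c \<in> A \<Longrightarrow> patch c (chart_dom c)" by (simp add: patch_def)

lemma patch_overlap: "c \<in> A \<Longrightarrow> c' \<in> A \<Longrightarrow> patch c (chart_dom c \<inter> chart_dom c')"
  unfolding patch_def using dom_openin
  by (metis dom_subset inf_le1 openin_Int openin_subset_trans)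

lemma patch_subset: "patch c U \<Longrightarrow> U \<subseteq> chart_dom c"
  unfolding patch_def by (blast dest: openin_imp_subset)

lemma patch_image: "patch c U \<Longrightarrow> openin (top_of_set (chart_range c)) (chart_map c ` U)"
  unfolding patch_def using chart_homeo homeomorphism_imp_open_map by blast

lemma wide_patch: "patch c U \<Longrightarrow> wide (chart_map c ` U)"
  using wide_openin[OF wide_range patch_image] by (simp add: patch_def)

definition differentiable_in :: "'a chart \<Rightarrow> ('a \<Rightarrow> 'b::real_normed_vector) \<Rightarrow> 'a \<Rightarrow> bool" where
  "differentiable_in c F p \<longleftrightarrow> (F \<circ> chart_inv c) differentiable (at (chart_map c p) within chart_range c)"

definition smooth_in :: "'a chart \<Rightarrow> 'a set \<Rightarrow> ('a \<Rightarrow> 'b::real_normed_vector) \<Rightarrow> bool" where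
  "smooth_in c U F \<longleftrightarrow> smooth_on (chart_map c ` U) (F \<circ> chart_inv c)"

lemma differential_works:
  "differentiable_in c F p \<Longrightarrow>
    ((F \<circ> chart_inv c) has_derivative differential c F p) (at (chart_map c p) within chart_range c)"
  unfolding differentiable_in_def differential_def by (rule frechet_derivative_works[THEN iffD1])

lemma differential_unique:
  assumes "c \<in> A" "p \<in> chart_dom c"
    "((F \<circ> chart_inv c) has_derivative L) (at (chart_map c p) within chart_range c)"
  shows "differential c F p = L"
  unfolding differential_def using wide_unique[OF wide_range map_in] assms by blast

lemma differential_expand:
  assumes "differentiable_in c F p"
  shows "differential c F p v = (v $ 1) *\<^sub>R coord_deriv c 1 F p + (v $ 2) *\<^sub>R coord_deriv c 2 F p"
proof -
  have l: "linear (differential c F p)"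
    using differential_works[OF assms] by (rule has_derivative_linear)
  show ?thesis
    by (subst real2_decomp[of v]) (simp add: linear_add[OF l] linear_scale[OF l] coord_deriv_def)
qed

lemma differential_local:
  assumes "patch c U" "p \<in> U" "\<And>q. q \<in> U \<Longrightarrow> F q = G q"
  shows "differential c F p = differential c G p" "differentiable_in c F p \<longleftrightarrow> differentiable_in c G p"
proof -
  have c: "c \<in> A" using assms(1) by (simp add: patch_def)
  have *: "(F' \<circ> chart_inv c has_derivative L) (at (chart_map c p) within chart_range c) \<Longrightarrow>
      (\<And>q. q \<in> U \<Longrightarrow> F' q = G' q) \<Longrightarrow>
      (G' \<circ> chart_inv c has_derivative L) (at (chart_map c p) within chart_range c)"
    for F' G' :: "'a \<Rightarrow> 'b" and L
    by (erule has_derivative_transform_openin[OF _ patch_image[OF assms(1)]])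
      (use assms(2) chart_map_image[OF c patch_subset[OF assms(1)]] in auto)
  have "(F \<circ> chart_inv c has_derivative L) (at (chart_map c p) within chart_range c) \<longleftrightarrow>
      (G \<circ> chart_inv c has_derivative L) (at (chart_map c p) within chart_range c)" for L
    using *[of F L G] *[of G L F] assms(3) by metis
  then show "differential c F p = differential c G p" "differentiable_in c F p \<longleftrightarrow> differentiable_in c G p"
    unfolding differential_def differentiable_in_def frechet_derivative_def differentiable_def by simp_all
qed

lemma coord_deriv_local:
  assumes "patch c U" "p \<in> U" "\<And>q. q \<in> U \<Longrightarrow> F q = G q"
  shows "coord_deriv c i F p = coord_deriv c i G p"
  unfolding coord_deriv_def using differential_local(1)[OF assms] by simp

lemma coord_deriv_cong:
  assumes "c \<in> A" "p \<in> chart_dom c" "\<And>q. q \<in> chart_dom c \<Longrightarrow> F q = G q"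
  shows "coord_deriv c i F p = coord_deriv c i G p"
  using coord_deriv_local[OF patch_dom] assms by blast

lemma smooth_in_has_derivative:
  assumes "patch c U" "smooth_in c U F" "p \<in> U"
  shows "((F \<circ> chart_inv c) has_derivative
      frechet_derivative (F \<circ> chart_inv c) (at (chart_map c p) within chart_map c ` U))
      (at (chart_map c p) within chart_range c)"
  using smooth_on_has_derivative[OF wide_patch[OF assms(1)] assms(2)[unfolded smooth_in_def], of "chart_map c p"]
    assms(3) at_within_openin[OF patch_image[OF assms(1)], of "chart_map c p"] by simp

lemma smooth_in_differentiable:
  "patch c U \<Longrightarrow> smooth_in c U F \<Longrightarrow> p \<in> U \<Longrightarrow> differentiable_in c F p"
  unfolding differentiable_in_def differentiable_def using smooth_in_has_derivative by blast

lemma patch_frechet: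
  assumes "patch c U" "u \<in> chart_map c ` U"
  shows "coord_deriv c i F (chart_inv c u) = frechet_derivative (F \<circ> chart_inv c) (at u within chart_map c ` U) (axis i 1)"
proof -
  have c: "c \<in> A" using assms(1) by (simp add: patch_def)
  have "u \<in> chart_range c" using assms chart_map_image[OF c patch_subset[OF assms(1)]] by blast
  then show ?thesis
    unfolding coord_deriv_def differential_def
    using at_within_openin[OF patch_image[OF assms(1)] assms(2)] map_inv[OF c] by simp
qed

lemma smooth_in_coord_deriv:
  assumes "patch c U" "smooth_in c U F"
  shows "smooth_in c U (coord_deriv c i F)"
  unfolding smooth_in_def
  using smooth_on_frechet_derivative[OF wide_patch[OF assms(1)] assms(2)[unfolded smooth_in_def], of "axis i 1"]
  by (rule smooth_on_cong[THEN iffD1, rotated]) (simp add: patch_frechet[OF assms(1)])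

lemma coord_deriv_commute:
  fixes F :: "'a \<Rightarrow> 'b::euclidean_space"
  assumes "patch c U" "smooth_in c U F" "p \<in> U"
  shows "coord_deriv c i (coord_deriv c j F) p = coord_deriv c j (coord_deriv c i F) p"
proof -
  have c: "c \<in> A" "p \<in> chart_dom c" using assms(1,3) patch_subset[of c U] by (auto simp: patch_def)
  let ?D = "chart_map c ` U" and ?u = "chart_map c p"
  have u: "?u \<in> ?D" using assms(3) by blast
  have *: "coord_deriv c i (coord_deriv c j F) p =
    frechet_derivative (\<lambda>y. frechet_derivative (F \<circ> chart_inv c) (at y within ?D) (axis j 1)) (at ?u within ?D) (axis i 1)"
    for i j
  proof -
    have "(((coord_deriv c j F) \<circ> chart_inv c) has_derivative
       frechet_derivative (\<lambda>y. frechet_derivative (F \<circ> chart_inv c) (at y within ?D) (axis j 1)) (at ?u within ?D)) (at ?u within ?D)"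
      by (rule has_derivative_transform_openin[OF smooth_on_has_derivative[OF wide_patch[OF assms(1)]
          smooth_on_frechet_derivative[OF wide_patch[OF assms(1)] assms(2)[unfolded smooth_in_def]] u], of ?D])
        (use u in \<open>simp_all add: patch_frechet[OF assms(1)]\<close>)
    note wide_unique[OF wide_patch[OF assms(1)] u this]
    then show ?thesis
      using patch_frechet[OF assms(1) u, of i "coord_deriv c j F"] inv_map[OF c] by (simp only:)
  qed
  show ?thesis unfolding *
    by (rule smooth_on_symmetric[OF wide_patch[OF assms(1)] assms(2)[unfolded smooth_in_def] u])
qed

lemma smooth_in_cong:
  assumes "patch c U" "\<And>q. q \<in> U \<Longrightarrow> F q = G q"
  shows "smooth_in c U F \<longleftrightarrow> smooth_in c U G"
  unfolding smooth_in_def using chart_map_image[of c U] patch_subset[OF assms(1)] assms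
  by (intro smooth_on_cong) (auto simp: patch_def)

lemma smooth_in_continuous_on:
  assumes "patch c U" "smooth_in c U F"
  shows "continuous_on U F"
proof -
  have c: "c \<in> A" using assms(1) by (simp add: patch_def)
  have "continuous_on (chart_dom c) (chart_map c)" using chart_homeo[OF c] by (simp add: homeomorphism_def)
  then have "continuous_on U ((F \<circ> chart_inv c) \<circ> chart_map c)"
    by (intro continuous_on_compose continuous_on_subset[OF _ patch_subset[OF assms(1)]]
        smooth_on_continuous_on assms(2)[unfolded smooth_in_def])
  then show ?thesis
    by (rule continuous_on_cong[THEN iffD1, rotated 2]) (use inv_map[OF c] patch_subset[OF assms(1)] in auto)
qed

lemma smooth_in_comps:
  fixes F G :: "'a \<Rightarrow> 'b::real_normed_vector" and f g :: "'a \<Rightarrow> real"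
    and X Y :: "'a \<Rightarrow> real^3" and V :: "'a \<Rightarrow> real^'n"
  shows "smooth_in c U (\<lambda>p. k :: 'b)"
    "smooth_in c U F \<Longrightarrow> smooth_in c U G \<Longrightarrow> smooth_in c U (\<lambda>p. F p + G p)"
    "smooth_in c U F \<Longrightarrow> smooth_in c U G \<Longrightarrow> smooth_in c U (\<lambda>p. F p - G p)"
    "smooth_in c U F \<Longrightarrow> smooth_in c U (\<lambda>p. - F p)"
    "smooth_in c U f \<Longrightarrow> smooth_in c U F \<Longrightarrow> smooth_in c U (\<lambda>p. f p *\<^sub>R F p)"
    "smooth_in c U f \<Longrightarrow> smooth_in c U g \<Longrightarrow> smooth_in c U (\<lambda>p. f p * g p)"
    "smooth_in c U f \<Longrightarrow> smooth_in c U (\<lambda>p. f p ^ n)"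
    "smooth_in c U X \<Longrightarrow> smooth_in c U Y \<Longrightarrow> smooth_in c U (\<lambda>p. X p \<bullet> Y p)"
    "smooth_in c U X \<Longrightarrow> smooth_in c U Y \<Longrightarrow> smooth_in c U (\<lambda>p. cross3 (X p) (Y p))"
    "smooth_in c U V \<Longrightarrow> smooth_in c U (\<lambda>p. V p $ i)"
  unfolding smooth_in_def o_def by (intro smooth_on_intros; assumption)+

lemma smooth_in_divide:
  fixes f g :: "'a \<Rightarrow> real"
  assumes "patch c U" "smooth_in c U f" "smooth_in c U g" "\<And>p. p \<in> U \<Longrightarrow> g p \<noteq> 0"
  shows "smooth_in c U (\<lambda>p. f p / g p)"
  using assms(2-) chart_map_image[of c U] patch_subset[OF assms(1)] assms(1)
  unfolding smooth_in_def o_def by (intro smooth_on_divide) (auto simp: patch_def)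

lemma smooth_in_sqrt:
  fixes f :: "'a \<Rightarrow> real"
  assumes "patch c U" "smooth_in c U f" "\<And>p. p \<in> U \<Longrightarrow> 0 < f p"
  shows "smooth_in c U (\<lambda>p. sqrt (f p))"
  using assms(2-) chart_map_image[of c U] patch_subset[OF assms(1)] assms(1)
  unfolding smooth_in_def o_def by (intro smooth_on_sqrt) (auto simp: patch_def)

subsection \<open>Rules for coordinate derivatives\<close>

text \<open>Chart membership, differentiability and value are bundled so that the usual
  differentiation rules compose without side conditions.\<close>

definition has_coord_deriv :: "'a chart \<Rightarrow> 2 \<Rightarrow> ('a \<Rightarrow> 'b::real_normed_vector) \<Rightarrow> 'a \<Rightarrow> 'b \<Rightarrow> bool" where
  "has_coord_deriv c i F p D \<longleftrightarrow> c \<in> A \<and> p \<in> chart_dom c \<and> differentiable_in c F p \<and> coord_deriv c i F p = D"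

lemma has_coord_derivI:
  "c \<in> A \<Longrightarrow> p \<in> chart_dom c \<Longrightarrow> differentiable_in c F p \<Longrightarrow> has_coord_deriv c i F p (coord_deriv c i F p)"
  by (simp add: has_coord_deriv_def)

lemma has_coord_derivD: "has_coord_deriv c i F p D \<Longrightarrow> coord_deriv c i F p = D"
  "has_coord_deriv c i F p D \<Longrightarrow> differentiable_in c F p"
  by (simp_all add: has_coord_deriv_def)

lemma has_coord_deriv_general:
  assumes "c \<in> A" "p \<in> chart_dom c"
    "((\<lambda>u. F (chart_inv c u)) has_derivative L) (at (chart_map c p) within chart_range c)"
    "L (axis i 1) = D"
  shows "has_coord_deriv c i F p D"
proof -
  have d: "(F \<circ> chart_inv c has_derivative L) (at (chart_map c p) within chart_range c)"
    using assms(3) by (simp only: o_def)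
  then show ?thesis
    using assms(1,2,4) differential_unique[OF assms(1,2) d]
    by (auto simp: has_coord_deriv_def coord_deriv_def differentiable_in_def differentiable_def)
qed

lemma has_coord_derivE:
  assumes "has_coord_deriv c i F p D"
  shows "c \<in> A" "p \<in> chart_dom c"
    "((\<lambda>u. F (chart_inv c u)) has_derivative differential c F p) (at (chart_map c p) within chart_range c)"
    "differential c F p (axis i 1) = D" "chart_inv c (chart_map c p) = p"
  using assms differential_works[of c F p, unfolded o_def] inv_map[of c p]
  by (simp_all add: has_coord_deriv_def coord_deriv_def)

lemma has_coord_deriv_bilinear:
  assumes "bounded_bilinear h" "has_coord_deriv c i F p D" "has_coord_deriv c i G p E"
  shows "has_coord_deriv c i (\<lambda>q. h (F q) (G q)) p (h (F p) E + h D (G p))"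
  by (rule has_coord_deriv_general[OF has_coord_derivE(1,2)[OF assms(2)]
      bounded_bilinear.FDERIV[OF assms(1) has_coord_derivE(3)[OF assms(2)] has_coord_derivE(3)[OF assms(3)]]])
    (simp add: has_coord_derivE(4,5)[OF assms(2)] has_coord_derivE(4)[OF assms(3)])

lemma has_coord_deriv_linear:
  assumes "bounded_linear L" "has_coord_deriv c i F p D"
  shows "has_coord_deriv c i (\<lambda>q. L (F q)) p (L D)"
  by (rule has_coord_deriv_general[OF has_coord_derivE(1,2)[OF assms(2)]
      bounded_linear.has_derivative[OF assms(1) has_coord_derivE(3)[OF assms(2)]]])
    (simp add: has_coord_derivE(4)[OF assms(2)])

lemma has_coord_deriv_add:
  assumes "has_coord_deriv c i F p D" "has_coord_deriv c i G p E"
  shows "has_coord_deriv c i (\<lambda>q. F q + G q) p (D + E)"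
  by (rule has_coord_deriv_general[OF has_coord_derivE(1,2)[OF assms(1)]
      has_derivative_add[OF has_coord_derivE(3)[OF assms(1)] has_coord_derivE(3)[OF assms(2)]]])
    (simp add: has_coord_derivE(4)[OF assms(1)] has_coord_derivE(4)[OF assms(2)])

lemma has_coord_deriv_const:
  assumes "c \<in> A" "p \<in> chart_dom c"
  shows "has_coord_deriv c i (\<lambda>q. k) p 0"
  by (rule has_coord_deriv_general[OF assms has_derivative_const]) simp

lemma has_coord_deriv_diff:
  assumes "has_coord_deriv c i F p D" "has_coord_deriv c i G p E"
  shows "has_coord_deriv c i (\<lambda>q. F q - G q) p (D - E)"
  by (rule has_coord_deriv_general[OF has_coord_derivE(1,2)[OF assms(1)]
      has_derivative_diff[OF has_coord_derivE(3)[OF assms(1)] has_coord_derivE(3)[OF assms(2)]]])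
    (simp add: has_coord_derivE(4)[OF assms(1)] has_coord_derivE(4)[OF assms(2)])

lemmas has_coord_deriv_minus = has_coord_deriv_linear[OF bounded_linear_minus[OF bounded_linear_ident]]
lemmas has_coord_deriv_vec_nth = has_coord_deriv_linear[OF bounded_linear_vec_nth]
lemmas has_coord_deriv_mult = has_coord_deriv_bilinear[OF bounded_bilinear_mult]
lemmas has_coord_deriv_scaleR = has_coord_deriv_bilinear[OF bounded_bilinear_scaleR]
lemmas has_coord_deriv_inner = has_coord_deriv_bilinear[OF bounded_bilinear_inner]

lemma has_coord_deriv_divide:
  fixes f g :: "'a \<Rightarrow> real"
  assumes "has_coord_deriv c i f p D" "has_coord_deriv c i g p E" "g p \<noteq> 0"
  shows "has_coord_deriv c i (\<lambda>q. f q / g q) p ((D * g p - f p * E) / (g p * g p))"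
  by (rule has_coord_deriv_general[OF has_coord_derivE(1,2)[OF assms(1)]
      has_derivative_divide'[OF has_coord_derivE(3)[OF assms(1)] has_coord_derivE(3)[OF assms(2)]]])
    (simp_all add: has_coord_derivE(4,5)[OF assms(1)] has_coord_derivE(4)[OF assms(2)] assms(3))

lemma has_coord_deriv_sqrt:
  fixes f :: "'a \<Rightarrow> real"
  assumes "has_coord_deriv c i f p D" "0 < f p"
  shows "has_coord_deriv c i (\<lambda>q. sqrt (f q)) p (D / (2 * sqrt (f p)))"
  by (rule has_coord_deriv_general[OF has_coord_derivE(1,2)[OF assms(1)]
      has_derivative_real_sqrt[OF _ has_coord_derivE(3)[OF assms(1)]]])
    (simp_all add: has_coord_derivE(4,5)[OF assms(1)] assms(2) divide_simps)

lemma has_coord_deriv_local: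
  assumes "patch c U" "p \<in> U" "\<And>q. q \<in> U \<Longrightarrow> F q = G q" "has_coord_deriv c i F p D"
  shows "has_coord_deriv c i G p D"
  using differential_local[OF assms(1-3)] assms(4) by (simp add: has_coord_deriv_def coord_deriv_def)

subsection \<open>Change of chart\<close>

text \<open>This is the derivative of the \<open>a\<close>-th coordinate of \<open>c'\<close> in the
  \<open>i\<close>-th coordinate direction of \<open>c\<close>: the row index \<open>a\<close>
  belongs to the target chart, the column index \<open>i\<close> to the source.\<close>

definition jac :: "'a chart \<Rightarrow> 'a chart \<Rightarrow> 2 \<Rightarrow> 2 \<Rightarrow> 'a \<Rightarrow> real" where
  "jac c c' a i p = coord_deriv c i (chart_map c') p $ a"

lemma smooth_in_transition:
  "c \<in> A \<Longrightarrow> c' \<in> A \<Longrightarrow> smooth_in c (chart_dom c \<inter> chart_dom c') (chart_map c')"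
  using surface unfolding smooth_in_def compact_oriented_surface_def by blast

lemma smooth_in_jac:
  "c \<in> A \<Longrightarrow> c' \<in> A \<Longrightarrow> smooth_in c (chart_dom c \<inter> chart_dom c') (jac c c' a i)"
  unfolding jac_def[abs_def]
  by (intro smooth_in_comps smooth_in_coord_deriv patch_overlap smooth_in_transition)

lemma transition_has_derivative:
  assumes "c \<in> A" "c' \<in> A" "p \<in> chart_dom c" "p \<in> chart_dom c'"
  shows "(chart_map c' \<circ> chart_inv c has_derivative differential c (chart_map c') p)
    (at (chart_map c p) within chart_range c)"
  using assms smooth_in_differentiable[OF patch_overlap smooth_in_transition]
  by (intro differential_works) auto

text \<open>The chain rule for the transition map, applied within the image of the overlap. That
  image is relatively open in the range of \<open>c\<close>, so the result is a derivative within
  the whole range.\<close>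

lemma differential_change:
  assumes "c \<in> A" "c' \<in> A" "p \<in> chart_dom c" "p \<in> chart_dom c'" "differentiable_in c' F p"
  shows "differentiable_in c F p" "differential c F p v = differential c' F p (differential c (chart_map c') p v)"
proof -
  let ?U = "chart_dom c \<inter> chart_dom c'"
  let ?D = "chart_map c ` ?U" and ?u = "chart_map c p"
  have u: "?u \<in> ?D" using assms by blast
  have at: "at ?u within ?D = at ?u within chart_range c"
    by (rule at_within_openin[OF patch_image[OF patch_overlap] u]) (use assms in auto)
  have tau: "(chart_map c' \<circ> chart_inv c has_derivative differential c (chart_map c') p) (at ?u within ?D)"
    unfolding at using transition_has_derivative assms by blast
  have tu: "(chart_map c' \<circ> chart_inv c) ?u = chart_map c' p" using inv_map assms by simp
  have "(F \<circ> chart_inv c' has_derivative differential c' F p)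
      (at ((chart_map c' \<circ> chart_inv c) ?u) within (chart_map c' \<circ> chart_inv c) ` ?D)"
    unfolding tu
    by (rule has_derivative_subset[OF differential_works[OF assms(5)]]) (use inv_map[OF assms(1)] map_in[of _ c'] in auto)
  from has_derivative_in_compose[OF tau this]
  have "((\<lambda>x. (F \<circ> chart_inv c') ((chart_map c' \<circ> chart_inv c) x)) has_derivative
     (\<lambda>x. differential c' F p (differential c (chart_map c') p x))) (at ?u within ?D)" .
  then have "(F \<circ> chart_inv c has_derivative (\<lambda>x. differential c' F p (differential c (chart_map c') p x))) (at ?u within ?D)"
    by (rule has_derivative_transform_openin[of _ _ _ _ ?D]) (use inv_map[OF assms(1)] inv_map[OF assms(2)] assms in auto)
  then have *: "(F \<circ> chart_inv c has_derivative (\<lambda>x. differential c' F p (differential c (chart_map c') p x)))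
     (at ?u within chart_range c)" unfolding at .
  then show "differentiable_in c F p" by (auto simp: differentiable_in_def differentiable_def)
  show "differential c F p v = differential c' F p (differential c (chart_map c') p v)"
    using differential_unique[OF assms(1,3) *] by simp
qed

lemma coord_deriv_change:
  assumes "c \<in> A" "c' \<in> A" "p \<in> chart_dom c" "p \<in> chart_dom c'" "differentiable_in c' F p"
  shows "coord_deriv c i F p = jac c c' 1 i p *\<^sub>R coord_deriv c' 1 F p + jac c c' 2 i p *\<^sub>R coord_deriv c' 2 F p"
proof -
  have "coord_deriv c i F p = differential c' F p (differential c (chart_map c') p (axis i 1))"
    using differential_change(2)[OF assms, of "axis i 1"] by (simp only: coord_deriv_def)
  then show ?thesis
    using differential_expand[OF assms(5), of "differential c (chart_map c') p (axis i 1)"]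
    by (simp only: jac_def coord_deriv_def[of c i "chart_map c'"])
qed

lemma jac_det_pos:
  assumes "c \<in> A" "c' \<in> A" "p \<in> chart_dom c" "p \<in> chart_dom c'"
  shows "0 < jac c c' 1 1 p * jac c c' 2 2 p - jac c c' 1 2 p * jac c c' 2 1 p"
proof -
  have "0 < det (matrix (differential c (chart_map c') p))"
    using surface assms unfolding compact_oriented_surface_def by blast
  then show ?thesis by (simp add: det_2 matrix_def jac_def coord_deriv_def)
qed

lemma jac_commute:
  assumes "c \<in> A" "c' \<in> A" "p \<in> chart_dom c" "p \<in> chart_dom c'"
  shows "coord_deriv c i (jac c c' a j) p = coord_deriv c j (jac c c' a i) p"
proof -
  have *: "coord_deriv c i (jac c c' a j) p = coord_deriv c i (coord_deriv c j (chart_map c')) p $ a" for i j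
    unfolding jac_def[abs_def]
    by (rule has_coord_derivD(1)[OF has_coord_deriv_vec_nth[OF has_coord_derivI]])
      (use assms smooth_in_differentiable[OF patch_overlap smooth_in_coord_deriv[OF patch_overlap smooth_in_transition]] in auto)
  show ?thesis unfolding *
    using coord_deriv_commute[OF patch_overlap smooth_in_transition, of c c' p i j] assms by simp
qed

subsection \<open>The boundary\<close>

text \<open>The second coordinate in \<open>c'\<close> vanishes at \<open>p\<close> and is
  nonnegative everywhere. A negative one-sided derivative along an admissible segment would make it
  negative shortly after the start.\<close>

lemma transition_second_nonneg:
  assumes "c \<in> A" "c' \<in> A" "p \<in> chart_dom c" "p \<in> chart_dom c'" "chart_map c' p $ 2 = 0"
    and v: "0 < r0" "\<And>s. 0 \<le> s \<Longrightarrow> s < r0 \<Longrightarrow> chart_map c p + s *\<^sub>R v \<in> half_plane"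
  shows "0 \<le> differential c (chart_map c') p v $ 2"
proof (rule ccontr)
  let ?U = "chart_dom c \<inter> chart_dom c'"
  let ?D = "chart_map c ` ?U" and ?u = "chart_map c p"
  let ?L = "differential c (chart_map c') p"
  assume neg: "\<not> ?thesis"
  have op: "openin (top_of_set half_plane) ?D"
    using patch_image[OF patch_overlap[OF assms(1,2)]] range_openin[OF assms(1)] openin_trans by blast
  then obtain r where r: "r > 0" "\<And>x. x \<in> half_plane \<Longrightarrow> dist x ?u < r \<Longrightarrow> x \<in> ?D"
    using assms(3,4) unfolding openin_euclidean_subtopology_iff by blast
  have l: "linear ?L" using transition_has_derivative[OF assms(1-4)] by (rule has_derivative_linear)
  define I where "I = {s. 0 \<le> s \<and> s < r0 \<and> s * (norm v + 1) < r}"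
  have I: "?u + s *\<^sub>R v \<in> ?D" if "s \<in> I" for s
  proof (rule r(2))
    show "?u + s *\<^sub>R v \<in> half_plane" using v that by (simp add: I_def)
    have "norm (s *\<^sub>R v) \<le> s * (norm v + 1)" using that by (auto simp: I_def intro!: mult_left_mono)
    then show "dist (?u + s *\<^sub>R v) ?u < r" using that by (simp add: I_def dist_norm)
  qed
  have "(\<lambda>s. ?u + s *\<^sub>R v) ` I \<subseteq> chart_range c"
    using I chart_map_image[OF assms(1), of ?U] by blast
  from has_derivative_subset[OF transition_has_derivative[OF assms(1-4)] this]
  have "(chart_map c' \<circ> chart_inv c has_derivative ?L) (at (?u + 0 *\<^sub>R v) within (\<lambda>s. ?u + s *\<^sub>R v) ` I)"
    by simp
  moreover have "((\<lambda>s. ?u + s *\<^sub>R v) has_derivative (\<lambda>s. s *\<^sub>R v)) (at 0 within I)"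
    by (auto intro!: derivative_eq_intros)
  ultimately have "((\<lambda>s. (chart_map c' \<circ> chart_inv c) (?u + s *\<^sub>R v)) has_derivative (\<lambda>s. ?L (s *\<^sub>R v))) (at 0 within I)"
    using has_derivative_in_compose by blast
  from bounded_linear.has_derivative[OF bounded_linear_vec_nth this, of 2]
  have "((\<lambda>s. (chart_map c' \<circ> chart_inv c) (?u + s *\<^sub>R v) $ 2) has_real_derivative ?L v $ 2) (at 0 within I)"
    unfolding has_field_derivative_def by (rule has_derivative_eq_rhs) (simp add: linear_scale[OF l] fun_eq_iff)
  from has_real_derivative_neg_dec_right[OF this] neg
  obtain d where d: "d > 0" "\<And>h. 0 < h \<Longrightarrow> h \<in> I \<Longrightarrow> h < d \<Longrightarrow>
      (chart_map c' \<circ> chart_inv c) (?u + h *\<^sub>R v) $ 2 < (chart_map c' \<circ> chart_inv c) (?u + 0 *\<^sub>R v) $ 2"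
    by auto
  \<comment> \<open>Three demands on \<open>h\<close>: below \<open>d\<close> for the strict
    decrease, below \<open>r0\<close> to stay in the half-plane, and \<open>h * (norm v + 1)\<close>
    below \<open>r\<close> to stay in the overlap.\<close>
  define h where "h = min (min (d / 2) (r0 / 2)) (r / (2 * (norm v + 1)))"
  have pos: "norm v + 1 > 0" by (simp add: add_nonneg_pos)
  have h: "0 < h" "h < d" "h < r0" using d r pos v(1) by (auto simp: h_def)
  have "h * (norm v + 1) \<le> r / (2 * (norm v + 1)) * (norm v + 1)"
    using pos by (intro mult_right_mono) (auto simp: h_def)
  also have "r / (2 * n) * n = r / 2" if "n > 0" for n using that by simp
  from this[OF pos] have "r / (2 * (norm v + 1)) * (norm v + 1) = r / 2" .
  finally have hI: "h \<in> I" using h r by (simp add: I_def)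
  have "(chart_map c' \<circ> chart_inv c) (?u + h *\<^sub>R v) $ 2 < 0"
    using d(2)[OF h(1) hI h(2)] assms inv_map by simp
  moreover have "(chart_map c' \<circ> chart_inv c) (?u + h *\<^sub>R v) \<in> chart_range c'"
    using I[OF hI] inv_map[OF assms(1)] map_in[of _ c'] by auto
  ultimately show False using range_half_plane[OF assms(2)] by fastforce
qed

text \<open>If \<open>p\<close> were interior in \<open>c\<close>, both \<open>v\<close> and
  \<open>- v\<close> would be admissible for every \<open>v\<close>, so the second row of the
  Jacobian would vanish, against its positive determinant.\<close>

lemma boundary_chart_independent:
  assumes "c \<in> A" "c' \<in> A" "p \<in> chart_dom c" "p \<in> chart_dom c'" "chart_map c' p $ 2 = 0"
  shows "chart_map c p $ 2 = 0"
proof (rule ccontr)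
  let ?L = "differential c (chart_map c') p"
  assume "chart_map c p $ 2 \<noteq> 0"
  then have pos: "chart_map c p $ 2 > 0" using range_half_plane[OF assms(1) map_in[OF assms(3)]] by simp
  have l: "linear ?L" using transition_has_derivative[OF assms(1-4)] by (rule has_derivative_linear)
  have sgn: "0 \<le> ?L v $ 2" for v
  proof (rule transition_second_nonneg[OF assms])
    show "0 < chart_map c p $ 2 / (\<bar>v $ 2\<bar> + 1)" using pos by simp
    fix s assume s: "0 \<le> s" "s < chart_map c p $ 2 / (\<bar>v $ 2\<bar> + 1)"
    have "- s * v $ 2 \<le> s * (\<bar>v $ 2\<bar> + 1)" using s(1) mult_left_mono[of "- v $ 2" "\<bar>v $ 2\<bar> + 1" s] by simp
    also have "\<dots> < chart_map c p $ 2" using s(2) by (simp add: pos_less_divide_eq add_nonneg_pos)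
    finally show "chart_map c p + s *\<^sub>R v \<in> half_plane" by (simp add: half_plane_def)
  qed
  have "?L v $ 2 = 0" for v
    using sgn[of v] sgn[of "- v"] by (simp add: linear_neg[OF l])
  then have "jac c c' 2 i p = 0" for i by (simp add: jac_def coord_deriv_def)
  then show False using jac_det_pos[OF assms(1-4)] by simp
qed

text \<open>At a boundary point both tangential directions are admissible, so the derivative of the
  second coordinate along the boundary is zero; the inward direction gives a nonnegative diagonal
  entry. The positive determinant of the resulting triangular matrix makes the two diagonal entries
  positive.\<close>

lemma jac_boundary:
  assumes "c \<in> A" "c' \<in> A" "p \<in> chart_dom c" "p \<in> chart_dom c'" "chart_map c' p $ 2 = 0"
  shows "jac c c' 2 1 p = 0" "0 < jac c c' 1 1 p" "0 < jac c c' 2 2 p"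
proof -
  let ?L = "differential c (chart_map c') p"
  have l: "linear ?L" using transition_has_derivative[OF assms(1-4)] by (rule has_derivative_linear)
  have u: "chart_map c p $ 2 = 0" using boundary_chart_independent[OF assms] .
  have sgn: "0 \<le> ?L v $ 2" if "v $ 2 \<ge> 0" for v
    using that u by (intro transition_second_nonneg[OF assms, of 1]) (auto simp: half_plane_def)
  have "?L (axis 1 1) $ 2 \<ge> 0" "?L (- axis 1 1) $ 2 \<ge> 0" "?L (axis 2 1) $ 2 \<ge> 0"
    by (auto intro!: sgn)
  then have *: "jac c c' 2 1 p = 0" "jac c c' 2 2 p \<ge> 0"
    by (auto simp: jac_def coord_deriv_def linear_neg[OF l])
  then show "jac c c' 2 1 p = 0" "0 < jac c c' 1 1 p" "0 < jac c c' 2 2 p"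
    using jac_det_pos[OF assms(1-4)] by (auto simp: zero_less_mult_iff)
qed

end

section \<open>The first variation of the Thomsen density in a chart\<close>

subsection \<open>Linear algebra in dimensions two and three\<close>

lemma matrix_inv_2:
  fixes B :: "real^2^2"
  assumes "det B \<noteq> 0"
  shows "matrix_inv B $ 1 $ 1 = B $ 2 $ 2 / det B" "matrix_inv B $ 1 $ 2 = - B $ 1 $ 2 / det B"
    "matrix_inv B $ 2 $ 1 = - B $ 2 $ 1 / det B" "matrix_inv B $ 2 $ 2 = B $ 1 $ 1 / det B"
proof -
  define C :: "real^2^2" where "C = vector [vector [B $ 2 $ 2 / det B, - B $ 1 $ 2 / det B],
    vector [- B $ 2 $ 1 / det B, B $ 1 $ 1 / det B]]"
  have "B ** C = mat 1"
    using assms by (simp add: C_def matrix_matrix_mult_def mat_def vec_eq_iff forall_2 sum_2 det_2 divide_simps)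
  then have C: "B ** C = mat 1" "C ** B = mat 1" using matrix_left_right_inverse by blast+
  then have "B ** matrix_inv B = mat 1"
    unfolding matrix_inv_def by (metis (mono_tags, lifting) someI_ex)
  then have "matrix_inv B = C" using C by (metis matrix_mul_assoc matrix_mul_lid matrix_mul_rid)
  then show "matrix_inv B $ 1 $ 1 = B $ 2 $ 2 / det B" "matrix_inv B $ 1 $ 2 = - B $ 1 $ 2 / det B"
    "matrix_inv B $ 2 $ 1 = - B $ 2 $ 1 / det B" "matrix_inv B $ 2 $ 2 = B $ 1 $ 1 / det B"
    by (simp_all add: C_def)
qed

lemma cross3_inner_self:
  "cross3 x y \<bullet> cross3 x y = (x \<bullet> x) * (y \<bullet> y) - (x \<bullet> y) * (x \<bullet> y)"
  by (simp add: cross3_simps)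

lemma unit_cross_frame:
  fixes x y :: "real^3"
  assumes "0 < (x \<bullet> x) * (y \<bullet> y) - (x \<bullet> y) * (x \<bullet> y)"
  defines "n \<equiv> sgn (cross3 x y)"
  shows "n \<bullet> n = 1" "n \<bullet> x = 0" "n \<bullet> y = 0" "\<exists>a b. w = a *\<^sub>R x + b *\<^sub>R y + (w \<bullet> n) *\<^sub>R n"
    "n = (1 / sqrt ((x \<bullet> x) * (y \<bullet> y) - (x \<bullet> y) * (x \<bullet> y))) *\<^sub>R cross3 x y"
proof -
  let ?d = "(x \<bullet> x) * (y \<bullet> y) - (x \<bullet> y) * (x \<bullet> y)"
  show n: "n = (1 / sqrt ?d) *\<^sub>R cross3 x y"
    by (simp add: n_def sgn_div_norm norm_eq_sqrt_inner cross3_inner_self inverse_eq_divide)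
  have perp: "cross3 x y \<bullet> x = 0" "cross3 x y \<bullet> y = 0" by (simp_all add: cross3_simps)
  show nn: "n \<bullet> n = 1"
    using assms(1) by (simp add: n cross3_inner_self)
  show nx: "n \<bullet> x = 0" and ny: "n \<bullet> y = 0" by (simp_all add: n perp)
  \<comment> \<open>Cramer's rule for the Gram system that determines the tangential components of
    \<open>w\<close>.\<close>
  define a where "a = ((y \<bullet> y) * (w \<bullet> x) - (x \<bullet> y) * (w \<bullet> y)) / ?d"
  define b where "b = ((x \<bullet> x) * (w \<bullet> y) - (x \<bullet> y) * (w \<bullet> x)) / ?d"
  define r where "r = w - (a *\<^sub>R x + b *\<^sub>R y + (w \<bullet> n) *\<^sub>R n)"
  have ab: "a * (x \<bullet> x) + b * (x \<bullet> y) = w \<bullet> x" "a * (x \<bullet> y) + b * (y \<bullet> y) = w \<bullet> y"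
    using assms(1) unfolding a_def b_def
    by (simp_all add: divide_simps) (simp_all add: algebra_simps)
  have rx: "r \<bullet> x = 0" and ry: "r \<bullet> y = 0" and rn: "r \<bullet> n = 0"
    using ab nx ny nn
    by (simp_all add: r_def inner_diff_left inner_add_left inner_commute[of y x] inner_commute[of x n] inner_commute[of y n])
  \<comment> \<open>The double cross product lies in the span of \<open>x\<close> and
    \<open>y\<close> with coefficients that vanish here. Together with orthogonality of
    \<open>r\<close> to \<open>cross3 x y\<close>, Lagrange's identity then forces \<open>r\<close>
    to be zero.\<close>
  have "cross3 (cross3 x y) r = (r \<bullet> x) *\<^sub>R y - (r \<bullet> y) *\<^sub>R x" by (simp add: cross3_simps) (metis (no_types, opaque_lifting) exhaust_3)
  then have "cross3 (cross3 x y) r = 0" using rx ry by simp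
  then have "(cross3 x y \<bullet> cross3 x y) * (r \<bullet> r) = (cross3 x y \<bullet> r) * (cross3 x y \<bullet> r)"
    using cross3_inner_self[of "cross3 x y" r] by simp
  moreover have "cross3 x y \<bullet> r = 0" using rn assms(1) by (auto simp: n inner_commute[of r])
  ultimately have "r \<bullet> r = 0" using assms(1) by (simp add: cross3_inner_self)
  then show "\<exists>a b. w = a *\<^sub>R x + b *\<^sub>R y + (w \<bullet> n) *\<^sub>R n" by (auto simp: r_def)
qed

subsection \<open>The density as a function of the fundamental forms\<close>

text \<open>In dimension two \<open>|h\<^sup>\<circ>|\<^sup>2 / 2 = H\<^sup>2 / 4 - K\<close>, with \<open>K\<close> the Gauss curvature.\<close>

definition forms_density :: "real \<Rightarrow> real \<Rightarrow> real \<Rightarrow> real \<Rightarrow> real \<Rightarrow> real \<Rightarrow> real" where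
  "forms_density E F G L M N = sqrt (E * G - F * F) *
     (((E * N - 2 * F * M + G * L) / (E * G - F * F))\<^sup>2 / 4 - (L * N - M * M) / (E * G - F * F))"

text \<open>The differential of \<open>forms_density\<close> in the direction of the primed
  arguments. With \<open>P = H * d\<close> and \<open>k = K * d\<close> the density is
  \<open>P\<^sup>2 / 4\<close> times d to the power -3/2 minus \<open>k\<close> times d to the power
  -1/2; these exponents produce the coefficients -3/8 and 1/2.\<close>

definition forms_density' ::
  "real \<Rightarrow> real \<Rightarrow> real \<Rightarrow> real \<Rightarrow> real \<Rightarrow> real \<Rightarrow> real \<Rightarrow> real \<Rightarrow> real \<Rightarrow> real \<Rightarrow> real \<Rightarrow> real \<Rightarrow> real" where
  "forms_density' E F G L M N E' F' G' L' M' N' =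
    (let d = E * G - F * F; H = (E * N - 2 * F * M + G * L) / d; K = (L * N - M * M) / d in
     (H * (E' * N + E * N' - 2 * (F' * M + F * M') + G' * L + G * L') / 2 - (L' * N + L * N' - 2 * M * M')
      + (E' * G + E * G' - 2 * F * F') * (K / 2 - 3 / 8 * H\<^sup>2)) / sqrt d)"

lemma forms_density_has_derivative:
  fixes E F G L M N :: "'a::real_normed_vector \<Rightarrow> real"
  assumes d[derivative_intros]: "(E has_derivative E') (at x within D)" "(F has_derivative F') (at x within D)"
    "(G has_derivative G') (at x within D)" "(L has_derivative L') (at x within D)"
    "(M has_derivative M') (at x within D)" "(N has_derivative N') (at x within D)"
    and pos: "0 < E x * G x - F x * F x"
  shows "((\<lambda>y. forms_density (E y) (F y) (G y) (L y) (M y) (N y)) has_derivative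
     (\<lambda>v. forms_density' (E x) (F x) (G x) (L x) (M x) (N x) (E' v) (F' v) (G' v) (L' v) (M' v) (N' v))) (at x within D)"
proof -
  define d where "d y = E y * G y - F y * F y" for y
  define P where "P y = E y * N y - 2 * F y * M y + G y * L y" for y
  define k where "k y = L y * N y - M y * M y" for y
  define d' where "d' v = E' v * G x + E x * G' v - 2 * F x * F' v" for v
  define P' where "P' v = E' v * N x + E x * N' v - 2 * (F' v * M x + F x * M' v) + G' v * L x + G x * L' v" for v
  define k' where "k' v = L' v * N x + L x * N' v - 2 * M x * M' v" for v
  have dx: "d x > 0" using pos by (simp add: d_def)
  have dd: "(d has_derivative d') (at x within D)"
    unfolding d_def[abs_def] d'_def[abs_def] by (auto intro!: derivative_eq_intros simp: algebra_simps fun_eq_iff)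
  have dP: "(P has_derivative P') (at x within D)"
    unfolding P_def[abs_def] P'_def[abs_def] by (auto intro!: derivative_eq_intros simp: algebra_simps fun_eq_iff)
  have dk: "(k has_derivative k') (at x within D)"
    unfolding k_def[abs_def] k'_def[abs_def] by (auto intro!: derivative_eq_intros simp: algebra_simps fun_eq_iff)
  have "((\<lambda>y. sqrt (d y) * (1 / 4 * (P y / d y)\<^sup>2 - k y / d y)) has_derivative
     (\<lambda>v. sqrt (d x) * (2 * (P x / d x) * ((P' v * d x - P x * d' v) / (d x * d x)) / 4
         - (k' v * d x - k x * d' v) / (d x * d x)) + d' v * (inverse (sqrt (d x)) / 2) * ((P x / d x)\<^sup>2 / 4 - k x / d x)))
     (at x within D)"
    using dx
    by (intro has_derivative_eq_rhs[OF has_derivative_mult[OF has_derivative_real_sqrt[OF dx dd]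
        has_derivative_diff[OF has_derivative_mult_right[OF has_derivative_power[OF has_derivative_divide'[OF dP dd], of 2], of "1/4"]
          has_derivative_divide'[OF dk dd]]]]) (auto simp: fun_eq_iff field_simps)
  moreover have "sqrt (d x) * (2 * (P x / d x) * ((P' v * d x - P x * d' v) / (d x * d x)) / 4
         - (k' v * d x - k x * d' v) / (d x * d x)) + d' v * (inverse (sqrt (d x)) / 2) * ((P x / d x)\<^sup>2 / 4 - k x / d x)
     = ((P x / d x) * P' v / 2 - k' v + d' v * (k x / d x / 2 - 3 / 8 * (P x / d x)\<^sup>2)) / sqrt (d x)" for v
  proof -
    define s where "s = sqrt (d x)"
    have s: "s > 0" "d x = s * s" using dx by (simp_all add: s_def)
    show ?thesis
      unfolding s_def[symmetric] s(2) using s(1) by (simp add: field_simps power2_eq_square)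
  qed
  ultimately show ?thesis
    unfolding forms_density_def forms_density'_def Let_def d_def P_def k_def d'_def P'_def k'_def by simp
qed

text \<open>The differential is linear, and the velocity of the two forms has four parts: the
  covariant Hessian \<open>u\<close> of \<phi>, the normal displacement by \<phi>, the transport
  along \<xi>, and the deformation by the first derivatives of \<xi>. Here \<open>x12\<close> is the
  derivative of the first component of \<xi> in direction 2, and \<open>x21\<close> that of the
  second component in direction 1.\<close>

lemma forms_density'_variation:
  fixes E F G L M N :: real
  defines "d \<equiv> E * G - F * F" and "H \<equiv> (E * N - 2 * F * M + G * L) / (E * G - F * F)"
    and "K \<equiv> (L * N - M * M) / (E * G - F * F)"
  assumes d: "0 < d"
    and E': "E' = - 2 * \<phi> * L + (\<xi>1 * E1 + \<xi>2 * E2) + 2 * (x11 * E + x21 * F)"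
    and F': "F' = - 2 * \<phi> * M + (\<xi>1 * F1 + \<xi>2 * F2) + (x11 * F + x21 * G + x12 * E + x22 * F)"
    and G': "G' = - 2 * \<phi> * N + (\<xi>1 * G1 + \<xi>2 * G2) + 2 * (x12 * F + x22 * G)"
    and L': "L' = u11 - \<phi> * (H * L - K * E) + (\<xi>1 * L1 + \<xi>2 * L2) + 2 * (x11 * L + x21 * M)"
    and M': "M' = u12 - \<phi> * (H * M - K * F) + (\<xi>1 * M1 + \<xi>2 * M2) + (x11 * M + x21 * N + x12 * L + x22 * M)"
    and N': "N' = u22 - \<phi> * (H * N - K * G) + (\<xi>1 * N1 + \<xi>2 * N2) + 2 * (x12 * M + x22 * N)"
  shows "forms_density' E F G L M N E' F' G' L' M' N' =
    forms_density E F G L M N * H * \<phi>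
    + (- (N - H * G / 2) * u11 + 2 * (M - H * F / 2) * u12 - (L - H * E / 2) * u22) / sqrt d
    + (\<xi>1 * forms_density' E F G L M N E1 F1 G1 L1 M1 N1 + \<xi>2 * forms_density' E F G L M N E2 F2 G2 L2 M2 N2)
    + forms_density E F G L M N * (x11 + x22)"
proof -
  \<comment> \<open>Up to the factor \<open>sqrt d\<close> this is the differential; without the
    root it is polynomial in the six directions and can be evaluated on each part
    separately.\<close>
  define \<Lambda> where "\<Lambda> e f g l m n = H * (e * N + E * n - 2 * (f * M + F * m) + g * L + G * l) / 2 - (l * N + L * n - 2 * M * m)
      + (e * G + E * g - 2 * F * f) * (K / 2 - 3 / 8 * H\<^sup>2)" for e f g l m n
  have fd': "forms_density' E F G L M N e f g l m n = \<Lambda> e f g l m n / sqrt d" for e f g l m n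
    unfolding forms_density'_def \<Lambda>_def d_def H_def K_def Let_def by simp
  have HP: "E * N - 2 * F * M + G * L = H * d" and Kk: "L * N - M * M = K * d"
    using d by (simp_all add: H_def K_def d_def)
  have dd: "E * G - F * F = d" by (simp add: d_def)
  have fd: "forms_density E F G L M N = (H\<^sup>2 / 4 - K) * d / sqrt d"
  proof -
    have sd: "d / sqrt d = sqrt d" using d by (simp add: real_div_sqrt)
    show ?thesis
      unfolding forms_density_def dd HP Kk times_divide_eq_right[symmetric] sd using d by simp
  qed
  have add: "\<Lambda> (a1 + b1) (a2 + b2) (a3 + b3) (a4 + b4) (a5 + b5) (a6 + b6) = \<Lambda> a1 a2 a3 a4 a5 a6 + \<Lambda> b1 b2 b3 b4 b5 b6"
    for a1 b1 a2 b2 a3 b3 a4 b4 a5 b5 a6 b6 unfolding \<Lambda>_def by (simp add: field_simps)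
  have scale: "\<Lambda> (t * a1) (t * a2) (t * a3) (t * a4) (t * a5) (t * a6) = t * \<Lambda> a1 a2 a3 a4 a5 a6"
    for t a1 a2 a3 a4 a5 a6 unfolding \<Lambda>_def by (simp add: field_simps)
  have P1: "\<Lambda> 0 0 0 u11 u12 u22 = - (N - H * G / 2) * u11 + 2 * (M - H * F / 2) * u12 - (L - H * E / 2) * u22"
    unfolding \<Lambda>_def by (simp add: field_simps)
  \<comment> \<open>The direction of the parallel surfaces: g changes by -2 h and h by minus the
    third fundamental form H h - K g.\<close>
  have P2: "\<Lambda> (- 2 * L) (- 2 * M) (- 2 * N) (- (H * L - K * E)) (- (H * M - K * F)) (- (H * N - K * G))
     = (H\<^sup>2 / 4 - K) * d * H"
  proof -
    have q1: "(- 2 * L) * N + E * (- (H * N - K * G)) - 2 * ((- 2 * M) * M + F * (- (H * M - K * F))) + (- 2 * N) * L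
        + G * (- (H * L - K * E)) = - 2 * K * d - H * (H * d)"
      using HP Kk dd by algebra
    have q2: "(- (H * L - K * E)) * N + L * (- (H * N - K * G)) - 2 * M * (- (H * M - K * F)) = - H * K * d"
      using HP Kk dd by algebra
    have q3: "(- 2 * L) * G + E * (- 2 * N) - 2 * F * (- 2 * M) = - 2 * H * d"
      using HP by algebra
    show ?thesis unfolding \<Lambda>_def q1 q2 q3 by (simp add: field_simps power2_eq_square)
  qed
  \<comment> \<open>An infinitesimal linear change of the coordinate frame. The density of the
    functional scales with the determinant of the frame change, so its derivative is its value times
    the trace.\<close>
  have P3: "\<Lambda> (2 * (x11 * E + x21 * F)) (x11 * F + x21 * G + x12 * E + x22 * F) (2 * (x12 * F + x22 * G))
      (2 * (x11 * L + x21 * M)) (x11 * M + x21 * N + x12 * L + x22 * M) (2 * (x12 * M + x22 * N))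
      = (H\<^sup>2 / 4 - K) * d * (x11 + x22)"
  proof -
    have "(2 * (x11 * E + x21 * F)) * N + E * (2 * (x12 * M + x22 * N)) - 2 * ((x11 * F + x21 * G + x12 * E + x22 * F) * M
      + F * (x11 * M + x21 * N + x12 * L + x22 * M)) + (2 * (x12 * F + x22 * G)) * L + G * (2 * (x11 * L + x21 * M))
      = 2 * (x11 + x22) * (H * d)"
      unfolding HP[symmetric] by (simp add: algebra_simps)
    moreover have "(2 * (x11 * L + x21 * M)) * N + L * (2 * (x12 * M + x22 * N)) - 2 * M * (x11 * M + x21 * N + x12 * L + x22 * M)
      = 2 * (x11 + x22) * (K * d)"
      unfolding Kk[symmetric] by (simp add: algebra_simps)
    moreover have "(2 * (x11 * E + x21 * F)) * G + E * (2 * (x12 * F + x22 * G)) - 2 * F * (x11 * F + x21 * G + x12 * E + x22 * F)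
      = 2 * (x11 + x22) * d"
      unfolding d_def by (simp add: algebra_simps)
    ultimately show ?thesis unfolding \<Lambda>_def by (simp add: field_simps power2_eq_square)
  qed
  have "\<Lambda> E' F' G' L' M' N' = \<Lambda> 0 0 0 u11 u12 u22
    + \<phi> * \<Lambda> (- 2 * L) (- 2 * M) (- 2 * N) (- (H * L - K * E)) (- (H * M - K * F)) (- (H * N - K * G))
    + (\<xi>1 * \<Lambda> E1 F1 G1 L1 M1 N1 + \<xi>2 * \<Lambda> E2 F2 G2 L2 M2 N2)
    + \<Lambda> (2 * (x11 * E + x21 * F)) (x11 * F + x21 * G + x12 * E + x22 * F) (2 * (x12 * F + x22 * G))
      (2 * (x11 * L + x21 * M)) (x11 * M + x21 * N + x12 * L + x22 * M) (2 * (x12 * M + x22 * N))"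
    unfolding scale[symmetric] add[symmetric] E' F' G' L' M' N'
    by (simp add: algebra_simps)
  note total = this[unfolded P1 P2 P3]
  show ?thesis
    unfolding fd' fd total divide_inverse[of _ "sqrt d"] by (simp add: algebra_simps)
qed

text \<open>Cayley-Hamilton for the shape operator: the third fundamental form is H h - K g. Here
  \<open>p\<close> and \<open>q\<close> play the derivatives of the unit normal, which are
  tangential by the fifth and sixth hypotheses; their coefficients are eliminated after
  multiplication by the Gram determinant.\<close>

lemma third_form:
  fixes E F G L M N :: real and x y p q :: "real^3"
  assumes d: "E * G - F * F \<noteq> 0"
    and "x \<bullet> x = E" "x \<bullet> y = F" "y \<bullet> y = G"
    and "p = a *\<^sub>R x + b *\<^sub>R y" "q = a' *\<^sub>R x + b' *\<^sub>R y"
    and "p \<bullet> x = - L" "p \<bullet> y = - M" "q \<bullet> x = - M" "q \<bullet> y = - N"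
  defines "H \<equiv> (E * N - 2 * F * M + G * L) / (E * G - F * F)" and "K \<equiv> (L * N - M * M) / (E * G - F * F)"
  shows "p \<bullet> p = H * L - K * E" "p \<bullet> q = H * M - K * F" "q \<bullet> q = H * N - K * G"
proof -
  have 1: "a * E + b * F = - L" "a * F + b * G = - M" "a' * E + b' * F = - M" "a' * F + b' * G = - N"
  proof -
    have yx: "y \<bullet> x = F" using assms(3) by (simp add: inner_commute)
    have "p \<bullet> x = a * E + b * F" "p \<bullet> y = a * F + b * G" "q \<bullet> x = a' * E + b' * F" "q \<bullet> y = a' * F + b' * G"
      unfolding assms(5,6) by (simp_all add: inner_add_left assms(2-4) yx)
    then show "a * E + b * F = - L" "a * F + b * G = - M" "a' * E + b' * F = - M" "a' * F + b' * G = - N"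
      using assms(7-10) by simp_all
  qed
  have 2: "p \<bullet> p = - (a * L + b * M)" "p \<bullet> q = - (a * M + b * N)" "q \<bullet> q = - (a' * M + b' * N)"
  proof -
    show "p \<bullet> p = - (a * L + b * M)"
      by (subst (2) assms(5)) (simp add: inner_add_right assms(7,8))
    show "p \<bullet> q = - (a * M + b * N)"
      by (subst assms(5)) (simp add: inner_add_left inner_commute[of x q] inner_commute[of y q] assms(9,10))
    show "q \<bullet> q = - (a' * M + b' * N)"
      by (subst (2) assms(6)) (simp add: inner_add_right assms(9,10))
  qed
  let ?d = "E * G - F * F"
  have 3: "H * ?d = E * N - 2 * F * M + G * L" "K * ?d = L * N - M * M"
    using d by (simp_all add: H_def K_def)
  have "?d * (p \<bullet> p) = ?d * (H * L - K * E)" unfolding 2 using 1 3 by algebra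
  then show "p \<bullet> p = H * L - K * E" using d by simp
  have "?d * (p \<bullet> q) = ?d * (H * M - K * F)" unfolding 2 using 1 3 by algebra
  then show "p \<bullet> q = H * M - K * F" using d by simp
  have "?d * (q \<bullet> q) = ?d * (H * N - K * G)" unfolding 2 using 1 3 by algebra
  then show "q \<bullet> q = H * N - K * G" using d by simp
qed

text \<open>The left-hand side is the trace of the square of the endomorphism obtained by raising
  one index of the trace-free form. For a trace-free 2 by 2 matrix this trace equals minus twice the
  determinant, and the determinant is K - H^2 / 4.\<close>

lemma tracefree_norm_sq_formula:
  fixes E F G L M N :: real
  defines "d \<equiv> E * G - F * F" and "H \<equiv> (E * N - 2 * F * M + G * L) / (E * G - F * F)"
  defines "a \<equiv> L - H / 2 * E" and "b \<equiv> M - H / 2 * F" and "e \<equiv> N - H / 2 * G"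
  assumes d: "d \<noteq> 0"
  shows "((G * a - F * b) / d)\<^sup>2 + 2 * ((G * b - F * e) / d) * ((E * b - F * a) / d) + ((E * e - F * b) / d)\<^sup>2
    = H\<^sup>2 / 2 - 2 * ((L * N - M * M) / d)"
proof -
  have HP: "E * N - 2 * F * M + G * L = H * d" using d by (simp add: H_def d_def)
  have dd: "E * G - F * F = d" by (simp add: d_def)
  have tr: "G * a - 2 * F * b + E * e = 0"
    unfolding a_def b_def e_def using HP dd by algebra
  have det: "a * e - b * b = (L * N - M * M) - H\<^sup>2 * d / 4"
  proof -
    have "4 * (a * e - b * b) = 4 * (L * N - M * M) - 2 * H * (E * N - 2 * F * M + G * L) + H * H * (E * G - F * F)"
      unfolding a_def b_def e_def by (simp add: algebra_simps)
    then show ?thesis unfolding HP dd by (simp add: power2_eq_square algebra_simps)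
  qed
  have "(G * a - F * b)\<^sup>2 + 2 * (G * b - F * e) * (E * b - F * a) + (E * e - F * b)\<^sup>2 = - 2 * (a * e - b * b) * d"
    using tr dd by algebra
  also have "\<dots> = (H\<^sup>2 / 2 - 2 * ((L * N - M * M) / d)) * d\<^sup>2"
    using d unfolding det by (simp add: field_simps power2_eq_square)
  finally have "((G * a - F * b)\<^sup>2 + 2 * (G * b - F * e) * (E * b - F * a) + (E * e - F * b)\<^sup>2) / d\<^sup>2
    = H\<^sup>2 / 2 - 2 * ((L * N - M * M) / d)"
    using d by simp
  then show ?thesis by (simp add: power_divide add_divide_distrib power2_eq_square)
qed

context surface
begin

subsection \<open>Geometry of an immersion in a chart\<close>

text \<open>Injectivity of the differential is replaced by positivity of the Gram determinant, an
  open condition that survives small changes of the parameter and permits division and square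
  roots.\<close>

definition immersed :: "'a chart \<Rightarrow> ('a \<Rightarrow> real^3) \<Rightarrow> bool" where
  "immersed c f \<longleftrightarrow> c \<in> A \<and> smooth_in c (chart_dom c) f \<and> (\<forall>p\<in>chart_dom c. 0 < det (metric c f p))"

definition density :: "'a chart \<Rightarrow> ('a \<Rightarrow> real^3) \<Rightarrow> 'a \<Rightarrow> real" where
  "density c f p = 1/2 * tracefree_norm_sq_in c f p * sqrt (det (metric c f p))"

lemma metric_nth: "metric c f p $ i $ j = coord_deriv c i f p \<bullet> coord_deriv c j f p"
  by (simp add: metric_def)

lemma metric_sym: "metric c f p $ i $ j = metric c f p $ j $ i"
  by (simp add: metric_nth inner_commute)

lemma second_form_nth:
  "second_form c f p $ i $ j = coord_deriv c i (coord_deriv c j f) p \<bullet> unit_normal c f p"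
  by (simp add: second_form_def)

lemma det_metric:
  "det (metric c f p) = metric c f p $ 1 $ 1 * metric c f p $ 2 $ 2 - metric c f p $ 1 $ 2 * metric c f p $ 1 $ 2"
  by (simp add: det_2 metric_sym[of c f p 2 1])

lemma unit_normal_frame:
  assumes "0 < det (metric c f p)"
  shows "unit_normal c f p \<bullet> unit_normal c f p = 1"
    "\<exists>a b. w = a *\<^sub>R coord_deriv c 1 f p + b *\<^sub>R coord_deriv c 2 f p + (w \<bullet> unit_normal c f p) *\<^sub>R unit_normal c f p"
    "unit_normal c f p = (1 / sqrt (det (metric c f p))) *\<^sub>R cross3 (coord_deriv c 1 f p) (coord_deriv c 2 f p)"
  using unit_cross_frame[of "coord_deriv c 1 f p" "coord_deriv c 2 f p"] assms
  unfolding det_metric metric_nth unit_normal_def by blast+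

lemma unit_normal_perp: "unit_normal c f p \<bullet> coord_deriv c i f p = 0"
proof -
  have "\<forall>i. cross3 (coord_deriv c 1 f p) (coord_deriv c 2 f p) \<bullet> coord_deriv c i f p = 0"
    unfolding forall_2 by (simp add: cross3_simps)
  then show ?thesis by (simp add: unit_normal_def sgn_div_norm)
qed

lemma metric_inv_2:
  assumes "0 < det (metric c f p)"
  shows "metric_inv c f p $ 1 $ 1 = metric c f p $ 2 $ 2 / det (metric c f p)"
    "metric_inv c f p $ 1 $ 2 = - metric c f p $ 1 $ 2 / det (metric c f p)"
    "metric_inv c f p $ 2 $ 1 = - metric c f p $ 1 $ 2 / det (metric c f p)"
    "metric_inv c f p $ 2 $ 2 = metric c f p $ 1 $ 1 / det (metric c f p)"
  using matrix_inv_2[of "metric c f p"] assms by (simp_all add: metric_inv_def metric_sym[of c f p 2 1])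

lemma mean_curvature_in_formula:
  assumes "0 < det (metric c f p)" "second_form c f p $ 2 $ 1 = second_form c f p $ 1 $ 2"
  shows "mean_curvature_in c f p =
    (metric c f p $ 1 $ 1 * second_form c f p $ 2 $ 2 - 2 * metric c f p $ 1 $ 2 * second_form c f p $ 1 $ 2
     + metric c f p $ 2 $ 2 * second_form c f p $ 1 $ 1) / det (metric c f p)"
  unfolding mean_curvature_in_def sum_2 metric_inv_2[OF assms(1)] assms(2)
  by (simp add: add_divide_distrib diff_divide_distrib)

lemma tracefree_form_nth:
  "tracefree_form c f p $ i $ j = second_form c f p $ i $ j - mean_curvature_in c f p / 2 * metric c f p $ i $ j"
  by (simp add: tracefree_form_def)

lemma tracefree_norm_sq_in_formula:
  assumes "0 < det (metric c f p)" "second_form c f p $ 2 $ 1 = second_form c f p $ 1 $ 2"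
  shows "tracefree_norm_sq_in c f p = (mean_curvature_in c f p)\<^sup>2 / 2 -
    2 * ((second_form c f p $ 1 $ 1 * second_form c f p $ 2 $ 2 - second_form c f p $ 1 $ 2 * second_form c f p $ 1 $ 2)
       / det (metric c f p))"
proof -
  define E F G L M N d where "E = metric c f p $ 1 $ 1" and "F = metric c f p $ 1 $ 2" and "G = metric c f p $ 2 $ 2"
    and "L = second_form c f p $ 1 $ 1" and "M = second_form c f p $ 1 $ 2" and "N = second_form c f p $ 2 $ 2"
    and "d = det (metric c f p)"
  note defs = this
  have d: "d = E * G - F * F" "d \<noteq> 0" using assms(1) by (simp_all add: defs det_metric)
  have H: "mean_curvature_in c f p = (E * N - 2 * F * M + G * L) / (E * G - F * F)"
    using mean_curvature_in_formula[OF assms] by (simp add: defs det_metric)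
  define H where "H = (E * N - 2 * F * M + G * L) / (E * G - F * F)"
  define a b e where "a = L - H / 2 * E" and "b = M - H / 2 * F" and "e = N - H / 2 * G"
  have t: "tracefree_form c f p $ 1 $ 1 = a" "tracefree_form c f p $ 1 $ 2 = b"
    "tracefree_form c f p $ 2 $ 1 = b" "tracefree_form c f p $ 2 $ 2 = e"
    unfolding tracefree_form_nth H a_def b_def e_def H_def
    by (simp_all add: defs assms(2) metric_sym[of c f p 2 1])
  have "tracefree_norm_sq_in c f p
    = ((G * a - F * b) / d)\<^sup>2 + 2 * ((G * b - F * e) / d) * ((E * b - F * a) / d) + ((E * e - F * b) / d)\<^sup>2"
    unfolding tracefree_norm_sq_in_def sum_2 metric_inv_2[OF assms(1)] t
    unfolding defs(1-3)[symmetric] defs(7)[symmetric] using d(2)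
    by (simp add: divide_simps) (simp add: algebra_simps power2_eq_square)
  also have "\<dots> = H\<^sup>2 / 2 - 2 * ((L * N - M * M) / d)"
    using tracefree_norm_sq_formula[where E=E and F=F and G=G and L=L and M=M and N=N] d unfolding a_def b_def e_def H_def by simp
  finally show ?thesis unfolding H H_def[symmetric] by (simp add: defs)
qed

lemma density_formula:
  assumes "0 < det (metric c f p)" "second_form c f p $ 2 $ 1 = second_form c f p $ 1 $ 2"
  shows "density c f p = forms_density (metric c f p $ 1 $ 1) (metric c f p $ 1 $ 2) (metric c f p $ 2 $ 2)
     (second_form c f p $ 1 $ 1) (second_form c f p $ 1 $ 2) (second_form c f p $ 2 $ 2)"
  unfolding density_def tracefree_norm_sq_in_formula[OF assms] mean_curvature_in_formula[OF assms]
    forms_density_def det_metric by (simp add: algebra_simps)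

lemma second_form_sym:
  assumes "c \<in> A" "smooth_in c (chart_dom c) f" "p \<in> chart_dom c"
  shows "second_form c f p $ 2 $ 1 = second_form c f p $ 1 $ 2"
  unfolding second_form_nth using coord_deriv_commute[OF patch_dom assms(2)] assms by metis

lemma smooth_geometry:
  assumes "immersed c f"
  defines "U \<equiv> chart_dom c"
  shows "smooth_in c U (\<lambda>p. metric c f p $ i $ j)"
    "smooth_in c U (\<lambda>p. sqrt (det (metric c f p)))"
    "smooth_in c U (\<lambda>p. det (metric c f p))"
    "smooth_in c U (unit_normal c f)"
    "smooth_in c U (\<lambda>p. second_form c f p $ i $ j)"
    "smooth_in c U (mean_curvature_in c f)"
    "smooth_in c U (\<lambda>p. tracefree_form c f p $ i $ j)"
    "smooth_in c U (tracefree_norm_sq_in c f)"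
    "smooth_in c U (density c f)"
proof -
  have c: "c \<in> A" and f: "smooth_in c U f" and pos: "\<And>p. p \<in> U \<Longrightarrow> 0 < det (metric c f p)"
    using assms by (auto simp: immersed_def)
  have U: "patch c U" using c by (simp add: U_def patch_dom)
  have sym: "second_form c f p $ 2 $ 1 = second_form c f p $ 1 $ 2" if "p \<in> U" for p
    using second_form_sym c f that by (simp add: U_def)
  show 1: "smooth_in c U (\<lambda>p. metric c f p $ i $ j)" for i j
    unfolding metric_nth by (intro smooth_in_comps smooth_in_coord_deriv U f)
  show 2: "smooth_in c U (\<lambda>p. det (metric c f p))"
    unfolding det_metric by (intro smooth_in_comps 1)
  show 3: "smooth_in c U (\<lambda>p. sqrt (det (metric c f p)))"
    by (intro smooth_in_sqrt U 2 pos)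
  \<comment> \<open>By Lagrange's identity the cross product of the coordinate vectors has length
    sqrt(det g), so the normalisation is division by a smooth positive function.\<close>
  have "smooth_in c U (\<lambda>p. (1 / sqrt (det (metric c f p))) *\<^sub>R cross3 (coord_deriv c 1 f p) (coord_deriv c 2 f p))"
    by (intro smooth_in_divide smooth_in_comps smooth_in_coord_deriv U f 3) (use pos in fastforce)
  then show 4: "smooth_in c U (unit_normal c f)"
    by (rule smooth_in_cong[OF U, THEN iffD1, rotated]) (simp add: unit_normal_frame(3)[OF pos])
  show 5: "smooth_in c U (\<lambda>p. second_form c f p $ i $ j)" for i j
    unfolding second_form_nth by (intro smooth_in_comps smooth_in_coord_deriv U f 4)
  have "smooth_in c U (\<lambda>p. (metric c f p $ 1 $ 1 * second_form c f p $ 2 $ 2 - 2 * metric c f p $ 1 $ 2 * second_form c f p $ 1 $ 2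
     + metric c f p $ 2 $ 2 * second_form c f p $ 1 $ 1) / det (metric c f p))"
    by (intro smooth_in_divide smooth_in_comps U 1 2 5) (use pos in fastforce)
  then show 6: "smooth_in c U (mean_curvature_in c f)"
    by (rule smooth_in_cong[OF U, THEN iffD1, rotated]) (simp add: mean_curvature_in_formula[OF pos sym])
  show "smooth_in c U (\<lambda>p. tracefree_form c f p $ i $ j)"
    unfolding tracefree_form_nth by (intro smooth_in_divide smooth_in_comps U 1 5 6) simp
  have "smooth_in c U (\<lambda>p. (mean_curvature_in c f p)\<^sup>2 / 2 -
    2 * ((second_form c f p $ 1 $ 1 * second_form c f p $ 2 $ 2 - second_form c f p $ 1 $ 2 * second_form c f p $ 1 $ 2)
       / det (metric c f p)))"
    by (intro smooth_in_divide smooth_in_comps U 6 5 2) (use pos in fastforce)+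
  then show 7: "smooth_in c U (tracefree_norm_sq_in c f)"
    by (rule smooth_in_cong[OF U, THEN iffD1, rotated]) (simp add: tracefree_norm_sq_in_formula[OF pos sym])
  show "smooth_in c U (density c f)"
    unfolding density_def[abs_def] by (intro smooth_in_comps U 7 3)
qed

text \<open>The last two clauses are the Weingarten relations. They come from differentiating the
  constant functions \<open>unit_normal c f q \<bullet> unit_normal c f q\<close> and
  \<open>unit_normal c f q \<bullet> coord_deriv c i f q\<close>.\<close>

lemma geometry_derivatives:
  assumes "immersed c f" "p \<in> chart_dom c"
  shows "has_coord_deriv c k (\<lambda>q. metric c f q $ i $ j) p
      (coord_deriv c k (coord_deriv c i f) p \<bullet> coord_deriv c j f p + coord_deriv c i f p \<bullet> coord_deriv c k (coord_deriv c j f) p)"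
    "has_coord_deriv c k (\<lambda>q. second_form c f q $ i $ j) p
      (coord_deriv c k (coord_deriv c i (coord_deriv c j f)) p \<bullet> unit_normal c f p
       + coord_deriv c i (coord_deriv c j f) p \<bullet> coord_deriv c k (unit_normal c f) p)"
    "coord_deriv c k (unit_normal c f) p \<bullet> unit_normal c f p = 0"
    "coord_deriv c k (unit_normal c f) p \<bullet> coord_deriv c i f p = - second_form c f p $ k $ i"
proof -
  have c: "c \<in> A" and f: "smooth_in c (chart_dom c) f" and pos: "\<And>p. p \<in> chart_dom c \<Longrightarrow> 0 < det (metric c f p)"
    using assms by (auto simp: immersed_def)
  note U = patch_dom[OF c]
  have I: "has_coord_deriv c k F p (coord_deriv c k F p)" if "smooth_in c (chart_dom c) F" for F :: "'a \<Rightarrow> real^3"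
    by (intro has_coord_derivI c assms(2) smooth_in_differentiable[OF U that])
  note f1 = smooth_in_coord_deriv[OF U f]
  note f2 = smooth_in_coord_deriv[OF U f1]
  note n = smooth_geometry(4)[OF assms(1)]
  show "has_coord_deriv c k (\<lambda>q. metric c f q $ i $ j) p
      (coord_deriv c k (coord_deriv c i f) p \<bullet> coord_deriv c j f p + coord_deriv c i f p \<bullet> coord_deriv c k (coord_deriv c j f) p)"
    unfolding metric_nth using has_coord_deriv_inner[OF I[OF f1] I[OF f1], of i j] by (simp only: add.commute)
  show "has_coord_deriv c k (\<lambda>q. second_form c f q $ i $ j) p
      (coord_deriv c k (coord_deriv c i (coord_deriv c j f)) p \<bullet> unit_normal c f p
       + coord_deriv c i (coord_deriv c j f) p \<bullet> coord_deriv c k (unit_normal c f) p)"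
    unfolding second_form_nth using has_coord_deriv_inner[OF I[OF f2] I[OF n], of i j] by (simp only: add.commute)
  have "has_coord_deriv c k (\<lambda>q. 1 :: real) p (unit_normal c f p \<bullet> coord_deriv c k (unit_normal c f) p + coord_deriv c k (unit_normal c f) p \<bullet> unit_normal c f p)"
    by (rule has_coord_deriv_local[OF U assms(2) _ has_coord_deriv_inner[OF I[OF n] I[OF n]]])
      (simp add: unit_normal_frame(1)[OF pos])
  from has_coord_derivD(1)[OF this] has_coord_derivD(1)[OF has_coord_deriv_const[OF c assms(2), of k "1::real"]]
  show "coord_deriv c k (unit_normal c f) p \<bullet> unit_normal c f p = 0" by (simp add: inner_commute)
  have "has_coord_deriv c k (\<lambda>q. 0 :: real) p (unit_normal c f p \<bullet> coord_deriv c k (coord_deriv c i f) p + coord_deriv c k (unit_normal c f) p \<bullet> coord_deriv c i f p)"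
    by (rule has_coord_deriv_local[OF U assms(2) _ has_coord_deriv_inner[OF I[OF n] I[OF f1]]])
      (simp add: unit_normal_perp)
  from has_coord_derivD(1)[OF this] has_coord_derivD(1)[OF has_coord_deriv_const[OF c assms(2), of k "0::real"]]
  show "coord_deriv c k (unit_normal c f) p \<bullet> coord_deriv c i f p = - second_form c f p $ k $ i"
    by (simp add: inner_commute second_form_nth)
qed

text \<open>\<open>flux c f \<phi> x\<close> is \<open>\<surd>det g\<close> times the vector field \<open>h\<^sup>\<circ>(grad \<phi>, \<cdot>)\<^sup>\<sharp> - \<phi>/2 grad H + |h\<^sup>\<circ>|\<^sup>2/2 \<xi>\<close>.
  In dimension two raising both indices of \<open>h\<^sup>\<circ>\<close> amounts to \<open>- adj(h\<^sup>\<circ>) / det g\<close>.\<close>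

definition flux :: "'a chart \<Rightarrow> ('a \<Rightarrow> real^3) \<Rightarrow> ('a \<Rightarrow> real) \<Rightarrow> ('a \<Rightarrow> real^2) \<Rightarrow> 2 \<Rightarrow> 'a \<Rightarrow> real" where
  "flux c f \<phi> x i p =
    (let s = sqrt (det (metric c f p)); g = metric c f p; t = tracefree_form c f p;
       u1 = coord_deriv c 1 \<phi> p; u2 = coord_deriv c 2 \<phi> p;
       H1 = coord_deriv c 1 (mean_curvature_in c f) p; H2 = coord_deriv c 2 (mean_curvature_in c f) p in
     if i = 1 then (- t $ 2 $ 2) / s * u1 + t $ 1 $ 2 / s * u2
         - 1/2 * \<phi> p * ((g $ 2 $ 2 * H1 - g $ 1 $ 2 * H2) / s) + density c f p * x p $ 1
     else t $ 1 $ 2 / s * u1 + (- t $ 1 $ 1) / s * u2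
         - 1/2 * \<phi> p * ((g $ 1 $ 1 * H2 - g $ 1 $ 2 * H1) / s) + density c f p * x p $ 2)"

text \<open>In dimension two sqrt(det g) times the inverse metric is the adjugate of g divided by
  sqrt(det g). This form contains no matrix inverse and matches the gradient part of
  \<open>flux\<close>.\<close>

lemma laplacian_in_flux:
  assumes "immersed c f" "p \<in> chart_dom c"
  shows "laplacian_in c f u p * sqrt (det (metric c f p)) =
    coord_deriv c 1 (\<lambda>q. (metric c f q $ 2 $ 2 * coord_deriv c 1 u q - metric c f q $ 1 $ 2 * coord_deriv c 2 u q) / sqrt (det (metric c f q))) p
    + coord_deriv c 2 (\<lambda>q. (metric c f q $ 1 $ 1 * coord_deriv c 2 u q - metric c f q $ 1 $ 2 * coord_deriv c 1 u q) / sqrt (det (metric c f q))) p"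
proof -
  have c: "c \<in> A" and pos: "\<And>p. p \<in> chart_dom c \<Longrightarrow> 0 < det (metric c f p)"
    using assms by (auto simp: immersed_def)
  have s: "sqrt d * (x / d) = x / sqrt d" if "d > 0" for d x :: real
  proof -
    define r where "r = sqrt d"
    have r: "d = r * r" "r > 0" using that by (simp_all add: r_def)
    show ?thesis unfolding r_def[symmetric] unfolding r(1) using r(2) by (simp add: field_simps)
  qed
  have 1: "sqrt (det (metric c f q)) * gradient c f u q $ 1 =
     (metric c f q $ 2 $ 2 * coord_deriv c 1 u q - metric c f q $ 1 $ 2 * coord_deriv c 2 u q) / sqrt (det (metric c f q))"
    "sqrt (det (metric c f q)) * gradient c f u q $ 2 =
     (metric c f q $ 1 $ 1 * coord_deriv c 2 u q - metric c f q $ 1 $ 2 * coord_deriv c 1 u q) / sqrt (det (metric c f q))"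
    if "q \<in> chart_dom c" for q
    unfolding s[OF pos[OF that], symmetric] gradient_def matrix_vector_mult_def
    by (simp_all add: sum_2 metric_inv_2[OF pos[OF that]] diff_divide_distrib)
  have "laplacian_in c f u p * sqrt (det (metric c f p)) =
    (\<Sum>i\<in>UNIV. coord_deriv c i (\<lambda>q. sqrt (det (metric c f q)) * gradient c f u q $ i) p)"
    using pos[OF assms(2)] by (simp add: laplacian_in_def divergence_def)
  then show ?thesis
    unfolding sum_2 using coord_deriv_cong[OF c assms(2) 1(1)] coord_deriv_cong[OF c assms(2) 1(2)] by simp
qed

end

section \<open>Variation of the second fundamental form and of the density\<close>

text \<open>Once the normal is known to be differentiable, its derivative need not be computed: its
  products with \<open>X 0\<close>, \<open>Y 0\<close> and \<open>n 0\<close> follow from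
  differentiating the orthonormality relations. Decomposing \<open>W 0\<close> in this frame then
  determines the remaining inner product. With second coordinate derivatives for \<open>W\<close>,
  the numbers \<open>a\<close> and \<open>b\<close> are Christoffel symbols.\<close>

lemma normal_component_variation:
  fixes X Y W :: "real \<Rightarrow> real^3"
  assumes X: "(X has_vector_derivative X') (at 0)" and Y: "(Y has_vector_derivative Y') (at 0)"
    and W: "(W has_vector_derivative W') (at 0)"
    and pos: "0 < (X 0 \<bullet> X 0) * (Y 0 \<bullet> Y 0) - (X 0 \<bullet> Y 0) * (X 0 \<bullet> Y 0)"
  defines "n \<equiv> \<lambda>t. sgn (cross3 (X t) (Y t))"
  assumes W0: "W 0 = a *\<^sub>R X 0 + b *\<^sub>R Y 0 + (W 0 \<bullet> n 0) *\<^sub>R n 0"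
  shows "((\<lambda>t. W t \<bullet> n t) has_real_derivative (W' \<bullet> n 0 - a * (X' \<bullet> n 0) - b * (Y' \<bullet> n 0))) (at 0)"
proof -
  define Z where "Z t = cross3 (X t) (Y t)" for t
  have Z: "(Z has_derivative (\<lambda>s. cross3 (X 0) (s *\<^sub>R Y') + cross3 (s *\<^sub>R X') (Y 0))) (at 0)"
    unfolding Z_def[abs_def]
    using bounded_bilinear.FDERIV[OF bounded_bilinear_cross3 X[unfolded has_vector_derivative_def] Y[unfolded has_vector_derivative_def]] .
  have Z0: "Z 0 \<noteq> 0" using pos cross3_inner_self[of "X 0" "Y 0"] by (auto simp: Z_def)
  have n_alt: "n = (\<lambda>t. inverse (norm (Z t)) *\<^sub>R Z t)" by (simp add: n_def Z_def sgn_div_norm fun_eq_iff)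
  have "(\<lambda>t. norm (Z t)) differentiable (at 0)"
    using has_derivative_compose[OF Z has_derivative_norm[OF Z0]] by (auto simp: differentiable_def)
  then have "n differentiable (at 0)"
    unfolding n_alt using Z Z0 by (intro differentiable_scaleR differentiable_inverse) (auto simp: differentiable_def)
  then obtain n' where n: "(n has_vector_derivative n') (at 0)"
    by (meson vector_derivative_works)
  \<comment> \<open>Since \<open>sgn\<close> of the zero vector is zero, the normal has unit length
    only where the cross product is nonzero, which is guaranteed near 0.\<close>
  have "isCont Z 0" using Z by (rule has_derivative_continuous)
  then have "eventually (\<lambda>t. Z t \<noteq> 0) (at 0)" using Z0 by (metis isCont_def tendsto_imp_eventually_ne)
  then have ev: "eventually (\<lambda>t. n t \<bullet> n t = 1) (at 0)"
    by eventually_elim (simp add: n_def Z_def dot_square_norm norm_sgn)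
  have nn: "n 0 \<bullet> n 0 = 1" using Z0 by (simp add: n_def Z_def dot_square_norm norm_sgn)
  have perp: "n t \<bullet> X t = 0" "n t \<bullet> Y t = 0" for t
    by (simp_all add: n_def sgn_div_norm cross3_simps)
  have dX: "((\<lambda>t. n t \<bullet> X t) has_vector_derivative (n 0 \<bullet> X' + n' \<bullet> X 0)) (at 0)"
    by (rule bounded_bilinear.has_vector_derivative[OF bounded_bilinear_inner n X])
  then have eX: "n' \<bullet> X 0 = - (n 0 \<bullet> X')"
    using vector_derivative_unique_at[OF dX, of 0] by (simp add: perp)
  have dY: "((\<lambda>t. n t \<bullet> Y t) has_vector_derivative (n 0 \<bullet> Y' + n' \<bullet> Y 0)) (at 0)"
    by (rule bounded_bilinear.has_vector_derivative[OF bounded_bilinear_inner n Y])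
  then have eY: "n' \<bullet> Y 0 = - (n 0 \<bullet> Y')"
    using vector_derivative_unique_at[OF dY, of 0] by (simp add: perp)
  have dn: "((\<lambda>t. n t \<bullet> n t) has_vector_derivative (n 0 \<bullet> n' + n' \<bullet> n 0)) (at 0)"
    by (rule bounded_bilinear.has_vector_derivative[OF bounded_bilinear_inner n n])
  have "((\<lambda>t. 1 :: real) has_vector_derivative (n 0 \<bullet> n' + n' \<bullet> n 0)) (at 0)"
    using has_derivative_transform_eventually[OF dn[unfolded has_vector_derivative_def], of "\<lambda>t. 1"] ev nn
    by (simp add: has_vector_derivative_def)
  then have en: "n' \<bullet> n 0 = 0"
    using vector_derivative_unique_at[OF _ has_vector_derivative_const] by (fastforce simp: inner_commute)
  have dW: "((\<lambda>t. W t \<bullet> n t) has_vector_derivative (W 0 \<bullet> n' + W' \<bullet> n 0)) (at 0)"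
    by (rule bounded_bilinear.has_vector_derivative[OF bounded_bilinear_inner W n])
  have "W 0 \<bullet> n' = a * (X 0 \<bullet> n') + b * (Y 0 \<bullet> n') + (W 0 \<bullet> n 0) * (n 0 \<bullet> n')"
    by (subst W0) (simp add: inner_add_left)
  also have "\<dots> = - a * (X' \<bullet> n 0) - b * (Y' \<bullet> n 0)"
    using eX eY en by (simp add: inner_commute)
  finally have "W 0 \<bullet> n' + W' \<bullet> n 0 = W' \<bullet> n 0 - a * (X' \<bullet> n 0) - b * (Y' \<bullet> n 0)" by simp
  then show ?thesis
    using dW unfolding has_real_derivative_iff_has_vector_derivative by (simp only:)
qed

context surface
begin

definition velocity :: "'a chart \<Rightarrow> ('a \<Rightarrow> real^3) \<Rightarrow> ('a \<Rightarrow> real) \<Rightarrow> ('a \<Rightarrow> real^2) \<Rightarrow> 'a \<Rightarrow> real^3" where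
  "velocity c f \<phi> x p = \<phi> p *\<^sub>R unit_normal c f p + x p $ 1 *\<^sub>R coord_deriv c 1 f p + x p $ 2 *\<^sub>R coord_deriv c 2 f p"

text \<open>Only the normal component of the second derivative is required. In it the second
  derivatives of the components of \<xi> and the products of first derivatives of \<phi> with
  derivatives of the normal drop out, because they multiply tangential vectors.\<close>

lemma velocity_derivatives:
  assumes im: "immersed c f" and p: "p \<in> chart_dom c"
    and \<phi>: "smooth_in c (chart_dom c) \<phi>" and x: "smooth_in c (chart_dom c) x"
  defines "n \<equiv> unit_normal c f" and "e \<equiv> \<lambda>i. coord_deriv c i f"
  shows "coord_deriv c k (velocity c f \<phi> x) p =
      coord_deriv c k \<phi> p *\<^sub>R n p + \<phi> p *\<^sub>R coord_deriv c k n p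
      + coord_deriv c k (\<lambda>q. x q $ 1) p *\<^sub>R e 1 p + x p $ 1 *\<^sub>R coord_deriv c k (e 1) p
      + coord_deriv c k (\<lambda>q. x q $ 2) p *\<^sub>R e 2 p + x p $ 2 *\<^sub>R coord_deriv c k (e 2) p"
    and "coord_deriv c i (coord_deriv c k (velocity c f \<phi> x)) p \<bullet> n p =
      coord_deriv c i (coord_deriv c k \<phi>) p - \<phi> p * (coord_deriv c i n p \<bullet> coord_deriv c k n p)
      + coord_deriv c k (\<lambda>q. x q $ 1) p * (coord_deriv c i (e 1) p \<bullet> n p)
      + coord_deriv c i (\<lambda>q. x q $ 1) p * (coord_deriv c k (e 1) p \<bullet> n p)
      + x p $ 1 * (coord_deriv c i (coord_deriv c k (e 1)) p \<bullet> n p)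
      + coord_deriv c k (\<lambda>q. x q $ 2) p * (coord_deriv c i (e 2) p \<bullet> n p)
      + coord_deriv c i (\<lambda>q. x q $ 2) p * (coord_deriv c k (e 2) p \<bullet> n p)
      + x p $ 2 * (coord_deriv c i (coord_deriv c k (e 2)) p \<bullet> n p)"
proof -
  have c: "c \<in> A" and f: "smooth_in c (chart_dom c) f" and pos: "\<And>p. p \<in> chart_dom c \<Longrightarrow> 0 < det (metric c f p)"
    using im by (auto simp: immersed_def)
  note U = patch_dom[OF c]
  have I: "has_coord_deriv c k F q (coord_deriv c k F q)" if "smooth_in c (chart_dom c) F" "q \<in> chart_dom c"
    for F :: "'a \<Rightarrow> 'b::real_normed_vector" and k q
    by (intro has_coord_derivI c that smooth_in_differentiable[OF U that])
  have e: "smooth_in c (chart_dom c) (e i)" for i unfolding e_def by (rule smooth_in_coord_deriv[OF U f])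
  have n: "smooth_in c (chart_dom c) n" unfolding n_def by (rule smooth_geometry(4)[OF im])
  have xi: "smooth_in c (chart_dom c) (\<lambda>q. x q $ i)" for i by (intro smooth_in_comps x)
  note D = smooth_in_coord_deriv[OF U]
  define W where "W k q =
      (\<phi> q *\<^sub>R coord_deriv c k n q + coord_deriv c k \<phi> q *\<^sub>R n q)
      + (x q $ 1 *\<^sub>R coord_deriv c k (e 1) q + coord_deriv c k (\<lambda>q. x q $ 1) q *\<^sub>R e 1 q)
      + (x q $ 2 *\<^sub>R coord_deriv c k (e 2) q + coord_deriv c k (\<lambda>q. x q $ 2) q *\<^sub>R e 2 q)" for q k
  have *: "coord_deriv c k (velocity c f \<phi> x) q = W k q" if q: "q \<in> chart_dom c" for q k
    unfolding W_def velocity_def[abs_def] n_def[symmetric]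
    using has_coord_derivD(1)[OF has_coord_deriv_add[OF has_coord_deriv_add[OF
        has_coord_deriv_scaleR[OF I[OF \<phi> q] I[OF n q]] has_coord_deriv_scaleR[OF I[OF xi q] I[OF e q]]]
        has_coord_deriv_scaleR[OF I[OF xi q] I[OF e q]]], of k 1 1 2 2]
    unfolding e_def by simp
  from *[OF p] show "coord_deriv c k (velocity c f \<phi> x) p =
      coord_deriv c k \<phi> p *\<^sub>R n p + \<phi> p *\<^sub>R coord_deriv c k n p
      + coord_deriv c k (\<lambda>q. x q $ 1) p *\<^sub>R e 1 p + x p $ 1 *\<^sub>R coord_deriv c k (e 1) p
      + coord_deriv c k (\<lambda>q. x q $ 2) p *\<^sub>R e 2 p + x p $ 2 *\<^sub>R coord_deriv c k (e 2) p" by (simp add: W_def)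
  have orth: "n p \<bullet> n p = 1" "coord_deriv c i n p \<bullet> n p = 0" "e i p \<bullet> n p = 0" for i
    using unit_normal_frame(1)[OF pos[OF p]] geometry_derivatives(3)[OF im p] unit_normal_perp[of c f p i]
    by (simp_all add: n_def e_def inner_commute)
  \<comment> \<open>Differentiating the orthogonality of the normal and its first derivative
    expresses the normal part of the second derivative of the normal by first derivatives
    alone.\<close>
  have "has_coord_deriv c i (\<lambda>q. 0 :: real) p (coord_deriv c k n p \<bullet> coord_deriv c i n p + coord_deriv c i (coord_deriv c k n) p \<bullet> n p)"
    by (rule has_coord_deriv_local[OF U p _ has_coord_deriv_inner[OF I[OF D[OF n] p] I[OF n p]]])
      (use geometry_derivatives(3)[OF im] in \<open>simp add: n_def\<close>)
  from has_coord_derivD(1)[OF this] has_coord_derivD(1)[OF has_coord_deriv_const[OF c p, of i "0::real"]]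
  have nik: "coord_deriv c i (coord_deriv c k n) p \<bullet> n p = - (coord_deriv c i n p \<bullet> coord_deriv c k n p)"
    by (simp add: inner_commute)
  have "coord_deriv c i (coord_deriv c k (velocity c f \<phi> x)) p = coord_deriv c i (W k) p"
    by (rule coord_deriv_cong[OF c p *])
  also have "\<dots> =
    (((\<phi> p *\<^sub>R coord_deriv c i (coord_deriv c k n) p + coord_deriv c i \<phi> p *\<^sub>R coord_deriv c k n p)
     + (coord_deriv c k \<phi> p *\<^sub>R coord_deriv c i n p + coord_deriv c i (coord_deriv c k \<phi>) p *\<^sub>R n p))
    + ((x p $ 1 *\<^sub>R coord_deriv c i (coord_deriv c k (e 1)) p + coord_deriv c i (\<lambda>q. x q $ 1) p *\<^sub>R coord_deriv c k (e 1) p)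
     + (coord_deriv c k (\<lambda>q. x q $ 1) p *\<^sub>R coord_deriv c i (e 1) p + coord_deriv c i (coord_deriv c k (\<lambda>q. x q $ 1)) p *\<^sub>R e 1 p)))
    + ((x p $ 2 *\<^sub>R coord_deriv c i (coord_deriv c k (e 2)) p + coord_deriv c i (\<lambda>q. x q $ 2) p *\<^sub>R coord_deriv c k (e 2) p)
     + (coord_deriv c k (\<lambda>q. x q $ 2) p *\<^sub>R coord_deriv c i (e 2) p + coord_deriv c i (coord_deriv c k (\<lambda>q. x q $ 2)) p *\<^sub>R e 2 p))"
    unfolding W_def[abs_def]
    by (rule has_coord_derivD(1)) (rule has_coord_deriv_add has_coord_deriv_scaleR I \<phi> xi e n p D)+
  finally show "coord_deriv c i (coord_deriv c k (velocity c f \<phi> x)) p \<bullet> n p =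
      coord_deriv c i (coord_deriv c k \<phi>) p - \<phi> p * (coord_deriv c i n p \<bullet> coord_deriv c k n p)
      + coord_deriv c k (\<lambda>q. x q $ 1) p * (coord_deriv c i (e 1) p \<bullet> n p)
      + coord_deriv c i (\<lambda>q. x q $ 1) p * (coord_deriv c k (e 1) p \<bullet> n p)
      + x p $ 1 * (coord_deriv c i (coord_deriv c k (e 1)) p \<bullet> n p)
      + coord_deriv c k (\<lambda>q. x q $ 2) p * (coord_deriv c i (e 2) p \<bullet> n p)
      + coord_deriv c i (\<lambda>q. x q $ 2) p * (coord_deriv c k (e 2) p \<bullet> n p)
      + x p $ 2 * (coord_deriv c i (coord_deriv c k (e 2)) p \<bullet> n p)"
    by (simp add: inner_add_left orth nik)
qed

text \<open>The product rule is carried out on everything except the columns of the trace-free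
  tensor divided by sqrt(det g). Their divergences stay unexpanded, ready for the Codazzi identity,
  and the derivative of the gradient part is recognised as the Laplacian.\<close>

lemma flux_divergence:
  assumes im: "immersed c f" and p: "p \<in> chart_dom c"
    and \<phi>: "smooth_in c (chart_dom c) \<phi>" and x: "smooth_in c (chart_dom c) x"
  defines "s \<equiv> \<lambda>q. sqrt (det (metric c f q))" and "g \<equiv> metric c f" and "H \<equiv> mean_curvature_in c f"
    and "T \<equiv> \<lambda>i j q. tracefree_form c f q $ i $ j"
  shows "coord_deriv c 1 (flux c f \<phi> x 1) p + coord_deriv c 2 (flux c f \<phi> x 2) p =
    (coord_deriv c 1 (\<lambda>q. - T 2 2 q / s q) p + coord_deriv c 2 (\<lambda>q. T 1 2 q / s q) p) * coord_deriv c 1 \<phi> p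
    + (coord_deriv c 1 (\<lambda>q. T 1 2 q / s q) p + coord_deriv c 2 (\<lambda>q. - T 1 1 q / s q) p) * coord_deriv c 2 \<phi> p
    + (- T 2 2 p * coord_deriv c 1 (coord_deriv c 1 \<phi>) p + 2 * T 1 2 p * coord_deriv c 1 (coord_deriv c 2 \<phi>) p
        - T 1 1 p * coord_deriv c 2 (coord_deriv c 2 \<phi>) p) / s p
    - 1/2 * \<phi> p * (laplacian_in c f H p * s p)
    - 1/2 * (coord_deriv c 1 \<phi> p * ((g p $ 2 $ 2 * coord_deriv c 1 H p - g p $ 1 $ 2 * coord_deriv c 2 H p) / s p)
       + coord_deriv c 2 \<phi> p * ((g p $ 1 $ 1 * coord_deriv c 2 H p - g p $ 1 $ 2 * coord_deriv c 1 H p) / s p))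
    + (coord_deriv c 1 (density c f) p * x p $ 1 + coord_deriv c 2 (density c f) p * x p $ 2)
    + density c f p * (coord_deriv c 1 (\<lambda>q. x q $ 1) p + coord_deriv c 2 (\<lambda>q. x q $ 2) p)"
    and "smooth_in c (chart_dom c) (flux c f \<phi> x i)"
proof -
  have c: "c \<in> A" and pos: "\<And>p. p \<in> chart_dom c \<Longrightarrow> 0 < det (metric c f p)"
    using im by (auto simp: immersed_def)
  note U = patch_dom[OF c]
  have I: "has_coord_deriv c k F p (coord_deriv c k F p)" if "smooth_in c (chart_dom c) F"
    for F :: "'a \<Rightarrow> real" and k
    by (intro has_coord_derivI c p smooth_in_differentiable[OF U that p])
  note D = smooth_in_coord_deriv[OF U]
  have s: "smooth_in c (chart_dom c) s" unfolding s_def by (rule smooth_geometry(2)[OF im])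
  have s0: "s q \<noteq> 0" if "q \<in> chart_dom c" for q using pos[OF that] by (simp add: s_def)
  have T: "smooth_in c (chart_dom c) (\<lambda>q. T i j q / s q)" "smooth_in c (chart_dom c) (\<lambda>q. - T i j q / s q)" for i j
    unfolding T_def by (intro smooth_in_divide smooth_in_comps smooth_geometry[OF im] s s0 U; assumption)+
  have H: "smooth_in c (chart_dom c) H" unfolding H_def by (rule smooth_geometry(6)[OF im])
  have Y: "smooth_in c (chart_dom c) (\<lambda>q. (g q $ i $ j * coord_deriv c k H q - g q $ i' $ j' * coord_deriv c k' H q) / s q)"
    for i j k i' j' k'
    unfolding g_def by (intro smooth_in_divide smooth_in_comps smooth_geometry[OF im] s s0 U D H; assumption)
  have q: "smooth_in c (chart_dom c) (density c f)" by (rule smooth_geometry(9)[OF im])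
  have xi: "smooth_in c (chart_dom c) (\<lambda>q. x q $ i)" for i by (intro smooth_in_comps x)
  have \<phi>2: "smooth_in c (chart_dom c) (\<lambda>q. 1/2 * \<phi> q)" by (intro smooth_in_comps \<phi>)
  have \<phi>2': "coord_deriv c k (\<lambda>q. 1/2 * \<phi> q) p = 1/2 * coord_deriv c k \<phi> p" for k
    by (rule has_coord_derivD(1)[OF has_coord_deriv_linear[OF bounded_linear_mult_right I[OF \<phi>]]])
  have F1: "flux c f \<phi> x 1 = (\<lambda>q. - T 2 2 q / s q * coord_deriv c 1 \<phi> q + T 1 2 q / s q * coord_deriv c 2 \<phi> q
      - 1/2 * \<phi> q * ((g q $ 2 $ 2 * coord_deriv c 1 H q - g q $ 1 $ 2 * coord_deriv c 2 H q) / s q) + density c f q * x q $ 1)"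
    unfolding flux_def Let_def s_def g_def H_def T_def by simp
  have F2: "flux c f \<phi> x i = (\<lambda>q. T 1 2 q / s q * coord_deriv c 1 \<phi> q + - T 1 1 q / s q * coord_deriv c 2 \<phi> q
      - 1/2 * \<phi> q * ((g q $ 1 $ 1 * coord_deriv c 2 H q - g q $ 1 $ 2 * coord_deriv c 1 H q) / s q) + density c f q * x q $ 2)"
    if "i \<noteq> 1" for i
    using that unfolding flux_def Let_def s_def g_def H_def T_def by simp
  show "smooth_in c (chart_dom c) (flux c f \<phi> x i)"
  proof (cases "i = 1")
    case True
    show ?thesis unfolding True F1 by (intro smooth_in_comps(2,3,6) T \<phi>2 Y q xi D \<phi>)
  next
    case False
    show ?thesis unfolding F2[OF False] by (intro smooth_in_comps(2,3,6) T \<phi>2 Y q xi D \<phi>)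
  qed
  note R = has_coord_deriv_add[OF has_coord_deriv_diff[OF has_coord_deriv_add[OF
     has_coord_deriv_mult[OF I[OF T(2)] I[OF D[OF \<phi>]]] has_coord_deriv_mult[OF I[OF T(1)] I[OF D[OF \<phi>]]]]
     has_coord_deriv_mult[OF I[OF \<phi>2] I[OF Y]]] has_coord_deriv_mult[OF I[OF q] I[OF xi]]]
  note R' = has_coord_deriv_add[OF has_coord_deriv_diff[OF has_coord_deriv_add[OF
     has_coord_deriv_mult[OF I[OF T(1)] I[OF D[OF \<phi>]]] has_coord_deriv_mult[OF I[OF T(2)] I[OF D[OF \<phi>]]]]
     has_coord_deriv_mult[OF I[OF \<phi>2] I[OF Y]]] has_coord_deriv_mult[OF I[OF q] I[OF xi]]]
  have lap: "laplacian_in c f H p * s p =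
     coord_deriv c 1 (\<lambda>q. (g q $ 2 $ 2 * coord_deriv c 1 H q - g q $ 1 $ 2 * coord_deriv c 2 H q) / s q) p
     + coord_deriv c 2 (\<lambda>q. (g q $ 1 $ 1 * coord_deriv c 2 H q - g q $ 1 $ 2 * coord_deriv c 1 H q) / s q) p"
    unfolding g_def s_def by (rule laplacian_in_flux[OF im p])
  have com: "coord_deriv c 2 (coord_deriv c 1 \<phi>) p = coord_deriv c 1 (coord_deriv c 2 \<phi>) p"
    by (rule coord_deriv_commute[OF U \<phi> p])
  have two_ne_one: "(2::2) \<noteq> 1" by simp
  show "coord_deriv c 1 (flux c f \<phi> x 1) p + coord_deriv c 2 (flux c f \<phi> x 2) p =
    (coord_deriv c 1 (\<lambda>q. - T 2 2 q / s q) p + coord_deriv c 2 (\<lambda>q. T 1 2 q / s q) p) * coord_deriv c 1 \<phi> p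
    + (coord_deriv c 1 (\<lambda>q. T 1 2 q / s q) p + coord_deriv c 2 (\<lambda>q. - T 1 1 q / s q) p) * coord_deriv c 2 \<phi> p
    + (- T 2 2 p * coord_deriv c 1 (coord_deriv c 1 \<phi>) p + 2 * T 1 2 p * coord_deriv c 1 (coord_deriv c 2 \<phi>) p
        - T 1 1 p * coord_deriv c 2 (coord_deriv c 2 \<phi>) p) / s p
    - 1/2 * \<phi> p * (laplacian_in c f H p * s p)
    - 1/2 * (coord_deriv c 1 \<phi> p * ((g p $ 2 $ 2 * coord_deriv c 1 H p - g p $ 1 $ 2 * coord_deriv c 2 H p) / s p)
       + coord_deriv c 2 \<phi> p * ((g p $ 1 $ 1 * coord_deriv c 2 H p - g p $ 1 $ 2 * coord_deriv c 1 H p) / s p))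
    + (coord_deriv c 1 (density c f) p * x p $ 1 + coord_deriv c 2 (density c f) p * x p $ 2)
    + density c f p * (coord_deriv c 1 (\<lambda>q. x q $ 1) p + coord_deriv c 2 (\<lambda>q. x q $ 2) p)"
    unfolding F1 F2[OF two_ne_one] has_coord_derivD(1)[OF R] has_coord_derivD(1)[OF R'] lap \<phi>2' com
    by (simp add: distrib_left distrib_right add_divide_distrib diff_divide_distrib algebra_simps)
qed

end

text \<open>Homogeneity in the direction turns the Frechet derivative along the real parameter into
  multiplication by a number.\<close>

lemma forms_density'_scale:
  "forms_density' E F G L M N (a * v) (b * v) (e * v) (a' * v) (b' * v) (e' * v) = forms_density' E F G L M N a b e a' b' e' * v"
  unfolding forms_density'_def Let_def divide_inverse[of _ "sqrt _"] by (simp add: algebra_simps)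

context surface
begin

lemma density_coord_deriv:
  assumes im: "immersed c f" and p: "p \<in> chart_dom c"
    and g: "\<And>i j. has_coord_deriv c k (\<lambda>q. metric c f q $ i $ j) p (g' i j)"
    and h: "\<And>i j. has_coord_deriv c k (\<lambda>q. second_form c f q $ i $ j) p (h' i j)"
  shows "coord_deriv c k (density c f) p =
    forms_density' (metric c f p $ 1 $ 1) (metric c f p $ 1 $ 2) (metric c f p $ 2 $ 2)
     (second_form c f p $ 1 $ 1) (second_form c f p $ 1 $ 2) (second_form c f p $ 2 $ 2)
     (g' 1 1) (g' 1 2) (g' 2 2) (h' 1 1) (h' 1 2) (h' 2 2)"
proof -
  have c: "c \<in> A" and f: "smooth_in c (chart_dom c) f" and pos: "\<And>p. p \<in> chart_dom c \<Longrightarrow> 0 < det (metric c f p)"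
    using im by (auto simp: immersed_def)
  let ?u = "chart_map c p"
  have iu: "chart_inv c ?u = p" using inv_map c p by blast
  have "has_coord_deriv c k (\<lambda>q. forms_density (metric c f q $ 1 $ 1) (metric c f q $ 1 $ 2) (metric c f q $ 2 $ 2)
     (second_form c f q $ 1 $ 1) (second_form c f q $ 1 $ 2) (second_form c f q $ 2 $ 2)) p
    (forms_density' (metric c f p $ 1 $ 1) (metric c f p $ 1 $ 2) (metric c f p $ 2 $ 2)
     (second_form c f p $ 1 $ 1) (second_form c f p $ 1 $ 2) (second_form c f p $ 2 $ 2)
     (g' 1 1) (g' 1 2) (g' 2 2) (h' 1 1) (h' 1 2) (h' 2 2))"
    by (rule has_coord_deriv_general[OF c p forms_density_has_derivative[OF
        has_coord_derivE(3)[OF g] has_coord_derivE(3)[OF g] has_coord_derivE(3)[OF g]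
        has_coord_derivE(3)[OF h] has_coord_derivE(3)[OF h] has_coord_derivE(3)[OF h]]])
      (use pos[OF p] in \<open>simp_all add: iu det_metric has_coord_derivE(4)[OF g] has_coord_derivE(4)[OF h]\<close>)
  then have "has_coord_deriv c k (density c f) p
    (forms_density' (metric c f p $ 1 $ 1) (metric c f p $ 1 $ 2) (metric c f p $ 2 $ 2)
     (second_form c f p $ 1 $ 1) (second_form c f p $ 1 $ 2) (second_form c f p $ 2 $ 2)
     (g' 1 1) (g' 1 2) (g' 2 2) (h' 1 1) (h' 1 2) (h' 2 2))"
    by (rule has_coord_deriv_local[OF patch_dom[OF c] p, rotated])
      (simp add: density_formula[OF pos second_form_sym[OF c f]])
  then show ?thesis by (rule has_coord_derivD)
qed

text \<open>Near t = 0 the density is a function of the two fundamental forms, whose derivatives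
  come from the velocity. The result is compared with \<open>flux_divergence\<close> after the
  Codazzi identity has been inserted. The hypotheses \<open>Ft1\<close> and \<open>Ft2\<close> say
  that time and space derivatives have been interchanged.\<close>

theorem density_variation:
  fixes Ft :: "real \<Rightarrow> 'a \<Rightarrow> real^3"
  assumes im: "immersed c f" and p: "p \<in> chart_dom c"
    and \<phi>: "smooth_in c (chart_dom c) \<phi>" and x: "smooth_in c (chart_dom c) x"
    and Ft0: "\<And>q. q \<in> chart_dom c \<Longrightarrow> Ft 0 q = f q"
    and Ft1: "\<And>i. ((\<lambda>t. coord_deriv c i (Ft t) p) has_vector_derivative
        coord_deriv c i (velocity c f \<phi> x) p) (at 0)"
    and Ft2: "\<And>i j. ((\<lambda>t. coord_deriv c i (coord_deriv c j (Ft t)) p) has_vector_derivative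
        coord_deriv c i (coord_deriv c j (velocity c f \<phi> x)) p) (at 0)"
    and sm: "eventually (\<lambda>t. smooth_in c (chart_dom c) (Ft t)) (at 0)"
  shows "((\<lambda>t. density c (Ft t) p) has_real_derivative
      (1/2 * (laplacian_in c f (mean_curvature_in c f) p + tracefree_norm_sq_in c f p * mean_curvature_in c f p)
         * \<phi> p * sqrt (det (metric c f p))
       + (coord_deriv c 1 (flux c f \<phi> x 1) p + coord_deriv c 2 (flux c f \<phi> x 2) p))) (at 0)"
proof -
  have c: "c \<in> A" and f: "smooth_in c (chart_dom c) f" and pos: "\<And>p. p \<in> chart_dom c \<Longrightarrow> 0 < det (metric c f p)"
    using im by (auto simp: immersed_def)
  note U = patch_dom[OF c]
  have I: "has_coord_deriv c k F p (coord_deriv c k F p)" if "smooth_in c (chart_dom c) F"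
    for F :: "'a \<Rightarrow> real" and k
    by (intro has_coord_derivI c p smooth_in_differentiable[OF U that])
  define e where "e i = coord_deriv c i f p" for i
  define e2 where "e2 i j = coord_deriv c i (coord_deriv c j f) p" for i j
  define e3 where "e3 i j k = coord_deriv c i (coord_deriv c j (coord_deriv c k f)) p" for i j k
  define n where "n = unit_normal c f p"
  define n1 where "n1 i = coord_deriv c i (unit_normal c f) p" for i
  define g where "g i j = metric c f p $ i $ j" for i j
  define h where "h i j = second_form c f p $ i $ j" for i j
  have e2s: "e2 2 1 = e2 1 2"
    unfolding e2_def by (rule coord_deriv_commute[OF U f p])
  \<comment> \<open>Commuting the two outer derivatives, and the two inner ones on the whole chart
    domain, leaves four different third derivatives. Their normal components are the numbers that
    carry the Codazzi equations.\<close>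
  have e3s: "e3 i 2 1 = e3 i 1 2" "e3 2 1 i = e3 1 2 i" for i
  proof -
    show "e3 2 1 i = e3 1 2 i"
      unfolding e3_def by (rule coord_deriv_commute[OF U smooth_in_coord_deriv[OF U f] p])
    show "e3 i 2 1 = e3 i 1 2"
      unfolding e3_def by (rule coord_deriv_cong[OF c p]) (rule coord_deriv_commute[OF U f])
  qed
  have g_e: "g i j = e i \<bullet> e j" for i j by (simp add: g_def e_def metric_nth)
  have h_e: "h i j = e2 i j \<bullet> n" for i j by (simp add: h_def e2_def n_def second_form_nth)
  have gs: "g 2 1 = g 1 2" by (simp add: g_e inner_commute)
  have hs: "h 2 1 = h 1 2" by (simp add: h_e e2s)
  have nn: "n \<bullet> n = 1" "n1 i \<bullet> n = 0" "n \<bullet> e i = 0" "e i \<bullet> n = 0" "n1 i \<bullet> e j = - h i j" for i j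
    using unit_normal_frame(1)[OF pos[OF p]] geometry_derivatives(3,4)[OF im p] unit_normal_perp[of c f p i]
    by (simp_all add: n_def n1_def e_def h_def inner_commute)
  \<comment> \<open>\<open>a, A, b, B, r, C\<close> are the Christoffel symbols.\<close>
  obtain a A where G11: "e2 1 1 = a *\<^sub>R e 1 + A *\<^sub>R e 2 + (e2 1 1 \<bullet> n) *\<^sub>R n"
    using unit_normal_frame(2)[OF pos[OF p], of "e2 1 1"] unfolding n_def e_def by blast
  obtain b B where G12: "e2 1 2 = b *\<^sub>R e 1 + B *\<^sub>R e 2 + (e2 1 2 \<bullet> n) *\<^sub>R n"
    using unit_normal_frame(2)[OF pos[OF p], of "e2 1 2"] unfolding n_def e_def by blast
  obtain r C where G22: "e2 2 2 = r *\<^sub>R e 1 + C *\<^sub>R e 2 + (e2 2 2 \<bullet> n) *\<^sub>R n"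
    using unit_normal_frame(2)[OF pos[OF p], of "e2 2 2"] unfolding n_def e_def by blast
  \<comment> \<open>The normal has constant length, so its derivative has no normal
    component.\<close>
  have n1_span: "\<exists>\<alpha> \<beta>. n1 i = \<alpha> *\<^sub>R e 1 + \<beta> *\<^sub>R e 2" for i
    using unit_normal_frame(2)[OF pos[OF p], of "n1 i"] nn(2)[of i] unfolding n_def[symmetric] e_def[symmetric] by auto
  define d where "d = g 1 1 * g 2 2 - g 1 2 * g 1 2"
  have d: "det (metric c f p) = d" by (simp add: d_def g_def det_metric)
  have d0: "d > 0" using pos[OF p] d by simp
  define H where "H = (g 1 1 * h 2 2 - 2 * g 1 2 * h 1 2 + g 2 2 * h 1 1) / d"
  define K where "K = (h 1 1 * h 2 2 - h 1 2 * h 1 2) / d"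
  have Hp: "mean_curvature_in c f p = H"
    using mean_curvature_in_formula[OF pos[OF p] second_form_sym[OF c f p]] unfolding d H_def g_def h_def by simp
  have III: "n1 1 \<bullet> n1 1 = H * h 1 1 - K * g 1 1" "n1 1 \<bullet> n1 2 = H * h 1 2 - K * g 1 2" "n1 2 \<bullet> n1 2 = H * h 2 2 - K * g 2 2"
  proof -
    obtain \<alpha> \<beta> \<alpha>' \<beta>' where ab: "n1 1 = \<alpha> *\<^sub>R e 1 + \<beta> *\<^sub>R e 2" "n1 2 = \<alpha>' *\<^sub>R e 1 + \<beta>' *\<^sub>R e 2"
      using n1_span by metis
    have d': "g 1 1 * g 2 2 - g 1 2 * g 1 2 \<noteq> 0" using d0 by (simp add: d_def)
    note t = third_form[OF d' g_e[symmetric] g_e[symmetric] g_e[symmetric] ab nn(5) nn(5) nn(5)[of 2 1, unfolded hs] nn(5)]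
    show "n1 1 \<bullet> n1 1 = H * h 1 1 - K * g 1 1" "n1 1 \<bullet> n1 2 = H * h 1 2 - K * g 1 2" "n1 2 \<bullet> n1 2 = H * h 2 2 - K * g 2 2"
      using t unfolding H_def K_def d_def by simp_all
  qed
  define g1 where "g1 k i j = e2 k i \<bullet> e j + e i \<bullet> e2 k j" for k i j
  define h1 where "h1 k i j = e3 k i j \<bullet> n + e2 i j \<bullet> n1 k" for k i j
  have dg: "has_coord_deriv c k (\<lambda>q. metric c f q $ i $ j) p (g1 k i j)" for k i j
    unfolding g1_def e_def e2_def by (rule geometry_derivatives(1)[OF im p])
  have dh: "has_coord_deriv c k (\<lambda>q. second_form c f q $ i $ j) p (h1 k i j)" for k i j
    unfolding h1_def n_def e3_def e2_def n1_def by (rule geometry_derivatives(2)[OF im p])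
  have ee: "e2 1 1 \<bullet> e j = a * g 1 j + A * g 2 j" "e2 1 2 \<bullet> e j = b * g 1 j + B * g 2 j"
    "e2 2 2 \<bullet> e j = r * g 1 j + C * g 2 j" for j
    using arg_cong[OF G11, of "\<lambda>w. w \<bullet> e j"] arg_cong[OF G12, of "\<lambda>w. w \<bullet> e j"] arg_cong[OF G22, of "\<lambda>w. w \<bullet> e j"]
    by (simp_all only: inner_add_left inner_scaleR_left nn g_e mult_zero_right add_0_right)
  have ee': "e j \<bullet> e2 1 1 = a * g 1 j + A * g 2 j" "e j \<bullet> e2 1 2 = b * g 1 j + B * g 2 j"
    "e j \<bullet> e2 2 2 = r * g 1 j + C * g 2 j" for j
    using ee[of j] by (simp_all add: inner_commute)
  have en: "e2 1 1 \<bullet> n1 j = - (a * h j 1 + A * h j 2)" "e2 1 2 \<bullet> n1 j = - (b * h j 1 + B * h j 2)"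
    "e2 2 2 \<bullet> n1 j = - (r * h j 1 + C * h j 2)" for j
    using arg_cong[OF G11, of "\<lambda>w. n1 j \<bullet> w"] arg_cong[OF G12, of "\<lambda>w. n1 j \<bullet> w"] arg_cong[OF G22, of "\<lambda>w. n1 j \<bullet> w"]
    unfolding inner_add_right inner_scaleR_right nn inner_commute[of "e2 _ _" "n1 j"] by simp_all
  define k111 k112 k122 k222 where "k111 = e3 1 1 1 \<bullet> n" and "k112 = e3 1 1 2 \<bullet> n" and "k122 = e3 1 2 2 \<bullet> n"
    and "k222 = e3 2 2 2 \<bullet> n"
  have gvals: "g1 1 1 1 = 2 * (a * g 1 1 + A * g 1 2)" "g1 2 1 1 = 2 * (b * g 1 1 + B * g 1 2)"
    "g1 1 1 2 = a * g 1 2 + A * g 2 2 + (b * g 1 1 + B * g 1 2)"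
    "g1 2 1 2 = b * g 1 2 + B * g 2 2 + (r * g 1 1 + C * g 1 2)"
    "g1 1 2 2 = 2 * (b * g 1 2 + B * g 2 2)" "g1 2 2 2 = 2 * (r * g 1 2 + C * g 2 2)"
    unfolding g1_def e2s ee ee' gs by simp_all
  have hvals: "h1 1 1 1 = k111 - (a * h 1 1 + A * h 1 2)" "h1 2 1 1 = k112 - (a * h 1 2 + A * h 2 2)"
    "h1 1 1 2 = k112 - (b * h 1 1 + B * h 1 2)" "h1 2 1 2 = k122 - (b * h 1 2 + B * h 2 2)"
    "h1 1 2 2 = k122 - (r * h 1 1 + C * h 1 2)" "h1 2 2 2 = k222 - (r * h 1 2 + C * h 2 2)"
    unfolding h1_def en hs e3s k111_def k112_def k122_def k222_def by simp_all
  define \<phi>1 where "\<phi>1 i = coord_deriv c i \<phi> p" for i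
  define \<phi>2 where "\<phi>2 i j = coord_deriv c i (coord_deriv c j \<phi>) p" for i j
  define x0 where "x0 i = x p $ i" for i
  define x1 where "x1 k i = coord_deriv c k (\<lambda>q. x q $ i) p" for k i
  define v1 where "v1 i = coord_deriv c i (velocity c f \<phi> x) p" for i
  define v2 where "v2 i j = coord_deriv c i (coord_deriv c j (velocity c f \<phi> x)) p" for i j
  have v1: "v1 k = \<phi>1 k *\<^sub>R n + \<phi> p *\<^sub>R n1 k + x1 k 1 *\<^sub>R e 1 + x0 1 *\<^sub>R e2 k 1 + x1 k 2 *\<^sub>R e 2 + x0 2 *\<^sub>R e2 k 2" for k
    unfolding v1_def velocity_derivatives(1)[OF im p \<phi> x] \<phi>1_def n_def n1_def x1_def x0_def e_def e2_def ..
  have v2n: "v2 i k \<bullet> n = \<phi>2 i k - \<phi> p * (n1 i \<bullet> n1 k) + x1 k 1 * h i 1 + x1 i 1 * h k 1 + x0 1 * (e3 i k 1 \<bullet> n)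
     + x1 k 2 * h i 2 + x1 i 2 * h k 2 + x0 2 * (e3 i k 2 \<bullet> n)" for i k
    unfolding v2_def n_def velocity_derivatives(2)[OF im p \<phi> x] \<phi>2_def n1_def x1_def x0_def h_e e2_def e3_def ..
  have v1n: "v1 k \<bullet> n = \<phi>1 k + x0 1 * h k 1 + x0 2 * h k 2" for k
    unfolding v1 by (simp add: inner_add_left nn h_e)
  have v1e: "e j \<bullet> v1 k = - \<phi> p * h k j + x1 k 1 * g 1 j + x0 1 * (e2 k 1 \<bullet> e j) + x1 k 2 * g 2 j + x0 2 * (e2 k 2 \<bullet> e j)" for j k
    unfolding v1 by (simp add: inner_add_right nn g_e inner_commute[of "e j"])
  have Fe: "coord_deriv c i (Ft 0) p = e i" for i
    unfolding e_def by (rule coord_deriv_cong[OF c p Ft0])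
  have Fe2: "coord_deriv c i (coord_deriv c j (Ft 0)) p = e2 i j" for i j
    unfolding e2_def by (rule coord_deriv_cong[OF c p coord_deriv_cong[OF c _ Ft0]])
  have Fn: "unit_normal c (Ft 0) p = n"
    unfolding n_def unit_normal_def Fe e_def ..
  define g' where "g' i j = e i \<bullet> v1 j + v1 i \<bullet> e j" for i j
  have tg: "((\<lambda>t. metric c (Ft t) p $ i $ j) has_real_derivative g' i j) (at 0)" for i j
    unfolding metric_nth has_real_derivative_iff_has_vector_derivative g'_def v1_def
    using bounded_bilinear.has_vector_derivative[OF bounded_bilinear_inner Ft1 Ft1, of i j] unfolding Fe .
  have th: "((\<lambda>t. second_form c (Ft t) p $ i $ j) has_real_derivative (v2 i j \<bullet> n - \<alpha> * (v1 1 \<bullet> n) - \<beta> * (v1 2 \<bullet> n))) (at 0)"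
    if "e2 i j = \<alpha> *\<^sub>R e 1 + \<beta> *\<^sub>R e 2 + (e2 i j \<bullet> n) *\<^sub>R n" for i j \<alpha> \<beta>
  proof -
    have "0 < (coord_deriv c 1 (Ft 0) p \<bullet> coord_deriv c 1 (Ft 0) p) * (coord_deriv c 2 (Ft 0) p \<bullet> coord_deriv c 2 (Ft 0) p)
       - (coord_deriv c 1 (Ft 0) p \<bullet> coord_deriv c 2 (Ft 0) p) * (coord_deriv c 1 (Ft 0) p \<bullet> coord_deriv c 2 (Ft 0) p)"
      unfolding Fe using d0 by (simp add: d_def g_e)
    from normal_component_variation[OF Ft1[of 1] Ft1[of 2] Ft2[of i j] this, of \<alpha> \<beta>,
        folded unit_normal_def[of c "Ft _" p], unfolded Fn Fe Fe2, OF that]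
    show ?thesis unfolding second_form_nth v1_def v2_def .
  qed
  define h11' h12' h22' where "h11' = v2 1 1 \<bullet> n - a * (v1 1 \<bullet> n) - A * (v1 2 \<bullet> n)"
    and "h12' = v2 1 2 \<bullet> n - b * (v1 1 \<bullet> n) - B * (v1 2 \<bullet> n)"
    and "h22' = v2 2 2 \<bullet> n - r * (v1 1 \<bullet> n) - C * (v1 2 \<bullet> n)"
  note th' = th[OF G11, folded h11'_def] th[OF G12, folded h12'_def] th[OF G22, folded h22'_def]
  define \<Delta> where "\<Delta> = forms_density' (g 1 1) (g 1 2) (g 2 2) (h 1 1) (h 1 2) (h 2 2) (g' 1 1) (g' 1 2) (g' 2 2) h11' h12' h22'"
  have Fg: "metric c (Ft 0) p $ i $ j = g i j" for i j unfolding metric_nth Fe g_e ..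
  have Fh: "second_form c (Ft 0) p $ i $ j = h i j" for i j unfolding second_form_nth Fe2 Fn h_e ..
  have D0: "((\<lambda>t. forms_density (metric c (Ft t) p $ 1 $ 1) (metric c (Ft t) p $ 1 $ 2) (metric c (Ft t) p $ 2 $ 2)
     (second_form c (Ft t) p $ 1 $ 1) (second_form c (Ft t) p $ 1 $ 2) (second_form c (Ft t) p $ 2 $ 2)) has_derivative
     (\<lambda>v. \<Delta> * v)) (at 0)"
    using forms_density_has_derivative[OF tg[unfolded has_field_derivative_def, of 1 1]
       tg[unfolded has_field_derivative_def, of 1 2] tg[unfolded has_field_derivative_def, of 2 2]
       th'[unfolded has_field_derivative_def]] d0
    unfolding Fg Fh forms_density'_scale d_def[symmetric] \<Delta>_def by simp
  \<comment> \<open>The formula for the density in terms of the forms requires a nondegenerate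
    metric, known at t = 0 and hence for small t. The filter omits t = 0 itself, so the equality
    there is established separately in \<open>eq0\<close>.\<close>
  have "eventually (\<lambda>t. 0 < det (metric c (Ft t) p)) (at 0)"
  proof -
    have "isCont (\<lambda>t. det (metric c (Ft t) p)) 0"
      unfolding det_metric by (intro continuous_intros DERIV_isCont[OF tg])
    moreover have "det (metric c (Ft 0) p) > 0" unfolding det_metric Fg using d0 by (simp add: d_def)
    ultimately show ?thesis unfolding isCont_def by (metis order_tendstoD(1))
  qed
  then have ev0: "eventually (\<lambda>t. forms_density (metric c (Ft t) p $ 1 $ 1) (metric c (Ft t) p $ 1 $ 2) (metric c (Ft t) p $ 2 $ 2)
     (second_form c (Ft t) p $ 1 $ 1) (second_form c (Ft t) p $ 1 $ 2) (second_form c (Ft t) p $ 2 $ 2) = density c (Ft t) p) (at 0)"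
    using sm by eventually_elim (simp add: density_formula[OF _ second_form_sym[OF c _ p]])
  have eq0: "forms_density (metric c (Ft 0) p $ 1 $ 1) (metric c (Ft 0) p $ 1 $ 2) (metric c (Ft 0) p $ 2 $ 2)
     (second_form c (Ft 0) p $ 1 $ 1) (second_form c (Ft 0) p $ 1 $ 2) (second_form c (Ft 0) p $ 2 $ 2) = density c (Ft 0) p"
  proof -
    have "0 < det (metric c (Ft 0) p)" unfolding det_metric Fg using d0 by (simp add: d_def)
    moreover have "second_form c (Ft 0) p $ 2 $ 1 = second_form c (Ft 0) p $ 1 $ 2" unfolding Fh hs ..
    ultimately show ?thesis by (rule density_formula[symmetric])
  qed
  have deriv: "((\<lambda>t. density c (Ft t) p) has_real_derivative \<Delta>) (at 0)"
    unfolding has_field_derivative_def by (rule has_derivative_transform_eventually[OF D0 ev0 eq0 UNIV_I])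
  define s where "s = sqrt d"
  have s: "s > 0" "s * s = d" "sqrt d = s" using d0 by (simp_all add: s_def)
  define q where "q = forms_density (g 1 1) (g 1 2) (g 2 2) (h 1 1) (h 1 2) (h 2 2)"
  define q1 where "q1 k = coord_deriv c k (density c f) p" for k
  have qp: "density c f p = q"
    unfolding q_def g_def h_def by (rule density_formula[OF pos[OF p] second_form_sym[OF c f p]])
  have q1: "q1 k = forms_density' (g 1 1) (g 1 2) (g 2 2) (h 1 1) (h 1 2) (h 2 2) (g1 k 1 1) (g1 k 1 2) (g1 k 2 2) (h1 k 1 1) (h1 k 1 2) (h1 k 2 2)" for k
    unfolding q1_def g_def h_def by (rule density_coord_deriv[OF im p dg dh])
  \<comment> \<open>The components of the covariant Hessian of \<phi>: second derivatives corrected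
    by Christoffel terms.\<close>
  define u11 u12 u22 where "u11 = \<phi>2 1 1 - a * \<phi>1 1 - A * \<phi>1 2" and "u12 = \<phi>2 1 2 - b * \<phi>1 1 - B * \<phi>1 2"
    and "u22 = \<phi>2 2 2 - r * \<phi>1 1 - C * \<phi>1 2"
  have \<Delta>: "\<Delta> = q * H * \<phi> p + (- (h 2 2 - H * g 2 2 / 2) * u11 + 2 * (h 1 2 - H * g 1 2 / 2) * u12 - (h 1 1 - H * g 1 1 / 2) * u22) / s
     + (x0 1 * q1 1 + x0 2 * q1 2) + q * (x1 1 1 + x1 2 2)"
    unfolding \<Delta>_def q1 q_def H_def d_def s_def
  proof (rule forms_density'_variation)
    show "0 < g 1 1 * g 2 2 - g 1 2 * g 1 2" using d0 by (simp add: d_def)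
    show "g' 1 1 = - 2 * \<phi> p * h 1 1 + (x0 1 * g1 1 1 1 + x0 2 * g1 2 1 1) + 2 * (x1 1 1 * g 1 1 + x1 1 2 * g 1 2)"
      unfolding g'_def inner_commute[of "v1 _"] v1e g1_def inner_commute[of "e _" "e2 _ _"] e2s gs by (simp add: algebra_simps)
    show "g' 1 2 = - 2 * \<phi> p * h 1 2 + (x0 1 * g1 1 1 2 + x0 2 * g1 2 1 2)
       + (x1 1 1 * g 1 2 + x1 1 2 * g 2 2 + x1 2 1 * g 1 1 + x1 2 2 * g 1 2)"
      unfolding g'_def inner_commute[of "v1 _"] v1e g1_def inner_commute[of "e _" "e2 _ _"] e2s gs hs by (simp add: algebra_simps)
    show "g' 2 2 = - 2 * \<phi> p * h 2 2 + (x0 1 * g1 1 2 2 + x0 2 * g1 2 2 2) + 2 * (x1 2 1 * g 1 2 + x1 2 2 * g 2 2)"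
      unfolding g'_def inner_commute[of "v1 _"] v1e g1_def inner_commute[of "e _" "e2 _ _"] e2s gs by (simp add: algebra_simps)
    note hh = v2n v1n hvals hs e3s III[unfolded H_def K_def d_def] u11_def u12_def u22_def
      k111_def[symmetric] k112_def[symmetric] k122_def[symmetric] k222_def[symmetric]
    show "h11' = u11 - \<phi> p * ((g 1 1 * h 2 2 - 2 * g 1 2 * h 1 2 + g 2 2 * h 1 1) / (g 1 1 * g 2 2 - g 1 2 * g 1 2) * h 1 1
       - (h 1 1 * h 2 2 - h 1 2 * h 1 2) / (g 1 1 * g 2 2 - g 1 2 * g 1 2) * g 1 1)
       + (x0 1 * h1 1 1 1 + x0 2 * h1 2 1 1) + 2 * (x1 1 1 * h 1 1 + x1 1 2 * h 1 2)"
      unfolding h11'_def hh by (simp add: algebra_simps)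
    show "h12' = u12 - \<phi> p * ((g 1 1 * h 2 2 - 2 * g 1 2 * h 1 2 + g 2 2 * h 1 1) / (g 1 1 * g 2 2 - g 1 2 * g 1 2) * h 1 2
       - (h 1 1 * h 2 2 - h 1 2 * h 1 2) / (g 1 1 * g 2 2 - g 1 2 * g 1 2) * g 1 2)
       + (x0 1 * h1 1 1 2 + x0 2 * h1 2 1 2) + (x1 1 1 * h 1 2 + x1 1 2 * h 2 2 + x1 2 1 * h 1 1 + x1 2 2 * h 1 2)"
      unfolding h12'_def hh by (simp add: algebra_simps)
    show "h22' = u22 - \<phi> p * ((g 1 1 * h 2 2 - 2 * g 1 2 * h 1 2 + g 2 2 * h 1 1) / (g 1 1 * g 2 2 - g 1 2 * g 1 2) * h 2 2
       - (h 1 1 * h 2 2 - h 1 2 * h 1 2) / (g 1 1 * g 2 2 - g 1 2 * g 1 2) * g 2 2)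
       + (x0 1 * h1 1 2 2 + x0 2 * h1 2 2 2) + 2 * (x1 2 1 * h 1 2 + x1 2 2 * h 2 2)"
      unfolding h22'_def hh by (simp add: algebra_simps)
  qed
  define H1 where "H1 k = coord_deriv c k (mean_curvature_in c f) p" for k
  define s1 where "s1 k = (g1 k 1 1 * g 2 2 + g 1 1 * g1 k 2 2 - 2 * g 1 2 * g1 k 1 2) / (2 * s)" for k
  have ds: "has_coord_deriv c k (\<lambda>q. sqrt (det (metric c f q))) p (s1 k)" for k
  proof -
    have "has_coord_deriv c k (\<lambda>q. metric c f q $ 1 $ 1 * metric c f q $ 2 $ 2 - metric c f q $ 1 $ 2 * metric c f q $ 1 $ 2) p
      (metric c f p $ 1 $ 1 * g1 k 2 2 + g1 k 1 1 * metric c f p $ 2 $ 2 - (metric c f p $ 1 $ 2 * g1 k 1 2 + g1 k 1 2 * metric c f p $ 1 $ 2))"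
      by (rule has_coord_deriv_diff[OF has_coord_deriv_mult[OF dg dg] has_coord_deriv_mult[OF dg dg]])
    from has_coord_deriv_sqrt[OF this[folded det_metric] pos[OF p]]
    show ?thesis unfolding s1_def d s(3) g_def[symmetric] by (simp add: algebra_simps)
  qed
  have dH: "has_coord_deriv c k (\<lambda>q. mean_curvature_in c f q / 2) p (H1 k / 2)" for k
    using has_coord_deriv_linear[OF bounded_linear_divide[of 2] I[OF smooth_geometry(6)[OF im]]] unfolding H1_def .
  have dT: "has_coord_deriv c k (\<lambda>q. tracefree_form c f q $ i $ j) p (h1 k i j - (H / 2 * g1 k i j + H1 k / 2 * g i j))" for k i j
    unfolding tracefree_form_nth
    using has_coord_deriv_diff[OF dh has_coord_deriv_mult[OF dH dg], of k i j i j] unfolding Hp g_def .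
  have Tp: "tracefree_form c f p $ i $ j = h i j - H / 2 * g i j" for i j
    unfolding tracefree_form_nth Hp g_def h_def ..
  have sp: "sqrt (det (metric c f p)) = s" unfolding d s_def ..
  have dTs: "coord_deriv c k (\<lambda>q. tracefree_form c f q $ i $ j / sqrt (det (metric c f q))) p =
     ((h1 k i j - (H1 k * g i j + H * g1 k i j) / 2) * s - (h i j - H * g i j / 2) * s1 k) / (s * s)"
    "coord_deriv c k (\<lambda>q. - tracefree_form c f q $ i $ j / sqrt (det (metric c f q))) p =
     (- (h1 k i j - (H1 k * g i j + H * g1 k i j) / 2) * s + (h i j - H * g i j / 2) * s1 k) / (s * s)" for k i j
    using has_coord_derivD(1)[OF has_coord_deriv_divide[OF dT ds]] has_coord_derivD(1)[OF has_coord_deriv_divide[OF has_coord_deriv_minus[OF dT] ds]]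
      s(1) unfolding sp Tp by (simp_all add: algebra_simps add_divide_distrib)
  note cod = codazzi_divergence[OF s(1) s(2)[unfolded d_def] gvals(1-6) hvals(1-6) s1_def[of 1] s1_def[of 2], where H=H and ?H1.0="H1 1" and ?H2.0="H1 2"]
  \<comment> \<open>The cubic term of the Euler-Lagrange operator is the density times H \<phi>,
    which is exactly what the normal displacement contributed.\<close>
  have tf: "1/2 * (X + tracefree_norm_sq_in c f p * H) * \<phi> p * s = 1/2 * \<phi> p * (X * s) + q * H * \<phi> p" for X
    unfolding qp[symmetric] density_def sp by (simp add: algebra_simps)
  \<comment> \<open>The Christoffel terms of the Codazzi identity complete the second derivatives of
    \<phi> to the Hessian \<open>u\<close>, and its half gradient of H cancels the product-rule term
    in which d\<phi> meets dH.\<close>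
  have "\<Delta> = 1/2 * (laplacian_in c f (mean_curvature_in c f) p + tracefree_norm_sq_in c f p * mean_curvature_in c f p)
         * \<phi> p * sqrt (det (metric c f p))
       + (coord_deriv c 1 (flux c f \<phi> x 1) p + coord_deriv c 2 (flux c f \<phi> x 2) p)"
    unfolding flux_divergence(1)[OF im p \<phi> x] dTs cod \<Delta> Hp sp tf qp Tp
      q1_def[symmetric] \<phi>1_def[symmetric] \<phi>2_def[symmetric] x0_def[symmetric] x1_def[symmetric] g_def[symmetric] H1_def[symmetric]
      u11_def u12_def u22_def divide_inverse[of _ s]
    by (simp add: algebra_simps add_divide_distrib diff_divide_distrib)
  then show ?thesis using deriv by simp
qed

end

section \<open>Independence of the chart\<close>

context surface
begin

lemma chart_at:
  assumes "p \<in> S"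
  shows "chart_at A p \<in> A" "p \<in> chart_dom (chart_at A p)"
proof -
  have "\<exists>c. c \<in> A \<and> p \<in> chart_dom c" using assms dom_cover by blast
  then have "chart_at A p \<in> A \<and> p \<in> chart_dom (chart_at A p)" unfolding chart_at_def by (rule someI_ex)
  then show "chart_at A p \<in> A" "p \<in> chart_dom (chart_at A p)" by auto
qed

text \<open>The Gram determinant is the squared length of a cross product, hence nonnegative. If it
  vanished, an explicit nonzero vector would lie in the kernel of the differential.\<close>

lemma immersion_immersed:
  assumes "smooth_immersion A f" "c \<in> A"
  shows "immersed c f"
proof -
  have sm: "smooth_in c (chart_dom c) f"
    using assms by (simp add: smooth_immersion_def smooth_map_def smooth_in_def chart_range_def)
  have "0 < det (metric c f p)" if p: "p \<in> chart_dom c" for p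
  proof (rule ccontr)
    assume neg: "\<not> ?thesis"
    define e1 e2 where "e1 = coord_deriv c 1 f p" and "e2 = coord_deriv c 2 f p"
    have "det (metric c f p) = cross3 e1 e2 \<bullet> cross3 e1 e2"
      unfolding det_metric metric_nth cross3_inner_self e1_def e2_def ..
    then have d: "(e1 \<bullet> e1) * (e2 \<bullet> e2) - (e1 \<bullet> e2) * (e1 \<bullet> e2) = 0"
      using neg inner_ge_zero[of "cross3 e1 e2"] unfolding cross3_inner_self by simp
    have inj: "inj (differential c f p)" using assms p by (simp add: smooth_immersion_def)
    have D: "differentiable_in c f p" by (rule smooth_in_differentiable[OF patch_dom[OF assms(2)] sm p])
    have zero: "v = 0" if "(v $ 1) *\<^sub>R e1 + (v $ 2) *\<^sub>R e2 = 0" for v :: "real^2"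
    proof -
      have "differential c f p v = differential c f p 0"
        using that differential_expand[OF D, of v] differential_expand[OF D, of 0] by (simp add: e1_def e2_def)
      then show ?thesis using inj by (simp add: inj_eq)
    qed
    \<comment> \<open>The coefficients that project \<open>e1\<close> off \<open>e2\<close>, scaled
      to avoid division. If this kernel vector is itself zero then \<open>e2 = 0\<close>, and the
      second basis vector lies in the kernel.\<close>
    define w :: "real^2" where "w = vector [e2 \<bullet> e2, - (e1 \<bullet> e2)]"
    define z where "z = (e2 \<bullet> e2) *\<^sub>R e1 - (e1 \<bullet> e2) *\<^sub>R e2"
    have "z \<bullet> z = (e2 \<bullet> e2) * ((e1 \<bullet> e1) * (e2 \<bullet> e2) - (e1 \<bullet> e2) * (e1 \<bullet> e2))"
      unfolding z_def by (simp add: inner_diff_left inner_diff_right inner_commute[of e2 e1] algebra_simps)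
    then have "z = 0" using d by simp
    then have "w = 0" by (intro zero) (simp add: w_def z_def)
    then have "e2 = 0" by (metis inner_eq_zero_iff vector_2(1) w_def zero_index)
    then have "axis 2 1 = (0 :: real^2)" by (intro zero) simp
    then show False using axis2_simps(4) by (metis zero_index zero_neq_one)
  qed
  then show ?thesis using sm assms(2) by (simp add: immersed_def)
qed

section \<open>Transformation laws under a change of chart\<close>

lemma metric_change:
  assumes "c \<in> A" "c' \<in> A" "p \<in> chart_dom c" "p \<in> chart_dom c'" "differentiable_in c' f p"
  shows "metric c f p $ i $ j = jac c c' 1 i p * jac c c' 1 j p * metric c' f p $ 1 $ 1
     + (jac c c' 1 i p * jac c c' 2 j p + jac c c' 2 i p * jac c c' 1 j p) * metric c' f p $ 1 $ 2
     + jac c c' 2 i p * jac c c' 2 j p * metric c' f p $ 2 $ 2"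
  unfolding metric_nth coord_deriv_change[OF assms]
  by (simp add: inner_add_left inner_add_right inner_commute[of "coord_deriv c' 2 f p" "coord_deriv c' 1 f p"] algebra_simps)

definition jac_det :: "'a chart \<Rightarrow> 'a chart \<Rightarrow> 'a \<Rightarrow> real" where
  "jac_det c c' p = jac c c' 1 1 p * jac c c' 2 2 p - jac c c' 1 2 p * jac c c' 2 1 p"

lemma det_metric_change:
  assumes "c \<in> A" "c' \<in> A" "p \<in> chart_dom c" "p \<in> chart_dom c'" "differentiable_in c' f p"
  shows "det (metric c f p) = (jac_det c c' p)\<^sup>2 * det (metric c' f p)"
    and "sqrt (det (metric c f p)) = jac_det c c' p * sqrt (det (metric c' f p))"
proof -
  show 1: "det (metric c f p) = (jac_det c c' p)\<^sup>2 * det (metric c' f p)"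
    unfolding det_metric metric_change[OF assms] jac_det_def by (simp add: power2_eq_square algebra_simps)
  have "0 < jac_det c c' p" unfolding jac_det_def using jac_det_pos assms by blast
  then show "sqrt (det (metric c f p)) = jac_det c c' p * sqrt (det (metric c' f p))"
    unfolding 1 by (simp add: real_sqrt_mult)
qed

lemma immersed_change:
  assumes "c \<in> A" "c' \<in> A" "p \<in> chart_dom c" "p \<in> chart_dom c'" "differentiable_in c' f p"
    "0 < det (metric c' f p)"
  shows "0 < det (metric c f p)"
  using jac_det_pos[OF assms(1-4)] assms(6) unfolding det_metric_change(1)[OF assms(1-5)] jac_det_def
  by (intro mult_pos_pos) auto

text \<open>The cross product is multiplied by the Jacobian determinant. Its positivity, the
  orientation of the atlas, makes the normal independent of the chart.\<close>

lemma unit_normal_change: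
  assumes "c \<in> A" "c' \<in> A" "p \<in> chart_dom c" "p \<in> chart_dom c'" "differentiable_in c' f p"
  shows "unit_normal c f p = unit_normal c' f p"
proof -
  have "cross3 (coord_deriv c 1 f p) (coord_deriv c 2 f p) = jac_det c c' p *\<^sub>R cross3 (coord_deriv c' 1 f p) (coord_deriv c' 2 f p)"
    unfolding coord_deriv_change[OF assms] jac_det_def by (simp add: cross3_simps)
  then show ?thesis using jac_det_pos[OF assms(1-4)] by (simp add: unit_normal_def sgn_scaleR jac_det_def)
qed

lemma smooth_in_overlap:
  assumes "c \<in> A" "c' \<in> A" "p \<in> chart_dom c" "p \<in> chart_dom c'" "smooth_in c' (chart_dom c') F"
  shows "differentiable_in c' F p" "differentiable_in c F p"
proof -
  show "differentiable_in c' F p" by (rule smooth_in_differentiable[OF patch_dom[OF assms(2)] assms(5,4)])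
  then show "differentiable_in c F p" by (rule differential_change(1)[OF assms(1-4)])
qed

lemma jac_has_coord_deriv:
  assumes "c \<in> A" "c' \<in> A" "p \<in> chart_dom c" "p \<in> chart_dom c'"
  shows "has_coord_deriv c k (jac c c' a i) p (coord_deriv c k (jac c c' a i) p)"
  using assms smooth_in_differentiable[OF patch_overlap smooth_in_jac, of c c' p a i]
  by (intro has_coord_derivI) auto

text \<open>Second derivatives of the transition map multiply only tangential vectors of the
  immersion. They vanish on pairing with the normal, so h is a tensor although the second
  derivatives of f are not.\<close>

lemma second_form_change:
  assumes cp: "c \<in> A" "c' \<in> A" "p \<in> chart_dom c" "p \<in> chart_dom c'" and f: "smooth_in c' (chart_dom c') f"
  shows "second_form c f p $ i $ j = jac c c' 1 i p * jac c c' 1 j p * second_form c' f p $ 1 $ 1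
     + (jac c c' 1 i p * jac c c' 2 j p + jac c c' 2 i p * jac c c' 1 j p) * second_form c' f p $ 1 $ 2
     + jac c c' 2 i p * jac c c' 2 j p * second_form c' f p $ 2 $ 2"
proof -
  note f1 = smooth_in_coord_deriv[OF patch_dom[OF cp(2)] f]
  have e: "has_coord_deriv c i (coord_deriv c' a f) p (coord_deriv c i (coord_deriv c' a f) p)" for a
    by (intro has_coord_derivI cp smooth_in_overlap[OF cp f1])
  note J = jac_has_coord_deriv[OF cp]
  have ch: "jac c c' 1 j q *\<^sub>R coord_deriv c' 1 f q + jac c c' 2 j q *\<^sub>R coord_deriv c' 2 f q = coord_deriv c j f q"
    if q: "q \<in> chart_dom c \<inter> chart_dom c'" for q
    using coord_deriv_change[OF cp(1,2) IntD1[OF q] IntD2[OF q] smooth_in_overlap(1)[OF cp(1,2) IntD1[OF q] IntD2[OF q] f]]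
    by (rule sym)
  have "has_coord_deriv c i (\<lambda>q. jac c c' 1 j q *\<^sub>R coord_deriv c' 1 f q + jac c c' 2 j q *\<^sub>R coord_deriv c' 2 f q) p
    ((jac c c' 1 j p *\<^sub>R coord_deriv c i (coord_deriv c' 1 f) p + coord_deriv c i (jac c c' 1 j) p *\<^sub>R coord_deriv c' 1 f p)
     + (jac c c' 2 j p *\<^sub>R coord_deriv c i (coord_deriv c' 2 f) p + coord_deriv c i (jac c c' 2 j) p *\<^sub>R coord_deriv c' 2 f p))"
    by (rule has_coord_deriv_add[OF has_coord_deriv_scaleR[OF J e] has_coord_deriv_scaleR[OF J e]])
  then have "has_coord_deriv c i (coord_deriv c j f) p
    ((jac c c' 1 j p *\<^sub>R coord_deriv c i (coord_deriv c' 1 f) p + coord_deriv c i (jac c c' 1 j) p *\<^sub>R coord_deriv c' 1 f p)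
     + (jac c c' 2 j p *\<^sub>R coord_deriv c i (coord_deriv c' 2 f) p + coord_deriv c i (jac c c' 2 j) p *\<^sub>R coord_deriv c' 2 f p))"
    by (rule has_coord_deriv_local[OF patch_overlap[OF cp(1,2)] IntI[OF cp(3,4)], rotated]) (rule ch)
  then have *: "coord_deriv c i (coord_deriv c j f) p =
    (jac c c' 1 j p *\<^sub>R coord_deriv c i (coord_deriv c' 1 f) p + coord_deriv c i (jac c c' 1 j) p *\<^sub>R coord_deriv c' 1 f p)
     + (jac c c' 2 j p *\<^sub>R coord_deriv c i (coord_deriv c' 2 f) p + coord_deriv c i (jac c c' 2 j) p *\<^sub>R coord_deriv c' 2 f p)"
    by (rule has_coord_derivD)
  have perp: "coord_deriv c' a f p \<bullet> unit_normal c' f p = 0" for a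
    using unit_normal_perp[of c' f p a] by (simp add: inner_commute)
  show ?thesis
    unfolding second_form_nth[of c] * unit_normal_change[OF cp smooth_in_overlap(1)[OF cp f]]
      coord_deriv_change[OF cp smooth_in_overlap(1)[OF cp f1], of i]
    by (simp add: inner_add_left perp second_form_nth[symmetric] second_form_sym[OF cp(2) f cp(4)] algebra_simps)
qed

text \<open>The numerators of H and K and the Gram determinant all acquire the square of the
  Jacobian determinant, so the quotients are invariant. The density retains one factor from sqrt(det
  g).\<close>

lemma curvature_change:
  assumes cp: "c \<in> A" "c' \<in> A" "p \<in> chart_dom c" "p \<in> chart_dom c'" and im: "immersed c f" "immersed c' f"
  shows "mean_curvature_in c f p = mean_curvature_in c' f p"
    "tracefree_norm_sq_in c f p = tracefree_norm_sq_in c' f p"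
    "tracefree_form c f p $ i $ j = jac c c' 1 i p * jac c c' 1 j p * tracefree_form c' f p $ 1 $ 1
     + (jac c c' 1 i p * jac c c' 2 j p + jac c c' 2 i p * jac c c' 1 j p) * tracefree_form c' f p $ 1 $ 2
     + jac c c' 2 i p * jac c c' 2 j p * tracefree_form c' f p $ 2 $ 2"
    "density c f p = jac_det c c' p * density c' f p"
proof -
  have f: "smooth_in c (chart_dom c) f" "smooth_in c' (chart_dom c') f"
    and pos: "0 < det (metric c f p)" "0 < det (metric c' f p)" using im cp by (auto simp: immersed_def)
  note D = smooth_in_overlap(1)[OF cp f(2)]
  note s = second_form_sym[OF cp(1) f(1) cp(3)] second_form_sym[OF cp(2) f(2) cp(4)]
  have J: "jac_det c c' p > 0" unfolding jac_det_def by (rule jac_det_pos[OF cp])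
  have "metric c f p $ 1 $ 1 * second_form c f p $ 2 $ 2 - 2 * metric c f p $ 1 $ 2 * second_form c f p $ 1 $ 2
     + metric c f p $ 2 $ 2 * second_form c f p $ 1 $ 1 =
     (jac_det c c' p)\<^sup>2 * (metric c' f p $ 1 $ 1 * second_form c' f p $ 2 $ 2 - 2 * metric c' f p $ 1 $ 2 * second_form c' f p $ 1 $ 2
     + metric c' f p $ 2 $ 2 * second_form c' f p $ 1 $ 1)"
    unfolding metric_change[OF cp D] second_form_change[OF cp f(2)] jac_det_def
    by (simp add: power2_eq_square algebra_simps)
  then show H: "mean_curvature_in c f p = mean_curvature_in c' f p"
    unfolding mean_curvature_in_formula[OF pos(1) s(1)] mean_curvature_in_formula[OF pos(2) s(2)] det_metric_change(1)[OF cp D]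
    using J by simp
  have "second_form c f p $ 1 $ 1 * second_form c f p $ 2 $ 2 - second_form c f p $ 1 $ 2 * second_form c f p $ 1 $ 2 =
     (jac_det c c' p)\<^sup>2 * (second_form c' f p $ 1 $ 1 * second_form c' f p $ 2 $ 2 - second_form c' f p $ 1 $ 2 * second_form c' f p $ 1 $ 2)"
    unfolding second_form_change[OF cp f(2)] jac_det_def by (simp add: power2_eq_square algebra_simps)
  then show n: "tracefree_norm_sq_in c f p = tracefree_norm_sq_in c' f p"
    unfolding tracefree_norm_sq_in_formula[OF pos(1) s(1)] tracefree_norm_sq_in_formula[OF pos(2) s(2)] H det_metric_change(1)[OF cp D]
    using J by simp
  show "tracefree_form c f p $ i $ j = jac c c' 1 i p * jac c c' 1 j p * tracefree_form c' f p $ 1 $ 1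
     + (jac c c' 1 i p * jac c c' 2 j p + jac c c' 2 i p * jac c c' 1 j p) * tracefree_form c' f p $ 1 $ 2
     + jac c c' 2 i p * jac c c' 2 j p * tracefree_form c' f p $ 2 $ 2"
    unfolding tracefree_form_nth H metric_change[OF cp D] second_form_change[OF cp f(2)] by (simp add: algebra_simps)
  show "density c f p = jac_det c c' p * density c' f p"
    unfolding density_def n det_metric_change(2)[OF cp D] by simp
qed

text \<open>The covariant adjugate \<open>(u, v) \<mapsto> (t\<^sub>2\<^sub>2 u - t\<^sub>1\<^sub>2 v, t\<^sub>1\<^sub>1 v - t\<^sub>1\<^sub>2 u)\<close> of a covariant 2-tensor.\<close>

lemma adjugate_change:
  fixes a b r e :: real
  assumes "t11 = a * a * t11' + (a * r + r * a) * t12' + r * r * t22'"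
    "t12 = a * b * t11' + (a * e + r * b) * t12' + r * e * t22'"
    "t22 = b * b * t11' + (b * e + e * b) * t12' + e * e * t22'"
    "u1 = a * u1' + r * u2'" "u2 = b * u1' + e * u2'"
  shows "a * (t22 * u1 - t12 * u2) + b * (t11 * u2 - t12 * u1) = (a * e - b * r)\<^sup>2 * (t22' * u1' - t12' * u2')"
    "r * (t22 * u1 - t12 * u2) + e * (t11 * u2 - t12 * u1) = (a * e - b * r)\<^sup>2 * (t11' * u2' - t12' * u1')"
  unfolding assms by (simp_all add: power2_eq_square algebra_simps)

text \<open>The pair \<open>Y1\<close>, \<open>Y2\<close> is sqrt(det g) times the gradient of
  \<open>u\<close>, a vector density: the Jacobian matrix carries it to its counterpart in the other
  chart times the Jacobian determinant.\<close>

lemma gradient_flux_change: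
  assumes cp: "c \<in> A" "c' \<in> A" "p \<in> chart_dom c" "p \<in> chart_dom c'" and im: "immersed c f" "immersed c' f"
    and u: "differentiable_in c' u p"
  defines "Y1 \<equiv> \<lambda>c. (metric c f p $ 2 $ 2 * coord_deriv c 1 u p - metric c f p $ 1 $ 2 * coord_deriv c 2 u p) / sqrt (det (metric c f p))"
    and "Y2 \<equiv> \<lambda>c. (metric c f p $ 1 $ 1 * coord_deriv c 2 u p - metric c f p $ 1 $ 2 * coord_deriv c 1 u p) / sqrt (det (metric c f p))"
  shows "jac c c' 1 1 p * Y1 c + jac c c' 1 2 p * Y2 c = jac_det c c' p * Y1 c'"
    "jac c c' 2 1 p * Y1 c + jac c c' 2 2 p * Y2 c = jac_det c c' p * Y2 c'"
proof -
  have f: "smooth_in c' (chart_dom c') f" using im by (auto simp: immersed_def)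
  note D = smooth_in_overlap(1)[OF cp f]
  have J: "jac_det c c' p > 0" unfolding jac_det_def by (rule jac_det_pos[OF cp])
  have e: "jac_det c c' p * (x / y) = (jac_det c c' p)\<^sup>2 * x / (jac_det c c' p * y)" for x y
    using J by (simp add: power2_eq_square)
  note ch = adjugate_change[OF metric_change[OF cp D] metric_change[OF cp D] metric_change[OF cp D]
      coord_deriv_change[OF cp u, of 1, unfolded real_scaleR_def] coord_deriv_change[OF cp u, of 2, unfolded real_scaleR_def],
      folded jac_det_def]
  show "jac c c' 1 1 p * Y1 c + jac c c' 1 2 p * Y2 c = jac_det c c' p * Y1 c'"
    "jac c c' 2 1 p * Y1 c + jac c c' 2 2 p * Y2 c = jac_det c c' p * Y2 c'"
    unfolding Y1_def Y2_def e det_metric_change(2)[OF cp D, symmetric] ch[symmetric]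
    by (simp_all add: add_divide_distrib)
qed

text \<open>Each of the three summands is a vector density: the first two by the adjugate law for
  the trace-free form and the metric, the third as the product of a scalar density and a tangent
  vector.\<close>

lemma flux_change:
  assumes cp: "c \<in> A" "c' \<in> A" "p \<in> chart_dom c" "p \<in> chart_dom c'"
    and im: "\<And>c. c \<in> A \<Longrightarrow> immersed c f" and \<phi>: "smooth_in c' (chart_dom c') \<phi>"
    and \<xi>: "\<xi> c' p = differential c (chart_map c') p (\<xi> c p)"
  shows "jac c c' a 1 p * flux c f \<phi> (\<xi> c) 1 p + jac c c' a 2 p * flux c f \<phi> (\<xi> c) 2 p = jac_det c c' p * flux c' f \<phi> (\<xi> c') a p"
proof -
  note im' = im[OF cp(1)] im[OF cp(2)]
  have f: "smooth_in c' (chart_dom c') f" using im' by (auto simp: immersed_def)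
  note D = smooth_in_overlap(1)[OF cp f]
  have J: "jac_det c c' p > 0" unfolding jac_det_def by (rule jac_det_pos[OF cp])
  have H: "coord_deriv c i (mean_curvature_in c f) p = coord_deriv c i (mean_curvature_in c' f) p" for i
    using curvature_change(1)[OF cp(1,2) _ _ im'] cp by (intro coord_deriv_local[OF patch_overlap[OF cp(1,2)]]) auto
  note g = gradient_flux_change[OF cp im' smooth_in_overlap(1)[OF cp smooth_geometry(6)[OF im'(2)]], folded H]
  note u = smooth_in_overlap(1)[OF cp \<phi>]
  note t = adjugate_change[OF curvature_change(3)[OF cp im'] curvature_change(3)[OF cp im'] curvature_change(3)[OF cp im']
      coord_deriv_change[OF cp u, of 1, unfolded real_scaleR_def] coord_deriv_change[OF cp u, of 2, unfolded real_scaleR_def],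
      folded jac_det_def]
  have e: "jac_det c c' p * (x / y) = (jac_det c c' p)\<^sup>2 * x / (jac_det c c' p * y)" for x y
    using J by (simp add: power2_eq_square)
  define s where "s = sqrt (det (metric c f p))"
  define s' where "s' = sqrt (det (metric c' f p))"
  have s: "s = jac_det c c' p * s'" unfolding s_def s'_def by (rule det_metric_change(2)[OF cp D])
  have e': "jac_det c c' p * y / s' = (jac_det c c' p)\<^sup>2 * y / s" for y
    unfolding s using J by (simp add: power2_eq_square)
  define W where "W c i = (if i = (1::2) then (tracefree_form c f p $ 2 $ 2 * coord_deriv c 1 \<phi> p - tracefree_form c f p $ 1 $ 2 * coord_deriv c 2 \<phi> p) / sqrt (det (metric c f p))
     else (tracefree_form c f p $ 1 $ 1 * coord_deriv c 2 \<phi> p - tracefree_form c f p $ 1 $ 2 * coord_deriv c 1 \<phi> p) / sqrt (det (metric c f p)))" for c i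
  define Y where "Y c i = (if i = (1::2) then (metric c f p $ 2 $ 2 * coord_deriv c 1 (mean_curvature_in c f) p - metric c f p $ 1 $ 2 * coord_deriv c 2 (mean_curvature_in c f) p) / sqrt (det (metric c f p))
     else (metric c f p $ 1 $ 1 * coord_deriv c 2 (mean_curvature_in c f) p - metric c f p $ 1 $ 2 * coord_deriv c 1 (mean_curvature_in c f) p) / sqrt (det (metric c f p)))" for c i
  have fl: "flux c f \<phi> (\<xi> c) i p = - W c i - 1/2 * \<phi> p * Y c i + density c f p * \<xi> c p $ i" for c i
  proof (cases "i = 1")
    case False
    then have "i = 2" using exhaust_2 by blast
    then show ?thesis by (simp add: flux_def Let_def W_def Y_def diff_divide_distrib)
  qed (simp add: flux_def Let_def W_def Y_def diff_divide_distrib)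
  have W: "jac c c' a 1 p * W c 1 + jac c c' a 2 p * W c 2 = jac_det c c' p * W c' a"
  proof -
    have "\<forall>a. jac c c' a 1 p * W c 1 + jac c c' a 2 p * W c 2 = jac_det c c' p * W c' a"
      unfolding forall_2 W_def s_def[symmetric] s'_def[symmetric]
      using t by (simp add: e' add_divide_distrib[symmetric])
    then show ?thesis ..
  qed
  have Y: "jac c c' a 1 p * Y c 1 + jac c c' a 2 p * Y c 2 = jac_det c c' p * Y c' a"
  proof -
    have "\<forall>a. jac c c' a 1 p * Y c 1 + jac c c' a 2 p * Y c 2 = jac_det c c' p * Y c' a"
      unfolding forall_2 Y_def using g by simp
    then show ?thesis ..
  qed
  have X: "\<xi> c' p $ a = jac c c' a 1 p * \<xi> c p $ 1 + jac c c' a 2 p * \<xi> c p $ 2"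
    unfolding \<xi> differential_expand[OF smooth_in_differentiable[OF patch_overlap[OF cp(1,2)] smooth_in_transition[OF cp(1,2)] IntI[OF cp(3,4)]]]
    by (simp add: jac_def)
  have "jac c c' a 1 p * flux c f \<phi> (\<xi> c) 1 p + jac c c' a 2 p * flux c f \<phi> (\<xi> c) 2 p =
     - (jac c c' a 1 p * W c 1 + jac c c' a 2 p * W c 2) - 1/2 * \<phi> p * (jac c c' a 1 p * Y c 1 + jac c c' a 2 p * Y c 2)
     + density c f p * (jac c c' a 1 p * \<xi> c p $ 1 + jac c c' a 2 p * \<xi> c p $ 2)"
    unfolding fl by (simp add: algebra_simps)
  also have "\<dots> = jac_det c c' p * flux c' f \<phi> (\<xi> c') a p"
    unfolding W Y X[symmetric] curvature_change(4)[OF cp im'] fl by (simp add: algebra_simps)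
  finally show ?thesis .
qed

text \<open>Piola's identity: the columns of the cofactor matrix of the Jacobian are divergence free.\<close>

lemma divergence_change:
  assumes cp: "c \<in> A" "c' \<in> A" "p \<in> chart_dom c" "p \<in> chart_dom c'"
    and X': "smooth_in c' (chart_dom c') (X' 1)" "smooth_in c' (chart_dom c') (X' 2)"
    and X: "\<And>q a. q \<in> chart_dom c \<Longrightarrow> q \<in> chart_dom c' \<Longrightarrow>
      jac c c' a 1 q * X 1 q + jac c c' a 2 q * X 2 q = jac_det c c' q * (X' a q :: real)"
  shows "coord_deriv c 1 (X 1) p + coord_deriv c 2 (X 2) p =
    jac_det c c' p * (coord_deriv c' 1 (X' 1) p + coord_deriv c' 2 (X' 2) p)"
proof -
  define J where "J a i q = jac c c' a i q" for a i q
  \<comment> \<open>Cramer's rule without division: the density in \<open>c\<close> is the adjugate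
    of the Jacobian matrix applied to the one in \<open>c'\<close>.\<close>
  have X1: "X 1 q = J 2 2 q * X' 1 q - J 1 2 q * X' 2 q" and X2: "X 2 q = J 1 1 q * X' 2 q - J 2 1 q * X' 1 q"
    if q: "q \<in> chart_dom c" "q \<in> chart_dom c'" for q
  proof -
    have pos: "jac_det c c' q \<noteq> 0" using jac_det_pos[OF cp(1,2) q] by (simp add: jac_det_def)
    have a: "J 1 1 q * X 1 q + J 1 2 q * X 2 q = jac_det c c' q * X' 1 q"
      "J 2 1 q * X 1 q + J 2 2 q * X 2 q = jac_det c c' q * X' 2 q" using X[OF q] by (simp_all add: J_def)
    have d: "jac_det c c' q = J 1 1 q * J 2 2 q - J 1 2 q * J 2 1 q" by (simp add: jac_det_def J_def)
    have "jac_det c c' q * X 1 q = jac_det c c' q * (J 2 2 q * X' 1 q - J 1 2 q * X' 2 q)"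
      "jac_det c c' q * X 2 q = jac_det c c' q * (J 1 1 q * X' 2 q - J 2 1 q * X' 1 q)"
      using a d by algebra+
    then show "X 1 q = J 2 2 q * X' 1 q - J 1 2 q * X' 2 q" "X 2 q = J 1 1 q * X' 2 q - J 2 1 q * X' 1 q"
      using pos by simp_all
  qed
  have J: "has_coord_deriv c k (J a i) p (coord_deriv c k (J a i) p)" for k a i
    unfolding J_def by (rule jac_has_coord_deriv[OF cp])
  \<comment> \<open>Because second derivatives of the transition map are symmetric, the derivatives
    of the cofactors cancel and only derivatives of \<open>X'\<close> survive.\<close>
  have com: "coord_deriv c 2 (J a 1) p = coord_deriv c 1 (J a 2) p" for a
    unfolding J_def by (rule jac_commute[OF cp])
  have D: "has_coord_deriv c k (X' 1) p (J 1 k p * coord_deriv c' 1 (X' 1) p + J 2 k p * coord_deriv c' 2 (X' 1) p)"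
    "has_coord_deriv c k (X' 2) p (J 1 k p * coord_deriv c' 1 (X' 2) p + J 2 k p * coord_deriv c' 2 (X' 2) p)" for k
    using has_coord_derivI[OF cp(1,3) smooth_in_overlap(2)[OF cp X'(1)], of k] has_coord_derivI[OF cp(1,3) smooth_in_overlap(2)[OF cp X'(2)], of k]
    unfolding coord_deriv_change[OF cp smooth_in_overlap(1)[OF cp X'(1)]] coord_deriv_change[OF cp smooth_in_overlap(1)[OF cp X'(2)]]
    by (simp_all add: J_def)
  have "has_coord_deriv c 1 (X 1) p (J 2 2 p * (J 1 1 p * coord_deriv c' 1 (X' 1) p + J 2 1 p * coord_deriv c' 2 (X' 1) p)
      + coord_deriv c 1 (J 2 2) p * X' 1 p - (J 1 2 p * (J 1 1 p * coord_deriv c' 1 (X' 2) p + J 2 1 p * coord_deriv c' 2 (X' 2) p)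
      + coord_deriv c 1 (J 1 2) p * X' 2 p))"
    by (rule has_coord_deriv_local[OF patch_overlap[OF cp(1,2)] IntI[OF cp(3,4)] _
        has_coord_deriv_diff[OF has_coord_deriv_mult[OF J D(1)] has_coord_deriv_mult[OF J D(2)]]]) (simp add: X1)
  note 1 = has_coord_derivD(1)[OF this]
  have "has_coord_deriv c 2 (X 2) p (J 1 1 p * (J 1 2 p * coord_deriv c' 1 (X' 2) p + J 2 2 p * coord_deriv c' 2 (X' 2) p)
      + coord_deriv c 2 (J 1 1) p * X' 2 p - (J 2 1 p * (J 1 2 p * coord_deriv c' 1 (X' 1) p + J 2 2 p * coord_deriv c' 2 (X' 1) p)
      + coord_deriv c 2 (J 2 1) p * X' 1 p))"
    by (rule has_coord_deriv_local[OF patch_overlap[OF cp(1,2)] IntI[OF cp(3,4)] _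
        has_coord_deriv_diff[OF has_coord_deriv_mult[OF J D(2)] has_coord_deriv_mult[OF J D(1)]]]) (simp add: X2)
  note 2 = has_coord_derivD(1)[OF this]
  show ?thesis unfolding 1 2 com jac_det_def J_def[symmetric] by (simp add: algebra_simps)
qed

text \<open>sqrt(det g) times the gradient of H is a vector density, so its divergence changes by
  the Jacobian determinant; the same factor in sqrt(det g) cancels it.\<close>

lemma laplacian_change:
  assumes cp: "c \<in> A" "c' \<in> A" "p \<in> chart_dom c" "p \<in> chart_dom c'" and im: "\<And>c. c \<in> A \<Longrightarrow> immersed c f"
  shows "laplacian_in c f (mean_curvature_in c f) p = laplacian_in c' f (mean_curvature_in c' f) p"
proof -
  note im' = im[OF cp(1)] im[OF cp(2)]
  have f: "smooth_in c' (chart_dom c') f" using im' by (auto simp: immersed_def)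
  have pos: "0 < det (metric c f p)" "0 < det (metric c' f p)" using im' cp by (auto simp: immersed_def)
  note D = smooth_in_overlap(1)[OF cp f]
  have H: "coord_deriv c i (mean_curvature_in c f) q = coord_deriv c i (mean_curvature_in c' f) q"
    if "q \<in> chart_dom c" "q \<in> chart_dom c'" for i q
    using curvature_change(1)[OF cp(1,2) _ _ im'] that by (intro coord_deriv_local[OF patch_overlap[OF cp(1,2)]]) auto
  define Y where "Y c i q = (if i = (1::2) then (metric c f q $ 2 $ 2 * coord_deriv c 1 (mean_curvature_in c f) q - metric c f q $ 1 $ 2 * coord_deriv c 2 (mean_curvature_in c f) q) / sqrt (det (metric c f q))
     else (metric c f q $ 1 $ 1 * coord_deriv c 2 (mean_curvature_in c f) q - metric c f q $ 1 $ 2 * coord_deriv c 1 (mean_curvature_in c f) q) / sqrt (det (metric c f q)))" for c i q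
  have sY: "smooth_in c' (chart_dom c') (Y c' i)" for i
  proof -
    have "smooth_in c' (chart_dom c') (\<lambda>q. (metric c' f q $ a $ b * coord_deriv c' k (mean_curvature_in c' f) q - metric c' f q $ a' $ b' * coord_deriv c' k' (mean_curvature_in c' f) q) / sqrt (det (metric c' f q)))"
      for a b k a' b' k'
      using im'(2) by (intro smooth_in_divide smooth_in_comps smooth_in_coord_deriv patch_dom cp smooth_geometry[OF im'(2)])
       (force simp: immersed_def)
    then show ?thesis unfolding Y_def by (cases "i = 1") simp_all
  qed
  have Ych: "jac c c' a 1 q * Y c 1 q + jac c c' a 2 q * Y c 2 q = jac_det c c' q * Y c' a q"
    if q: "q \<in> chart_dom c" "q \<in> chart_dom c'" for a q
  proof -
    have "\<forall>a. jac c c' a 1 q * Y c 1 q + jac c c' a 2 q * Y c 2 q = jac_det c c' q * Y c' a q"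
      using gradient_flux_change[OF cp(1,2) q im' smooth_in_overlap(1)[OF cp(1,2) q smooth_geometry(6)[OF im'(2)]]]
      unfolding forall_2 Y_def H[OF q] by simp
    then show ?thesis ..
  qed
  have lap: "laplacian_in c f (mean_curvature_in c f) p * sqrt (det (metric c f p)) = coord_deriv c 1 (Y c 1) p + coord_deriv c 2 (Y c 2) p"
    if "c \<in> A" "p \<in> chart_dom c" for c
    using laplacian_in_flux[OF im[OF that(1)] that(2), of "mean_curvature_in c f"] unfolding Y_def by simp
  have "laplacian_in c f (mean_curvature_in c f) p * sqrt (det (metric c f p)) =
    jac_det c c' p * (laplacian_in c' f (mean_curvature_in c' f) p * sqrt (det (metric c' f p)))"
    unfolding lap[OF cp(1,3)] lap[OF cp(2,4)]
    using divergence_change[where X="Y c" and X'="Y c'", OF cp sY sY Ych] .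
  then show ?thesis
    using jac_det_pos[OF cp] pos(2) unfolding det_metric_change(2)[OF cp D] jac_det_def[symmetric] by simp
qed

text \<open>Invariance allows the chart picked by \<open>chart_at\<close> to be exchanged for any
  other. For the Laplacian, the global function H must first be replaced by its chart expression on
  the whole domain, since it is differentiated twice.\<close>

lemma global_curvature:
  assumes "c \<in> A" "p \<in> chart_dom c" and im: "\<And>c. c \<in> A \<Longrightarrow> immersed c f"
  shows "mean_curvature A f p = mean_curvature_in c f p" "tracefree_norm_sq A f p = tracefree_norm_sq_in c f p"
    "laplacian A f (mean_curvature A f) p = laplacian_in c f (mean_curvature_in c f) p"
proof -
  have H: "mean_curvature A f q = mean_curvature_in c f q \<and> tracefree_norm_sq A f q = tracefree_norm_sq_in c f q"
    if "c \<in> A" "q \<in> chart_dom c" for c q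
  proof -
    have q: "q \<in> S" using that dom_subset by blast
    show ?thesis
      unfolding mean_curvature_def tracefree_norm_sq_def
      using curvature_change[OF chart_at(1)[OF q] that(1) chart_at(2)[OF q] that(2) im[OF chart_at(1)[OF q]] im[OF that(1)]] by blast
  qed
  then show "mean_curvature A f p = mean_curvature_in c f p" "tracefree_norm_sq A f p = tracefree_norm_sq_in c f p"
    using assms by blast+
  have p: "p \<in> S" using assms dom_subset by blast
  note ca = chart_at[OF p]
  let ?c = "chart_at A p"
  have pos: "\<And>q. q \<in> chart_dom ?c \<Longrightarrow> 0 < det (metric ?c f q)" using im[OF ca(1)] by (simp add: immersed_def)
  have g: "gradient ?c f (mean_curvature A f) q = gradient ?c f (mean_curvature_in ?c f) q" if "q \<in> chart_dom ?c" for q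
    unfolding gradient_def using coord_deriv_cong[OF ca(1) that, of "mean_curvature A f" "mean_curvature_in ?c f"] H[OF ca(1)] by simp
  have "laplacian_in ?c f (mean_curvature A f) p = laplacian_in ?c f (mean_curvature_in ?c f) p"
    unfolding laplacian_in_def divergence_def
    by (intro arg_cong2[where f="(/)"] sum.cong coord_deriv_cong[OF ca]) (simp_all add: g)
  also have "\<dots> = laplacian_in c f (mean_curvature_in c f) p"
    by (rule laplacian_change[OF ca(1) assms(1) ca(2) assms(2) im])
  finally show "laplacian A f (mean_curvature A f) p = laplacian_in c f (mean_curvature_in c f) p"
    unfolding laplacian_def .
qed

subsection \<open>The boundary integrand\<close>

text \<open>Orthogonality to the boundary tangent forces a multiple of (-F, E). The squared length
  of this vector is E (E G - F^2), and the positive second component selects the sign.\<close>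

lemma interior_normal_eq:
  assumes "0 < det (metric c f p)"
  defines "l \<equiv> 1 / (sqrt (metric c f p $ 1 $ 1) * sqrt (det (metric c f p)))"
  shows "interior_normal c f p = vector [- l * metric c f p $ 1 $ 2, l * metric c f p $ 1 $ 1]"
    and "0 < metric c f p $ 1 $ 1"
proof -
  define E F G where "E = metric c f p $ 1 $ 1" and "F = metric c f p $ 1 $ 2" and "G = metric c f p $ 2 $ 2"
  have F': "metric c f p $ 2 $ 1 = F" unfolding F_def by (rule metric_sym)
  have d: "0 < E * G - F * F" using assms(1) by (simp add: det_metric E_def F_def G_def)
  have "E \<ge> 0" by (simp add: E_def metric_nth)
  moreover have "E \<noteq> 0" using d by (auto simp: not_less)
  ultimately have E: "E > 0" by simp
  then show "0 < metric c f p $ 1 $ 1" by (simp add: E_def)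
  have l: "l > 0" "l * l * (E * (E * G - F * F)) = 1"
    using E d unfolding l_def det_metric E_def[symmetric] F_def[symmetric] G_def[symmetric]
    by (simp_all add: divide_simps) (simp add: algebra_simps)?
  show "interior_normal c f p = vector [- l * metric c f p $ 1 $ 2, l * metric c f p $ 1 $ 1]"
    unfolding interior_normal_def
  proof (rule the_equality)
    show "bilin (metric c f p) (vector [- l * metric c f p $ 1 $ 2, l * metric c f p $ 1 $ 1]) (vector [- l * metric c f p $ 1 $ 2, l * metric c f p $ 1 $ 1]) = 1 \<and>
      bilin (metric c f p) (vector [- l * metric c f p $ 1 $ 2, l * metric c f p $ 1 $ 1]) (axis 1 1) = 0 \<and>
      0 < (vector [- l * metric c f p $ 1 $ 2, l * metric c f p $ 1 $ 1] :: real^2) $ 2"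
      unfolding bilin_def sum_2 F' E_def[symmetric] F_def[symmetric] G_def[symmetric] using l E
      by (simp add: algebra_simps)
    fix n :: "real^2"
    assume n: "bilin (metric c f p) n n = 1 \<and> bilin (metric c f p) n (axis 1 1) = 0 \<and> 0 < n $ 2"
    have 1: "E * (n $ 1 * n $ 1) + 2 * F * (n $ 1 * n $ 2) + G * (n $ 2 * n $ 2) = 1" and 2: "E * n $ 1 + F * n $ 2 = 0" and 3: "n $ 2 > 0"
      using n unfolding bilin_def sum_2 F' E_def[symmetric] F_def[symmetric] G_def[symmetric] by (simp_all add: algebra_simps)
    have "(n $ 2)\<^sup>2 * (E * G - F * F) = E" using 1 2 by algebra
    also have "\<dots> = (l * E)\<^sup>2 * (E * G - F * F)" using l(2) by algebra
    finally have "(n $ 2)\<^sup>2 = (l * E)\<^sup>2" using d by simp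
    then have n2: "n $ 2 = l * E" using 3 l E by (simp add: power2_eq_iff_nonneg)
    have "E * n $ 1 = E * (- l * F)" using 2 unfolding n2 by (simp add: algebra_simps)
    then have "n $ 1 = - l * F" using E by (metis less_irrefl mult_left_cancel)
    then show "n = vector [- l * metric c f p $ 1 $ 2, l * metric c f p $ 1 $ 1]"
      using n2 by (simp add: vec_eq_iff forall_2 E_def F_def)
  qed
qed

text \<open>The rectangle identity produces the second flux component, the boundary integral a
  scalar times the line element. In the chosen chart \<open>k\<close> the two are matched through
  the explicit interior normal; the minus sign reflects that outward flux through the lower side is
  minus the second component.\<close>

lemma boundary_term_flux:
  assumes "c \<in> A" "p \<in> chart_dom c" "chart_map c p $ 2 = 0"
    and im: "\<And>c. c \<in> A \<Longrightarrow> immersed c f" and \<phi>: "\<And>c. c \<in> A \<Longrightarrow> smooth_in c (chart_dom c) \<phi>"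
    and \<xi>: "\<And>c c' p. c \<in> A \<Longrightarrow> c' \<in> A \<Longrightarrow> p \<in> chart_dom c \<inter> chart_dom c' \<Longrightarrow> \<xi> c' p = differential c (chart_map c') p (\<xi> c p)"
  shows "boundary_term A f \<phi> \<xi> p * sqrt (metric c f p $ 1 $ 1) = - flux c f \<phi> (\<xi> c) 2 p"
proof -
  have p: "p \<in> S" using assms dom_subset by blast
  note ca = chart_at[OF p]
  define k where "k = chart_at A p"
  have k: "k \<in> A" "p \<in> chart_dom k" using ca by (simp_all add: k_def)
  note imk = im[OF k(1)]
  have pos: "0 < det (metric k f p)" using imk k(2) by (simp add: immersed_def)
  have fk: "smooth_in k (chart_dom k) f" using imk by (simp add: immersed_def)
  define E F G s where "E = metric k f p $ 1 $ 1" and "F = metric k f p $ 1 $ 2" and "G = metric k f p $ 2 $ 2"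
    and "s = sqrt (det (metric k f p))"
  define l where "l = 1 / (sqrt E * s)"
  note et = interior_normal_eq[OF pos, folded E_def F_def s_def, folded l_def]
  have E0: "sqrt E > 0" using et(2) by simp
  have s0: "s > 0" using pos by (simp add: s_def)
  have ss: "det (metric k f p) = s * s" using pos by (simp add: s_def)
  have d: "E * G - F * F = s * s" using ss by (simp add: det_metric E_def F_def G_def)
  define t11 t12 t22 where "t11 = tracefree_form k f p $ 1 $ 1" and "t12 = tracefree_form k f p $ 1 $ 2" and "t22 = tracefree_form k f p $ 2 $ 2"
  have t21: "tracefree_form k f p $ 2 $ 1 = t12"
    unfolding t12_def tracefree_form_nth second_form_sym[OF k(1) fk k(2)] metric_sym[of k f p 2 1] ..
  have tr: "G * t11 - 2 * F * t12 + E * t22 = 0"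
  proof -
    have "E * second_form k f p $ 2 $ 2 - 2 * F * second_form k f p $ 1 $ 2 + G * second_form k f p $ 1 $ 1
       = mean_curvature_in k f p * (E * G - F * F)"
      using mean_curvature_in_formula[OF pos second_form_sym[OF k(1) fk k(2)]] s0
      unfolding d ss E_def[symmetric] F_def[symmetric] G_def[symmetric] by simp
    then show ?thesis
      unfolding t11_def t12_def t22_def tracefree_form_nth E_def[symmetric] F_def[symmetric] G_def[symmetric]
      by (simp add: algebra_simps)
  qed
  define u1 u2 where "u1 = coord_deriv k 1 \<phi> p" and "u2 = coord_deriv k 2 \<phi> p"
  define H1 H2 where "H1 = coord_deriv k 1 (mean_curvature_in k f) p" and "H2 = coord_deriv k 2 (mean_curvature_in k f) p"
  have dH: "differential k (mean_curvature A f) p v = v $ 1 * H1 + v $ 2 * H2" for v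
  proof -
    have "differential k (mean_curvature A f) p = differential k (mean_curvature_in k f) p"
      by (rule differential_local(1)[OF patch_dom[OF k(1)] k(2)]) (rule global_curvature(1)[OF k(1) _ im])
    then show ?thesis
      using differential_expand[OF smooth_in_differentiable[OF patch_dom[OF k(1)] smooth_geometry(6)[OF imk] k(2)], of v]
      by (simp add: H1_def H2_def)
  qed
  have gr: "gradient k f \<phi> p $ 1 = (G * u1 - F * u2) / (s * s)" "gradient k f \<phi> p $ 2 = (E * u2 - F * u1) / (s * s)"
    unfolding gradient_def matrix_vector_mult_def
    by (simp_all add: sum_2 metric_inv_2[OF pos] ss E_def F_def G_def u1_def u2_def diff_divide_distrib)
  \<comment> \<open>The trace relation \<open>tr\<close> eliminates \<open>t22\<close> together with
    its factor \<open>E\<close>, after which the Gram determinant factors out.\<close>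
  have "(G * u1 - F * u2) * (t12 * E - t11 * F) + (E * u2 - F * u1) * (t22 * E - t12 * F) = s * s * (t12 * u1 - t11 * u2)"
    using tr d by algebra
  then have th: "bilin (tracefree_form k f p) (gradient k f \<phi> p) (interior_normal k f p) = l * (t12 * u1 - t11 * u2)"
  proof -
    assume *: "(G * u1 - F * u2) * (t12 * E - t11 * F) + (E * u2 - F * u1) * (t22 * E - t12 * F) = s * s * (t12 * u1 - t11 * u2)"
    have "bilin (tracefree_form k f p) (gradient k f \<phi> p) (interior_normal k f p)
      = l * ((G * u1 - F * u2) * (t12 * E - t11 * F) + (E * u2 - F * u1) * (t22 * E - t12 * F)) / (s * s)"
      unfolding bilin_def sum_2 gr et t21 t11_def[symmetric] t12_def[symmetric] t22_def[symmetric]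
      by (simp add: add_divide_distrib diff_divide_distrib algebra_simps)
    then show ?thesis unfolding * using s0 by simp
  qed
  have gx: "bilin (metric k f p) (\<xi> k p) (interior_normal k f p) = l * (s * s) * \<xi> k p $ 2"
    unfolding bilin_def sum_2 et d[symmetric] metric_sym[of k f p 2 1] E_def[symmetric] F_def[symmetric] G_def[symmetric]
    by (simp add: algebra_simps)
  have gc: "tracefree_norm_sq A f p = tracefree_norm_sq_in k f p"
    using global_curvature(2)[OF k] im by blast
  have bt: "boundary_term A f \<phi> \<xi> p = 1/2 * \<phi> p * (l * (E * H2 - F * H1)) - l * (t12 * u1 - t11 * u2)
     - 1/2 * tracefree_norm_sq_in k f p * (l * (s * s) * \<xi> k p $ 2)"
    unfolding boundary_term_def Let_def k_def[symmetric] th gx gc unfolding dH et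
    by (simp add: algebra_simps)
  have l: "l * sqrt E = 1 / s" using E0 s0 by (simp add: l_def)
  have fl: "flux k f \<phi> (\<xi> k) 2 p = (t12 * u1 - t11 * u2) / s - 1/2 * \<phi> p * ((E * H2 - F * H1) / s)
     + 1/2 * tracefree_norm_sq_in k f p * s * \<xi> k p $ 2"
    unfolding flux_def Let_def density_def s_def[symmetric] t11_def[symmetric] t12_def[symmetric] E_def[symmetric] F_def[symmetric]
      u1_def[symmetric] u2_def[symmetric] H1_def[symmetric] H2_def[symmetric]
    by (simp add: diff_divide_distrib)
  have "boundary_term A f \<phi> \<xi> p * sqrt E = 1/2 * \<phi> p * ((l * sqrt E) * (E * H2 - F * H1)) - (l * sqrt E) * (t12 * u1 - t11 * u2)
     - 1/2 * tracefree_norm_sq_in k f p * ((l * sqrt E) * (s * s) * \<xi> k p $ 2)"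
    unfolding bt by (simp add: algebra_simps)
  also have "\<dots> = - flux k f \<phi> (\<xi> k) 2 p"
    unfolding l fl using s0 by simp
  finally have 1: "boundary_term A f \<phi> \<xi> p * sqrt E = - flux k f \<phi> (\<xi> k) 2 p" .
  note kc = assms(1) k(1) assms(2) k(2)
  \<comment> \<open>At a boundary point the Jacobian matrix is upper triangular. The second flux
    component and the line element then both scale by its first diagonal entry, so the identity
    passes from \<open>k\<close> to \<open>c\<close>.\<close>
  have bk: "chart_map k p $ 2 = 0" by (rule boundary_chart_independent[OF k(1) assms(1) k(2) assms(2) assms(3)])
  note jb = jac_boundary[OF kc bk]
  have g11: "metric c f p $ 1 $ 1 = (jac c k 1 1 p)\<^sup>2 * E"
    unfolding metric_change[OF kc smooth_in_overlap(1)[OF kc fk]] jb(1) E_def by (simp add: power2_eq_square)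
  have g11: "sqrt (metric c f p $ 1 $ 1) = jac c k 1 1 p * sqrt E"
    unfolding g11 using jb(2) by (simp add: real_sqrt_mult)
  have "jac c k 2 2 p * flux c f \<phi> (\<xi> c) 2 p = jac c k 2 2 p * (jac c k 1 1 p * flux k f \<phi> (\<xi> k) 2 p)"
    using flux_change[where \<xi>=\<xi> and a=2, OF kc im \<phi>[OF k(1)] \<xi>[OF kc(1,2) IntI[OF kc(3,4)]]] jb(1) by (simp add: jac_det_def)
  then have "flux c f \<phi> (\<xi> c) 2 p = jac c k 1 1 p * flux k f \<phi> (\<xi> k) 2 p" using jb(3) by simp
  moreover have "boundary_term A f \<phi> \<xi> p * (jac c k 1 1 p * sqrt E) = jac c k 1 1 p * (boundary_term A f \<phi> \<xi> p * sqrt E)"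
    by simp
  ultimately show ?thesis unfolding g11 1 by simp
qed

end

section \<open>Measures glued from charts\<close>

text \<open>A finite subcover is cut into disjoint pieces and a set is measured piece by piece.
  Consistency makes this agree with every local measure on its own domain. Any competitor is
  additive over the same pieces, which gives the uniqueness demanded by a definite
  description.\<close>

lemma glue_measure:
  fixes M0 :: "'a measure" and N :: "'i \<Rightarrow> 'a measure" and U :: "'i \<Rightarrow> 'a set"
  assumes N: "\<And>i. i \<in> I \<Longrightarrow> sets (N i) = sets M0" and U: "\<And>i. i \<in> I \<Longrightarrow> U i \<in> sets M0"
    and J: "finite J" "J \<subseteq> I" "space M0 = (\<Union>i\<in>J. U i)"
    and consistent: "\<And>i j B. i \<in> I \<Longrightarrow> j \<in> I \<Longrightarrow> B \<in> sets M0 \<Longrightarrow> B \<subseteq> U i \<Longrightarrow> B \<subseteq> U j \<Longrightarrow>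
      emeasure (N i) B = emeasure (N j) B"
  shows "\<exists>!M. sets M = sets M0 \<and> (\<forall>i\<in>I. \<forall>B\<in>sets M. B \<subseteq> U i \<longrightarrow> emeasure M B = emeasure (N i) B)"
proof -
  obtain js where js: "set js = J" using J(1) finite_list by blast
  define n where "n = length js"
  \<comment> \<open>The finite cover becomes a sequence padded with empty sets, the form to which
    \<open>disjointed\<close> applies.\<close>
  define V where "V k = (if k < n then U (js ! k) else {})" for k
  have jsI: "js ! k \<in> I" if "k < n" for k using that js J(2) nth_mem unfolding n_def by blast
  have V: "V k \<in> sets M0" for k using U jsI by (simp add: V_def)
  define D where "D k = disjointed V k" for k
  have D: "D k \<in> sets M0" for k
    using sets.range_disjointed_sets[of V M0] V unfolding D_def by blast
  have DU: "D k \<subseteq> U (js ! k)" if "k < n" for k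
    using disjointed_subset[of V k] that by (simp add: D_def V_def)
  have D_un: "(\<Union>k<n. D k) = space M0"
  proof -
    have "(\<Union>k. D k) = (\<Union>k. V k)" unfolding D_def by (rule UN_disjointed_eq)
    also have "\<dots> = (\<Union>k<n. U (js ! k))" by (auto simp: V_def split: if_splits)
    also have "\<dots> = space M0" unfolding J(3) js[symmetric] n_def by (force simp: in_set_conv_nth)
    finally have "(\<Union>k. D k) = space M0" .
    moreover have "k < n" if "y \<in> D k" for y k
      using disjointed_subset[of V k] that by (auto simp: D_def V_def split: if_splits)
    ultimately show ?thesis by blast
  qed
  have D_disj: "disjoint_family_on D {..<n}"
    using disjoint_family_disjointed[of V] unfolding D_def by (auto simp: disjoint_family_on_def)
  have split: "emeasure Q B = (\<Sum>k<n. emeasure Q (B \<inter> D k))" if "sets Q = sets M0" "B \<in> sets M0" for Q B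
  proof -
    have "(\<Sum>k<n. emeasure Q (B \<inter> D k)) = emeasure Q (\<Union>k<n. B \<inter> D k)"
      using that D disjoint_family_on_bisimulation[OF D_disj, of "\<lambda>k. B \<inter> D k"]
      by (intro sum_emeasure) auto
    also have "(\<Union>k<n. B \<inter> D k) = B" using D_un sets.sets_into_space[OF that(2)] by blast
    finally show ?thesis by simp
  qed
  define \<mu> where "\<mu> B = (\<Sum>k<n. emeasure (N (js ! k)) (B \<inter> D k))" for B
  define M where "M = measure_of (space M0) (sets M0) \<mu>"
  have sM: "sets M = sets M0" unfolding M_def by (simp add: sets.sigma_sets_eq sets.space_closed)
  have emM: "emeasure M B = \<mu> B" if "B \<in> sets M0" for B
  proof (rule emeasure_measure_of[OF M_def])
    show "sets M0 \<subseteq> Pow (space M0)" by (rule sets.space_closed)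
    show "positive (sets M) \<mu>" by (simp add: positive_def \<mu>_def)
    show "countably_additive (sets M) \<mu>"
    proof (rule countably_additiveI)
      fix B :: "nat \<Rightarrow> 'a set"
      assume B: "range B \<subseteq> sets M" "disjoint_family B" "\<Union> (range B) \<in> sets M"
      have "(\<Sum>i. \<mu> (B i)) = (\<Sum>k<n. \<Sum>i. emeasure (N (js ! k)) (B i \<inter> D k))"
        unfolding \<mu>_def by (rule suminf_sum) simp
      also have "\<dots> = (\<Sum>k<n. emeasure (N (js ! k)) (\<Union>i. B i \<inter> D k))"
        using B D N[OF jsI] sM by (intro sum.cong suminf_emeasure refl) (auto simp: disjoint_family_on_def)
      also have "\<dots> = \<mu> (\<Union> (range B))" unfolding \<mu>_def by (intro sum.cong) auto
      finally show "(\<Sum>i. \<mu> (B i)) = \<mu> (\<Union> (range B))" .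
    qed
    show "B \<in> sets M" using that sM by simp
  qed
  show ?thesis
  proof (rule ex1I[of _ M])
    have "emeasure M B = emeasure (N i) B" if i: "i \<in> I" and B: "B \<in> sets M0" "B \<subseteq> U i" for i B
    proof -
      have "emeasure M B = (\<Sum>k<n. emeasure (N i) (B \<inter> D k))"
        unfolding emM[OF B(1)] \<mu>_def
      proof (intro sum.cong refl consistent)
        fix k assume k: "k \<in> {..<n}"
        then show "js ! k \<in> I" "i \<in> I" "B \<inter> D k \<in> sets M0" "B \<inter> D k \<subseteq> U (js ! k)" "B \<inter> D k \<subseteq> U i"
          using jsI[of k] i B D[of k] DU[of k] by auto
      qed
      then show ?thesis using split[OF N[OF i] B(1)] by simp
    qed
    then show "sets M = sets M0 \<and> (\<forall>i\<in>I. \<forall>B\<in>sets M. B \<subseteq> U i \<longrightarrow> emeasure M B = emeasure (N i) B)"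
      using sM by simp
  next
    fix Q assume Q: "sets Q = sets M0 \<and> (\<forall>i\<in>I. \<forall>B\<in>sets Q. B \<subseteq> U i \<longrightarrow> emeasure Q B = emeasure (N i) B)"
    show "Q = M"
    proof (rule measure_eqI)
      show "sets Q = sets M" using Q sM by simp
      fix B assume "B \<in> sets Q"
      then have B: "B \<in> sets M0" using Q by simp
      have "emeasure Q B = (\<Sum>k<n. emeasure Q (B \<inter> D k))" using split Q B by blast
      also have "\<dots> = \<mu> B"
        unfolding \<mu>_def
      proof (intro sum.cong refl)
        fix k assume k: "k \<in> {..<n}"
        have "B \<inter> D k \<in> sets Q" "B \<inter> D k \<subseteq> U (js ! k)" using Q B D DU k by auto
        then show "emeasure Q (B \<inter> D k) = emeasure (N (js ! k)) (B \<inter> D k)" using Q jsI k by blast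
      qed
      finally show "emeasure Q B = emeasure M B" using emM[OF B] by simp
    qed
  qed
qed

text \<open>The image under the parametrization \<gamma> of Lebesgue measure on \<open>R\<close>
  with weight \<open>w\<close>. Taking the whole space \<open>X\<close> as target gives all charts
  the same sigma-algebra, so that their measures can be glued.\<close>

definition chart_measure :: "'a::topological_space set \<Rightarrow> 'e::euclidean_space set \<Rightarrow> ('e \<Rightarrow> 'a) \<Rightarrow> ('e \<Rightarrow> real) \<Rightarrow> 'a measure" where
  "chart_measure X R \<gamma> w = distr (density (restrict_space lborel R) (\<lambda>u. ennreal (w u))) (restrict_space borel X) \<gamma>"

lemma sets_chart_measure [simp]: "sets (chart_measure X R \<gamma> w) = sets (restrict_space borel X)"
  by (simp add: chart_measure_def)

lemma measurable_param:
  assumes "continuous_on R \<gamma>" "\<gamma> ` R \<subseteq> X"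
  shows "\<gamma> \<in> measurable (restrict_space lborel R) (restrict_space borel X)"
proof (rule measurable_restrict_space2)
  show "\<gamma> \<in> space (restrict_space lborel R) \<rightarrow> X" using assms(2) by (auto simp: space_restrict_space)
  have "\<gamma> \<in> measurable (restrict_space borel R) borel" by (rule borel_measurable_continuous_on_restrict[OF assms(1)])
  then show "\<gamma> \<in> measurable (restrict_space lborel R) borel"
    by (simp cong: measurable_cong_sets add: sets_restrict_space_cong[OF sets_lborel])
qed

lemma measurable_weight:
  fixes w :: "'e::euclidean_space \<Rightarrow> real"
  assumes "continuous_on R w"
  shows "w \<in> borel_measurable (restrict_space lborel R)"
proof -
  have "w \<in> measurable (restrict_space borel R) borel" by (rule borel_measurable_continuous_on_restrict[OF assms])
  then show ?thesis
    by (simp cong: measurable_cong_sets add: sets_restrict_space_cong[OF sets_lborel])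
qed

lemma emeasure_chart_measure:
  assumes R: "R \<in> sets borel" and \<gamma>: "continuous_on R \<gamma>" "\<gamma> ` R \<subseteq> X" and w: "continuous_on R w"
    and B: "B \<in> sets (restrict_space borel X)"
  shows "emeasure (chart_measure X R \<gamma> w) B = (\<integral>\<^sup>+ u \<in> {u\<in>R. \<gamma> u \<in> B}. ennreal (w u) \<partial>lborel)"
proof -
  note m = measurable_param[OF \<gamma>]
  note mw = measurable_weight[OF w]
  have R': "R \<inter> space lborel \<in> sets lborel" using R by simp
  have pre: "\<gamma> -` B \<inter> space (restrict_space lborel R) \<in> sets (restrict_space lborel R)"
    using measurable_sets[OF m B] .
  have "emeasure (chart_measure X R \<gamma> w) B =
     (\<integral>\<^sup>+ u. ennreal (w u) * indicator (\<gamma> -` B \<inter> space (restrict_space lborel R)) u \<partial>restrict_space lborel R)"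
    unfolding chart_measure_def using m mw B pre
    by (subst emeasure_distr) (auto simp: emeasure_density)
  also have "\<dots> = (\<integral>\<^sup>+ u. ennreal (w u) * indicator (\<gamma> -` B \<inter> space (restrict_space lborel R)) u * indicator R u \<partial>lborel)"
    by (rule nn_integral_restrict_space[OF R'])
  also have "\<dots> = (\<integral>\<^sup>+ u \<in> {u\<in>R. \<gamma> u \<in> B}. ennreal (w u) \<partial>lborel)"
    by (intro nn_integral_cong) (auto simp: indicator_def space_restrict_space)
  finally show ?thesis .
qed

text \<open>The measure is known only on subsets of \<open>U\<close>. There its restriction equals
  that of the image measure, and an integrand supported in the image of a compact set does not see
  the rest of the space.\<close>

lemma chart_integral:
  fixes \<psi> :: "'a::topological_space \<Rightarrow> real" and \<gamma> :: "'e::euclidean_space \<Rightarrow> 'a"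
  assumes M: "sets M = sets (restrict_space borel X)" and U: "U \<in> sets M"
    and R: "R \<in> sets borel" and \<gamma>: "continuous_on R \<gamma>" "\<gamma> ` R \<subseteq> U"
    and w: "continuous_on R w" "\<And>u. u \<in> R \<Longrightarrow> 0 \<le> w u"
    and em: "\<And>B. B \<in> sets M \<Longrightarrow> B \<subseteq> U \<Longrightarrow> emeasure M B = (\<integral>\<^sup>+ u \<in> {u\<in>R. \<gamma> u \<in> B}. ennreal (w u) \<partial>lborel)"
    and \<psi>: "continuous_on U \<psi>" and K: "compact K" "K \<subseteq> R"
    and supp: "\<And>p. p \<in> X \<Longrightarrow> p \<notin> \<gamma> ` K \<Longrightarrow> \<psi> p = 0" and suppR: "\<And>u. u \<in> R \<Longrightarrow> u \<notin> K \<Longrightarrow> \<psi> (\<gamma> u) = 0"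
  shows "integrable M \<psi>" "integral\<^sup>L M \<psi> = integral K (\<lambda>u. \<psi> (\<gamma> u) * w u)"
proof -
  have UX: "U \<subseteq> X" using sets.sets_into_space[OF U] sets_eq_imp_space_eq[OF M] by (simp add: space_restrict_space)
  have spM: "space M = X" using sets_eq_imp_space_eq[OF M] by (simp add: space_restrict_space)
  define Q where "Q = chart_measure X R \<gamma> w"
  have \<gamma>X: "\<gamma> ` R \<subseteq> X" using \<gamma> UX by blast
  have sQ: "sets Q = sets M" by (simp add: Q_def M)
  have spQ: "space Q = space M" using sQ by (rule sets_eq_imp_space_eq)
  have U': "U \<inter> space M \<in> sets M" "U \<inter> space Q \<in> sets Q" using U sQ spM spQ UX by (simp_all add: Int_absorb2)
  have eq: "restrict_space M U = restrict_space Q U"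
  proof (rule measure_eqI)
    show "sets (restrict_space M U) = sets (restrict_space Q U)" using sQ by (simp add: sets_restrict_space)
    fix B assume "B \<in> sets (restrict_space M U)"
    then have B: "B \<subseteq> U" "B \<in> sets M" using U' by (auto simp: sets_restrict_space_iff)
    have "emeasure (restrict_space M U) B = emeasure M B" by (rule emeasure_restrict_space[OF U'(1) B(1)])
    also have "\<dots> = emeasure Q B"
      unfolding Q_def using emeasure_chart_measure[OF R \<gamma>(1) \<gamma>X w(1), of B] em[OF B(2,1)] B(2) M by simp
    also have "\<dots> = emeasure (restrict_space Q U) B" by (rule emeasure_restrict_space[OF U'(2) B(1), symmetric])
    finally show "emeasure (restrict_space M U) B = emeasure (restrict_space Q U) B" .
  qed
  have ind: "indicator U p *\<^sub>R \<psi> p = \<psi> p" if "p \<in> X" for p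
    using supp[OF that] \<gamma>(2) K(2) by (cases "p \<in> U") auto
  have mU: "(\<lambda>p. indicator U p *\<^sub>R \<psi> p) \<in> borel_measurable (restrict_space borel X)"
  proof -
    have "sets (restrict_space (restrict_space borel X) U) = sets (restrict_space borel U)"
      using UX by (simp add: sets_restrict_restrict_space Int_absorb1)
    then have "\<psi> \<in> borel_measurable (restrict_space (restrict_space borel X) U)"
      using borel_measurable_continuous_on_restrict[OF \<psi>] by (simp cong: measurable_cong_sets)
    then show ?thesis
      by (subst (asm) borel_measurable_restrict_space_iff) (use U UX M in \<open>auto simp: space_restrict_space Int_absorb2\<close>)
  qed
  have m\<psi>: "\<psi> \<in> borel_measurable (restrict_space borel X)"
  proof -
    have "(\<lambda>p. indicator U p *\<^sub>R \<psi> p) \<in> borel_measurable (restrict_space borel X) \<longleftrightarrow>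
        \<psi> \<in> borel_measurable (restrict_space borel X)"
      by (rule measurable_cong, rule ind) (simp add: space_restrict_space)
    then show ?thesis using mU by blast
  qed
  have m\<psi>': "\<psi> \<in> borel_measurable M" "\<psi> \<in> borel_measurable Q" using m\<psi> M sQ by (simp_all cong: measurable_cong_sets)
  define G where "G u = \<psi> (\<gamma> u) * w u" for u
  have cG: "continuous_on K G"
    unfolding G_def by (intro continuous_intros continuous_on_compose2[OF \<psi>] continuous_on_subset[OF \<gamma>(1) K(2)]
        continuous_on_subset[OF w(1) K(2)]) (use \<gamma>(2) K(2) in auto)
  have iK: "integrable lborel (\<lambda>u. indicator K u *\<^sub>R G u)" by (rule borel_integrable_compact[OF K(1) cG])
  note mp = measurable_param[OF \<gamma>(1) \<gamma>X]
  note mw = measurable_weight[OF w(1)]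
  have md: "(\<lambda>u. \<psi> (\<gamma> u)) \<in> borel_measurable (restrict_space lborel R)" using measurable_compose[OF mp m\<psi>] .
  have R': "R \<inter> space lborel \<in> sets lborel" using R by simp
  have GK: "indicator R u * (w u * \<psi> (\<gamma> u)) = indicator K u * G u" for u
    using suppR[of u] K(2) by (cases "u \<in> K"; cases "u \<in> R") (auto simp: G_def)
  have w': "AE u in restrict_space lborel R. 0 \<le> w u" by (rule AE_I2) (simp add: w(2) space_restrict_space)
  have iQ: "integrable Q \<psi>"
    unfolding Q_def chart_measure_def
    using mp m\<psi> md mw w' iK R'
    by (simp add: integrable_distr_eq integrable_density integrable_restrict_space GK)
  have LQ: "integral\<^sup>L Q \<psi> = (LINT u|lborel. indicator K u *\<^sub>R G u)"
    unfolding Q_def chart_measure_def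
    using mp m\<psi> md mw w' R'
    by (simp add: integral_distr integral_density integral_restrict_space GK)
  have "integrable Q (\<lambda>p. indicator U p *\<^sub>R \<psi> p) \<longleftrightarrow> integrable Q \<psi>"
    by (rule Bochner_Integration.integrable_cong[OF refl], rule ind) (simp add: spQ spM)
  then have "integrable (restrict_space Q U) \<psi>"
    using iQ integrable_restrict_space[OF U'(2), of \<psi>] by blast
  then have "integrable M (\<lambda>p. indicator U p *\<^sub>R \<psi> p)"
    using integrable_restrict_space[OF U'(1), of \<psi>] eq by simp
  moreover have "integrable M (\<lambda>p. indicator U p *\<^sub>R \<psi> p) \<longleftrightarrow> integrable M \<psi>"
    by (rule Bochner_Integration.integrable_cong[OF refl], rule ind) (simp add: spM)
  ultimately show "integrable M \<psi>" by blast
  have "integral\<^sup>L M \<psi> = integral\<^sup>L M (\<lambda>p. indicator U p *\<^sub>R \<psi> p)"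
    by (rule Bochner_Integration.integral_cong[OF refl], rule ind[symmetric]) (simp add: spM)
  also have "\<dots> = integral\<^sup>L (restrict_space Q U) \<psi>"
    unfolding eq[symmetric] by (rule integral_restrict_space[OF U'(1), symmetric])
  also have "\<dots> = integral\<^sup>L Q (\<lambda>p. indicator U p *\<^sub>R \<psi> p)" by (rule integral_restrict_space[OF U'(2)])
  also have "\<dots> = integral\<^sup>L Q \<psi>"
    by (rule Bochner_Integration.integral_cong[OF refl], rule ind) (simp add: spQ spM)
  also have "\<dots> = integral K G"
    unfolding LQ using set_borel_integral_eq_integral(2)[of K G] iK
    by (simp add: set_lebesgue_integral_def set_integrable_def)
  finally show "integral\<^sup>L M \<psi> = integral K (\<lambda>u. \<psi> (\<gamma> u) * w u)" unfolding G_def .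
qed

subsection \<open>Change of variables for nonnegative functions\<close>

text \<open>The change of variables theorem concerns absolutely integrable functions, while measures
  are given by extended nonnegative integrals. Here the two are linked, with infinity as the value
  in the case of failing integrability.\<close>

lemma nn_integral_absolutely_integrable:
  fixes w :: "'e::euclidean_space \<Rightarrow> real"
  assumes m: "(\<lambda>u. indicator T u * w u) \<in> borel_measurable borel" and w: "\<And>u. u \<in> T \<Longrightarrow> 0 \<le> w u"
  shows "(\<integral>\<^sup>+ u \<in> T. ennreal (w u) \<partial>lborel) = (if w absolutely_integrable_on T then ennreal (integral T w) else \<infinity>)"
proof -
  let ?g = "\<lambda>u. indicator T u * w u"
  have nn: "0 \<le> ?g u" for u using w by (auto simp: indicator_def)
  have g: "(\<integral>\<^sup>+ u \<in> T. ennreal (w u) \<partial>lborel) = (\<integral>\<^sup>+ u. ennreal (?g u) \<partial>lborel)"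
    by (intro nn_integral_cong) (auto simp: indicator_def)
  have m': "?g \<in> borel_measurable lborel" using m by simp
  have iff: "w absolutely_integrable_on T \<longleftrightarrow> integrable lborel ?g"
    unfolding set_integrable_def real_scaleR_def using integrable_completion[OF m'] .
  show ?thesis
  proof (cases "integrable lborel ?g")
    case True
    have "(\<integral>\<^sup>+ u. ennreal (?g u) \<partial>lborel) = ennreal (integral\<^sup>L lborel ?g)"
      using True nn by (intro nn_integral_eq_integral) auto
    also have "integral\<^sup>L lborel ?g = integral T w"
      using set_borel_integral_eq_integral(2)[of T w] True by (simp add: set_integrable_def set_lebesgue_integral_def)
    finally show ?thesis using True iff g by simp
  next
    case False
    have "\<not> (\<integral>\<^sup>+ u. ennreal (?g u) \<partial>lborel) < \<infinity>"
      using integrableI_nonneg[OF m' AE_I2[OF nn]] False by blast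
    then have "(\<integral>\<^sup>+ u. ennreal (?g u) \<partial>lborel) = \<infinity>"
      by (simp add: less_top[symmetric])
    then show ?thesis using False iff g by simp
  qed
qed

lemma nn_integral_change_of_variables:
  fixes \<tau> :: "real^2 \<Rightarrow> real^2"
  assumes T: "T \<in> sets borel" and \<tau>: "\<And>x. x \<in> T \<Longrightarrow> (\<tau> has_derivative \<tau>' x) (at x within T)" "inj_on \<tau> T"
    and m: "(\<lambda>u. indicator T u * w u) \<in> borel_measurable borel" "(\<lambda>u. indicator (\<tau> ` T) u * w' u) \<in> borel_measurable borel"
    and w: "\<And>u. u \<in> T \<Longrightarrow> 0 \<le> w u" "\<And>u. u \<in> T \<Longrightarrow> 0 \<le> w' (\<tau> u)"
    and ww': "\<And>u. u \<in> T \<Longrightarrow> w u = \<bar>det (matrix (\<tau>' u))\<bar> * w' (\<tau> u)"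
  shows "(\<integral>\<^sup>+ u \<in> T. ennreal (w u) \<partial>lborel) = (\<integral>\<^sup>+ u \<in> \<tau> ` T. ennreal (w' u) \<partial>lborel)"
proof -
  have "T \<in> sets lebesgue" using T by auto
  \<comment> \<open>The real weight is viewed as a map into \<open>real^1\<close>, the vector-valued
    form in which the theorem is applied.\<close>
  note ch = has_absolute_integral_change_of_variables[OF this \<tau>, where f="\<lambda>x. vec (w' x) :: real^1"]
  have c: "(\<lambda>x. \<bar>det (matrix (\<tau>' x))\<bar> *\<^sub>R (vec (w' (\<tau> x)) :: real^1)) = (\<lambda>x. vec (\<bar>det (matrix (\<tau>' x))\<bar> * w' (\<tau> x)))"
    by (simp add: vec_eq_iff fun_eq_iff)
  have ch': "(\<lambda>x. \<bar>det (matrix (\<tau>' x))\<bar> * w' (\<tau> x)) absolutely_integrable_on T \<and>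
      integral T (\<lambda>x. \<bar>det (matrix (\<tau>' x))\<bar> * w' (\<tau> x)) = b \<longleftrightarrow>
      w' absolutely_integrable_on \<tau> ` T \<and> integral (\<tau> ` T) w' = b" for b
    using ch[of "vec b"] unfolding c by (simp add: absolutely_integrable_on_1_iff integral_on_1_eq)
  have a: "w absolutely_integrable_on T \<longleftrightarrow> (\<lambda>x. \<bar>det (matrix (\<tau>' x))\<bar> * w' (\<tau> x)) absolutely_integrable_on T"
    unfolding set_integrable_def by (intro Bochner_Integration.integrable_cong) (auto simp: ww' indicator_def)
  have i: "integral T w = integral T (\<lambda>x. \<bar>det (matrix (\<tau>' x))\<bar> * w' (\<tau> x))"
    by (intro Henstock_Kurzweil_Integration.integral_cong ww')
  have A: "w absolutely_integrable_on T \<longleftrightarrow> w' absolutely_integrable_on \<tau> ` T" using ch' a by blast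
  have B: "integral (\<tau> ` T) w' = integral T w" if "w absolutely_integrable_on T"
    using ch'[of "integral T w"] a i that by simp
  have "(\<integral>\<^sup>+ u \<in> T. ennreal (w u) \<partial>lborel) = (if w absolutely_integrable_on T then ennreal (integral T w) else \<infinity>)"
    by (rule nn_integral_absolutely_integrable[OF m(1)]) (rule w(1))
  also have "\<dots> = (if w' absolutely_integrable_on \<tau> ` T then ennreal (integral (\<tau> ` T) w') else \<infinity>)"
    using A B by simp
  also have "\<dots> = (\<integral>\<^sup>+ u \<in> \<tau> ` T. ennreal (w' u) \<partial>lborel)"
    by (rule nn_integral_absolutely_integrable[OF m(2), symmetric]) (use w(2) in auto)
  finally show ?thesis .
qed

lemma nn_integral_change_of_variables_real:
  fixes \<tau> :: "real \<Rightarrow> real"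
  assumes T: "T \<in> sets borel" and \<tau>: "\<And>x. x \<in> T \<Longrightarrow> (\<tau> has_field_derivative \<tau>' x) (at x within T)" "inj_on \<tau> T"
    and m: "(\<lambda>u. indicator T u * w u) \<in> borel_measurable borel" "(\<lambda>u. indicator (\<tau> ` T) u * w' u) \<in> borel_measurable borel"
    and w: "\<And>u. u \<in> T \<Longrightarrow> 0 \<le> w u" "\<And>u. u \<in> T \<Longrightarrow> 0 \<le> w' (\<tau> u)"
    and ww': "\<And>u. u \<in> T \<Longrightarrow> w u = \<bar>\<tau>' u\<bar> * w' (\<tau> u)"
  shows "(\<integral>\<^sup>+ u \<in> T. ennreal (w u) \<partial>lborel) = (\<integral>\<^sup>+ u \<in> \<tau> ` T. ennreal (w' u) \<partial>lborel)"
proof -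
  have "T \<in> sets lebesgue" using T by auto
  note ch' = has_absolute_integral_change_of_variables_1'[OF this \<tau>, where f=w']
  have a: "w absolutely_integrable_on T \<longleftrightarrow> (\<lambda>x. \<bar>\<tau>' x\<bar> * w' (\<tau> x)) absolutely_integrable_on T"
    unfolding set_integrable_def by (intro Bochner_Integration.integrable_cong) (auto simp: ww' indicator_def)
  have i: "integral T w = integral T (\<lambda>x. \<bar>\<tau>' x\<bar> * w' (\<tau> x))"
    by (intro Henstock_Kurzweil_Integration.integral_cong ww')
  have A: "w absolutely_integrable_on T \<longleftrightarrow> w' absolutely_integrable_on \<tau> ` T" using ch' a by blast
  have B: "integral (\<tau> ` T) w' = integral T w" if "w absolutely_integrable_on T"
    using ch'[of "integral T w"] a i that by simp
  have "(\<integral>\<^sup>+ u \<in> T. ennreal (w u) \<partial>lborel) = (if w absolutely_integrable_on T then ennreal (integral T w) else \<infinity>)"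
    by (rule nn_integral_absolutely_integrable[OF m(1)]) (rule w(1))
  also have "\<dots> = (if w' absolutely_integrable_on \<tau> ` T then ennreal (integral (\<tau> ` T) w') else \<infinity>)"
    using A B by simp
  also have "\<dots> = (\<integral>\<^sup>+ u \<in> \<tau> ` T. ennreal (w' u) \<partial>lborel)"
    by (rule nn_integral_absolutely_integrable[OF m(2), symmetric]) (use w(2) in auto)
  finally show ?thesis .
qed

lemma indicator_continuous_borel_measurable:
  fixes w :: "'e::euclidean_space \<Rightarrow> real"
  assumes "T \<in> sets borel" "T \<subseteq> R" "continuous_on R w"
  shows "(\<lambda>u. indicator T u * w u) \<in> borel_measurable borel"
  using borel_measurable_continuous_on_indicator[OF assms(1) continuous_on_subset[OF assms(3,2)]] by simp

lemma sets_preimage: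
  assumes "R \<in> sets borel" "continuous_on R \<gamma>" "\<gamma> ` R \<subseteq> X" "B \<in> sets (restrict_space borel X)"
  shows "{u\<in>R. \<gamma> u \<in> B} \<in> sets (borel :: 'e::euclidean_space measure)"
proof -
  have "\<gamma> -` B \<inter> space (restrict_space lborel R) \<in> sets (restrict_space lborel R)"
    by (rule measurable_sets[OF measurable_param[OF assms(2,3)] assms(4)])
  then have "\<gamma> -` B \<inter> space (restrict_space lborel R) \<in> sets borel"
    using assms(1) by (subst (asm) sets_restrict_space_iff) auto
  moreover have "\<gamma> -` B \<inter> space (restrict_space lborel R) = {u\<in>R. \<gamma> u \<in> B}" by (auto simp: space_restrict_space)
  ultimately show ?thesis by simp
qed

lemma vector_line: "vector [s, 0] = (s *\<^sub>R axis 1 1 :: real^2)"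
  by (simp add: vec_eq_iff forall_2)

context surface
begin

section \<open>Integration on the surface and along its boundary\<close>

lemma finite_cover: "\<exists>J. finite J \<and> J \<subseteq> A \<and> S = (\<Union>c\<in>J. chart_dom c)"
proof -
  have "\<forall>c\<in>A. \<exists>T. open T \<and> chart_dom c = S \<inter> T"
    using dom_openin by (simp add: openin_open)
  then obtain T where T: "\<And>c. c \<in> A \<Longrightarrow> open (T c)" "\<And>c. c \<in> A \<Longrightarrow> chart_dom c = S \<inter> T c" by metis
  have "S \<subseteq> (\<Union>c\<in>A. T c)" using dom_cover T(2) by blast
  then obtain J where J: "J \<subseteq> A" "finite J" "S \<subseteq> (\<Union>c\<in>J. T c)"
    by (rule compactE_image[OF compact_S T(1), rotated])
  then have "S = (\<Union>c\<in>J. chart_dom c)" using T(2) by blast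
  with J show ?thesis by blast
qed

lemma dom_sets: "c \<in> A \<Longrightarrow> chart_dom c \<in> sets (restrict_space borel S)"
proof -
  assume "c \<in> A"
  then obtain T where "open T" "chart_dom c = S \<inter> T" using dom_openin[of c] by (auto simp: openin_open)
  then show ?thesis by (auto simp: sets_restrict_space)
qed

lemma range_sets: "c \<in> A \<Longrightarrow> chart_range c \<in> sets borel"
proof -
  assume "c \<in> A"
  then obtain T where "open T" "chart_range c = half_plane \<inter> T" using range_openin[of c] by (auto simp: openin_open)
  moreover have "closed half_plane" unfolding half_plane_def by (intro closed_Collect_le continuous_intros)
  ultimately show ?thesis by auto
qed

lemma chart_inv_continuous: "c \<in> A \<Longrightarrow> continuous_on (chart_range c) (chart_inv c)"
  using chart_homeo by (simp add: homeomorphism_def)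

lemma chart_inv_image: "c \<in> A \<Longrightarrow> chart_inv c ` chart_range c = chart_dom c"
  using chart_homeo by (simp add: homeomorphism_def)

lemma continuous_in_chart:
  assumes "c \<in> A" "continuous_on (chart_dom c) G"
  shows "continuous_on (chart_range c) (\<lambda>u. G (chart_inv c u))"
  using assms chart_inv_continuous chart_inv_image by (intro continuous_on_compose2[OF assms(2)]) auto

lemma smooth_continuous: "c \<in> A \<Longrightarrow> smooth_in c (chart_dom c) G \<Longrightarrow> continuous_on (chart_dom c) G"
  by (rule smooth_in_continuous_on[OF patch_dom])

lemma det_matrix_transition: "det (matrix (differential c (chart_map c') p)) = jac_det c c' p"
  by (simp add: det_2 matrix_def jac_def jac_det_def coord_deriv_def)

text \<open>Two charts measure a common subset alike because sqrt(det g) picks up precisely the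
  Jacobian determinant of the transition map. Gluing then gives existence and uniqueness, without
  which the definite description would carry no information.\<close>

lemma area_measure:
  assumes im: "\<And>c. c \<in> A \<Longrightarrow> immersed c f"
  shows "sets (area_measure S A f) = sets (restrict_space borel S)"
    and "\<And>c B. c \<in> A \<Longrightarrow> B \<in> sets (restrict_space borel S) \<Longrightarrow> B \<subseteq> chart_dom c \<Longrightarrow>
      emeasure (area_measure S A f) B =
        (\<integral>\<^sup>+ u \<in> {u\<in>chart_range c. chart_inv c u \<in> B}. ennreal (sqrt (det (metric c f (chart_inv c u)))) \<partial>lborel)"
proof -
  define w where "w c u = sqrt (det (metric c f (chart_inv c u)))" for c u
  define N where "N c = chart_measure S (chart_range c) (chart_inv c) (w c)" for c
  define I where "I c B = {u\<in>chart_range c. chart_inv c u \<in> B}" for c :: "'a chart" and B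
  have wc: "continuous_on (chart_range c) (w c)" if "c \<in> A" for c
    unfolding w_def by (rule continuous_in_chart[OF that smooth_continuous[OF that smooth_geometry(2)[OF im[OF that]]]])
  have w0: "0 \<le> w c u" if "c \<in> A" "u \<in> chart_range c" for c u
    using im[OF that(1)] inv_in[OF that] unfolding immersed_def w_def by (auto intro: less_imp_le)
  have sub: "chart_inv c ` chart_range c \<subseteq> S" if "c \<in> A" for c
    using chart_inv_image dom_subset that by blast
  have emN: "emeasure (N c) B = (\<integral>\<^sup>+ u \<in> I c B. ennreal (w c u) \<partial>lborel)" if "c \<in> A" "B \<in> sets (restrict_space borel S)" for c B
    unfolding N_def I_def
    by (rule emeasure_chart_measure[OF range_sets[OF that(1)] chart_inv_continuous[OF that(1)] sub[OF that(1)] wc[OF that(1)] that(2)])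
  have I_sets: "I c B \<in> sets borel" if "c \<in> A" "B \<in> sets (restrict_space borel S)" for c B
    unfolding I_def by (rule sets_preimage[OF range_sets[OF that(1)] chart_inv_continuous[OF that(1)] sub[OF that(1)] that(2)])
  have cons: "emeasure (N c) B = emeasure (N c') B"
    if c: "c \<in> A" "c' \<in> A" and B: "B \<in> sets (restrict_space borel S)" "B \<subseteq> chart_dom c" "B \<subseteq> chart_dom c'" for c c' B
  proof -
    let ?\<tau> = "chart_map c' \<circ> chart_inv c"
    have img: "?\<tau> ` I c B = I c' B"
    proof
      show "?\<tau> ` I c B \<subseteq> I c' B"
        using B c inv_map[of c'] map_in[of _ c'] by (auto simp: I_def)
      show "I c' B \<subseteq> ?\<tau> ` I c B"
      proof
        fix v assume v: "v \<in> I c' B"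
        then have p: "chart_inv c' v \<in> B" "v \<in> chart_range c'" by (auto simp: I_def)
        have "v = ?\<tau> (chart_map c (chart_inv c' v))" using p B c inv_map[of c] map_inv[of c' v] by auto
        moreover have "chart_map c (chart_inv c' v) \<in> I c B" using p B c inv_map[of c] map_in[of _ c] by (auto simp: I_def)
        ultimately show "v \<in> ?\<tau> ` I c B" by blast
      qed
    qed
    have inj: "inj_on ?\<tau> (I c B)"
    proof (rule inj_onI)
      fix u v assume u: "u \<in> I c B" "v \<in> I c B" "?\<tau> u = ?\<tau> v"
      then have mem: "chart_inv c u \<in> chart_dom c'" "chart_inv c v \<in> chart_dom c'" using B by (auto simp: I_def)
      have "chart_inv c u = chart_inv c' (?\<tau> u)" using inv_map[OF c(2) mem(1)] by simp
      also have "\<dots> = chart_inv c' (?\<tau> v)" using u(3) by (simp only:)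
      also have "\<dots> = chart_inv c v" using inv_map[OF c(2) mem(2)] by simp
      finally have "chart_inv c u = chart_inv c v" .
      moreover have "u \<in> chart_range c" "v \<in> chart_range c" using u(1,2) by (simp_all add: I_def)
      ultimately show "u = v" using map_inv[OF c(1)] by metis
    qed
    have "(\<integral>\<^sup>+ u \<in> I c B. ennreal (w c u) \<partial>lborel) = (\<integral>\<^sup>+ u \<in> ?\<tau> ` I c B. ennreal (w c' u) \<partial>lborel)"
    proof (rule nn_integral_change_of_variables[OF I_sets[OF c(1) B(1)], of _ "\<lambda>u. differential c (chart_map c') (chart_inv c u)"])
      show "inj_on ?\<tau> (I c B)" by (rule inj)
      show "(\<lambda>u. indicator (I c B) u * w c u) \<in> borel_measurable borel"
        by (rule indicator_continuous_borel_measurable[OF I_sets[OF c(1) B(1)] _ wc[OF c(1)]]) (auto simp: I_def)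
      show "(\<lambda>u. indicator (?\<tau> ` I c B) u * w c' u) \<in> borel_measurable borel"
        unfolding img by (rule indicator_continuous_borel_measurable[OF I_sets[OF c(2) B(1)] _ wc[OF c(2)]]) (auto simp: I_def)
    next
      fix u assume u: "u \<in> I c B"
      define p where "p = chart_inv c u"
      have p: "p \<in> chart_dom c" "p \<in> chart_dom c'" "chart_map c p = u" "u \<in> chart_range c"
        using u B map_inv[OF c(1)] by (auto simp: I_def p_def)
      show "(?\<tau> has_derivative differential c (chart_map c') (chart_inv c u)) (at u within I c B)"
        using transition_has_derivative[OF c p(1,2)] unfolding p_def[symmetric] p(3)
        by (rule has_derivative_subset) (auto simp: I_def)
      show "0 \<le> w c u" using w0 c p by blast
      have tu: "?\<tau> u \<in> chart_range c'" "chart_inv c' (?\<tau> u) = p"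
        using p map_in[of p c'] inv_map[OF c(2), of p] by (simp_all add: p_def[symmetric])
      then show "0 \<le> w c' (?\<tau> u)" using w0 c by blast
      have f: "smooth_in c' (chart_dom c') f" using im[OF c(2)] by (simp add: immersed_def)
      have "jac_det c c' p > 0" unfolding jac_det_def by (rule jac_det_pos[OF c p(1,2)])
      then show "w c u = \<bar>det (matrix (differential c (chart_map c') (chart_inv c u)))\<bar> * w c' (?\<tau> u)"
        unfolding det_matrix_transition w_def tu(2) p_def[symmetric]
        using det_metric_change(2)[OF c p(1,2) smooth_in_overlap(1)[OF c p(1,2) f]] by simp
    qed
    then show ?thesis unfolding emN[OF c(1) B(1)] emN[OF c(2) B(1)] img .
  qed
  obtain J where J: "finite J" "J \<subseteq> A" "S = (\<Union>c\<in>J. chart_dom c)" using finite_cover by blast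
  have sp: "space (restrict_space borel S) = (\<Union>c\<in>J. chart_dom c)" using J(3) by (simp add: space_restrict_space)
  have ex: "\<exists>!M. sets M = sets (restrict_space borel S) \<and> (\<forall>c\<in>A. \<forall>B\<in>sets M. B \<subseteq> chart_dom c \<longrightarrow> emeasure M B = emeasure (N c) B)"
    by (rule glue_measure[OF _ dom_sets J(1,2) sp cons]) (auto simp: N_def)
  have im_I: "chart_map c ` B = I c B" if "c \<in> A" "B \<subseteq> chart_dom c" for c B
    using chart_map_image[OF that] by (auto simp: I_def)
  \<comment> \<open>The equivalence is for every candidate \<open>M\<close>, since unique existence
    has to be transferred to the predicate used in the definition. There the domain of integration
    is an image under the chart; here it is a preimage under the parametrization.\<close>
  have eq: "(sets M = sets (restrict_space borel S) \<and> (\<forall>c\<in>A. \<forall>B\<in>sets M. B \<subseteq> chart_dom c \<longrightarrow> emeasure M B = emeasure (N c) B))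
    \<longleftrightarrow> (sets M = sets (restrict_space borel S) \<and> (\<forall>c\<in>A. \<forall>B\<in>sets M. B \<subseteq> chart_dom c \<longrightarrow>
        emeasure M B = (\<integral>\<^sup>+ u \<in> chart_map c ` B. ennreal (sqrt (det (metric c f (chart_inv c u)))) \<partial>lborel)))" for M
    using emN im_I unfolding w_def by (intro conj_cong refl ball_cong imp_cong) auto
  have props: "sets (area_measure S A f) = sets (restrict_space borel S) \<and>
     (\<forall>c\<in>A. \<forall>B\<in>sets (area_measure S A f). B \<subseteq> chart_dom c \<longrightarrow> emeasure (area_measure S A f) B = emeasure (N c) B)"
    unfolding area_measure_def using theI'[OF ex] unfolding eq .
  then show s: "sets (area_measure S A f) = sets (restrict_space borel S)" by blast
  fix c B assume c: "c \<in> A" "B \<in> sets (restrict_space borel S)" "B \<subseteq> chart_dom c"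
  then have "emeasure (area_measure S A f) B = emeasure (N c) B" using props s by blast
  then show "emeasure (area_measure S A f) B =
        (\<integral>\<^sup>+ u \<in> {u\<in>chart_range c. chart_inv c u \<in> B}. ennreal (sqrt (det (metric c f (chart_inv c u)))) \<partial>lborel)"
    unfolding emN[OF c(1,2)] I_def w_def .
qed

lemma area_integral:
  assumes im: "\<And>c. c \<in> A \<Longrightarrow> immersed c f" and c: "c \<in> A"
    and \<psi>: "continuous_on (chart_dom c) \<psi>" and K: "compact K" "K \<subseteq> chart_range c"
    and supp: "\<And>p. p \<in> S \<Longrightarrow> p \<notin> chart_inv c ` K \<Longrightarrow> \<psi> p = 0"
  shows "integrable (area_measure S A f) \<psi>"
    "integral\<^sup>L (area_measure S A f) \<psi> = integral K (\<lambda>u. \<psi> (chart_inv c u) * sqrt (det (metric c f (chart_inv c u))))"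
proof -
  have wc: "continuous_on (chart_range c) (\<lambda>u. sqrt (det (metric c f (chart_inv c u))))"
    by (rule continuous_in_chart[OF c smooth_continuous[OF c smooth_geometry(2)[OF im[OF c]]]])
  have w0: "0 \<le> sqrt (det (metric c f (chart_inv c u)))" if "u \<in> chart_range c" for u
    using im[OF c] inv_in[OF c that] unfolding immersed_def by (auto intro: less_imp_le)
  have U: "chart_dom c \<in> sets (area_measure S A f)" using dom_sets[OF c] area_measure(1)[OF im] by simp
  have sR: "\<psi> (chart_inv c u) = 0" if "u \<in> chart_range c" "u \<notin> K" for u
  proof (rule supp)
    show "chart_inv c u \<in> S" using inv_in[OF c that(1)] dom_subset[OF c] by blast
    show "chart_inv c u \<notin> chart_inv c ` K"
    proof
      assume "chart_inv c u \<in> chart_inv c ` K"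
      then obtain v where "v \<in> K" "chart_inv c u = chart_inv c v" by blast
      then show False using map_inv[OF c, of u] map_inv[OF c, of v] that K(2) by auto
    qed
  qed
  note R = chart_integral[OF area_measure(1)[OF im] U range_sets[OF c] chart_inv_continuous[OF c]
      equalityD1[OF chart_inv_image[OF c]] wc w0 _ \<psi> K supp sR]
  show "integrable (area_measure S A f) \<psi>"
    by (rule R(1)) (use area_measure[OF im] c in auto)
  show "integral\<^sup>L (area_measure S A f) \<psi> = integral K (\<lambda>u. \<psi> (chart_inv c u) * sqrt (det (metric c f (chart_inv c u))))"
    by (rule R(2)) (use area_measure[OF im] c in auto)
qed

lemma boundary_iff: "c \<in> A \<Longrightarrow> p \<in> chart_dom c \<Longrightarrow> p \<in> surface_boundary A \<longleftrightarrow> chart_map c p $ 2 = 0"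
  unfolding surface_boundary_def using boundary_chart_independent by blast

text \<open>Each chart parametrizes its part of the boundary by the line where the second coordinate
  vanishes. Transition maps preserve this line and have along it the positive derivative
  \<open>jac c c' 1 1\<close>, the factor by which the line element changes. The later clauses
  record the properties of the parametrization required by \<open>chart_integral\<close>.\<close>

lemma length_measure:
  assumes im: "\<And>c. c \<in> A \<Longrightarrow> immersed c f"
  defines "X \<equiv> surface_boundary A"
  shows "sets (length_measure A f) = sets (restrict_space borel X)"
    and "\<And>c B. c \<in> A \<Longrightarrow> B \<in> sets (restrict_space borel X) \<Longrightarrow> B \<subseteq> chart_dom c \<Longrightarrow>
      emeasure (length_measure A f) B =
        (\<integral>\<^sup>+ s \<in> {s\<in>{s. vector [s, 0] \<in> chart_range c}. chart_inv c (vector [s, 0]) \<in> B}.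
           ennreal (sqrt (metric c f (chart_inv c (vector [s, 0])) $ 1 $ 1)) \<partial>lborel)"
    and "\<And>c. c \<in> A \<Longrightarrow> {s. vector [s, 0] \<in> chart_range c} \<in> sets borel"
    and "\<And>c. c \<in> A \<Longrightarrow> continuous_on {s. vector [s, 0] \<in> chart_range c} (\<lambda>s. chart_inv c (vector [s, 0]))"
    and "\<And>c. c \<in> A \<Longrightarrow> continuous_on {s. vector [s, 0] \<in> chart_range c} (\<lambda>s. sqrt (metric c f (chart_inv c (vector [s, 0])) $ 1 $ 1))"
    and "\<And>c. c \<in> A \<Longrightarrow> (\<lambda>s. chart_inv c (vector [s, 0])) ` {s. vector [s, 0] \<in> chart_range c} = chart_dom c \<inter> X"
    and "\<And>c. c \<in> A \<Longrightarrow> chart_dom c \<inter> X \<in> sets (restrict_space borel X)"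
proof -
  define R where "R c = {s. vector [s, 0] \<in> chart_range c}" for c :: "'a chart"
  define \<gamma> where "\<gamma> c s = chart_inv c (vector [s, 0])" for c :: "'a chart" and s :: real
  define w where "w c s = sqrt (metric c f (\<gamma> c s) $ 1 $ 1)" for c s
  define N where "N c = chart_measure X (R c) (\<gamma> c) (w c)" for c
  define I where "I c B = {s\<in>R c. \<gamma> c s \<in> B}" for c :: "'a chart" and B
  have lc: "continuous_on UNIV (\<lambda>s. vector [s, 0] :: real^2)" unfolding vector_line by (intro continuous_intros)
  have R_sets: "R c \<in> sets borel" if "c \<in> A" for c
  proof -
    have "(\<lambda>s. vector [s, 0] :: real^2) \<in> borel_measurable borel" using lc by (rule borel_measurable_continuous_onI)
    from measurable_sets[OF this range_sets[OF that]] show ?thesis by (simp add: R_def vimage_def)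
  qed
  then show "\<And>c. c \<in> A \<Longrightarrow> {s. vector [s, 0] \<in> chart_range c} \<in> sets borel" by (simp add: R_def)
  have comp: "continuous_on (R c) (\<lambda>s. G (vector [s, 0]))" if "continuous_on (chart_range c) G" for c and G :: "real^2 \<Rightarrow> 'c::topological_space"
    using continuous_on_compose2[OF that continuous_on_subset[OF lc subset_UNIV], of "R c"] by (auto simp: R_def)
  have \<gamma>c: "continuous_on (R c) (\<gamma> c)" if "c \<in> A" for c
    unfolding \<gamma>_def by (rule comp[OF chart_inv_continuous[OF that]])
  then show "\<And>c. c \<in> A \<Longrightarrow> continuous_on {s. vector [s, 0] \<in> chart_range c} (\<lambda>s. chart_inv c (vector [s, 0]))"
    by (simp add: R_def \<gamma>_def)
  have E0: "0 < metric c f p $ 1 $ 1" if "c \<in> A" "p \<in> chart_dom c" for c p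
    using interior_normal_eq(2)[of c f p] im[OF that(1)] that(2) by (simp add: immersed_def)
  have wc: "continuous_on (R c) (w c)" if c: "c \<in> A" for c
  proof -
    have "smooth_in c (chart_dom c) (\<lambda>p. sqrt (metric c f p $ 1 $ 1))"
      by (rule smooth_in_sqrt[OF patch_dom[OF c] smooth_geometry(1)[OF im[OF c]] E0[OF c]])
    from comp[OF continuous_in_chart[OF c smooth_continuous[OF c this]]] show ?thesis unfolding w_def \<gamma>_def .
  qed
  then show "\<And>c. c \<in> A \<Longrightarrow> continuous_on {s. vector [s, 0] \<in> chart_range c} (\<lambda>s. sqrt (metric c f (chart_inv c (vector [s, 0])) $ 1 $ 1))"
    by (simp add: R_def \<gamma>_def w_def)
  have w0: "0 \<le> w c s" if "c \<in> A" "s \<in> R c" for c s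
    using E0[OF that(1), of "\<gamma> c s"] inv_in[OF that(1)] that(2) by (auto simp: R_def \<gamma>_def w_def intro: less_imp_le)
  have g_img: "\<gamma> c ` R c = chart_dom c \<inter> X" if c: "c \<in> A" for c
  proof
    show "\<gamma> c ` R c \<subseteq> chart_dom c \<inter> X"
      using inv_in[OF c] map_inv[OF c] boundary_iff[OF c] by (auto simp: R_def \<gamma>_def X_def)
    show "chart_dom c \<inter> X \<subseteq> \<gamma> c ` R c"
    proof
      fix p assume p: "p \<in> chart_dom c \<inter> X"
      have v: "vector [chart_map c p $ 1, 0] = chart_map c p"
        using p boundary_iff[OF c, of p] by (auto simp: X_def vec_eq_iff forall_2)
      then have "chart_map c p $ 1 \<in> R c" "p = \<gamma> c (chart_map c p $ 1)"
        using p map_in[of p c] inv_map[OF c] by (auto simp: R_def \<gamma>_def)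
      then show "p \<in> \<gamma> c ` R c" by blast
    qed
  qed
  then show "\<And>c. c \<in> A \<Longrightarrow> (\<lambda>s. chart_inv c (vector [s, 0])) ` {s. vector [s, 0] \<in> chart_range c} = chart_dom c \<inter> X"
    unfolding R_def \<gamma>_def .
  have sub: "\<gamma> c ` R c \<subseteq> X" if "c \<in> A" for c using g_img[OF that] by blast
  have XS: "X \<subseteq> S" unfolding X_def surface_boundary_def using dom_subset by blast
  have U_sets: "chart_dom c \<inter> X \<in> sets (restrict_space borel X)" if c: "c \<in> A" for c
  proof -
    obtain T where "open T" "chart_dom c = S \<inter> T" using dom_openin[OF c] by (auto simp: openin_open)
    then have "chart_dom c \<inter> X = X \<inter> T" "T \<in> sets borel" using XS by auto
    then show ?thesis by (auto simp: sets_restrict_space)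
  qed
  then show "\<And>c. c \<in> A \<Longrightarrow> chart_dom c \<inter> X \<in> sets (restrict_space borel X)" .
  have emN: "emeasure (N c) B = (\<integral>\<^sup>+ s \<in> I c B. ennreal (w c s) \<partial>lborel)" if "c \<in> A" "B \<in> sets (restrict_space borel X)" for c B
    unfolding N_def I_def
    by (rule emeasure_chart_measure[OF R_sets[OF that(1)] \<gamma>c[OF that(1)] sub[OF that(1)] wc[OF that(1)] that(2)])
  have I_sets: "I c B \<in> sets borel" if "c \<in> A" "B \<in> sets (restrict_space borel X)" for c B
    unfolding I_def by (rule sets_preimage[OF R_sets[OF that(1)] \<gamma>c[OF that(1)] sub[OF that(1)] that(2)])
  have in_X: "B \<subseteq> X" if "B \<in> sets (restrict_space borel X)" for B
    using sets.sets_into_space[OF that] by (simp add: space_restrict_space)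
  have cons: "emeasure (N c) B = emeasure (N c') B"
    if c: "c \<in> A" "c' \<in> A" and B: "B \<in> sets (restrict_space borel X)" "B \<subseteq> chart_dom c \<inter> X" "B \<subseteq> chart_dom c' \<inter> X" for c c' B
  proof -
    define \<tau> where "\<tau> s = chart_map c' (\<gamma> c s) $ 1" for s
    have line: "vector [\<tau> s, 0] = chart_map c' (\<gamma> c s)" if "s \<in> I c B" for s
      using that B boundary_iff[OF c(2), of "\<gamma> c s"] by (auto simp: \<tau>_def I_def X_def vec_eq_iff forall_2)
    have g\<tau>: "\<gamma> c' (\<tau> s) = \<gamma> c s" "\<tau> s \<in> R c'" if "s \<in> I c B" for s
      using line[OF that] inv_map[OF c(2), of "\<gamma> c s"] map_in[of "\<gamma> c s" c'] that B by (auto simp: \<gamma>_def R_def I_def)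
    have g_inj: "s = s'" if "\<gamma> c s = \<gamma> c s'" "s \<in> R c" "s' \<in> R c" "c \<in> A" for c s s'
    proof -
      have "(vector [s, 0] :: real^2) = vector [s', 0]"
        using map_inv[OF that(4)] that by (metis \<gamma>_def R_def mem_Collect_eq)
      then show ?thesis by (metis vector_2(1))
    qed
    have img: "\<tau> ` I c B = I c' B"
    proof
      show "\<tau> ` I c B \<subseteq> I c' B" using g\<tau> by (auto simp: I_def)
      show "I c' B \<subseteq> \<tau> ` I c B"
      proof
        fix t assume t: "t \<in> I c' B"
        then have "\<gamma> c' t \<in> chart_dom c \<inter> X" using B by (auto simp: I_def)
        then obtain s where s: "s \<in> R c" "\<gamma> c s = \<gamma> c' t" using g_img[OF c(1)] by force
        then have sI: "s \<in> I c B" using t by (auto simp: I_def)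
        have "\<tau> s = t" using g_inj[of c' "\<tau> s" t] g\<tau>[OF sI] s t c by (auto simp: I_def)
        then show "t \<in> \<tau> ` I c B" using sI by blast
      qed
    qed
    have inj: "inj_on \<tau> (I c B)"
    proof (rule inj_onI)
      fix s t assume s: "s \<in> I c B" "t \<in> I c B" "\<tau> s = \<tau> t"
      then have "\<gamma> c s = \<gamma> c t" using g\<tau>(1) by metis
      then show "s = t" using g_inj[of c s t] s c by (auto simp: I_def)
    qed
    have "(\<integral>\<^sup>+ s \<in> I c B. ennreal (w c s) \<partial>lborel) = (\<integral>\<^sup>+ s \<in> \<tau> ` I c B. ennreal (w c' s) \<partial>lborel)"
    proof (rule nn_integral_change_of_variables_real[OF I_sets[OF c(1) B(1)], of _ "\<lambda>s. jac c c' 1 1 (\<gamma> c s)"])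
      show "inj_on \<tau> (I c B)" by (rule inj)
      show "(\<lambda>u. indicator (I c B) u * w c u) \<in> borel_measurable borel"
        by (rule indicator_continuous_borel_measurable[OF I_sets[OF c(1) B(1)] _ wc[OF c(1)]]) (auto simp: I_def)
      show "(\<lambda>u. indicator (\<tau> ` I c B) u * w c' u) \<in> borel_measurable borel"
        unfolding img by (rule indicator_continuous_borel_measurable[OF I_sets[OF c(2) B(1)] _ wc[OF c(2)]]) (auto simp: I_def)
    next
      fix s assume s: "s \<in> I c B"
      define p where "p = \<gamma> c s"
      have p: "p \<in> chart_dom c" "p \<in> chart_dom c'" "chart_map c p = s *\<^sub>R axis 1 1" "chart_map c' p $ 2 = 0" "s \<in> R c"
        using s B map_inv[OF c(1)] boundary_iff[OF c(2), of p] by (auto simp: I_def p_def R_def \<gamma>_def X_def vector_line)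
      have "(\<lambda>t. t *\<^sub>R axis 1 1) ` I c B \<subseteq> chart_range c" by (auto simp: I_def R_def vector_line)
      from has_derivative_subset[OF transition_has_derivative[OF c p(1,2)] this]
      have d: "(chart_map c' \<circ> chart_inv c has_derivative differential c (chart_map c') p)
         (at (s *\<^sub>R axis 1 1) within (\<lambda>t. t *\<^sub>R axis 1 1) ` I c B)" unfolding p(3) .
      have d0: "((\<lambda>t. t *\<^sub>R axis 1 1 :: real^2) has_derivative (\<lambda>t. t *\<^sub>R axis 1 1)) (at s within I c B)"
        by (auto intro!: derivative_eq_intros)
      have l: "linear (differential c (chart_map c') p)" using d by (rule has_derivative_linear)
      have "\<tau> = (\<lambda>x. (chart_map c' \<circ> chart_inv c) (x *\<^sub>R axis 1 1) $ 1)"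
        by (simp add: fun_eq_iff \<tau>_def \<gamma>_def vector_line)
      moreover have "(*) (jac c c' 1 1 p) = (\<lambda>x. differential c (chart_map c') p (x *\<^sub>R axis 1 1) $ 1)"
        by (simp add: fun_eq_iff linear_scale[OF l] jac_def coord_deriv_def)
      ultimately show "(\<tau> has_field_derivative jac c c' 1 1 (\<gamma> c s)) (at s within I c B)"
        using bounded_linear.has_derivative[OF bounded_linear_vec_nth has_derivative_in_compose[OF d0 d], of 1]
        unfolding has_field_derivative_def p_def[symmetric] by simp
      show "0 \<le> w c s" using w0 c p by blast
      show "0 \<le> w c' (\<tau> s)" using w0 c g\<tau>(2)[OF s] by blast
      have f: "smooth_in c' (chart_dom c') f" using im[OF c(2)] by (simp add: immersed_def)
      note jb = jac_boundary[OF c p(1,2,4)]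
      have "metric c f p $ 1 $ 1 = (jac c c' 1 1 p)\<^sup>2 * metric c' f p $ 1 $ 1"
        unfolding metric_change[OF c p(1,2) smooth_in_overlap(1)[OF c p(1,2) f]] jb(1) by (simp add: power2_eq_square)
      then show "w c s = \<bar>jac c c' 1 1 (\<gamma> c s)\<bar> * w c' (\<tau> s)"
        unfolding w_def g\<tau>(1)[OF s] p_def[symmetric] by (simp add: real_sqrt_mult)
    qed
    then show ?thesis unfolding emN[OF c(1) B(1)] emN[OF c(2) B(1)] img .
  qed
  obtain J where J: "finite J" "J \<subseteq> A" "S = (\<Union>c\<in>J. chart_dom c)" using finite_cover by blast
  have sp: "space (restrict_space borel X) = (\<Union>c\<in>J. chart_dom c \<inter> X)" using J(3) XS by (auto simp: space_restrict_space)
  have ex: "\<exists>!M. sets M = sets (restrict_space borel X) \<and> (\<forall>c\<in>A. \<forall>B\<in>sets M. B \<subseteq> chart_dom c \<inter> X \<longrightarrow> emeasure M B = emeasure (N c) B)"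
    by (rule glue_measure[OF _ U_sets J(1,2) sp cons]) (auto simp: N_def)
  have im_I: "{s. vector [s, 0] \<in> chart_map c ` B} = I c B" if "c \<in> A" "B \<subseteq> chart_dom c" for c B
    using chart_map_image[OF that] by (auto simp: I_def R_def \<gamma>_def)
  have eq: "(sets M = sets (restrict_space borel X) \<and> (\<forall>c\<in>A. \<forall>B\<in>sets M. B \<subseteq> chart_dom c \<inter> X \<longrightarrow> emeasure M B = emeasure (N c) B))
    \<longleftrightarrow> (sets M = sets (restrict_space borel (surface_boundary A)) \<and> (\<forall>c\<in>A. \<forall>B\<in>sets M. B \<subseteq> chart_dom c \<longrightarrow>
        emeasure M B = (\<integral>\<^sup>+ s \<in> {s. vector [s, 0] \<in> chart_map c ` B}. ennreal (sqrt (metric c f (chart_inv c (vector [s, 0])) $ 1 $ 1)) \<partial>lborel)))" for M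
    unfolding X_def[symmetric] using emN im_I in_X unfolding w_def \<gamma>_def[symmetric]
    by (intro conj_cong refl ball_cong imp_cong) auto
  have props: "sets (length_measure A f) = sets (restrict_space borel X) \<and>
     (\<forall>c\<in>A. \<forall>B\<in>sets (length_measure A f). B \<subseteq> chart_dom c \<inter> X \<longrightarrow> emeasure (length_measure A f) B = emeasure (N c) B)"
    unfolding length_measure_def using theI'[OF ex] unfolding eq .
  then show s: "sets (length_measure A f) = sets (restrict_space borel X)" by blast
  fix c B assume c: "c \<in> A" "B \<in> sets (restrict_space borel X)" "B \<subseteq> chart_dom c"
  have "B \<in> sets (length_measure A f)" "B \<subseteq> chart_dom c \<inter> X" using c(2,3) s in_X by simp_all
  then have "emeasure (length_measure A f) B = emeasure (N c) B"
    by (rule props[THEN conjunct2, rule_format, OF c(1)])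
  then show "emeasure (length_measure A f) B =
        (\<integral>\<^sup>+ s \<in> {s\<in>{s. vector [s, 0] \<in> chart_range c}. chart_inv c (vector [s, 0]) \<in> B}.
           ennreal (sqrt (metric c f (chart_inv c (vector [s, 0])) $ 1 $ 1)) \<partial>lborel)"
    unfolding emN[OF c(1,2)] I_def w_def \<gamma>_def R_def .
qed

lemma length_integral:
  assumes im: "\<And>c. c \<in> A \<Longrightarrow> immersed c f" and c: "c \<in> A"
    and \<psi>: "continuous_on (chart_dom c \<inter> surface_boundary A) \<psi>" and K: "compact K" "K \<subseteq> {s. vector [s, 0] \<in> chart_range c}"
    and supp: "\<And>p. p \<in> surface_boundary A \<Longrightarrow> p \<notin> (\<lambda>s. chart_inv c (vector [s, 0])) ` K \<Longrightarrow> \<psi> p = 0"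
  shows "integrable (length_measure A f) \<psi>"
    "integral\<^sup>L (length_measure A f) \<psi> =
      integral K (\<lambda>s. \<psi> (chart_inv c (vector [s, 0])) * sqrt (metric c f (chart_inv c (vector [s, 0])) $ 1 $ 1))"
proof -
  have w0: "0 \<le> sqrt (metric c f (chart_inv c (vector [s, 0])) $ 1 $ 1)" for s by (simp add: metric_nth)
  have U: "chart_dom c \<inter> surface_boundary A \<in> sets (length_measure A f)"
    using length_measure(7)[OF im c] length_measure(1)[OF im] by simp
  have sR: "\<psi> (chart_inv c (vector [s, 0])) = 0" if "s \<in> {s. vector [s, 0] \<in> chart_range c}" "s \<notin> K" for s
  proof (rule supp)
    show "chart_inv c (vector [s, 0]) \<in> surface_boundary A" using that length_measure(6)[OF im c] by blast
    show "chart_inv c (vector [s, 0]) \<notin> (\<lambda>s. chart_inv c (vector [s, 0])) ` K"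
    proof
      assume "chart_inv c (vector [s, 0]) \<in> (\<lambda>s. chart_inv c (vector [s, 0])) ` K"
      then obtain t where t: "t \<in> K" "chart_inv c (vector [s, 0]) = chart_inv c (vector [t, 0])" by blast
      then have "(vector [s, 0] :: real^2) = vector [t, 0]"
        using map_inv[OF c, of "vector [s, 0]"] map_inv[OF c, of "vector [t, 0]"] that K(2) by auto
      then show False using t that by (metis vector_2(1))
    qed
  qed
  note R = chart_integral[OF length_measure(1)[OF im] U length_measure(3)[OF im c] length_measure(4)[OF im c]
      equalityD1[OF length_measure(6)[OF im c]] length_measure(5)[OF im c] w0 _ \<psi> K supp sR]
  show "integrable (length_measure A f) \<psi>"
    by (rule R(1)) (use length_measure[OF im] c in auto)
  show "integral\<^sup>L (length_measure A f) \<psi> =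
      integral K (\<lambda>s. \<psi> (chart_inv c (vector [s, 0])) * sqrt (metric c f (chart_inv c (vector [s, 0])) $ 1 $ 1))"
    by (rule R(2)) (use length_measure[OF im] c in auto)
qed

end

section \<open>A partition of unity subordinate to rectangles\<close>

text \<open>At 0 the difference quotient in \<open>h\<close> is \<open>max 0 h\<close>, which tends
  to zero; elsewhere the function is locally a square or zero.\<close>

lemma max_0_square_derivative:
  "((\<lambda>x. (max 0 x)\<^sup>2) has_real_derivative 2 * max 0 x) (at (x::real))"
proof (cases "x = 0")
  case True
  have "((\<lambda>h. max 0 h) \<longlongrightarrow> max 0 (0::real)) (at 0)" by (intro tendsto_intros)
  moreover have "eventually (\<lambda>h. ((max 0 (0 + h))\<^sup>2 - (max 0 0)\<^sup>2) / h = max 0 h) (at (0::real))"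
    by (auto simp: eventually_at_filter max_def power2_eq_square)
  ultimately have "((\<lambda>h. ((max 0 (0 + h))\<^sup>2 - (max 0 0)\<^sup>2) / h) \<longlongrightarrow> 0) (at (0::real))"
    using tendsto_cong by force
  then show ?thesis using True by (simp add: DERIV_def)
next
  case False
  then consider "x > 0" | "x < 0" by linarith
  then show ?thesis
  proof cases
    case 1
    have "((\<lambda>x. x\<^sup>2) has_real_derivative 2 * max 0 x) (at x)" using 1 by (auto intro!: derivative_eq_intros)
    then show ?thesis by (rule has_field_derivative_transform_within_open[of _ _ _ "{0<..}"]) (use 1 in auto)
  next
    case 2
    have "((\<lambda>x. 0) has_real_derivative 2 * max 0 x) (at x)" using 2 by simp
    then show ?thesis by (rule has_field_derivative_transform_within_open[of _ _ _ "{..<0}"]) (use 2 in auto)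
  qed
qed

text \<open>A polynomial on the interval of radius |r| about \<open>m\<close>, squared at its ends
  so that the continuation by zero is of class C1.\<close>

definition bump1 :: "real \<Rightarrow> real \<Rightarrow> real \<Rightarrow> real" where
  "bump1 m r x = (max 0 (r\<^sup>2 - (x - m)\<^sup>2))\<^sup>2"

definition bump1' :: "real \<Rightarrow> real \<Rightarrow> real \<Rightarrow> real" where
  "bump1' m r x = 2 * max 0 (r\<^sup>2 - (x - m)\<^sup>2) * (- 2 * (x - m))"

lemma bump1_derivative: "(bump1 m r has_real_derivative bump1' m r x) (at x)"
  unfolding bump1_def[abs_def] bump1'_def
  by (rule DERIV_chain2[OF max_0_square_derivative]) (auto intro!: derivative_eq_intros)

lemma bump1_pos_iff: "0 < bump1 m r x \<longleftrightarrow> \<bar>x - m\<bar> < \<bar>r\<bar>"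
proof -
  have "0 < bump1 m r x \<longleftrightarrow> (x - m)\<^sup>2 < r\<^sup>2" by (auto simp: bump1_def max_def)
  then show ?thesis by (metis abs_le_square_iff linorder_not_less)
qed

lemma bump1_nonneg: "0 \<le> bump1 m r x" by (simp add: bump1_def)

definition bump :: "real^2 \<Rightarrow> real \<Rightarrow> real^2 \<Rightarrow> real" where
  "bump m r u = bump1 (m $ 1) r (u $ 1) * bump1 (m $ 2) r (u $ 2)"

definition bump' :: "real^2 \<Rightarrow> real \<Rightarrow> 2 \<Rightarrow> real^2 \<Rightarrow> real" where
  "bump' m r i u = (if i = 1 then bump1' (m $ 1) r (u $ 1) * bump1 (m $ 2) r (u $ 2)
     else bump1 (m $ 1) r (u $ 1) * bump1' (m $ 2) r (u $ 2))"

lemma bump_derivative: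
  "(bump m r has_derivative (\<lambda>v. v $ 1 * bump' m r 1 u + v $ 2 * bump' m r 2 u)) (at u within D)"
proof -
  have d: "((\<lambda>u. bump1 k r (u $ i)) has_derivative (\<lambda>v. bump1' k r (u $ i) * v $ i)) (at u within D)" for k i
    by (rule has_derivative_compose[OF bounded_linear_imp_has_derivative[OF bounded_linear_vec_nth]
          bump1_derivative[unfolded has_field_derivative_def]])
  show ?thesis
    unfolding bump_def[abs_def]
    by (rule has_derivative_eq_rhs[OF has_derivative_mult[OF d d]]) (simp add: bump'_def fun_eq_iff)
qed

lemma continuous_on_bump': "continuous_on D (bump' m r i)"
proof -
  have "continuous_on D (\<lambda>u. bump1 k r (u $ j))" "continuous_on D (\<lambda>u. bump1' k r (u $ j))" for k j
    unfolding bump1_def bump1'_def by (intro continuous_intros)+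
  then show ?thesis unfolding bump'_def[abs_def] by (cases "i = 1") (auto intro!: continuous_intros)
qed

lemma continuous_on_local:
  fixes F :: "'a::t2_space \<Rightarrow> 'b::topological_space"
  assumes "\<And>x. x \<in> D \<Longrightarrow> \<exists>U. openin (top_of_set D) U \<and> x \<in> U \<and> continuous_on U F"
  shows "continuous_on D F"
  unfolding continuous_on_eq_continuous_within
proof
  fix x assume "x \<in> D"
  then obtain U where U: "openin (top_of_set D) U" "x \<in> U" "continuous_on U F" using assms by blast
  then have "continuous (at x within U) F" by (simp add: continuous_on_eq_continuous_within)
  then show "continuous (at x within D) F" by (simp add: at_within_openin[OF U(1,2)])
qed

context surface
begin

definition C1_in :: "'a chart \<Rightarrow> ('a \<Rightarrow> real) \<Rightarrow> bool" where
  "C1_in c \<rho> \<longleftrightarrow> (\<forall>p\<in>chart_dom c. differentiable_in c \<rho> p) \<and> (\<forall>i. continuous_on (chart_dom c) (coord_deriv c i \<rho>))"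

lemma C1_in_continuous:
  assumes "c \<in> A" "C1_in c \<rho>"
  shows "continuous_on (chart_dom c) \<rho>"
proof -
  have "continuous_on (chart_range c) (\<rho> \<circ> chart_inv c)"
    unfolding continuous_on_eq_continuous_within
  proof
    fix u assume u: "u \<in> chart_range c"
    then have "differentiable_in c \<rho> (chart_inv c u)" using assms inv_in by (auto simp: C1_in_def)
    then show "continuous (at u within chart_range c) (\<rho> \<circ> chart_inv c)"
      unfolding differentiable_in_def using map_inv[OF assms(1) u] differentiable_imp_continuous_within by metis
  qed
  then have "continuous_on (chart_dom c) (\<lambda>p. (\<rho> \<circ> chart_inv c) (chart_map c p))"
    by (rule continuous_on_compose2) (use chart_homeo[OF assms(1)] in \<open>simp_all add: homeomorphism_def\<close>)
  then show ?thesis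
    by (rule continuous_on_cong[THEN iffD1, rotated 2]) (use inv_map[OF assms(1)] in auto)
qed

lemma C1_in_has: "c \<in> A \<Longrightarrow> C1_in c \<rho> \<Longrightarrow> p \<in> chart_dom c \<Longrightarrow> has_coord_deriv c i \<rho> p (coord_deriv c i \<rho> p)"
  by (intro has_coord_derivI) (auto simp: C1_in_def)

lemma C1_inI:
  assumes "c \<in> A" "\<And>p i. p \<in> chart_dom c \<Longrightarrow> has_coord_deriv c i F p (D i p)" "\<And>i. continuous_on (chart_dom c) (D i)"
  shows "C1_in c F"
  unfolding C1_in_def
proof (intro conjI ballI allI)
  show "differentiable_in c F p" if "p \<in> chart_dom c" for p using has_coord_derivD(2)[OF assms(2)[OF that]] .
  show "continuous_on (chart_dom c) (coord_deriv c i F)" for i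
    using assms(3)[of i] by (rule continuous_on_cong[THEN iffD1, rotated 2]) (simp_all add: has_coord_derivD(1)[OF assms(2)])
qed

lemma C1_in_const: "c \<in> A \<Longrightarrow> C1_in c (\<lambda>p. k)"
  by (rule C1_inI[of _ _ "\<lambda>i p. 0"]) (auto intro: has_coord_deriv_const)

lemma C1_in_add:
  assumes "c \<in> A" "C1_in c F" "C1_in c G"
  shows "C1_in c (\<lambda>p. F p + G p)"
  by (rule C1_inI[OF assms(1) has_coord_deriv_add[OF C1_in_has[OF assms(1,2)] C1_in_has[OF assms(1,3)]]])
    (use assms in \<open>auto simp: C1_in_def intro!: continuous_intros\<close>)

lemma C1_in_sum:
  assumes "c \<in> A" "finite P" "\<And>k. k \<in> P \<Longrightarrow> C1_in c (F k)"
  shows "C1_in c (\<lambda>p. \<Sum>k\<in>P. F k p)"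
  using assms(2,3) by (induction P) (auto intro: C1_in_const C1_in_add assms(1))

lemma C1_in_divide:
  assumes "c \<in> A" "C1_in c F" "C1_in c G" "\<And>p. p \<in> chart_dom c \<Longrightarrow> G p \<noteq> 0"
  shows "C1_in c (\<lambda>p. F p / G p)"
proof (rule C1_inI[OF assms(1)])
  show "has_coord_deriv c i (\<lambda>q. F q / G q) p ((coord_deriv c i F p * G p - F p * coord_deriv c i G p) / (G p * G p))"
    if "p \<in> chart_dom c" for p i
    by (rule has_coord_deriv_divide[OF C1_in_has[OF assms(1,2) that] C1_in_has[OF assms(1,3) that] assms(4)[OF that]])
  show "continuous_on (chart_dom c) (\<lambda>p. (coord_deriv c i F p * G p - F p * coord_deriv c i G p) / (G p * G p))" for i
    using assms C1_in_continuous[OF assms(1,2)] C1_in_continuous[OF assms(1,3)]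
    by (intro continuous_intros) (auto simp: C1_in_def)
qed

text \<open>The domain of an arbitrary chart \<open>d\<close> is covered by two relatively open
  sets: the overlap with \<open>c\<close>, where the chain rule applies, and the complement of the
  image of \<open>K\<close>, where the function is zero. The image is closed because it is compact
  in a Hausdorff space.\<close>

lemma chart_bump_C1:
  assumes c: "c \<in> A" and d: "d \<in> A" and K: "compact K" "K \<subseteq> chart_range c"
    and supp: "\<And>u. u \<in> chart_range c \<Longrightarrow> u \<notin> K \<Longrightarrow> bump m r u = 0"
  defines "B \<equiv> \<lambda>q. if q \<in> chart_dom c then bump m r (chart_map c q) else 0"
  shows "C1_in d B" and "\<And>p. p \<notin> chart_inv c ` K \<Longrightarrow> B p = 0"
proof -
  have Bc: "has_coord_deriv c i B q (bump' m r i (chart_map c q))" if q: "q \<in> chart_dom c" for q i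
  proof (rule has_coord_deriv_general[OF c q])
    show "((\<lambda>u. B (chart_inv c u)) has_derivative (\<lambda>v. v $ 1 * bump' m r 1 (chart_map c q) + v $ 2 * bump' m r 2 (chart_map c q)))
       (at (chart_map c q) within chart_range c)"
      by (rule has_derivative_transform[OF map_in[OF q] _ bump_derivative]) (use inv_in[OF c] map_inv[OF c] in \<open>simp add: B_def\<close>)
    have "\<forall>i. (axis i 1 :: real^2) $ 1 * bump' m r 1 (chart_map c q) + (axis i 1 :: real^2) $ 2 * bump' m r 2 (chart_map c q) = bump' m r i (chart_map c q)"
      unfolding forall_2 by simp
    then show "(axis i 1 :: real^2) $ 1 * bump' m r 1 (chart_map c q) + (axis i 1 :: real^2) $ 2 * bump' m r 2 (chart_map c q) = bump' m r i (chart_map c q)" ..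
  qed
  show z: "B p = 0" if "p \<notin> chart_inv c ` K" for p
  proof (cases "p \<in> chart_dom c")
    case True
    then have "chart_map c p \<notin> K" using that inv_map[OF c True] by (metis imageI)
    then show ?thesis using supp map_in[OF True] by (simp add: B_def)
  qed (simp add: B_def)
  have "compact (chart_inv c ` K)"
    by (rule compact_continuous_image[OF _ K(1)]) (use chart_homeo[OF c] K(2) in \<open>auto simp: homeomorphism_def intro: continuous_on_subset\<close>)
  then have cl: "closed (chart_inv c ` K)" by (rule compact_imp_closed)
  define U1 where "U1 = chart_dom d \<inter> chart_dom c"
  define U2 where "U2 = chart_dom d - chart_inv c ` K"
  have U1: "patch d U1" unfolding U1_def by (rule patch_overlap[OF d c])
  have "U2 = chart_dom d \<inter> - chart_inv c ` K" unfolding U2_def by blast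
  then have U2: "patch d U2" using cl d unfolding patch_def by (auto intro: openin_open_Int)
  have cov: "q \<in> U1 \<or> q \<in> U2" if "q \<in> chart_dom d" for q
    using that K(2) inv_in[OF c] unfolding U1_def U2_def by blast
  have D2: "has_coord_deriv d i B q 0" if "q \<in> U2" for q i
    by (rule has_coord_deriv_local[OF U2 that _ has_coord_deriv_const[OF d]]) (use z that U2_def in auto)
  have D1: "has_coord_deriv d i B q (jac d c 1 i q * bump' m r 1 (chart_map c q) + jac d c 2 i q * bump' m r 2 (chart_map c q))"
    if "q \<in> U1" for q i
  proof -
    have q: "q \<in> chart_dom d" "q \<in> chart_dom c" using that by (auto simp: U1_def)
    note D = has_coord_derivD(2)[OF Bc[OF q(2)]]
    show ?thesis
      using has_coord_derivI[OF d q(1) differential_change(1)[OF d c q D], of i]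
      unfolding coord_deriv_change[OF d c q D] has_coord_derivD(1)[OF Bc[OF q(2)]] by simp
  qed
  show "C1_in d B"
    unfolding C1_in_def
  proof (intro conjI ballI allI)
    fix q assume "q \<in> chart_dom d"
    then show "differentiable_in d B q" using cov D1[of q 1] D2[of q 1] has_coord_derivD(2) by blast
  next
    fix i
    show "continuous_on (chart_dom d) (coord_deriv d i B)"
    proof (rule continuous_on_local)
      fix q assume q: "q \<in> chart_dom d"
      have "continuous_on U2 (coord_deriv d i B)"
        by (rule continuous_on_cong[THEN iffD1, OF refl _ continuous_on_const[of _ 0]]) (simp add: has_coord_derivD(1)[OF D2])
      moreover have "continuous_on U1 (coord_deriv d i B)"
      proof -
        have cm: "continuous_on U1 (chart_map c)"
          using chart_homeo[OF c] unfolding homeomorphism_def U1_def by (blast intro: continuous_on_subset)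
        have "continuous_on U1 (\<lambda>q. jac d c 1 i q * bump' m r 1 (chart_map c q) + jac d c 2 i q * bump' m r 2 (chart_map c q))"
          using smooth_in_continuous_on[OF patch_overlap[OF d c] smooth_in_jac[OF d c]]
          by (intro continuous_intros continuous_on_compose2[OF continuous_on_bump'[of UNIV] cm]) (auto simp: U1_def)
        then show ?thesis
          by (rule continuous_on_cong[THEN iffD1, rotated 2]) (simp_all add: has_coord_derivD(1)[OF D1])
      qed
      ultimately show "\<exists>U. openin (top_of_set (chart_dom d)) U \<and> q \<in> U \<and> continuous_on U (coord_deriv d i B)"
        using cov[OF q] U1 U2 unfolding patch_def by blast
    qed
  qed
qed

text \<open>The bump lives on a square about \<open>m\<close>, clipped at the boundary line. It
  vanishes on the sides of the square, so on the rectangle it can be nonzero only on a side created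
  by clipping, and such a side has second coordinate zero.\<close>

lemma chart_rectangle:
  assumes "c \<in> A" "m \<in> chart_range c"
  shows "\<exists>r a b. (\<forall>i. a $ i < b $ i) \<and> cbox a b \<subseteq> chart_range c \<and> 0 < bump m r m \<and>
    (\<forall>u. u \<in> chart_range c \<longrightarrow> u \<notin> cbox a b \<longrightarrow> bump m r u = 0) \<and>
    (\<forall>u. u $ 1 = a $ 1 \<or> u $ 1 = b $ 1 \<or> u $ 2 = b $ 2 \<or> (u $ 2 = a $ 2 \<and> a $ 2 \<noteq> 0) \<longrightarrow> bump m r u = 0) \<and>
    0 \<le> a $ 2"
proof -
  obtain T where T: "open T" "chart_range c = half_plane \<inter> T" using range_openin[OF assms(1)] by (auto simp: openin_open)
  obtain e where e: "e > 0" "ball m e \<subseteq> T" using T assms(2) by (metis IntD2 open_contains_ball)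
  have m2: "0 \<le> m $ 2" by (rule range_half_plane[OF assms])
  \<comment> \<open>The bound \<open>e / 3\<close> puts the square inside the ball of radius
    \<open>e\<close>, since its points are within \<open>2 * r\<close> of the centre. For an
    interior point the second bound keeps the square off the boundary line, so clipping happens only
    at boundary points.\<close>
  define r where "r = (if m $ 2 = 0 then e / 3 else min (e / 3) (m $ 2 / 2))"
  have r: "0 < r" "r \<le> e / 3" "m $ 2 \<noteq> 0 \<Longrightarrow> r < m $ 2" using e m2 by (auto simp: r_def)
  define a :: "real^2" where "a = vector [m $ 1 - r, max 0 (m $ 2 - r)]"
  define b :: "real^2" where "b = vector [m $ 1 + r, m $ 2 + r]"
  have box: "u \<in> cbox a b \<longleftrightarrow> \<bar>u $ 1 - m $ 1\<bar> \<le> r \<and> \<bar>u $ 2 - m $ 2\<bar> \<le> r \<and> 0 \<le> u $ 2" for u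
    unfolding mem_box_cart forall_2 a_def b_def by auto
  show ?thesis
  proof (rule exI[of _ r], rule exI[of _ a], rule exI[of _ b], intro conjI)
    have "\<forall>i. a $ i < b $ i" unfolding forall_2 a_def b_def using r m2 by auto
    then show "\<forall>i. a $ i < b $ i" .
    show "cbox a b \<subseteq> chart_range c"
    proof
      fix u assume u: "u \<in> cbox a b"
      have "dist m u = norm (u - m)" by (simp add: dist_norm norm_minus_commute)
      also have "\<dots> \<le> (\<Sum>i\<in>UNIV. \<bar>(u - m) $ i\<bar>)" by (rule norm_le_l1_cart)
      also have "\<dots> \<le> 2 * r" using u unfolding box sum_2 by simp
      also have "\<dots> < e" using r e by linarith
      finally have "u \<in> T" using e by auto
      then show "u \<in> chart_range c" using u T unfolding box half_plane_def by auto
    qed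
    show "0 < bump m r m" using r by (simp add: bump_def bump1_pos_iff)
    show "\<forall>u. u \<in> chart_range c \<longrightarrow> u \<notin> cbox a b \<longrightarrow> bump m r u = 0"
    proof (intro allI impI)
      fix u assume u: "u \<in> chart_range c" "u \<notin> cbox a b"
      have "\<not> (\<bar>u $ 1 - m $ 1\<bar> \<le> r \<and> \<bar>u $ 2 - m $ 2\<bar> \<le> r)"
        using u range_half_plane[OF assms(1) u(1)] unfolding box by blast
      then have "\<not> 0 < bump1 (m $ 1) r (u $ 1) \<or> \<not> 0 < bump1 (m $ 2) r (u $ 2)"
        unfolding bump1_pos_iff using r by auto
      then have "bump1 (m $ 1) r (u $ 1) = 0 \<or> bump1 (m $ 2) r (u $ 2) = 0"
        using bump1_nonneg[of "m $ 1" r "u $ 1"] bump1_nonneg[of "m $ 2" r "u $ 2"] by auto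
      then show "bump m r u = 0" by (auto simp: bump_def)
    qed
    show "\<forall>u. u $ 1 = a $ 1 \<or> u $ 1 = b $ 1 \<or> u $ 2 = b $ 2 \<or> (u $ 2 = a $ 2 \<and> a $ 2 \<noteq> 0) \<longrightarrow> bump m r u = 0"
    proof (intro allI impI)
      fix u :: "real^2" assume u: "u $ 1 = a $ 1 \<or> u $ 1 = b $ 1 \<or> u $ 2 = b $ 2 \<or> (u $ 2 = a $ 2 \<and> a $ 2 \<noteq> 0)"
      have "\<bar>u $ 1 - m $ 1\<bar> = r \<or> \<bar>u $ 2 - m $ 2\<bar> = r"
        using u r m2 by (auto simp: a_def b_def max_def split: if_splits)
      then have "(u $ 1 - m $ 1)\<^sup>2 = r\<^sup>2 \<or> (u $ 2 - m $ 2)\<^sup>2 = r\<^sup>2" by (metis power2_abs)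
      then show "bump m r u = 0" by (auto simp: bump_def bump1_def)
    qed
    show "0 \<le> a $ 2" by (simp add: a_def)
  qed
qed

end

text \<open>The rectangle of each cut-off lives in its own chart, but differentiability is demanded
  in every chart: the derivatives of all cut-offs at a point have to be added in one common
  chart.\<close>

locale partitioned_surface = surface S A for S :: "'a::t2_space set" and A :: "'a chart set" +
  fixes P :: "'a set" and c :: "'a \<Rightarrow> 'a chart" and a b :: "'a \<Rightarrow> real^2" and \<rho> :: "'a \<Rightarrow> 'a \<Rightarrow> real"
  assumes finite_P: "finite P"
    and chart_P: "k \<in> P \<Longrightarrow> c k \<in> A"
    and box_range: "k \<in> P \<Longrightarrow> cbox (a k) (b k) \<subseteq> chart_range (c k)"
    and box_less: "k \<in> P \<Longrightarrow> a k $ i < b k $ i"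
    and box_nonneg: "k \<in> P \<Longrightarrow> 0 \<le> a k $ 2"
    and support: "k \<in> P \<Longrightarrow> p \<in> S \<Longrightarrow> p \<notin> chart_inv (c k) ` cbox (a k) (b k) \<Longrightarrow> \<rho> k p = 0"
    and C1: "k \<in> P \<Longrightarrow> d \<in> A \<Longrightarrow> C1_in d (\<rho> k)"
    and box_boundary: "k \<in> P \<Longrightarrow> u \<in> cbox (a k) (b k) \<Longrightarrow>
      u $ 1 = a k $ 1 \<or> u $ 1 = b k $ 1 \<or> u $ 2 = b k $ 2 \<or> (u $ 2 = a k $ 2 \<and> a k $ 2 \<noteq> 0) \<Longrightarrow>
      \<rho> k (chart_inv (c k) u) = 0"
    and partition: "p \<in> S \<Longrightarrow> (\<Sum>k\<in>P. \<rho> k p) = 1"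

context surface
begin

text \<open>Each bump is positive at its centre, hence on a neighbourhood. Finitely many of these
  neighbourhoods cover the compact surface, so the sum of the corresponding bumps is positive and
  can be divided out. The index of a cut-off is the point at which its bump is centred.\<close>

theorem partition_of_unity: "\<exists>P c a b \<rho>. partitioned_surface S A P c a b \<rho>"
proof -
  define c where "c p = chart_at A p" for p
  have c: "c p \<in> A" "p \<in> chart_dom (c p)" if "p \<in> S" for p using chart_at[OF that] by (simp_all add: c_def)
  define m where "m p = chart_map (c p) p" for p
  define Q where "Q p r a b \<longleftrightarrow> (\<forall>i. a $ i < b $ i) \<and> cbox a b \<subseteq> chart_range (c p) \<and> 0 < bump (m p) r (m p) \<and>
    (\<forall>u. u \<in> chart_range (c p) \<longrightarrow> u \<notin> cbox a b \<longrightarrow> bump (m p) r u = 0) \<and>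
    (\<forall>u. u $ 1 = a $ 1 \<or> u $ 1 = b $ 1 \<or> u $ 2 = b $ 2 \<or> (u $ 2 = a $ 2 \<and> a $ 2 \<noteq> 0) \<longrightarrow> bump (m p) r u = 0) \<and> 0 \<le> a $ 2" for p r a b
  have "\<exists>r a b. Q p r a b" if p: "p \<in> S" for p
    unfolding Q_def by (rule chart_rectangle[OF c(1)[OF p]]) (simp add: m_def map_in[OF c(2)[OF p]])
  then obtain r a b where Q: "\<And>p. p \<in> S \<Longrightarrow> Q p (r p) (a p) (b p)" by metis
  have rab: "a p $ i < b p $ i" "cbox (a p) (b p) \<subseteq> chart_range (c p)" "bump (m p) (r p) (m p) > 0"
    "u \<in> chart_range (c p) \<Longrightarrow> u \<notin> cbox (a p) (b p) \<Longrightarrow> bump (m p) (r p) u = 0"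
    "u $ 1 = a p $ 1 \<or> u $ 1 = b p $ 1 \<or> u $ 2 = b p $ 2 \<or> (u $ 2 = a p $ 2 \<and> a p $ 2 \<noteq> 0) \<Longrightarrow> bump (m p) (r p) u = 0"
    "0 \<le> a p $ 2" if "p \<in> S" for p u i
    using Q[OF that] unfolding Q_def by blast+
  define B where "B p q = (if q \<in> chart_dom (c p) then bump (m p) (r p) (chart_map (c p) q) else 0)" for p q
  have C1: "C1_in d (B p)" and zero: "\<And>q. q \<notin> chart_inv (c p) ` cbox (a p) (b p) \<Longrightarrow> B p q = 0" if "p \<in> S" "d \<in> A" for p d
    using chart_bump_C1[OF c(1)[OF that(1)] that(2) compact_cbox rab(2)[OF that(1)] rab(4)[OF that(1)]]
    unfolding B_def[abs_def] by blast+
  have nonneg: "0 \<le> B p q" for p q by (simp add: B_def bump_def bump1_nonneg)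
  have pos: "0 < B p p" if "p \<in> S" for p using c(2)[OF that] rab(3)[OF that] by (simp add: B_def m_def)
  have "\<exists>T. open T \<and> p \<in> T \<and> (\<forall>q\<in>S \<inter> T. 0 < B p q)" if p: "p \<in> S" for p
  proof -
    have "continuous_on (chart_dom (c p)) (B p)" by (rule C1_in_continuous[OF c(1)[OF p] C1[OF p c(1)[OF p]]])
    then have "openin (top_of_set (chart_dom (c p))) (chart_dom (c p) \<inter> B p -` {0<..})"
      by (rule continuous_openin_preimage_gen) simp
    then have "openin (top_of_set S) (chart_dom (c p) \<inter> B p -` {0<..})"
      using dom_openin[OF c(1)[OF p]] openin_trans by blast
    then obtain T where "open T" "chart_dom (c p) \<inter> B p -` {0<..} = S \<inter> T" by (auto simp: openin_open)
    then show ?thesis using pos[OF p] c(2)[OF p] p by blast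
  qed
  then obtain T where T: "\<And>p. p \<in> S \<Longrightarrow> open (T p)" "\<And>p. p \<in> S \<Longrightarrow> p \<in> T p" "\<And>p q. p \<in> S \<Longrightarrow> q \<in> S \<Longrightarrow> q \<in> T p \<Longrightarrow> 0 < B p q"
    by (metis IntI)
  have "S \<subseteq> (\<Union>p\<in>S. T p)" using T(2) by blast
  then obtain P where P: "P \<subseteq> S" "finite P" "S \<subseteq> (\<Union>p\<in>P. T p)"
    by (rule compactE_image[OF compact_S T(1), rotated])
  define s where "s q = (\<Sum>p\<in>P. B p q)" for q
  have s: "0 < s q" if q: "q \<in> S" for q
  proof -
    obtain p where p: "p \<in> P" "q \<in> T p" using P(3) q by blast
    then have "0 < B p q" using T(3) P(1) q by blast
    also have "B p q \<le> s q" unfolding s_def by (rule member_le_sum[OF p(1)]) (use nonneg P(2) in auto)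
    finally show ?thesis .
  qed
  have "partitioned_surface S A P c a b (\<lambda>p q. B p q / s q)"
  proof unfold_locales
    fix k d assume k: "k \<in> P" and d: "d \<in> A"
    have sC: "C1_in d s" unfolding s_def[abs_def] by (rule C1_in_sum[OF d P(2)]) (use C1 P(1) d in blast)
    show "C1_in d (\<lambda>q. B k q / s q)"
    proof (rule C1_in_divide[OF d _ sC])
      show "C1_in d (B k)" using C1 k P(1) d by blast
      show "s p \<noteq> 0" if p: "p \<in> chart_dom d" for p
        using s[of p] dom_subset[OF d] p by auto
    qed
  next
    fix p assume "p \<in> S"
    then show "(\<Sum>k\<in>P. B k p / s p) = 1" using s[of p] by (simp add: sum_divide_distrib[symmetric] s_def)
  next
    fix k u assume k: "k \<in> P" and u: "u \<in> cbox (a k) (b k)"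
      "u $ 1 = a k $ 1 \<or> u $ 1 = b k $ 1 \<or> u $ 2 = b k $ 2 \<or> (u $ 2 = a k $ 2 \<and> a k $ 2 \<noteq> 0)"
    have kS: "k \<in> S" using k P(1) by blast
    have "chart_map (c k) (chart_inv (c k) u) = u" using map_inv[OF c(1)[OF kS]] rab(2)[OF kS] u(1) by blast
    then show "B k (chart_inv (c k) u) / s (chart_inv (c k) u) = 0" using rab(5)[OF kS u(2)] by (simp add: B_def)
  next
    fix k p assume "k \<in> P" "p \<in> S" "p \<notin> chart_inv (c k) ` cbox (a k) (b k)"
    then show "B k p / s p = 0" using zero[of k "c k" p] P(1) c(1) by auto
  next
    show "finite P" by (rule P(2))
  next
    fix k assume "k \<in> P"
    then have k: "k \<in> S" using P(1) by blast
    show "c k \<in> A" by (rule c(1)[OF k])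
    show "cbox (a k) (b k) \<subseteq> chart_range (c k)" by (rule rab(2)[OF k])
    show "0 \<le> a k $ 2" by (rule rab(6)[OF k])
    show "a k $ i < b k $ i" for i by (rule rab(1)[OF k])
  qed
  then show ?thesis by blast
qed

end

section \<open>The divergence theorem on a rectangle\<close>

lemma vector2_eq: "vector [x, y] = (x *\<^sub>R axis 1 1 + y *\<^sub>R axis 2 1 :: real^2)"
  by (simp add: vec_eq_iff forall_2)

text \<open>Iterated integration is carried over from pairs of reals by the coordinate map, which
  takes boxes to boxes of the same measure.\<close>

lemma integral_rectangle:
  fixes f :: "real^2 \<Rightarrow> real"
  assumes "continuous_on (cbox a b) f"
  shows "integral (cbox a b) f = integral {a $ 1..b $ 1} (\<lambda>x. integral {a $ 2..b $ 2} (\<lambda>y. f (vector [x, y])))"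
    "integral (cbox a b) f = integral {a $ 2..b $ 2} (\<lambda>y. integral {a $ 1..b $ 1} (\<lambda>x. f (vector [x, y])))"
proof -
  define g :: "real \<times> real \<Rightarrow> real^2" where "g z = vector [fst z, snd z]" for z
  define h :: "real^2 \<Rightarrow> real \<times> real" where "h u = (u $ 1, u $ 2)" for u
  have hg: "h (g z) = z" "g (h u) = u" for z u by (simp_all add: h_def g_def vec_eq_iff forall_2)
  have gmem: "g z \<in> cbox (g u) (g v) \<longleftrightarrow> z \<in> cbox u v" for z u v
    by (cases u; cases v; cases z) (auto simp: g_def mem_box_cart forall_2 cbox_Pair_eq)
  have g_box: "g ` cbox u v = cbox (g u) (g v)" for u v
  proof
    show "g ` cbox u v \<subseteq> cbox (g u) (g v)" using gmem by blast
    show "cbox (g u) (g v) \<subseteq> g ` cbox u v"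
    proof
      fix w assume "w \<in> cbox (g u) (g v)"
      then have "h w \<in> cbox u v" using gmem[of "h w" u v] by (simp add: hg)
      then show "w \<in> g ` cbox u v" using hg(2)[of w] by (metis imageI)
    qed
  qed
  have h_box: "h ` cbox u v = cbox (h u) (h v)" for u v
    using g_box[of "h u" "h v"] hg by (metis (no_types, lifting) image_cong image_image image_ident)
  have measure_eq: "measure lborel (g ` cbox u v) = measure lborel (cbox u v)" for u v
  proof (cases "cbox u v = {}")
    case False
    then have ne: "cbox (g u) (g v) \<noteq> {}" using g_box[of u v] by blast
    have le: "fst u \<le> fst v" "snd u \<le> snd v"
      using False by (cases u; cases v; auto simp: cbox_Pair_eq)+
    have "measure lborel (cbox (g u) (g v)) = (\<Prod>i\<in>UNIV. g v $ i - g u $ i)" by (rule content_cbox_cart[OF ne])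
    also have "\<dots> = (fst v - fst u) * (snd v - snd u)" by (simp add: UNIV_2 g_def)
    also have "\<dots> = measure lborel (cbox u v)" using le by (cases u; cases v) (simp add: content_Pair)
    finally show ?thesis by (simp add: g_box)
  qed simp
  have contg: "continuous (at z) g" for z
    unfolding g_def vector2_eq by (intro continuous_intros)
  have int: "f integrable_on cbox a b" by (rule integrable_continuous[OF assms])
  have "((\<lambda>z. f (g z)) has_integral (1 / 1) *\<^sub>R integral (cbox a b) f) (h ` cbox a b)"
  proof (rule has_integral_twiddle[OF zero_less_one hg contg _ _ _ integrable_integral[OF int]])
    show "\<exists>w z. g ` cbox u v = cbox w z" for u v using g_box by blast
    show "\<exists>w z. h ` cbox u v = cbox w z" for u v using h_box by blast
    show "measure lborel (g ` cbox u v) = 1 * measure lborel (cbox u v)" for u v using measure_eq by simp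
  qed
  then have eq: "integral (cbox a b) f = integral (cbox (a $ 1, a $ 2) (b $ 1, b $ 2)) (\<lambda>z. f (g z))"
    unfolding h_box by (simp add: h_def integral_unique)
  have "g ` cbox (a $ 1, a $ 2) (b $ 1, b $ 2) = cbox a b"
    using g_box[of "h a" "h b"] by (simp add: hg) (simp add: h_def)
  then have cont: "continuous_on (cbox (a $ 1, a $ 2) (b $ 1, b $ 2)) (\<lambda>z. f (g z))"
    using contg by (intro continuous_on_compose2[OF assms] continuous_at_imp_continuous_on) auto
  show 1: "integral (cbox a b) f = integral {a $ 1..b $ 1} (\<lambda>x. integral {a $ 2..b $ 2} (\<lambda>y. f (vector [x, y])))"
    unfolding eq integral_prod_continuous[OF cont] by (simp add: g_def)
  have cont': "continuous_on (cbox (a $ 1, a $ 2) (b $ 1, b $ 2)) (\<lambda>(x, y). f (vector [x, y]))"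
    using cont by (simp add: g_def case_prod_beta)
  show "integral (cbox a b) f = integral {a $ 2..b $ 2} (\<lambda>y. integral {a $ 1..b $ 1} (\<lambda>x. f (vector [x, y])))"
    unfolding 1 using integral_swap_continuous[OF cont'] by simp
qed

text \<open>The fundamental theorem of calculus on each line parallel to an axis. The first
  component vanishes at both ends and contributes nothing; the second vanishes at the upper end
  only. Derivatives are taken within the closed rectangle, so its sides need no
  neighbourhood.\<close>

lemma rectangle_divergence:
  fixes Y1 Y2 :: "real^2 \<Rightarrow> real"
  assumes ab: "\<And>i. a $ i < b $ i"
    and Y1: "\<And>u. u \<in> cbox a b \<Longrightarrow> (Y1 has_derivative L1 u) (at u within cbox a b)"
    and Y2: "\<And>u. u \<in> cbox a b \<Longrightarrow> (Y2 has_derivative L2 u) (at u within cbox a b)"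
    and cont: "continuous_on (cbox a b) (\<lambda>u. L1 u (axis 1 1))" "continuous_on (cbox a b) (\<lambda>u. L2 u (axis 2 1))"
    and zero: "\<And>u. u \<in> cbox a b \<Longrightarrow> u $ 1 = a $ 1 \<or> u $ 1 = b $ 1 \<Longrightarrow> Y1 u = 0"
      "\<And>u. u \<in> cbox a b \<Longrightarrow> u $ 2 = b $ 2 \<Longrightarrow> Y2 u = 0"
  shows "integral (cbox a b) (\<lambda>u. L1 u (axis 1 1) + L2 u (axis 2 1)) = - integral {a $ 1..b $ 1} (\<lambda>s. Y2 (vector [s, a $ 2]))"
proof -
  have mem: "vector [x, y] \<in> cbox a b \<longleftrightarrow> x \<in> {a $ 1..b $ 1} \<and> y \<in> {a $ 2..b $ 2}" for x y
    by (auto simp: mem_box_cart forall_2)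
  have le: "a $ i \<le> b $ i" for i using ab[of i] by simp
  have I1: "integral {a $ 1..b $ 1} (\<lambda>x. L1 (vector [x, y]) (axis 1 1)) = 0" if y: "y \<in> {a $ 2..b $ 2}" for y
  proof -
    have "((\<lambda>x. Y1 (vector [x, y])) has_vector_derivative L1 (vector [x, y]) (axis 1 1)) (at x within {a $ 1..b $ 1})"
      if x: "x \<in> {a $ 1..b $ 1}" for x
    proof -
      have "vector [x, y] \<in> cbox a b" using mem x y by blast
      from has_derivative_subset[OF Y1[OF this], of "(\<lambda>x. vector [x, y]) ` {a $ 1..b $ 1}"]
      have d: "(Y1 has_derivative L1 (vector [x, y])) (at (vector [x, y]) within (\<lambda>x. vector [x, y]) ` {a $ 1..b $ 1})"
        using mem y by blast
      have "((\<lambda>x. vector [x, y] :: real^2) has_derivative (\<lambda>v. v *\<^sub>R axis 1 1)) (at x within {a $ 1..b $ 1})"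
        unfolding vector2_eq by (auto intro!: derivative_eq_intros)
      from has_derivative_in_compose[OF this d]
      show ?thesis unfolding has_vector_derivative_def
        by (rule has_derivative_eq_rhs) (simp add: fun_eq_iff linear_scale[OF has_derivative_linear[OF d]])
    qed
    from fundamental_theorem_of_calculus[OF le this]
    have "((\<lambda>x. L1 (vector [x, y]) (axis 1 1)) has_integral (Y1 (vector [b $ 1, y]) - Y1 (vector [a $ 1, y]))) {a $ 1..b $ 1}" .
    moreover have "Y1 (vector [b $ 1, y]) = 0" "Y1 (vector [a $ 1, y]) = 0"
      using zero(1)[of "vector [b $ 1, y]"] zero(1)[of "vector [a $ 1, y]"] mem y le by simp_all
    ultimately show ?thesis by (simp add: integral_unique)
  qed
  have I2: "integral {a $ 2..b $ 2} (\<lambda>y. L2 (vector [x, y]) (axis 2 1)) = - Y2 (vector [x, a $ 2])" if x: "x \<in> {a $ 1..b $ 1}" for x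
  proof -
    have "((\<lambda>y. Y2 (vector [x, y])) has_vector_derivative L2 (vector [x, y]) (axis 2 1)) (at y within {a $ 2..b $ 2})"
      if y: "y \<in> {a $ 2..b $ 2}" for y
    proof -
      have "vector [x, y] \<in> cbox a b" using mem x y by blast
      from has_derivative_subset[OF Y2[OF this], of "(\<lambda>y. vector [x, y]) ` {a $ 2..b $ 2}"]
      have d: "(Y2 has_derivative L2 (vector [x, y])) (at (vector [x, y]) within (\<lambda>y. vector [x, y]) ` {a $ 2..b $ 2})"
        using mem x by blast
      have "((\<lambda>y. vector [x, y] :: real^2) has_derivative (\<lambda>v. v *\<^sub>R axis 2 1)) (at y within {a $ 2..b $ 2})"
        unfolding vector2_eq by (auto intro!: derivative_eq_intros)
      from has_derivative_in_compose[OF this d]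
      show ?thesis unfolding has_vector_derivative_def
        by (rule has_derivative_eq_rhs) (simp add: fun_eq_iff linear_scale[OF has_derivative_linear[OF d]])
    qed
    from fundamental_theorem_of_calculus[OF le this]
    have "((\<lambda>y. L2 (vector [x, y]) (axis 2 1)) has_integral (Y2 (vector [x, b $ 2]) - Y2 (vector [x, a $ 2]))) {a $ 2..b $ 2}" .
    moreover have "Y2 (vector [x, b $ 2]) = 0" using zero(2)[of "vector [x, b $ 2]"] mem x le by simp
    ultimately show ?thesis by (simp add: integral_unique)
  qed
  have "integral (cbox a b) (\<lambda>u. L1 u (axis 1 1) + L2 u (axis 2 1)) =
     integral (cbox a b) (\<lambda>u. L1 u (axis 1 1)) + integral (cbox a b) (\<lambda>u. L2 u (axis 2 1))"
    by (intro Henstock_Kurzweil_Integration.integral_add integrable_continuous cont)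
  also have "integral (cbox a b) (\<lambda>u. L1 u (axis 1 1)) = integral {a $ 2..b $ 2} (\<lambda>y. 0)"
    unfolding integral_rectangle(2)[OF cont(1)] by (intro Henstock_Kurzweil_Integration.integral_cong I1)
  also have "integral (cbox a b) (\<lambda>u. L2 u (axis 2 1)) = integral {a $ 1..b $ 1} (\<lambda>x. - Y2 (vector [x, a $ 2]))"
    unfolding integral_rectangle(1)[OF cont(2)] by (intro Henstock_Kurzweil_Integration.integral_cong I2)
  finally show ?thesis by simp
qed

section \<open>Smooth families of maps\<close>

context surface
begin

definition family_in :: "'a chart \<Rightarrow> real set \<Rightarrow> (real \<Rightarrow> 'a \<Rightarrow> 'b::real_normed_vector) \<Rightarrow> bool" where
  "family_in c I G \<longleftrightarrow> smooth_on (chart_range c \<times> I) (\<lambda>z. G (snd z) (chart_inv c (fst z)))"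

text \<open>Defined through the joint derivative in point and time rather than for each point
  separately: the time derivative is then again a smooth family and can be differentiated in
  space.\<close>

definition time_deriv :: "'a chart \<Rightarrow> real set \<Rightarrow> (real \<Rightarrow> 'a \<Rightarrow> 'b::real_normed_vector) \<Rightarrow> real \<Rightarrow> 'a \<Rightarrow> 'b" where
  "time_deriv c I G t p = frechet_derivative (\<lambda>z. G (snd z) (chart_inv c (fst z))) (at (chart_map c p, t) within chart_range c \<times> I) (0, 1)"

lemma wide_product: "c \<in> A \<Longrightarrow> open I \<Longrightarrow> wide (chart_range c \<times> I)"
  by (intro wide_Times wide_range wide_open)

lemma family_slice:
  assumes "c \<in> A" "open I" "family_in c I G" "t \<in> I"
  shows "smooth_in c (chart_dom c) (G t)"
  using smooth_on_slice[OF assms(3)[unfolded family_in_def] assms(4)]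
  by (simp add: smooth_in_def o_def chart_range_def)

lemma family_has_derivative:
  assumes "c \<in> A" "open I" "family_in c I G" "t \<in> I" "u \<in> chart_range c"
  shows "((\<lambda>z. G (snd z) (chart_inv c (fst z))) has_derivative
    frechet_derivative (\<lambda>z. G (snd z) (chart_inv c (fst z))) (at (u, t) within chart_range c \<times> I)) (at (u, t) within chart_range c \<times> I)"
  by (rule smooth_on_has_derivative[OF wide_product[OF assms(1,2)] assms(3)[unfolded family_in_def]]) (use assms in simp)

lemma family_coord_deriv_eq:
  assumes "c \<in> A" "open I" "family_in c I G" "t \<in> I" "u \<in> chart_range c"
  shows "coord_deriv c i (G t) (chart_inv c u) =
    frechet_derivative (\<lambda>z. G (snd z) (chart_inv c (fst z))) (at (u, t) within chart_range c \<times> I) (axis i 1, 0)"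
proof -
  have "((\<lambda>u. G t (chart_inv c u)) has_derivative
     (\<lambda>v. frechet_derivative (\<lambda>z. G (snd z) (chart_inv c (fst z))) (at (u, t) within chart_range c \<times> I) (v, 0))) (at u within chart_range c)"
    using has_derivative_slice_left[OF family_has_derivative[OF assms] assms(4)] by simp
  then have "((G t \<circ> chart_inv c) has_derivative
     (\<lambda>v. frechet_derivative (\<lambda>z. G (snd z) (chart_inv c (fst z))) (at (u, t) within chart_range c \<times> I) (v, 0)))
     (at (chart_map c (chart_inv c u)) within chart_range c)"
    by (simp add: o_def map_inv[OF assms(1,5)])
  from differential_unique[OF assms(1) inv_in[OF assms(1,5)] this] show ?thesis by (simp add: coord_deriv_def)
qed

lemma family_coord_deriv:
  assumes "c \<in> A" "open I" "family_in c I G"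
  shows "family_in c I (\<lambda>t. coord_deriv c i (G t))"
  unfolding family_in_def
  using smooth_on_frechet_derivative[OF wide_product[OF assms(1,2)] assms(3)[unfolded family_in_def], of "(axis i 1, 0)"]
  by (rule smooth_on_cong[THEN iffD1, rotated]) (auto simp: family_coord_deriv_eq[OF assms])

lemma family_time_deriv_has:
  assumes "c \<in> A" "open I" "family_in c I G" "t \<in> I" "p \<in> chart_dom c"
  shows "((\<lambda>t. G t p) has_vector_derivative time_deriv c I G t p) (at t)"
proof -
  let ?L = "frechet_derivative (\<lambda>z. G (snd z) (chart_inv c (fst z))) (at (chart_map c p, t) within chart_range c \<times> I)"
  note h = family_has_derivative[OF assms(1-4) map_in[OF assms(5)]]
  have "((\<lambda>t. G t p) has_derivative (\<lambda>v. ?L (0, v))) (at t within I)"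
    using has_derivative_slice_right[OF h map_in[OF assms(5)]] by (simp add: inv_map[OF assms(1,5)])
  then have d: "((\<lambda>t. G t p) has_derivative (\<lambda>v. ?L (0, v))) (at t)" by (simp add: at_within_open[OF assms(4,2)])
  have "?L (0, v) = v *\<^sub>R ?L (0, 1)" for v
    using linear_scale[OF has_derivative_linear[OF h], of v "(0, 1)"] by simp
  then have "(\<lambda>v. ?L (0, v)) = (\<lambda>v. v *\<^sub>R ?L (0, 1))" by (rule ext)
  with d show ?thesis unfolding has_vector_derivative_def time_deriv_def by (simp only:)
qed

text \<open>Symmetry of second derivatives of the joint map on the product of chart range and time
  interval, in a spatial and the temporal direction. Uniqueness of derivatives on this product
  identifies both iterated expressions.\<close>

lemma time_deriv_coord_deriv:
  fixes G :: "real \<Rightarrow> 'a \<Rightarrow> 'b::euclidean_space"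
  assumes "c \<in> A" "open I" "family_in c I G" "t \<in> I" "p \<in> chart_dom c"
  shows "time_deriv c I (\<lambda>t. coord_deriv c i (G t)) t p = coord_deriv c i (time_deriv c I G t) p"
proof -
  let ?D = "chart_range c \<times> I" and ?u = "chart_map c p"
  let ?R = "\<lambda>z. G (snd z) (chart_inv c (fst z))"
  note w = wide_product[OF assms(1,2)]
  note sm = assms(3)[unfolded family_in_def]
  have ut: "(?u, t) \<in> ?D" using map_in[OF assms(5)] assms(4) by simp
  have 1: "frechet_derivative (\<lambda>z. coord_deriv c i (G (snd z)) (chart_inv c (fst z))) (at (?u, t) within ?D) =
     frechet_derivative (\<lambda>z. frechet_derivative ?R (at z within ?D) (axis i 1, 0)) (at (?u, t) within ?D)"
    by (rule wide_unique[OF w ut has_derivative_transform[OF ut _ smooth_on_has_derivative[OF w smooth_on_frechet_derivative[OF w sm] ut]]])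
      (auto simp: family_coord_deriv_eq[OF assms(1-3)])
  have tf: "family_in c I (time_deriv c I G)"
    unfolding family_in_def
    using smooth_on_frechet_derivative[OF w sm, of "(0, 1)"]
    by (rule smooth_on_cong[THEN iffD1, rotated]) (auto simp: time_deriv_def map_inv[OF assms(1)])
  have 2: "frechet_derivative (\<lambda>z. time_deriv c I G (snd z) (chart_inv c (fst z))) (at (?u, t) within ?D) =
     frechet_derivative (\<lambda>z. frechet_derivative ?R (at z within ?D) (0, 1)) (at (?u, t) within ?D)"
    by (rule wide_unique[OF w ut has_derivative_transform[OF ut _ smooth_on_has_derivative[OF w smooth_on_frechet_derivative[OF w sm] ut]]])
      (auto simp: time_deriv_def map_inv[OF assms(1)])
  have "time_deriv c I (\<lambda>t. coord_deriv c i (G t)) t p =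
     frechet_derivative (\<lambda>z. frechet_derivative ?R (at z within ?D) (0, 1)) (at (?u, t) within ?D) (axis i 1, 0)"
    unfolding time_deriv_def 1 by (rule smooth_on_symmetric[OF w sm ut])
  also have "\<dots> = coord_deriv c i (time_deriv c I G t) (chart_inv c ?u)"
    unfolding family_coord_deriv_eq[OF assms(1,2) tf assms(4) map_in[OF assms(5)]] 2 ..
  finally show ?thesis by (simp add: inv_map[OF assms(1,5)])
qed

text \<open>The density is built from first and second space derivatives, which are jointly smooth,
  by operations that need a positive Gram determinant. The set \<open>D\<close> is where that
  positivity is available.\<close>

lemma family_density:
  fixes F :: "real \<Rightarrow> 'a \<Rightarrow> real^3"
  assumes c: "c \<in> A" and I: "open I" and F: "family_in c I F" and D: "D \<subseteq> chart_range c \<times> I"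
    and pos: "\<And>u t. (u, t) \<in> D \<Longrightarrow> 0 < det (metric c (F t) (chart_inv c u))"
  shows "smooth_on D (\<lambda>z. density c (F (snd z)) (chart_inv c (fst z)))"
proof -
  note F1 = family_coord_deriv[OF c I F]
  note F2 = family_coord_deriv[OF c I F1]
  have s1: "smooth_on D (\<lambda>z. coord_deriv c i (F (snd z)) (chart_inv c (fst z)))" for i
    by (rule smooth_on_subset[OF F1[unfolded family_in_def] D])
  have s2: "smooth_on D (\<lambda>z. coord_deriv c i (coord_deriv c j (F (snd z))) (chart_inv c (fst z)))" for i j
    by (rule smooth_on_subset[OF F2[unfolded family_in_def] D])
  have pos': "0 < det (metric c (F (snd z)) (chart_inv c (fst z)))" if "z \<in> D" for z
    using pos[of "fst z" "snd z"] that by simp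
  have g: "smooth_on D (\<lambda>z. metric c (F (snd z)) (chart_inv c (fst z)) $ i $ j)" for i j
    unfolding metric_nth by (intro smooth_on_inner s1)
  have d: "smooth_on D (\<lambda>z. det (metric c (F (snd z)) (chart_inv c (fst z))))"
    unfolding det_metric by (intro smooth_on_diff smooth_on_mult g)
  have sd: "smooth_on D (\<lambda>z. sqrt (det (metric c (F (snd z)) (chart_inv c (fst z)))))"
    by (rule smooth_on_sqrt[OF d pos'])
  have "smooth_on D (\<lambda>z. (1 / sqrt (det (metric c (F (snd z)) (chart_inv c (fst z))))) *\<^sub>R
     cross3 (coord_deriv c 1 (F (snd z)) (chart_inv c (fst z))) (coord_deriv c 2 (F (snd z)) (chart_inv c (fst z))))"
    by (intro smooth_on_scaleR smooth_on_divide smooth_on_const smooth_on_cross3 s1 sd) (use pos' in fastforce)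
  then have n: "smooth_on D (\<lambda>z. unit_normal c (F (snd z)) (chart_inv c (fst z)))"
    by (rule smooth_on_cong[THEN iffD1, rotated]) (simp add: unit_normal_frame(3)[OF pos'])
  have h: "smooth_on D (\<lambda>z. second_form c (F (snd z)) (chart_inv c (fst z)) $ i $ j)" for i j
    unfolding second_form_nth by (intro smooth_on_inner s2 n)
  have "smooth_on D (\<lambda>z. forms_density (metric c (F (snd z)) (chart_inv c (fst z)) $ 1 $ 1)
     (metric c (F (snd z)) (chart_inv c (fst z)) $ 1 $ 2) (metric c (F (snd z)) (chart_inv c (fst z)) $ 2 $ 2)
     (second_form c (F (snd z)) (chart_inv c (fst z)) $ 1 $ 1) (second_form c (F (snd z)) (chart_inv c (fst z)) $ 1 $ 2)
     (second_form c (F (snd z)) (chart_inv c (fst z)) $ 2 $ 2))"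
    unfolding forms_density_def det_metric[symmetric]
    by (intro smooth_on_divide smooth_on_add smooth_on_diff smooth_on_mult smooth_on_power smooth_on_const g h d sd)
      (use pos' in fastforce)+
  then show ?thesis
  proof (rule smooth_on_cong[THEN iffD1, rotated])
    fix z assume z: "z \<in> D"
    then have "snd z \<in> I" "fst z \<in> chart_range c" using D by auto
    then show "forms_density (metric c (F (snd z)) (chart_inv c (fst z)) $ 1 $ 1)
     (metric c (F (snd z)) (chart_inv c (fst z)) $ 1 $ 2) (metric c (F (snd z)) (chart_inv c (fst z)) $ 2 $ 2)
     (second_form c (F (snd z)) (chart_inv c (fst z)) $ 1 $ 1) (second_form c (F (snd z)) (chart_inv c (fst z)) $ 1 $ 2)
     (second_form c (F (snd z)) (chart_inv c (fst z)) $ 2 $ 2) = density c (F (snd z)) (chart_inv c (fst z))"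
      using density_formula[OF pos'[OF z] second_form_sym[OF c family_slice[OF c I F] inv_in[OF c]]] by simp
  qed
qed

text \<open>The tube lemma: positivity on a neighbourhood of the slice at time 0 over a compact set
  contains a whole interval of times.\<close>

lemma family_immersed_near:
  fixes F :: "real \<Rightarrow> 'a \<Rightarrow> real^3"
  assumes c: "c \<in> A" and F: "family_in c {-\<delta><..<\<delta>} F" and K: "compact K" "K \<subseteq> chart_range c" and \<delta>: "0 < \<delta>"
    and pos: "\<And>u. u \<in> K \<Longrightarrow> 0 < det (metric c (F 0) (chart_inv c u))"
  shows "\<exists>e>0. e \<le> \<delta> \<and> (\<forall>u\<in>K. \<forall>t\<in>{-e<..<e}. 0 < det (metric c (F t) (chart_inv c u)))"
proof -
  let ?I = "{-\<delta><..<\<delta>}"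
  let ?d = "\<lambda>z. det (metric c (F (snd z)) (chart_inv c (fst z)))"
  note F1 = family_coord_deriv[OF c open_greaterThanLessThan F]
  have g: "smooth_on (chart_range c \<times> ?I) (\<lambda>z. metric c (F (snd z)) (chart_inv c (fst z)) $ i $ j)" for i j
    unfolding metric_nth by (intro smooth_on_inner F1[unfolded family_in_def])
  have "smooth_on (chart_range c \<times> ?I) ?d"
    unfolding det_metric by (intro smooth_on_diff smooth_on_mult g)
  then have "continuous_on (K \<times> ?I) ?d"
    by (rule continuous_on_subset[OF smooth_on_continuous_on]) (use K in auto)
  then have "openin (top_of_set (K \<times> ?I)) (K \<times> ?I \<inter> ?d -` {0<..})"
    by (rule continuous_openin_preimage_gen) simp
  then obtain W where W: "open W" "K \<times> ?I \<inter> ?d -` {0<..} = K \<times> ?I \<inter> W" by (auto simp: openin_open)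
  have W': "open (W \<inter> UNIV \<times> ?I)" using W(1) by (intro open_Int open_Times) auto
  have "K \<times> {0} \<subseteq> W \<inter> UNIV \<times> ?I"
  proof
    fix z assume "z \<in> K \<times> {0::real}"
    then have "z \<in> K \<times> ?I \<inter> ?d -` {0<..}" using pos \<delta> by auto
    then show "z \<in> W \<inter> UNIV \<times> ?I" using W(2) by auto
  qed
  \<comment> \<open>Product neighbourhoods around the points of the slice; finitely many of them
    cover \<open>K\<close>, and the intersection of their time factors is the required neighbourhood
    of 0.\<close>
  have "\<forall>u\<in>K. \<exists>X Y. open X \<and> open Y \<and> u \<in> X \<and> 0 \<in> Y \<and> X \<times> Y \<subseteq> W \<inter> UNIV \<times> ?I"
  proof
    fix u assume "u \<in> K"
    then have "(u, 0) \<in> W \<inter> UNIV \<times> ?I" using \<open>K \<times> {0} \<subseteq> _\<close> by auto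
    with W' obtain X Y where "open X" "open Y" "(u, 0) \<in> X \<times> Y" "X \<times> Y \<subseteq> W \<inter> UNIV \<times> ?I"
      by (rule open_prod_elim)
    then show "\<exists>X Y. open X \<and> open Y \<and> u \<in> X \<and> 0 \<in> Y \<and> X \<times> Y \<subseteq> W \<inter> UNIV \<times> ?I" by blast
  qed
  then obtain X Y where XY: "\<And>u. u \<in> K \<Longrightarrow> open (X u)" "\<And>u. u \<in> K \<Longrightarrow> open (Y u)" "\<And>u. u \<in> K \<Longrightarrow> u \<in> X u"
    "\<And>u. u \<in> K \<Longrightarrow> 0 \<in> Y u" "\<And>u. u \<in> K \<Longrightarrow> X u \<times> Y u \<subseteq> W \<inter> UNIV \<times> ?I" by metis
  have "K \<subseteq> (\<Union>u\<in>K. X u)" using XY(3) by blast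
  then obtain N where N: "N \<subseteq> K" "finite N" "K \<subseteq> (\<Union>u\<in>N. X u)"
    by (rule compactE_image[OF K(1) XY(1), rotated])
  define Z where "Z = ?I \<inter> (\<Inter>u\<in>N. Y u)"
  have "open Z" "0 \<in> Z" unfolding Z_def using XY N \<delta> by (auto intro!: open_Int open_INT)
  then obtain e where e: "e > 0" "ball 0 e \<subseteq> Z" by (meson open_contains_ball)
  have "t \<in> Z" if "t \<in> {- min e \<delta><..<min e \<delta>}" for t
    using e(2) that by (auto simp: dist_norm)
  then have "0 < det (metric c (F t) (chart_inv c u))" if ut: "u \<in> K" "t \<in> {- min e \<delta><..<min e \<delta>}" for u t
  proof -
    obtain v where v: "v \<in> N" "u \<in> X v" using N(3) ut(1) by blast
    have t: "t \<in> Y v" "t \<in> ?I" using \<open>\<And>t. t \<in> {- min e \<delta><..<min e \<delta>} \<Longrightarrow> t \<in> Z\<close>[OF ut(2)] v by (auto simp: Z_def)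
    then have "(u, t) \<in> W" using XY(5)[of v] v N(1) by blast
    then have "(u, t) \<in> K \<times> ?I \<inter> ?d -` {0<..}" using W(2) ut t by blast
    then show ?thesis by simp
  qed
  then show ?thesis using e(1) \<delta> by (intro exI[of _ "min e \<delta>"]) auto
qed

end

section \<open>The first variation formula\<close>

context partitioned_surface
begin

abbreviation box_k :: "'a \<Rightarrow> (real^2) set" where "box_k k \<equiv> cbox (a k) (b k)"
abbreviation par :: "'a \<Rightarrow> real^2 \<Rightarrow> 'a" where "par k \<equiv> chart_inv (c k)"

lemma par_dom: "k \<in> P \<Longrightarrow> u \<in> box_k k \<Longrightarrow> par k u \<in> chart_dom (c k)"
  using inv_in[OF chart_P] box_range by blast

lemma par_continuous:
  assumes "k \<in> P" "continuous_on (chart_dom (c k)) G"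
  shows "continuous_on (box_k k) (\<lambda>u. G (par k u))"
  by (rule continuous_on_subset[OF continuous_in_chart[OF chart_P[OF assms(1)] assms(2)] box_range[OF assms(1)]])

section \<open>Integrals and divergence through the partition of unity\<close>

lemma area_integral_sum:
  assumes im: "\<And>d. d \<in> A \<Longrightarrow> immersed d f" and G: "\<And>d. d \<in> A \<Longrightarrow> continuous_on (chart_dom d) G"
  shows "(LINT p|area_measure S A f. G p) =
    (\<Sum>k\<in>P. integral (box_k k) (\<lambda>u. \<rho> k (par k u) * G (par k u) * sqrt (det (metric (c k) f (par k u)))))"
proof -
  have sp: "space (area_measure S A f) = S"
    using sets_eq_imp_space_eq[OF area_measure(1)[OF im]] by (simp add: space_restrict_space)
  have cont: "continuous_on (chart_dom (c k)) (\<lambda>p. \<rho> k p * G p)" if "k \<in> P" for k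
    by (intro continuous_on_mult C1_in_continuous C1 chart_P G that)
  have supp: "\<rho> k p * G p = 0" if "k \<in> P" "p \<in> S" "p \<notin> par k ` box_k k" for k p
    using support[OF that] by simp
  have int: "integrable (area_measure S A f) (\<lambda>p. \<rho> k p * G p)" if k: "k \<in> P" for k
    by (rule area_integral(1)[OF im chart_P[OF k] cont[OF k] compact_cbox box_range[OF k] supp[OF k]])
  have "(LINT p|area_measure S A f. G p) = (LINT p|area_measure S A f. (\<Sum>k\<in>P. \<rho> k p * G p))"
    by (intro Bochner_Integration.integral_cong refl) (simp add: sp partition flip: sum_distrib_right)
  also have "\<dots> = (\<Sum>k\<in>P. LINT p|area_measure S A f. \<rho> k p * G p)"
    by (rule Bochner_Integration.integral_sum[OF int])
  also have "\<dots> = (\<Sum>k\<in>P. integral (box_k k) (\<lambda>u. \<rho> k (par k u) * G (par k u) * sqrt (det (metric (c k) f (par k u)))))"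
  proof (rule sum.cong[OF refl])
    fix k assume k: "k \<in> P"
    show "(LINT p|area_measure S A f. \<rho> k p * G p) = integral (box_k k) (\<lambda>u. \<rho> k (par k u) * G (par k u) * sqrt (det (metric (c k) f (par k u))))"
      by (rule area_integral(2)[OF im chart_P[OF k] cont[OF k] compact_cbox box_range[OF k] supp[OF k]])
  qed
  finally show ?thesis .
qed

lemma length_integral_sum:
  assumes im: "\<And>d. d \<in> A \<Longrightarrow> immersed d f"
    and G: "\<And>d. d \<in> A \<Longrightarrow> continuous_on (chart_dom d \<inter> surface_boundary A) G"
  shows "(LINT p|length_measure A f. G p) =
    (\<Sum>k\<in>P. integral {s. vector [s, 0] \<in> box_k k}
      (\<lambda>s. \<rho> k (par k (vector [s, 0])) * G (par k (vector [s, 0])) * sqrt (metric (c k) f (par k (vector [s, 0])) $ 1 $ 1)))"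
proof -
  let ?X = "surface_boundary A"
  let ?K = "\<lambda>k. {s. vector [s, 0] \<in> box_k k}"
  have XS: "?X \<subseteq> S" unfolding surface_boundary_def using dom_subset by blast
  have sp: "space (length_measure A f) = ?X"
    using sets_eq_imp_space_eq[OF length_measure(1)[OF im]] by (simp add: space_restrict_space)
  have cont: "continuous_on (chart_dom (c k) \<inter> ?X) (\<lambda>p. \<rho> k p * G p)" if "k \<in> P" for k
    by (intro continuous_on_mult continuous_on_subset[OF C1_in_continuous[OF chart_P C1]] chart_P G that) (use that in auto)
  have K: "compact (?K k)" "?K k \<subseteq> {s. vector [s, 0] \<in> chart_range (c k)}" if "k \<in> P" for k
  proof -
    \<comment> \<open>The trace of a rectangle on the boundary line is a full interval or
      empty.\<close>
    have "?K k = (if a k $ 2 \<le> 0 \<and> 0 \<le> b k $ 2 then {a k $ 1..b k $ 1} else {})"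
      by (auto simp: mem_box_cart forall_2)
    then show "compact (?K k)" by simp
    show "?K k \<subseteq> {s. vector [s, 0] \<in> chart_range (c k)}" using box_range[OF that] by blast
  qed
  have supp: "\<rho> k p * G p = 0" if k: "k \<in> P" and p: "p \<in> ?X" "p \<notin> (\<lambda>s. par k (vector [s, 0])) ` ?K k" for k p
  proof -
    have "p \<notin> par k ` box_k k"
    proof
      assume "p \<in> par k ` box_k k"
      then obtain u where u: "u \<in> box_k k" "p = par k u" by blast
      have "chart_map (c k) p = u" using map_inv[OF chart_P[OF k]] box_range[OF k] u by blast
      then have "u $ 2 = 0" using boundary_iff[OF chart_P[OF k] par_dom[OF k u(1)]] p(1) u(2) by simp
      then have "u = vector [u $ 1, 0]" by (simp add: vec_eq_iff forall_2)
      then have "u $ 1 \<in> ?K k" "p = par k (vector [u $ 1, 0])" using u by auto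
      then show False using p(2) by blast
    qed
    then show ?thesis using support[OF k] p(1) XS by auto
  qed
  have int: "integrable (length_measure A f) (\<lambda>p. \<rho> k p * G p)" if k: "k \<in> P" for k
    by (rule length_integral(1)[OF im chart_P[OF k] cont[OF k] K[OF k] supp[OF k]])
  have "(LINT p|length_measure A f. G p) = (LINT p|length_measure A f. (\<Sum>k\<in>P. \<rho> k p * G p))"
    using XS by (intro Bochner_Integration.integral_cong refl) (auto simp: sp partition simp flip: sum_distrib_right)
  also have "\<dots> = (\<Sum>k\<in>P. LINT p|length_measure A f. \<rho> k p * G p)"
    by (rule Bochner_Integration.integral_sum[OF int])
  also have "\<dots> = (\<Sum>k\<in>P. integral {s. vector [s, 0] \<in> box_k k}
      (\<lambda>s. \<rho> k (par k (vector [s, 0])) * G (par k (vector [s, 0])) * sqrt (metric (c k) f (par k (vector [s, 0])) $ 1 $ 1)))"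
  proof (rule sum.cong[OF refl])
    fix k assume k: "k \<in> P"
    show "(LINT p|length_measure A f. \<rho> k p * G p) = integral {s. vector [s, 0] \<in> box_k k}
      (\<lambda>s. \<rho> k (par k (vector [s, 0])) * G (par k (vector [s, 0])) * sqrt (metric (c k) f (par k (vector [s, 0])) $ 1 $ 1))"
      by (rule length_integral(2)[OF im chart_P[OF k] cont[OF k] K[OF k] supp[OF k]])
  qed
  finally show ?thesis .
qed

context
  fixes f :: "'a \<Rightarrow> real^3" and \<phi> :: "'a \<Rightarrow> real" and \<xi> :: "'a chart \<Rightarrow> 'a \<Rightarrow> real^2"
  assumes im: "\<And>d. d \<in> A \<Longrightarrow> immersed d f"
    and \<phi>: "\<And>d. d \<in> A \<Longrightarrow> smooth_in d (chart_dom d) \<phi>"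
    and \<xi>: "\<And>d. d \<in> A \<Longrightarrow> smooth_in d (chart_dom d) (\<xi> d)"
    and \<xi>_change: "\<And>d d' p. d \<in> A \<Longrightarrow> d' \<in> A \<Longrightarrow> p \<in> chart_dom d \<inter> chart_dom d' \<Longrightarrow> \<xi> d' p = differential d (chart_map d') p (\<xi> d p)"
begin

abbreviation X :: "'a chart \<Rightarrow> 2 \<Rightarrow> 'a \<Rightarrow> real" where "X d i \<equiv> flux d f \<phi> (\<xi> d) i"

lemma X_smooth: "d \<in> A \<Longrightarrow> smooth_in d (chart_dom d) (X d i)"
proof -
  assume d: "d \<in> A"
  show ?thesis
  proof (cases "chart_dom d = {}")
    case True
    then show ?thesis by (simp add: smooth_in_def smooth_on_def)
  next
    case False
    then obtain p where "p \<in> chart_dom d" by blast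
    then show ?thesis by (rule flux_divergence(2)[OF im[OF d] _ \<phi>[OF d] \<xi>[OF d]])
  qed
qed

text \<open>The derivative of the cut-off along the vector field. Division by sqrt(det g) turns the
  vector density \<open>X\<close> back into a vector field, so the result is a function on the
  surface and not a chart expression.\<close>

definition cutoff_flux :: "'a chart \<Rightarrow> 'a \<Rightarrow> 'a \<Rightarrow> real" where
  "cutoff_flux d k p = (X d 1 p * coord_deriv d 1 (\<rho> k) p + X d 2 p * coord_deriv d 2 (\<rho> k) p) / sqrt (det (metric d f p))"

lemma cutoff_flux_change:
  assumes "k \<in> P" "d \<in> A" "d' \<in> A" "p \<in> chart_dom d" "p \<in> chart_dom d'"
  shows "cutoff_flux d k p = cutoff_flux d' k p"
proof -
  note cp = assms(2-5)
  have D: "differentiable_in d' (\<rho> k) p" using C1[OF assms(1,3)] assms(5) by (simp add: C1_in_def)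
  have f: "smooth_in d' (chart_dom d') f" using im[OF cp(2)] by (simp add: immersed_def)
  have J: "jac_det d d' p > 0" unfolding jac_det_def by (rule jac_det_pos[OF cp])
  have fl: "jac d d' \<alpha> 1 p * X d 1 p + jac d d' \<alpha> 2 p * X d 2 p = jac_det d d' p * X d' \<alpha> p" for \<alpha>
    by (rule flux_change[where \<xi>=\<xi>, OF cp _ \<phi>[OF cp(2)] \<xi>_change[OF cp(1,2) IntI[OF cp(3,4)]]]) (rule im)
  have "X d 1 p * coord_deriv d 1 (\<rho> k) p + X d 2 p * coord_deriv d 2 (\<rho> k) p
    = (jac d d' 1 1 p * X d 1 p + jac d d' 1 2 p * X d 2 p) * coord_deriv d' 1 (\<rho> k) p
    + (jac d d' 2 1 p * X d 1 p + jac d d' 2 2 p * X d 2 p) * coord_deriv d' 2 (\<rho> k) p"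
    unfolding coord_deriv_change[OF cp D] by (simp add: algebra_simps)
  also have "\<dots> = jac_det d d' p * (X d' 1 p * coord_deriv d' 1 (\<rho> k) p + X d' 2 p * coord_deriv d' 2 (\<rho> k) p)"
    unfolding fl by (simp add: algebra_simps)
  finally show ?thesis
    unfolding cutoff_flux_def det_metric_change(2)[OF cp smooth_in_overlap(1)[OF cp f]] using J by simp
qed

lemma cutoff_flux_continuous:
  assumes "k \<in> P" "d \<in> A"
  shows "continuous_on (chart_dom d) (cutoff_flux d k)"
proof -
  have c\<rho>: "continuous_on (chart_dom d) (coord_deriv d i (\<rho> k))" for i
    using C1[OF assms] by (simp add: C1_in_def)
  have cX: "continuous_on (chart_dom d) (X d i)" for i
    by (rule smooth_continuous[OF assms(2) X_smooth[OF assms(2)]])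
  have cs: "continuous_on (chart_dom d) (\<lambda>p. sqrt (det (metric d f p)))"
    by (rule smooth_continuous[OF assms(2) smooth_geometry(2)[OF im[OF assms(2)]]])
  have nz: "\<forall>p\<in>chart_dom d. sqrt (det (metric d f p)) \<noteq> 0"
    using im[OF assms(2)] by (auto simp: immersed_def)
  show ?thesis
    unfolding cutoff_flux_def[abs_def]
    by (intro continuous_on_divide continuous_on_add continuous_on_mult c\<rho> cX cs nz)
qed

text \<open>The image of the rectangle is compact, hence closed. The cut-off vanishes on a whole
  neighbourhood of a point outside, and so does its derivative.\<close>

lemma cutoff_flux_support:
  assumes k: "k \<in> P" and d: "d \<in> A" and p: "p \<in> chart_dom d" "p \<notin> par k ` box_k k"
  shows "cutoff_flux d k p = 0"
proof -
  have "compact (par k ` box_k k)"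
    by (intro compact_continuous_image compact_cbox continuous_on_subset[OF chart_inv_continuous[OF chart_P[OF k]] box_range[OF k]])
  then have "closed (par k ` box_k k)" by (rule compact_imp_closed)
  then have U: "patch d (chart_dom d \<inter> - par k ` box_k k)" using d unfolding patch_def by (auto intro: openin_open_Int)
  have "coord_deriv d i (\<rho> k) p = coord_deriv d i (\<lambda>p. 0) p" for i
    by (rule coord_deriv_local[OF U]) (use p support[OF k] dom_subset[OF d] in auto)
  then have "coord_deriv d i (\<rho> k) p = 0" for i
    using has_coord_derivD(1)[OF has_coord_deriv_const[OF d p(1), of i "0::real"]] by simp
  then show ?thesis by (simp add: cutoff_flux_def)
qed

text \<open>The summands are integrals over different rectangles in different charts and cannot be
  added pointwise as they stand. Rewritten as integrals of \<open>cutoff_flux\<close> over the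
  surface, they share one domain, and the sum is evaluated at each point in a single chart.\<close>

lemma cutoff_flux_sum: "(\<Sum>k\<in>P. integral (box_k k) (\<lambda>u. X (c k) 1 (par k u) * coord_deriv (c k) 1 (\<rho> k) (par k u)
     + X (c k) 2 (par k u) * coord_deriv (c k) 2 (\<rho> k) (par k u))) = 0"
proof -
  define \<theta> where "\<theta> k p = cutoff_flux (chart_at A p) k p" for k p
  have \<theta>: "\<theta> k p = cutoff_flux d k p" if "k \<in> P" "d \<in> A" "p \<in> chart_dom d" for k d p
    unfolding \<theta>_def using cutoff_flux_change[OF that(1) chart_at(1) that(2) chart_at(2) that(3)] dom_subset that by blast
  have cont: "continuous_on (chart_dom d) (\<theta> k)" if "k \<in> P" "d \<in> A" for k d
    using cutoff_flux_continuous[OF that] by (rule continuous_on_cong[THEN iffD1, rotated 2]) (simp_all add: \<theta>[OF that])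
  have supp: "\<theta> k p = 0" if "k \<in> P" "p \<in> S" "p \<notin> par k ` box_k k" for k p
    unfolding \<theta>_def by (rule cutoff_flux_support[OF that(1) chart_at[OF that(2)] that(3)])
  have sp: "space (area_measure S A f) = S"
    using sets_eq_imp_space_eq[OF area_measure(1)[OF im]] by (simp add: space_restrict_space)
  have "(\<Sum>k\<in>P. integral (box_k k) (\<lambda>u. X (c k) 1 (par k u) * coord_deriv (c k) 1 (\<rho> k) (par k u)
     + X (c k) 2 (par k u) * coord_deriv (c k) 2 (\<rho> k) (par k u))) = (\<Sum>k\<in>P. LINT p|area_measure S A f. \<theta> k p)"
  proof (rule sum.cong[OF refl])
    fix k assume k: "k \<in> P"
    have "(LINT p|area_measure S A f. \<theta> k p) = integral (box_k k) (\<lambda>u. \<theta> k (par k u) * sqrt (det (metric (c k) f (par k u))))"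
      by (rule area_integral(2)[OF im chart_P[OF k] cont[OF k chart_P[OF k]] compact_cbox box_range[OF k] supp[OF k]])
    also have "\<dots> = integral (box_k k) (\<lambda>u. X (c k) 1 (par k u) * coord_deriv (c k) 1 (\<rho> k) (par k u)
       + X (c k) 2 (par k u) * coord_deriv (c k) 2 (\<rho> k) (par k u))"
    proof (rule Henstock_Kurzweil_Integration.integral_cong)
      fix u assume u: "u \<in> box_k k"
      have "0 < det (metric (c k) f (par k u))"
        using im[OF chart_P[OF k]] par_dom[OF k u] by (simp add: immersed_def)
      then show "\<theta> k (par k u) * sqrt (det (metric (c k) f (par k u))) = X (c k) 1 (par k u) * coord_deriv (c k) 1 (\<rho> k) (par k u)
       + X (c k) 2 (par k u) * coord_deriv (c k) 2 (\<rho> k) (par k u)"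
        unfolding \<theta>[OF k chart_P[OF k] par_dom[OF k u]] cutoff_flux_def by simp
    qed
    finally show "integral (box_k k) (\<lambda>u. X (c k) 1 (par k u) * coord_deriv (c k) 1 (\<rho> k) (par k u)
       + X (c k) 2 (par k u) * coord_deriv (c k) 2 (\<rho> k) (par k u)) = (LINT p|area_measure S A f. \<theta> k p)" ..
  qed
  also have "\<dots> = (LINT p|area_measure S A f. (\<Sum>k\<in>P. \<theta> k p))"
    by (rule Bochner_Integration.integral_sum[symmetric])
      (rule area_integral(1)[OF im chart_P cont[OF _ chart_P] compact_cbox box_range supp])
  also have "\<dots> = (LINT p|area_measure S A f. 0)"
  proof (rule Bochner_Integration.integral_cong[OF refl])
    fix p assume "p \<in> space (area_measure S A f)"
    then have p: "p \<in> S" by (simp add: sp)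
    define d where "d = chart_at A p"
    have d: "d \<in> A" "p \<in> chart_dom d" using chart_at[OF p] by (simp_all add: d_def)
    have z: "(\<Sum>k\<in>P. coord_deriv d i (\<rho> k) p) = 0" for i
    proof -
      have sum: "has_coord_deriv d i (\<lambda>q. \<Sum>k\<in>Q. \<rho> k q) p (\<Sum>k\<in>Q. coord_deriv d i (\<rho> k) p)" if "finite Q" "Q \<subseteq> P" for Q
        using that
      proof (induction Q)
        case empty
        then show ?case using has_coord_deriv_const[OF d] by simp
      next
        case (insert k Q)
        then show ?case using has_coord_deriv_add[OF C1_in_has[OF d(1) C1[OF _ d(1)] d(2)]] by simp
      qed
      have "coord_deriv d i (\<lambda>q. \<Sum>k\<in>P. \<rho> k q) p = coord_deriv d i (\<lambda>q. 1) p"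
        by (rule coord_deriv_cong[OF d]) (use partition dom_subset[OF d(1)] in auto)
      then show ?thesis
        using has_coord_derivD(1)[OF sum[OF finite_P order_refl]] has_coord_derivD(1)[OF has_coord_deriv_const[OF d, of i "1::real"]]
        by simp
    qed
    have "(\<Sum>k\<in>P. \<theta> k p) = (X d 1 p * (\<Sum>k\<in>P. coord_deriv d 1 (\<rho> k) p) + X d 2 p * (\<Sum>k\<in>P. coord_deriv d 2 (\<rho> k) p)) / sqrt (det (metric d f p))"
      unfolding \<theta>_def d_def[symmetric] cutoff_flux_def
      by (simp add: sum_divide_distrib[symmetric] sum.distrib sum_distrib_left)
    then show "(\<Sum>k\<in>P. \<theta> k p) = 0" unfolding z by simp
  qed
  finally show ?thesis by simp
qed

text \<open>Since \<open>cutoff_flux_sum\<close> is zero, the terms with derivatives of the cut-offs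
  may be added. They complete each integrand to the divergence of the cut-off times the flux, to
  which the rectangle identity applies.\<close>

lemma divergence_sum:
  "(\<Sum>k\<in>P. integral (box_k k) (\<lambda>u. \<rho> k (par k u) * (coord_deriv (c k) 1 (X (c k) 1) (par k u) + coord_deriv (c k) 2 (X (c k) 2) (par k u))))
   = (LINT p|length_measure A f. boundary_term A f \<phi> \<xi> p)"
proof -
  let ?div = "\<lambda>k u. \<rho> k (par k u) * (coord_deriv (c k) 1 (X (c k) 1) (par k u) + coord_deriv (c k) 2 (X (c k) 2) (par k u))"
  let ?cut = "\<lambda>k u. X (c k) 1 (par k u) * coord_deriv (c k) 1 (\<rho> k) (par k u) + X (c k) 2 (par k u) * coord_deriv (c k) 2 (\<rho> k) (par k u)"
  let ?edge = "\<lambda>k. integral {a k $ 1..b k $ 1} (\<lambda>s. \<rho> k (par k (vector [s, a k $ 2])) * X (c k) 2 (par k (vector [s, a k $ 2])))"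
  have 1: "integral (box_k k) (?div k) + integral (box_k k) (?cut k) = - ?edge k" if k: "k \<in> P" for k
  proof -
    note ck = chart_P[OF k]
    have I: "has_coord_deriv (c k) i (X (c k) j) p (coord_deriv (c k) i (X (c k) j) p)" if "p \<in> chart_dom (c k)" for i j p
      by (intro has_coord_derivI ck that smooth_in_differentiable[OF patch_dom[OF ck] X_smooth[OF ck] that])
    have J: "has_coord_deriv (c k) i (\<lambda>p. \<rho> k p * X (c k) i p) p (\<rho> k p * coord_deriv (c k) i (X (c k) i) p + coord_deriv (c k) i (\<rho> k) p * X (c k) i p)"
      if "p \<in> chart_dom (c k)" for i p
      by (rule has_coord_deriv_mult[OF C1_in_has[OF ck C1[OF k ck] that] I[OF that]])
    define L where "L i u = differential (c k) (\<lambda>p. \<rho> k p * X (c k) i p) (par k u)" for i u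
    have L: "((\<lambda>u. \<rho> k (par k u) * X (c k) i (par k u)) has_derivative L i u) (at u within box_k k)"
      and Lv: "L i u (axis i 1) = \<rho> k (par k u) * coord_deriv (c k) i (X (c k) i) (par k u) + coord_deriv (c k) i (\<rho> k) (par k u) * X (c k) i (par k u)"
      if u: "u \<in> box_k k" for i u
    proof -
      have "chart_map (c k) (par k u) = u" using map_inv[OF ck] box_range[OF k] u by blast
      then show "((\<lambda>u. \<rho> k (par k u) * X (c k) i (par k u)) has_derivative L i u) (at u within box_k k)"
        using has_derivative_subset[OF has_coord_derivE(3)[OF J[OF par_dom[OF k u], of i]] box_range[OF k]] by (simp add: L_def)
      show "L i u (axis i 1) = \<rho> k (par k u) * coord_deriv (c k) i (X (c k) i) (par k u) + coord_deriv (c k) i (\<rho> k) (par k u) * X (c k) i (par k u)"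
        unfolding L_def by (rule has_coord_derivE(4)[OF J[OF par_dom[OF k u]]])
    qed
    have cX: "continuous_on (chart_dom (c k)) (X (c k) i)" "continuous_on (chart_dom (c k)) (coord_deriv (c k) j (X (c k) i))" for i j
      by (intro smooth_continuous[OF ck] X_smooth[OF ck] smooth_in_coord_deriv[OF patch_dom[OF ck]])+
    have c\<rho>: "continuous_on (chart_dom (c k)) (\<rho> k)" "continuous_on (chart_dom (c k)) (coord_deriv (c k) j (\<rho> k))" for j
      using C1_in_continuous[OF ck C1[OF k ck]] C1[OF k ck] by (auto simp: C1_in_def)
    have cL: "continuous_on (box_k k) (\<lambda>u. L i u (axis i 1))" for i
    proof -
      have "continuous_on (box_k k) (\<lambda>u. \<rho> k (par k u) * coord_deriv (c k) i (X (c k) i) (par k u) + coord_deriv (c k) i (\<rho> k) (par k u) * X (c k) i (par k u))"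
        by (intro continuous_intros par_continuous[OF k] cX c\<rho>)
      then show ?thesis by (rule continuous_on_cong[THEN iffD1, rotated 2]) (simp_all add: Lv)
    qed
    have "integral (box_k k) (?div k) + integral (box_k k) (?cut k) = integral (box_k k) (\<lambda>u. ?div k u + ?cut k u)"
      by (intro Henstock_Kurzweil_Integration.integral_add[symmetric] integrable_continuous continuous_intros par_continuous[OF k] cX c\<rho>)
    also have "\<dots> = integral (box_k k) (\<lambda>u. L 1 u (axis 1 1) + L 2 u (axis 2 1))"
      by (rule Henstock_Kurzweil_Integration.integral_cong) (simp add: Lv algebra_simps)
    also have "\<dots> = - ?edge k"
      by (rule rectangle_divergence[OF box_less[OF k] L L cL cL]) (use box_boundary[OF k] in auto)
    finally show ?thesis .
  qed
  have bt: "boundary_term A f \<phi> \<xi> p * sqrt (metric d f p $ 1 $ 1) = - X d 2 p" if "d \<in> A" "p \<in> chart_dom d" "chart_map d p $ 2 = 0" for d p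
    by (rule boundary_term_flux[OF that]) (use im \<phi> \<xi>_change in blast)+
  \<comment> \<open>The boundary integrand is defined through an arbitrary choice of chart at each
    point; its continuity is visible only after it is written as a quotient of smooth functions in
    one chart.\<close>
  have cont: "continuous_on (chart_dom d \<inter> surface_boundary A) (boundary_term A f \<phi> \<xi>)" if d: "d \<in> A" for d
  proof -
    have E: "0 < metric d f p $ 1 $ 1" if "p \<in> chart_dom d" for p
      using interior_normal_eq(2)[of d f p] im[OF d] that by (simp add: immersed_def)
    have "continuous_on (chart_dom d \<inter> surface_boundary A) (\<lambda>p. - X d 2 p / sqrt (metric d f p $ 1 $ 1))"
      by (intro continuous_intros continuous_on_subset[OF smooth_continuous[OF d X_smooth[OF d]]]
          continuous_on_subset[OF smooth_continuous[OF d smooth_geometry(1)[OF im[OF d]]]]) (use E in force)+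
    then show ?thesis
    proof (rule continuous_on_cong[THEN iffD1, rotated 2])
      fix p assume p: "p \<in> chart_dom d \<inter> surface_boundary A"
      then have "boundary_term A f \<phi> \<xi> p * sqrt (metric d f p $ 1 $ 1) = - X d 2 p"
        using boundary_iff[OF d, of p] by (intro bt[OF d]) auto
      moreover have "sqrt (metric d f p $ 1 $ 1) > 0" using E p by simp
      ultimately show "- X d 2 p / sqrt (metric d f p $ 1 $ 1) = boundary_term A f \<phi> \<xi> p"
        by (metis less_irrefl nonzero_mult_div_cancel_right)
    qed simp
  qed
  have 2: "integral {s. vector [s, 0] \<in> box_k k} (\<lambda>s. \<rho> k (par k (vector [s, 0])) * boundary_term A f \<phi> \<xi> (par k (vector [s, 0]))
      * sqrt (metric (c k) f (par k (vector [s, 0])) $ 1 $ 1)) = - ?edge k" if k: "k \<in> P" for k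
  proof (cases "a k $ 2 = 0")
    case True
    then have set: "{s. vector [s, 0] \<in> box_k k} = {a k $ 1..b k $ 1}"
      using box_less[OF k, of 2] by (auto simp: mem_box_cart forall_2)
    have "integral {a k $ 1..b k $ 1} (\<lambda>s. \<rho> k (par k (vector [s, 0])) * boundary_term A f \<phi> \<xi> (par k (vector [s, 0]))
      * sqrt (metric (c k) f (par k (vector [s, 0])) $ 1 $ 1))
      = integral {a k $ 1..b k $ 1} (\<lambda>s. - (\<rho> k (par k (vector [s, a k $ 2])) * X (c k) 2 (par k (vector [s, a k $ 2]))))"
    proof (rule Henstock_Kurzweil_Integration.integral_cong)
      fix s assume "s \<in> {a k $ 1..b k $ 1}"
      then have u: "vector [s, 0] \<in> box_k k" using set by blast
      have "chart_map (c k) (par k (vector [s, 0])) = vector [s, 0]" using map_inv[OF chart_P[OF k]] box_range[OF k] u by blast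
      then have "chart_map (c k) (par k (vector [s, 0])) $ 2 = 0" by simp
      from bt[OF chart_P[OF k] par_dom[OF k u] this]
      show "\<rho> k (par k (vector [s, 0])) * boundary_term A f \<phi> \<xi> (par k (vector [s, 0]))
        * sqrt (metric (c k) f (par k (vector [s, 0])) $ 1 $ 1) = - (\<rho> k (par k (vector [s, a k $ 2])) * X (c k) 2 (par k (vector [s, a k $ 2])))"
        unfolding True by (simp only: mult.assoc mult_minus_right)
    qed
    then show ?thesis unfolding set by simp
  next
    case False
    \<comment> \<open>A rectangle whose lower side is off the boundary line contributes nothing on
      either side: it does not meet the boundary, and the cut-off vanishes on that side too.\<close>
    then have pos: "a k $ 2 > 0" using box_nonneg[OF k] by simp
    then have set: "{s. vector [s, 0] \<in> box_k k} = {}" by (auto simp: mem_box_cart forall_2)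
    have "?edge k = integral {a k $ 1..b k $ 1} (\<lambda>s. 0)"
    proof (rule Henstock_Kurzweil_Integration.integral_cong)
      fix s assume "s \<in> {a k $ 1..b k $ 1}"
      then have "vector [s, a k $ 2] \<in> box_k k" using box_less[OF k, of 2] by (simp add: mem_box_cart forall_2)
      then have "\<rho> k (par k (vector [s, a k $ 2])) = 0" using False by (intro box_boundary[OF k]) simp_all
      then show "\<rho> k (par k (vector [s, a k $ 2])) * X (c k) 2 (par k (vector [s, a k $ 2])) = 0" by simp
    qed
    then show ?thesis unfolding set by simp
  qed
  have "(\<Sum>k\<in>P. integral (box_k k) (?div k)) = (\<Sum>k\<in>P. integral (box_k k) (?div k)) + (\<Sum>k\<in>P. integral (box_k k) (?cut k))"
    using cutoff_flux_sum by simp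
  also have "\<dots> = (\<Sum>k\<in>P. - ?edge k)" unfolding sum.distrib[symmetric] by (rule sum.cong[OF refl 1])
  also have "\<dots> = (\<Sum>k\<in>P. integral {s. vector [s, 0] \<in> box_k k} (\<lambda>s. \<rho> k (par k (vector [s, 0])) * boundary_term A f \<phi> \<xi> (par k (vector [s, 0]))
      * sqrt (metric (c k) f (par k (vector [s, 0])) $ 1 $ 1)))"
    by (rule sum.cong[OF refl 2[symmetric]])
  also have "\<dots> = (LINT p|length_measure A f. boundary_term A f \<phi> \<xi> p)"
    by (rule length_integral_sum[symmetric, OF im cont])
  finally show ?thesis .
qed

end

end

lemma (in surface) laplacian_smooth:
  assumes im: "immersed d f"
  shows "smooth_in d (chart_dom d) (laplacian_in d f (mean_curvature_in d f))"
proof -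
  have d: "d \<in> A" and pos: "\<And>p. p \<in> chart_dom d \<Longrightarrow> 0 < det (metric d f p)"
    using im by (auto simp: immersed_def)
  note U = patch_dom[OF d]
  have nz: "sqrt (det (metric d f p)) \<noteq> 0" if "p \<in> chart_dom d" for p using pos[OF that] by simp
  have Y: "smooth_in d (chart_dom d) (\<lambda>q. (metric d f q $ i $ j * coord_deriv d k (mean_curvature_in d f) q
      - metric d f q $ i' $ j' * coord_deriv d k' (mean_curvature_in d f) q) / sqrt (det (metric d f q)))"
    for i j k i' j' k'
    by (intro smooth_in_divide smooth_in_comps smooth_in_coord_deriv U smooth_geometry[OF im] nz; assumption)
  have "smooth_in d (chart_dom d) (\<lambda>p. (coord_deriv d 1 (\<lambda>q. (metric d f q $ 2 $ 2 * coord_deriv d 1 (mean_curvature_in d f) q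
      - metric d f q $ 1 $ 2 * coord_deriv d 2 (mean_curvature_in d f) q) / sqrt (det (metric d f q))) p
    + coord_deriv d 2 (\<lambda>q. (metric d f q $ 1 $ 1 * coord_deriv d 2 (mean_curvature_in d f) q
      - metric d f q $ 1 $ 2 * coord_deriv d 1 (mean_curvature_in d f) q) / sqrt (det (metric d f q))) p)
    / sqrt (det (metric d f p)))"
    by (intro smooth_in_divide smooth_in_comps(2) smooth_in_coord_deriv U smooth_geometry[OF im] Y nz; assumption)
  then show ?thesis
    by (rule smooth_in_cong[OF U, THEN iffD1, rotated])
      (use nz in \<open>simp add: laplacian_in_flux[OF im, symmetric]\<close>)
qed

theorem mainTheorem4:
  fixes S :: "'a::t2_space set" and A :: "'a chart set"
    and f :: "'a \<Rightarrow> real^3" and F :: "real \<Rightarrow> 'a \<Rightarrow> real^3" and \<delta> :: real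
    and \<phi> :: "'a \<Rightarrow> real" and \<xi> :: "'a chart \<Rightarrow> 'a \<Rightarrow> real^2"
  assumes "compact_oriented_surface S A"
    and "smooth_immersion A f"
    and "0 < \<delta>"
    and "smooth_family A \<delta> F"
    and "\<And>p. p \<in> S \<Longrightarrow> F 0 p = f p"
    and "smooth_map A \<phi>"
    and "smooth_vector_field A \<xi>"
    and "\<And>c p. c \<in> A \<Longrightarrow> p \<in> chart_dom c \<Longrightarrow>
           ((\<lambda>t. F t p) has_vector_derivative
             \<phi> p *\<^sub>R unit_normal c f p + differential c f p (\<xi> c p)) (at 0)"
  shows "((\<lambda>t. thomsen S A (F t)) has_real_derivative
           1/2 * (LINT p|area_measure S A f. thomsen_gradient A f p * \<phi> p)
           + (LINT p|length_measure A f. boundary_term A f \<phi> \<xi> p)) (at 0)"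
proof -
  interpret surface S A by unfold_locales (rule assms(1))
  obtain P c a b \<rho> where "partitioned_surface S A P c a b \<rho>" using partition_of_unity by blast
  then interpret partitioned_surface S A P c a b \<rho> .
  define I where "I = {-\<delta><..<\<delta>}"
  have I: "open I" "0 \<in> I" using assms(3) by (simp_all add: I_def)
  have fam: "family_in d I F" if "d \<in> A" for d
    using assms(4) that by (simp add: smooth_family_def family_in_def I_def case_prod_beta')
  have im: "immersed d f" if "d \<in> A" for d by (rule immersion_immersed[OF assms(2) that])
  have fs: "smooth_in d (chart_dom d) f" if "d \<in> A" for d using im[OF that] by (simp add: immersed_def)
  have \<phi>: "smooth_in d (chart_dom d) \<phi>" if "d \<in> A" for d
    using assms(6) that by (simp add: smooth_map_def smooth_in_def chart_range_def)
  have \<xi>: "smooth_in d (chart_dom d) (\<xi> d)" if "d \<in> A" for d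
    using assms(7) that by (simp add: smooth_vector_field_def smooth_in_def chart_range_def)
  have \<xi>c: "\<xi> d' p = differential d (chart_map d') p (\<xi> d p)" if "d \<in> A" "d' \<in> A" "p \<in> chart_dom d \<inter> chart_dom d'" for d d' p
    using assms(7) that unfolding smooth_vector_field_def by blast
  have F0: "F 0 p = f p" if "d \<in> A" "p \<in> chart_dom d" for d p using assms(5) dom_subset that by blast
  have met0: "metric d (F 0) p = metric d f p" if "d \<in> A" "p \<in> chart_dom d" for d p
    using coord_deriv_cong[OF that F0[OF that(1)]] by (simp add: metric_def)
  have "\<exists>e>0. e \<le> \<delta> \<and> (\<forall>u\<in>box_k k. \<forall>t\<in>{-e<..<e}. 0 < det (metric (c k) (F t) (par k u)))" if k: "k \<in> P" for k
    by (rule family_immersed_near[OF chart_P[OF k] fam[OF chart_P[OF k], unfolded I_def] compact_cbox box_range[OF k] assms(3)])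
      (use met0[OF chart_P[OF k] par_dom[OF k]] im[OF chart_P[OF k]] par_dom[OF k] in \<open>simp add: immersed_def\<close>)
  then obtain e where e: "\<And>k. k \<in> P \<Longrightarrow> 0 < e k"
    "\<And>k u t. k \<in> P \<Longrightarrow> u \<in> box_k k \<Longrightarrow> t \<in> {- e k<..<e k} \<Longrightarrow> 0 < det (metric (c k) (F t) (par k u))" by metis
  \<comment> \<open>One time bound for all rectangles; \<open>\<delta>\<close> is inserted so that
    the set is nonempty and the bound stays in the interval of the variation.\<close>
  define \<epsilon> where "\<epsilon> = Min (insert \<delta> (e ` P))"
  have \<epsilon>: "0 < \<epsilon>" "\<epsilon> \<le> \<delta>" "\<And>k. k \<in> P \<Longrightarrow> \<epsilon> \<le> e k"
    using e(1) assms(3) finite_P by (auto simp: \<epsilon>_def)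
  define U where "U = {-\<epsilon><..<\<epsilon>}"
  have U: "open U" "0 \<in> U" "U \<subseteq> I" "convex U" using \<epsilon> by (auto simp: U_def I_def)
  have pos: "0 < det (metric (c k) (F t) (par k u))" if "k \<in> P" "u \<in> box_k k" "t \<in> U" for k u t
    using \<epsilon>(3)[OF that(1)] that by (intro e(2)) (auto simp: U_def)
  have im_t: "immersed d (F t)" if d: "d \<in> A" and t: "t \<in> U" for d t
  proof -
    have tI: "t \<in> I" using t U(3) by blast
    have sm: "smooth_in d' (chart_dom d') (F t)" if "d' \<in> A" for d' by (rule family_slice[OF that I(1) fam[OF that] tI])
    have "0 < det (metric d (F t) p)" if p: "p \<in> chart_dom d" for p
    proof -
      have pS: "p \<in> S" using p dom_subset[OF d] by blast
      \<comment> \<open>The cut-offs sum to one, so some rectangle contains the given point.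
        Nondegeneracy, known on the rectangles only, then passes to every chart around the
        point.\<close>
      obtain k where k: "k \<in> P" "\<rho> k p \<noteq> 0"
        using partition[OF pS] by (metis sum.neutral zero_neq_one)
      then obtain u where u: "u \<in> box_k k" "p = par k u" using support[OF k(1) pS] by blast
      have pk: "p \<in> chart_dom (c k)" using par_dom[OF k(1) u(1)] u(2) by simp
      show ?thesis
        using immersed_change[OF d chart_P[OF k(1)] p pk smooth_in_overlap(1)[OF d chart_P[OF k(1)] p pk sm[OF chart_P[OF k(1)]]]]
          pos[OF k(1) u(1) t] u(2) by simp
    qed
    then show ?thesis using sm[OF d] d by (simp add: immersed_def)
  qed
  have T: "thomsen S A (F t) = (\<Sum>k\<in>P. integral (box_k k) (\<lambda>u. \<rho> k (par k u) * density (c k) (F t) (par k u)))" if t: "t \<in> U" for t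
  proof -
    have im': "immersed d (F t)" if "d \<in> A" for d by (rule im_t[OF that t])
    have tn: "tracefree_norm_sq A (F t) p = tracefree_norm_sq_in d (F t) p" if "d \<in> A" "p \<in> chart_dom d" for d p
      by (rule global_curvature(2)[OF that im'])
    have cont: "continuous_on (chart_dom d) (tracefree_norm_sq A (F t))" if d: "d \<in> A" for d
      using smooth_continuous[OF d smooth_geometry(8)[OF im'[OF d]]]
      by (rule continuous_on_cong[THEN iffD1, rotated 2]) (simp_all add: tn[OF d])
    have "thomsen S A (F t) = (\<Sum>k\<in>P. 1/2 * integral (box_k k) (\<lambda>u. \<rho> k (par k u) * tracefree_norm_sq A (F t) (par k u) * sqrt (det (metric (c k) (F t) (par k u)))))"
      unfolding thomsen_def using area_integral_sum[OF im' cont] by (simp add: sum_distrib_left)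
    also have "\<dots> = (\<Sum>k\<in>P. integral (box_k k) (\<lambda>u. \<rho> k (par k u) * density (c k) (F t) (par k u)))"
    proof (rule sum.cong[OF refl])
      fix k assume k: "k \<in> P"
      have "1/2 * integral (box_k k) (\<lambda>u. \<rho> k (par k u) * tracefree_norm_sq A (F t) (par k u) * sqrt (det (metric (c k) (F t) (par k u))))
        = integral (box_k k) (\<lambda>u. 1/2 * (\<rho> k (par k u) * tracefree_norm_sq A (F t) (par k u) * sqrt (det (metric (c k) (F t) (par k u)))))"
        by (rule Henstock_Kurzweil_Integration.integral_mult_right[symmetric])
      also have "\<dots> = integral (box_k k) (\<lambda>u. \<rho> k (par k u) * density (c k) (F t) (par k u))"
        by (rule Henstock_Kurzweil_Integration.integral_cong) (simp add: tn[OF chart_P[OF k] par_dom[OF k]] density_def)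
      finally show "1/2 * integral (box_k k) (\<lambda>u. \<rho> k (par k u) * tracefree_norm_sq A (F t) (par k u) * sqrt (det (metric (c k) (F t) (par k u))))
        = integral (box_k k) (\<lambda>u. \<rho> k (par k u) * density (c k) (F t) (par k u))" .
    qed
    finally show ?thesis .
  qed
  define W where "W d p = 1/2 * (laplacian_in d f (mean_curvature_in d f) p + tracefree_norm_sq_in d f p * mean_curvature_in d f p)
      * \<phi> p * sqrt (det (metric d f p))" for d p
  define V where "V d p = coord_deriv d 1 (flux d f \<phi> (\<xi> d) 1) p + coord_deriv d 2 (flux d f \<phi> (\<xi> d) 2) p" for d p
  \<comment> \<open>Uniqueness of the derivative identifies the time derivative with the prescribed
    velocity on the whole chart domain, so that the identity may be differentiated in space.\<close>
  have vel: "time_deriv d I F 0 q = velocity d f \<phi> (\<xi> d) q" if "d \<in> A" "q \<in> chart_dom d" for d q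
    using vector_derivative_unique_at[OF family_time_deriv_has[OF that(1) I(1) fam[OF that(1)] I(2) that(2)] assms(8)[OF that]]
      differential_expand[OF smooth_in_differentiable[OF patch_dom[OF that(1)] fs[OF that(1)] that(2)]]
    by (simp add: velocity_def)
  have der: "((\<lambda>t. density d (F t) p) has_real_derivative W d p + V d p) (at 0)" if d: "d \<in> A" and p: "p \<in> chart_dom d" for d p
    unfolding W_def V_def
  proof (rule density_variation[OF im[OF d] p \<phi>[OF d] \<xi>[OF d]])
    show "F 0 q = f q" if "q \<in> chart_dom d" for q by (rule F0[OF d that])
    note F1 = family_coord_deriv[OF d I(1) fam[OF d]]
    note F2 = family_coord_deriv[OF d I(1) F1]
    have v1: "time_deriv d I (\<lambda>t. coord_deriv d i (F t)) 0 q = coord_deriv d i (velocity d f \<phi> (\<xi> d)) q" if "q \<in> chart_dom d" for i q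
      unfolding time_deriv_coord_deriv[OF d I(1) fam[OF d] I(2) that] by (rule coord_deriv_cong[OF d that vel[OF d]])
    show "((\<lambda>t. coord_deriv d i (F t) p) has_vector_derivative coord_deriv d i (velocity d f \<phi> (\<xi> d)) p) (at 0)" for i
      using family_time_deriv_has[OF d I(1) F1 I(2) p] unfolding v1[OF p] .
    have v2: "time_deriv d I (\<lambda>t. coord_deriv d i (coord_deriv d j (F t))) 0 p = coord_deriv d i (coord_deriv d j (velocity d f \<phi> (\<xi> d))) p" for i j
      unfolding time_deriv_coord_deriv[OF d I(1) F1 I(2) p] by (rule coord_deriv_cong[OF d p v1])
    show "((\<lambda>t. coord_deriv d i (coord_deriv d j (F t)) p) has_vector_derivative
        coord_deriv d i (coord_deriv d j (velocity d f \<phi> (\<xi> d))) p) (at 0)" for i j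
      using family_time_deriv_has[OF d I(1) F2 I(2) p] unfolding v2 .
    show "eventually (\<lambda>t. smooth_in d (chart_dom d) (F t)) (at 0)"
      unfolding eventually_at_topological using I family_slice[OF d I(1) fam[OF d]] by blast
  qed
  \<comment> \<open>Differentiation under the integral over a compact rectangle. The time derivative
    of the density is jointly continuous because the density is smooth on the product of rectangle
    and time interval.\<close>
  have leib: "((\<lambda>t. integral (box_k k) (\<lambda>u. \<rho> k (par k u) * density (c k) (F t) (par k u))) has_real_derivative
      integral (box_k k) (\<lambda>u. \<rho> k (par k u) * (W (c k) (par k u) + V (c k) (par k u)))) (at 0)" if k: "k \<in> P" for k
  proof -
    note ck = chart_P[OF k]
    let ?D = "box_k k \<times> U"
    let ?R = "\<lambda>z. density (c k) (F (snd z)) (par k (fst z))"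
    have sR: "smooth_on ?D ?R"
      by (rule family_density[OF ck I(1) fam[OF ck]]) (use box_range[OF k] U(3) pos[OF k] in auto)
    \<comment> \<open>The rectangle has sides of positive length, so derivatives within the product
      are unique even at its edges.\<close>
    have wD: "wide ?D"
    proof (rule wide_Times[OF wide_cbox wide_open[OF U(1)]])
      fix i :: "real^2" assume "i \<in> Basis"
      then obtain j where "i = axis j 1" by (auto simp: Basis_vec_def)
      then show "a k \<bullet> i < b k \<bullet> i" using box_less[OF k, of j] by (simp add: inner_axis)
    qed
    define R' where "R' z = frechet_derivative ?R (at z within ?D) (0, 1)" for z
    have cR': "continuous_on ?D R'"
      unfolding R'_def[abs_def] by (rule smooth_on_continuous_on[OF smooth_on_frechet_derivative[OF wD sR]])
    have dR: "((\<lambda>t. density (c k) (F t) (par k u)) has_real_derivative R' (u, t)) (at t within U)" if ut: "u \<in> box_k k" "t \<in> U" for u t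
    proof -
      have h: "(?R has_derivative frechet_derivative ?R (at (u, t) within ?D)) (at (u, t) within ?D)"
        by (rule smooth_on_has_derivative[OF wD sR]) (use ut in simp)
      have "((\<lambda>t. density (c k) (F t) (par k u)) has_derivative (\<lambda>v. frechet_derivative ?R (at (u, t) within ?D) (0, v))) (at t within U)"
        using has_derivative_slice_right[OF h ut(1)] by (simp only: fst_conv snd_conv)
      moreover have "frechet_derivative ?R (at (u, t) within ?D) (0, v) = R' (u, t) * v" for v
        using linear_scale[OF has_derivative_linear[OF h], of v "(0, 1)"] by (simp add: R'_def mult.commute)
      ultimately show ?thesis by (simp add: has_field_derivative_def fun_eq_iff)
    qed
    have c\<rho>: "continuous_on (box_k k) (\<lambda>u. \<rho> k (par k u))"
      by (rule par_continuous[OF k C1_in_continuous[OF ck C1[OF k ck]]])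
    have "((\<lambda>t. integral (box_k k) (\<lambda>u. \<rho> k (par k u) * density (c k) (F t) (par k u))) has_real_derivative
      integral (box_k k) (\<lambda>u. \<rho> k (par k u) * R' (u, 0))) (at 0 within U)"
    proof (rule leibniz_rule_field_derivative[where fx="\<lambda>t u. \<rho> k (par k u) * R' (u, t)", OF _ _ _ U(2,4)])
      show "((\<lambda>t. \<rho> k (par k u) * density (c k) (F t) (par k u)) has_real_derivative \<rho> k (par k u) * R' (u, t)) (at t within U)"
        if "t \<in> U" "u \<in> box_k k" for t u by (rule DERIV_cmult[OF dR[OF that(2,1)]])
      show "(\<lambda>u. \<rho> k (par k u) * density (c k) (F t) (par k u)) integrable_on box_k k" if "t \<in> U" for t
        by (intro integrable_continuous continuous_on_mult c\<rho> par_continuous[OF k] smooth_continuous[OF ck]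
            smooth_geometry(9)[OF im_t[OF ck that]])
      have "continuous_on (U \<times> box_k k) (\<lambda>z. \<rho> k (par k (snd z)) * R' (snd z, fst z))"
        by (intro continuous_on_mult continuous_on_compose2[OF c\<rho>] continuous_on_compose2[OF cR'] continuous_intros) auto
      then show "continuous_on (U \<times> box_k k) (\<lambda>(t, u). \<rho> k (par k u) * R' (u, t))" by (simp add: case_prod_beta')
    qed
    \<comment> \<open>The pointwise variation formula enters: at time 0 the derivative of the
      density is known explicitly.\<close>
    moreover have "R' (u, 0) = W (c k) (par k u) + V (c k) (par k u)" if u: "u \<in> box_k k" for u
      using DERIV_unique[OF _ der[OF ck par_dom[OF k u]]] dR[OF u U(2)] by (simp add: at_within_open[OF U(2,1)])
    then have "integral (box_k k) (\<lambda>u. \<rho> k (par k u) * R' (u, 0)) = integral (box_k k) (\<lambda>u. \<rho> k (par k u) * (W (c k) (par k u) + V (c k) (par k u)))"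
      by (intro Henstock_Kurzweil_Integration.integral_cong) simp
    ultimately show ?thesis by (simp add: at_within_open[OF U(2,1)])
  qed
  have "((\<lambda>t. \<Sum>k\<in>P. integral (box_k k) (\<lambda>u. \<rho> k (par k u) * density (c k) (F t) (par k u))) has_real_derivative
      (\<Sum>k\<in>P. integral (box_k k) (\<lambda>u. \<rho> k (par k u) * (W (c k) (par k u) + V (c k) (par k u))))) (at 0)"
    by (intro DERIV_sum leib)
  \<comment> \<open>The functional is a sum of chart integrals only for times at which the map is an
    immersion; an open interval around 0 is enough for the derivative.\<close>
  then have main: "((\<lambda>t. thomsen S A (F t)) has_real_derivative
      (\<Sum>k\<in>P. integral (box_k k) (\<lambda>u. \<rho> k (par k u) * (W (c k) (par k u) + V (c k) (par k u))))) (at 0)"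
    by (rule has_field_derivative_transform_within_open[OF _ U(1,2)]) (simp add: T)
  have Ws: "smooth_in d (chart_dom d) (W d)" if d: "d \<in> A" for d
    unfolding W_def[abs_def] by (intro smooth_in_comps laplacian_smooth smooth_geometry im d \<phi>)
  have Vs: "smooth_in d (chart_dom d) (V d)" if d: "d \<in> A" for d
    unfolding V_def[abs_def]
    by (intro smooth_in_comps smooth_in_coord_deriv patch_dom d X_smooth[of f \<phi> \<xi>] im \<phi> \<xi> \<xi>c)
  have "(\<Sum>k\<in>P. integral (box_k k) (\<lambda>u. \<rho> k (par k u) * (W (c k) (par k u) + V (c k) (par k u)))) =
    (\<Sum>k\<in>P. integral (box_k k) (\<lambda>u. \<rho> k (par k u) * W (c k) (par k u))) + (\<Sum>k\<in>P. integral (box_k k) (\<lambda>u. \<rho> k (par k u) * V (c k) (par k u)))"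
    unfolding sum.distrib[symmetric]
  proof (rule sum.cong[OF refl])
    fix k assume k: "k \<in> P"
    note ck = chart_P[OF k]
    have c\<rho>: "continuous_on (box_k k) (\<lambda>u. \<rho> k (par k u))"
      by (rule par_continuous[OF k C1_in_continuous[OF ck C1[OF k ck]]])
    have "integral (box_k k) (\<lambda>u. \<rho> k (par k u) * (W (c k) (par k u) + V (c k) (par k u))) =
      integral (box_k k) (\<lambda>u. \<rho> k (par k u) * W (c k) (par k u) + \<rho> k (par k u) * V (c k) (par k u))"
      by (simp add: distrib_left)
    also have "\<dots> = integral (box_k k) (\<lambda>u. \<rho> k (par k u) * W (c k) (par k u)) + integral (box_k k) (\<lambda>u. \<rho> k (par k u) * V (c k) (par k u))"
      by (intro Henstock_Kurzweil_Integration.integral_add integrable_continuous continuous_on_mult c\<rho>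
          par_continuous[OF k] smooth_continuous[OF ck] Ws[OF ck] Vs[OF ck])
    finally show "integral (box_k k) (\<lambda>u. \<rho> k (par k u) * (W (c k) (par k u) + V (c k) (par k u))) =
      integral (box_k k) (\<lambda>u. \<rho> k (par k u) * W (c k) (par k u)) + integral (box_k k) (\<lambda>u. \<rho> k (par k u) * V (c k) (par k u))" .
  qed
  also have "(\<Sum>k\<in>P. integral (box_k k) (\<lambda>u. \<rho> k (par k u) * V (c k) (par k u))) = (LINT p|length_measure A f. boundary_term A f \<phi> \<xi> p)"
    unfolding V_def by (rule divergence_sum[of f \<phi> \<xi>, OF im \<phi> \<xi> \<xi>c])
  also have "(\<Sum>k\<in>P. integral (box_k k) (\<lambda>u. \<rho> k (par k u) * W (c k) (par k u))) =
    1/2 * (LINT p|area_measure S A f. thomsen_gradient A f p * \<phi> p)"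
  proof -
    have tg: "thomsen_gradient A f p * \<phi> p =
       (laplacian_in d f (mean_curvature_in d f) p + tracefree_norm_sq_in d f p * mean_curvature_in d f p) * \<phi> p"
      if "d \<in> A" "p \<in> chart_dom d" for d p
      using global_curvature[OF that im] by (simp add: thomsen_gradient_def)
    have cont: "continuous_on (chart_dom d) (\<lambda>p. thomsen_gradient A f p * \<phi> p)" if d: "d \<in> A" for d
    proof -
      have "smooth_in d (chart_dom d) (\<lambda>p. (laplacian_in d f (mean_curvature_in d f) p + tracefree_norm_sq_in d f p * mean_curvature_in d f p) * \<phi> p)"
        by (intro smooth_in_comps laplacian_smooth smooth_geometry im d \<phi>)
      from smooth_continuous[OF d this] show ?thesis
        by (rule continuous_on_cong[THEN iffD1, rotated 2]) (simp_all add: tg[OF d])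
    qed
    have "1/2 * (LINT p|area_measure S A f. thomsen_gradient A f p * \<phi> p) =
      (\<Sum>k\<in>P. 1/2 * integral (box_k k) (\<lambda>u. \<rho> k (par k u) * (thomsen_gradient A f (par k u) * \<phi> (par k u)) * sqrt (det (metric (c k) f (par k u)))))"
      using area_integral_sum[OF im cont] by (simp add: sum_distrib_left)
    also have "\<dots> = (\<Sum>k\<in>P. integral (box_k k) (\<lambda>u. \<rho> k (par k u) * W (c k) (par k u)))"
    proof (rule sum.cong[OF refl])
      fix k assume k: "k \<in> P"
      have "1/2 * integral (box_k k) (\<lambda>u. \<rho> k (par k u) * (thomsen_gradient A f (par k u) * \<phi> (par k u)) * sqrt (det (metric (c k) f (par k u))))
        = integral (box_k k) (\<lambda>u. 1/2 * (\<rho> k (par k u) * (thomsen_gradient A f (par k u) * \<phi> (par k u)) * sqrt (det (metric (c k) f (par k u)))))"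
        by (rule Henstock_Kurzweil_Integration.integral_mult_right[symmetric])
      also have "\<dots> = integral (box_k k) (\<lambda>u. \<rho> k (par k u) * W (c k) (par k u))"
        by (rule Henstock_Kurzweil_Integration.integral_cong) (simp add: tg[OF chart_P[OF k] par_dom[OF k]] W_def)
      finally show "1/2 * integral (box_k k) (\<lambda>u. \<rho> k (par k u) * (thomsen_gradient A f (par k u) * \<phi> (par k u)) * sqrt (det (metric (c k) f (par k u))))
        = integral (box_k k) (\<lambda>u. \<rho> k (par k u) * W (c k) (par k u))" .
    qed
    finally show ?thesis ..
  qed
  finally show ?thesis using main by simp
qed

end
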